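(* Let $R$ be a complete discrete valuation ring of equal characteristic $p>0$ with algebraically closed residue field $k$ and uniformiser $\pi$. Let $A:=R[[T]]\{T^{-1}\}$ and let $f:\operatorname{Spf}B\to\operatorname{Spf}A$ be a non-trivial Galois cover of degree $p$. Assume that the ramification index of the corresponding extension of discrete valuation rings equals $1$. Then $f$ is a torsor under a finite and flat $R$-group scheme $G_R$ of rank $p$. Let $\delta$ be the degree of the different in the extension of discrete valuation rings $A\to B$ corresponding to $f$. Then the following cases occur: (a) $\delta=0$. In this case $f$ is a torsor under the étale group $(\mathbb Z/p\mathbb Z)_R$ and, for a suitable choice of the parameter $T$ of $A$, the torsor $f$ is given by an equation $X^p-X=T^m$ for some negative integer $m$ which is prime to $p$. In this case $X^{1/m}$ is a parameter for $B$. (b) $0<\delta=n(p-1)$ for some positive integer $n$. In this case $f$ is a torsor under the group scheme $\mathcal M_{n,R}$. Moreover, for a suitable choice of the parameter $T$, the torsor $f$ is given by an equation $X^p-\pi^{n(p-1)}X=T^m$ with $m\in\mathbb Z$ prime to $p$. In this case $X^{1/m}$ is a parameter for $B$.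
   Context: $R[[T]]\{T^{-1}\}$ denotes the ring of formal power series $\sum_{i\in\mathbb Z}a_iT^i$ with $a_i\in R$ and $\lim_{i\to-\infty}|a_i|=0$, where $|\ |$ is an absolute value attached to the valuation of $K=\operatorname{Fr}R$. It is a complete discrete valuation ring with uniformiser $\pi$ and residue field $k((t))$, $t=T\bmod\pi$; $T$ is called a parameter. More generally an element $T$ of such a ring is a parameter if it induces an identification of the ring with $R[[T]]\{T^{-1}\}$. $\mathcal M_{n,R}$ is the kernel of $\mathbb G_{a,R}\to\mathbb G_{a,R}$, $x\mapsto x^p-\pi^{(p-1)n}x$, a finite flat $R$-group scheme of rank $p$. The degree of the different is its valuation with $\pi$ of valuation $1$. *)

theory Defs
  imports "HOL-Algebra.Algebra" "HOL-Algebra.UnivPoly" "HOL-Computational_Algebra.Primes"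
begin

section \<open>Discrete valuation rings\<close>

definition dvr :: "'r ring \<Rightarrow> bool"
  where "dvr R \<longleftrightarrow> principal_domain R \<and> (\<exists>!P. primeideal P R \<and> P \<noteq> {\<zero>\<^bsub>R\<^esub>})"

definition uniformiser :: "'r ring \<Rightarrow> 'r \<Rightarrow> bool"
  where "uniformiser R u \<longleftrightarrow>
    u \<in> carrier R \<and> u \<noteq> \<zero>\<^bsub>R\<^esub> \<and> maximalideal (PIdl\<^bsub>R\<^esub> u) R"

text \<open>Convergence and completeness are taken with respect to the powers of the ideal generated
  by \<open>u\<close>; for a uniformiser \<open>u\<close> of a discrete valuation ring this is the topology of the
  absolute value.\<close>

definition adic_limit :: "'r ring \<Rightarrow> 'r \<Rightarrow> (nat \<Rightarrow> 'r) \<Rightarrow> 'r \<Rightarrow> bool"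
  where "adic_limit R u x l \<longleftrightarrow>
    l \<in> carrier R \<and> (\<forall>N::nat. \<exists>M. \<forall>j\<ge>M. x j \<ominus>\<^bsub>R\<^esub> l \<in> PIdl\<^bsub>R\<^esub> (u [^]\<^bsub>R\<^esub> N))"

definition adic_cauchy :: "'r ring \<Rightarrow> 'r \<Rightarrow> (nat \<Rightarrow> 'r) \<Rightarrow> bool"
  where "adic_cauchy R u x \<longleftrightarrow>
    (\<forall>N::nat. \<exists>M. \<forall>i\<ge>M. \<forall>j\<ge>M. x i \<ominus>\<^bsub>R\<^esub> x j \<in> PIdl\<^bsub>R\<^esub> (u [^]\<^bsub>R\<^esub> N))"

definition complete_dvr :: "'r ring \<Rightarrow> 'r \<Rightarrow> bool"
  where "complete_dvr R u \<longleftrightarrow> dvr R \<and> uniformiser R u \<and>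
    (\<forall>x. range x \<subseteq> carrier R \<and> adic_cauchy R u x \<longrightarrow> (\<exists>l. adic_limit R u x l))"

text \<open>The exponent \<open>e\<close> with \<open>a B = b\<^sup>e B\<close>, where \<open>a\<close>, \<open>b\<close> are uniformisers of \<open>A\<close>, \<open>B\<close>.\<close>

definition ramification_index :: "'a ring \<Rightarrow> 'b ring \<Rightarrow> ('a \<Rightarrow> 'b) \<Rightarrow> nat"
  where "ramification_index A B \<beta> = (THE e. \<forall>a b. uniformiser A a \<longrightarrow> uniformiser B b \<longrightarrow>
    PIdl\<^bsub>B\<^esub> (\<beta> a) = PIdl\<^bsub>B\<^esub> (b [^]\<^bsub>B\<^esub> e))"


section \<open>The ring \<open>R[[T]]{T\<inverse>}\<close> and its parameters\<close>

text \<open>A series \<open>\<Sum> a\<^sub>i T\<^sup>i\<close> is its coefficient function. The coefficients of a product are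
  two-sided infinite sums, whose terms tend to \<open>0\<close> in both directions; they are computed as
  limits of symmetric partial sums.\<close>

definition conv_laurent :: "'r ring \<Rightarrow> 'r \<Rightarrow> (int \<Rightarrow> 'r) ring"
  where "conv_laurent R \<pi> =
    \<lparr> carrier = {f. (\<forall>i. f i \<in> carrier R) \<and>
                    (\<forall>N::nat. \<exists>M. \<forall>i\<le>M. f i \<in> PIdl\<^bsub>R\<^esub> (\<pi> [^]\<^bsub>R\<^esub> N))},
      monoid.mult = (\<lambda>f g n. THE l. adic_limit R \<pi>
                (\<lambda>N. \<Oplus>\<^bsub>R\<^esub>i\<in>{- int N..int N}. f i \<otimes>\<^bsub>R\<^esub> g (n - i)) l),
      one = (\<lambda>i. if i = 0 then \<one>\<^bsub>R\<^esub> else \<zero>\<^bsub>R\<^esub>),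
      ring.zero = (\<lambda>i. \<zero>\<^bsub>R\<^esub>),
      ring.add = (\<lambda>f g i. f i \<oplus>\<^bsub>R\<^esub> g i) \<rparr>"

definition const_ser :: "'r ring \<Rightarrow> 'r \<Rightarrow> int \<Rightarrow> 'r"
  where "const_ser R a = (\<lambda>i. if i = 0 then a else \<zero>\<^bsub>R\<^esub>)"

definition var_ser :: "'r ring \<Rightarrow> int \<Rightarrow> 'r"
  where "var_ser R = (\<lambda>i. if i = 1 then \<one>\<^bsub>R\<^esub> else \<zero>\<^bsub>R\<^esub>)"

text \<open>\<open>C\<close> is an \<open>R\<close>-algebra with structure map \<open>\<gamma>\<close>. An element \<open>x\<close> is a parameter if some
  isomorphism of \<open>R\<close>-algebras from \<open>R[[T]]{T\<inverse>}\<close> to \<open>C\<close> takes \<open>T\<close> to \<open>x\<close>. No continuity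
  is demanded: it is automatic when \<open>R\<close> has characteristic \<open>p\<close> and perfect residue field.\<close>

definition parameter :: "'r ring \<Rightarrow> 'r \<Rightarrow> 'c ring \<Rightarrow> ('r \<Rightarrow> 'c) \<Rightarrow> 'c \<Rightarrow> bool"
  where "parameter R \<pi> C \<gamma> x \<longleftrightarrow> (\<exists>\<phi> \<in> ring_iso (conv_laurent R \<pi>) C.
    (\<forall>a\<in>carrier R. \<phi> (const_ser R a) = \<gamma> a) \<and> \<phi> (var_ser R) = x)"


section \<open>Algebras\<close>

text \<open>An \<open>A\<close>-algebra is a commutative ring \<open>S\<close> together with its structure map \<open>\<alpha>\<close>.\<close>

definition algebra_over :: "'a ring \<Rightarrow> 'c ring \<Rightarrow> ('a \<Rightarrow> 'c) \<Rightarrow> bool"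
  where "algebra_over A S \<alpha> \<longleftrightarrow> cring S \<and> \<alpha> \<in> ring_hom A S"

definition alg_homs ::
    "'a ring \<Rightarrow> 'b ring \<Rightarrow> ('a \<Rightarrow> 'b) \<Rightarrow> 'c ring \<Rightarrow> ('a \<Rightarrow> 'c) \<Rightarrow> ('b \<Rightarrow> 'c) set"
  where "alg_homs A B \<beta> S \<alpha> =
    {\<phi> \<in> ring_hom B S \<inter> extensional (carrier B). \<forall>a\<in>carrier A. \<phi> (\<beta> a) = \<alpha> a}"

definition alg_auts :: "'a ring \<Rightarrow> 'b ring \<Rightarrow> ('a \<Rightarrow> 'b) \<Rightarrow> ('b \<Rightarrow> 'b) set"
  where "alg_auts A B \<beta> = {\<sigma> \<in> alg_homs A B \<beta> B \<beta>. bij_betw \<sigma> (carrier B) (carrier B)}"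

definition module_finite :: "'a ring \<Rightarrow> 'b ring \<Rightarrow> ('a \<Rightarrow> 'b) \<Rightarrow> bool"
  where "module_finite A B \<beta> \<longleftrightarrow> (\<exists>d::nat. \<exists>b \<in> {..<d} \<rightarrow> carrier B. \<forall>x\<in>carrier B.
    \<exists>a \<in> {..<d} \<rightarrow>\<^sub>E carrier A. x = (\<Oplus>\<^bsub>B\<^esub>i\<in>{..<d}. \<beta> (a i) \<otimes>\<^bsub>B\<^esub> b i))"

text \<open>Only used over a local ring \<open>A\<close>, where free of rank \<open>d\<close> is the same as finite and flat
  (equivalently, finite and locally free) of rank \<open>d\<close>.\<close>

definition module_free :: "'a ring \<Rightarrow> 'b ring \<Rightarrow> ('a \<Rightarrow> 'b) \<Rightarrow> nat \<Rightarrow> bool"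
  where "module_free A B \<beta> d \<longleftrightarrow> (\<exists>b \<in> {..<d} \<rightarrow> carrier B. \<forall>x\<in>carrier B.
    \<exists>!a. a \<in> {..<d} \<rightarrow>\<^sub>E carrier A \<and> x = (\<Oplus>\<^bsub>B\<^esub>i\<in>{..<d}. \<beta> (a i) \<otimes>\<^bsub>B\<^esub> b i))"

text \<open>The \<open>A\<close>-algebra \<open>B\<close> is \<open>A[X]/(X\<^sup>p - c X - u)\<close>, the class of the variable being \<open>x\<close>.\<close>

definition given_by_equation ::
    "'a ring \<Rightarrow> 'b ring \<Rightarrow> ('a \<Rightarrow> 'b) \<Rightarrow> nat \<Rightarrow> 'a \<Rightarrow> 'a \<Rightarrow> 'b \<Rightarrow> bool"
  where "given_by_equation A B \<beta> p c u x \<longleftrightarrow> x \<in> carrier B \<and>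
    eval A B \<beta> x ` carrier (UP A) = carrier B \<and>
    a_kernel (UP A) B (eval A B \<beta> x) =
      PIdl\<^bsub>UP A\<^esub> (up_ring.monom (UP A) \<one>\<^bsub>A\<^esub> p \<ominus>\<^bsub>UP A\<^esub> up_ring.monom (UP A) c 1 \<ominus>\<^bsub>UP A\<^esub> up_ring.monom (UP A) u 0)"


section \<open>Galois covers and the different\<close>

text \<open>Since \<open>B\<close> is a discrete valuation ring, it is normal and connected, so that the cover is
  non-trivial. By Artin's theorem the conditions on the automorphisms say that
  \<open>Frac B / Frac A\<close> is Galois of degree \<open>d\<close>.\<close>

definition galois_cover :: "'a ring \<Rightarrow> 'b ring \<Rightarrow> ('a \<Rightarrow> 'b) \<Rightarrow> nat \<Rightarrow> bool"
  where "galois_cover A B \<beta> d \<longleftrightarrow> dvr B \<and>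
    algebra_over A B \<beta> \<and> inj_on \<beta> (carrier A) \<and> module_finite A B \<beta> \<and>
    finite (alg_auts A B \<beta>) \<and> card (alg_auts A B \<beta>) = d \<and>
    {b \<in> carrier B. \<forall>\<sigma>\<in>alg_auts A B \<beta>. \<sigma> b = b} = \<beta> ` carrier A"

definition galois_trace :: "'a ring \<Rightarrow> 'b ring \<Rightarrow> ('a \<Rightarrow> 'b) \<Rightarrow> 'b \<Rightarrow> 'b"
  where "galois_trace A B \<beta> b = (\<Oplus>\<^bsub>B\<^esub>\<sigma>\<in>alg_auts A B \<beta>. \<sigma> b)"

text \<open>For \<open>B\<close> finite over \<open>A\<close> every element of \<open>Frac B\<close> is a fraction \<open>b/a\<close> with \<open>b\<close> in \<open>B\<close> and
  \<open>a \<noteq> 0\<close> in \<open>A\<close>. The pair \<open>(b, a)\<close> lies in the following set iff \<open>b/a\<close> is in the codifferent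
  \<open>{y \<in> Frac B. Tr (y B) \<subseteq> A}\<close>; the different \<open>{d. d y \<in> B for all y in the codifferent}\<close> is
  contained in \<open>B\<close>, because \<open>1\<close> lies in the codifferent.\<close>

definition codifferent_fractions :: "'a ring \<Rightarrow> 'b ring \<Rightarrow> ('a \<Rightarrow> 'b) \<Rightarrow> ('b \<times> 'a) set"
  where "codifferent_fractions A B \<beta> = {(b, a). b \<in> carrier B \<and> a \<in> carrier A \<and> a \<noteq> \<zero>\<^bsub>A\<^esub> \<and>
    (\<forall>y\<in>carrier B. \<exists>c\<in>carrier A. galois_trace A B \<beta> (b \<otimes>\<^bsub>B\<^esub> y) = \<beta> a \<otimes>\<^bsub>B\<^esub> \<beta> c)}"

definition different :: "'a ring \<Rightarrow> 'b ring \<Rightarrow> ('a \<Rightarrow> 'b) \<Rightarrow> 'b set"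
  where "different A B \<beta> = {d \<in> carrier B.
    \<forall>(b, a) \<in> codifferent_fractions A B \<beta>. d \<otimes>\<^bsub>B\<^esub> b \<in> PIdl\<^bsub>B\<^esub> (\<beta> a)}"

text \<open>The valuation of the different, normalised by giving \<open>u\<close> the valuation \<open>1\<close>. It is used
  when \<open>u\<close> is a uniformiser of \<open>B\<close>, so the value is a natural number.\<close>

definition different_degree :: "'a ring \<Rightarrow> 'b ring \<Rightarrow> ('a \<Rightarrow> 'b) \<Rightarrow> 'b \<Rightarrow> nat"
  where "different_degree A B \<beta> u = (THE d. different A B \<beta> = PIdl\<^bsub>B\<^esub> (u [^]\<^bsub>B\<^esub> d))"


section \<open>Group schemes and torsors\<close>

text \<open>Affine schemes and group schemes are treated through their functors of points. A group
  functor on \<open>R\<close>-algebras has a group \<open>pts G S \<sigma>\<close> for each \<open>R\<close>-algebra \<open>(S, \<sigma>)\<close> and a map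
  \<open>pmap G \<phi>\<close> for each morphism \<open>\<phi>\<close> of \<open>R\<close>-algebras. The test algebras \<open>S\<close> range over all rings
  on the type \<open>'c\<close>. By Yoneda's lemma the notions below are the usual ones as soon as \<open>'c\<close> is large
  enough to carry the tensor products of the coordinate rings involved; for algebras that are
  finite over \<open>B\<close>, the type \<open>nat \<Rightarrow> 'b\<close> is large enough.\<close>

record ('r, 'c, 'g) group_fun =
  pts :: "'c ring \<Rightarrow> ('r \<Rightarrow> 'c) \<Rightarrow> 'g monoid"
  pmap :: "('c \<Rightarrow> 'c) \<Rightarrow> 'g \<Rightarrow> 'g"

definition group_functor :: "'r ring \<Rightarrow> ('r, 'c, 'g) group_fun \<Rightarrow> bool"
  where "group_functor R G \<longleftrightarrow>
    (\<forall>S \<sigma>. algebra_over R S \<sigma> \<longrightarrow> group (pts G S \<sigma>) \<and>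
      (\<forall>g\<in>carrier (pts G S \<sigma>). pmap G (\<lambda>s\<in>carrier S. s) g = g)) \<and>
    (\<forall>S \<sigma> S' \<sigma>' \<phi>. algebra_over R S \<sigma> \<and> algebra_over R S' \<sigma>' \<and> \<phi> \<in> alg_homs R S \<sigma> S' \<sigma>' \<longrightarrow>
      pmap G \<phi> \<in> hom (pts G S \<sigma>) (pts G S' \<sigma>') \<and>
      (\<forall>S'' \<sigma>'' \<psi>. algebra_over R S'' \<sigma>'' \<and> \<psi> \<in> alg_homs R S' \<sigma>' S'' \<sigma>'' \<longrightarrow>
        (\<forall>g\<in>carrier (pts G S \<sigma>). pmap G (compose (carrier S) \<psi> \<phi>) g = pmap G \<psi> (pmap G \<phi> g))))"

definition represented_by ::
    "'r ring \<Rightarrow> ('r, 'c, 'g) group_fun \<Rightarrow> 'h ring \<Rightarrow> ('r \<Rightarrow> 'h) \<Rightarrow> bool"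
  where "represented_by R G H \<eta> \<longleftrightarrow> (\<exists>\<Phi>.
    (\<forall>S \<sigma>. algebra_over R S \<sigma> \<longrightarrow>
      bij_betw (\<Phi> S \<sigma>) (alg_homs R H \<eta> S \<sigma>) (carrier (pts G S \<sigma>))) \<and>
    (\<forall>S \<sigma> S' \<sigma>' \<phi>. algebra_over R S \<sigma> \<and> algebra_over R S' \<sigma>' \<and> \<phi> \<in> alg_homs R S \<sigma> S' \<sigma>' \<longrightarrow>
      (\<forall>f\<in>alg_homs R H \<eta> S \<sigma>. \<Phi> S' \<sigma>' (compose (carrier H) \<phi> f) = pmap G \<phi> (\<Phi> S \<sigma> f))))"

text \<open>Over the local ring \<open>R\<close>. Every free \<open>R\<close>-module of finite rank has an isomorphic copy whose
  elements have type \<open>nat \<Rightarrow> 'r\<close>.\<close>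

definition finite_flat_group_scheme :: "'r ring \<Rightarrow> nat \<Rightarrow> ('r, 'c, 'g) group_fun \<Rightarrow> bool"
  where "finite_flat_group_scheme R d G \<longleftrightarrow> group_functor R G \<and>
    (\<exists>(H :: (nat \<Rightarrow> 'r) ring) \<eta>. algebra_over R H \<eta> \<and> module_free R H \<eta> d \<and> represented_by R G H \<eta>)"

text \<open>Here \<open>A\<close> is a local \<open>R\<close>-algebra with structure map \<open>\<iota>\<close>. The family \<open>act\<close> makes \<open>Spec B\<close> a
  torsor over \<open>Spec A\<close> under the group functor \<open>G\<close>: \<open>B\<close> is finite and faithfully flat over \<open>A\<close>, and
  \<open>G(S)\<close> acts simply transitively and functorially on the set of \<open>S\<close>-points of \<open>Spec B\<close> over
  \<open>Spec A\<close>, for each \<open>A\<close>-algebra \<open>(S, \<alpha>)\<close>. All algebras involved being finite over \<open>A\<close>, this is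
  the same for formal spectra.\<close>

definition torsor ::
    "'a ring \<Rightarrow> ('r \<Rightarrow> 'a) \<Rightarrow> 'b ring \<Rightarrow> ('a \<Rightarrow> 'b) \<Rightarrow> ('r, 'c, 'g) group_fun \<Rightarrow>
     ('c ring \<Rightarrow> ('a \<Rightarrow> 'c) \<Rightarrow> 'g \<Rightarrow> ('b \<Rightarrow> 'c) \<Rightarrow> ('b \<Rightarrow> 'c)) \<Rightarrow> bool"
  where "torsor A \<iota> B \<beta> G act \<longleftrightarrow>
    algebra_over A B \<beta> \<and> (\<exists>d>0. module_free A B \<beta> d) \<and>
    (\<forall>S \<alpha>. algebra_over A S \<alpha> \<longrightarrow>
      group_action (pts G S (\<alpha> \<circ> \<iota>)) (alg_homs A B \<beta> S \<alpha>) (act S \<alpha>) \<and>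
      (\<forall>x\<in>alg_homs A B \<beta> S \<alpha>. \<forall>y\<in>alg_homs A B \<beta> S \<alpha>.
        \<exists>!g. g \<in> carrier (pts G S (\<alpha> \<circ> \<iota>)) \<and> act S \<alpha> g x = y)) \<and>
    (\<forall>S \<alpha> S' \<alpha>' \<phi>. algebra_over A S \<alpha> \<and> algebra_over A S' \<alpha>' \<and> \<phi> \<in> alg_homs A S \<alpha> S' \<alpha>' \<longrightarrow>
      (\<forall>g\<in>carrier (pts G S (\<alpha> \<circ> \<iota>)). \<forall>x\<in>alg_homs A B \<beta> S \<alpha>.
        act S' \<alpha>' (pmap G \<phi> g) (compose (carrier B) \<phi> x) = compose (carrier B) \<phi> (act S \<alpha> g x)))"

text \<open>The group scheme \<open>\<M>\<^sub>n\<close>: the kernel of the endomorphism \<open>x \<mapsto> x\<^sup>p - \<pi>\<^sup>(\<^sup>p\<^sup>-\<^sup>1\<^sup>)\<^sup>n x\<close> of the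
  additive group.\<close>

definition M_group :: "'r ring \<Rightarrow> 'r \<Rightarrow> nat \<Rightarrow> nat \<Rightarrow> ('r, 'c, 'c) group_fun"
  where "M_group R \<pi> p n =
    \<lparr> pts = (\<lambda>S \<sigma>. (add_monoid S) \<lparr> carrier := kernel (add_monoid S) (add_monoid S)
         (\<lambda>s. s [^]\<^bsub>S\<^esub> p \<ominus>\<^bsub>S\<^esub> \<sigma> (\<pi> [^]\<^bsub>R\<^esub> ((p - 1) * n)) \<otimes>\<^bsub>S\<^esub> s) \<rparr>),
      pmap = (\<lambda>\<phi>. \<phi>) \<rparr>"

text \<open>The constant group scheme \<open>\<int>/p\<int>\<close>. A locally constant function from \<open>Spec S\<close> to
  \<open>{0..<p}\<close> is given by the family of orthogonal idempotents \<open>e i\<close> with sum \<open>1\<close> that cut out the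
  loci where it takes the value \<open>i\<close>. Pointwise addition modulo \<open>p\<close> is then a convolution.\<close>

definition const_Zp :: "nat \<Rightarrow> ('r, 'c, nat \<Rightarrow> 'c) group_fun"
  where "const_Zp p =
    \<lparr> pts = (\<lambda>S \<sigma>.
        \<lparr> carrier = {e \<in> {..<p} \<rightarrow>\<^sub>E carrier S.
             (\<forall>i<p. \<forall>j<p. e i \<otimes>\<^bsub>S\<^esub> e j = (if i = j then e i else \<zero>\<^bsub>S\<^esub>)) \<and>
             (\<Oplus>\<^bsub>S\<^esub>i\<in>{..<p}. e i) = \<one>\<^bsub>S\<^esub>},
          monoid.mult = (\<lambda>e f. \<lambda>k\<in>{..<p}. \<Oplus>\<^bsub>S\<^esub>i\<in>{..<p}. e i \<otimes>\<^bsub>S\<^esub> f ((k + p - i) mod p)),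
          one = (\<lambda>i\<in>{..<p}. if i = 0 then \<one>\<^bsub>S\<^esub> else \<zero>\<^bsub>S\<^esub>) \<rparr>),
      pmap = (\<lambda>\<phi> e. \<lambda>i\<in>{..<p}. \<phi> (e i)) \<rparr>"

end

(* A generator s of the Galois group satisfies (s - 1)^p = s^p - 1 = 0, so some y has (s - 1) y fixed
   and nonzero; dividing by a unit of A gives theta with s theta = theta + pi^n, and n is taken minimal.
   Then theta^p - pi^(n(p-1)) theta = u lies in A. Subtracting elements of A from theta, one arranges
   that u has residue of order m prime to p in k((t)); the other possibility, u = 0 mod pi, contradicts the
   minimality of n, or for n = 0 the Artin-Schreier equation. Expanding the sum over i of
   (theta - s^i theta)^(p-1) s^i b expresses pi^(n(p-1)) b through theta with traces as coefficients,
   and the p-th power map on residues shows that 1, theta, ..., theta^(p-1) is a basis of B modulo pi.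
   This yields the equation of B and, through the traces of the powers of theta, the different.
   The parameter T is an m-th root of u. A parameter S of B with S^m = theta is found by mapping B
   onto A by theta |-> T^m and T |-> T', where T'^m = T^(mp) - pi^(n(p-1)) T^m. *)

theory Submission
  imports Defs "HOL-Decision_Procs.Commutative_Ring" "HOL-Number_Theory.Cong"
begin

section \<open>Commutative rings of prime characteristic\<close>

text \<open>Everything stays integral: congruences modulo powers of the uniformiser and cancellation
  in B replace fraction fields. The main obstacle is topological. A series T of residual order 1 is
  a unit of A, so its powers do not tend to 0 \<pi>-adically, and substituting T for the variable
  converges only for a weaker topology, which looks modulo \<pi>^N at the coefficients below a given
  exponent. High powers of T are small there because of Frobenius, which removes the exponents below
  1 from T^(p^N) modulo \<pi>^(N+1). Fixed points of contractions supply inverses and roots, twice: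
  T-adically in R[[T]] and \<pi>-adically in A. A unit of A is handled in these two stages, after
  its leading coefficient. Why the powers of \<theta> stay independent modulo \<pi> is a matter of
  orders in k((t)): the terms a_i^p u^i have orders that are distinct modulo p, because m is prime
  to p. The same arithmetic shows that A is generated by p elements over the image of the
  substitution of T', whose residual order is p.\<close>

context cring
begin

lemma finsum_swap:
  assumes "finite I" "finite J" "\<And>i j. i \<in> I \<Longrightarrow> j \<in> J \<Longrightarrow> f i j \<in> carrier R"
  shows "(\<Oplus>i\<in>I. \<Oplus>j\<in>J. f i j) = (\<Oplus>j\<in>J. \<Oplus>i\<in>I. f i j)"
  using assms(1,3)
proof (induction I rule: finite_induct)
  case empty
  then show ?case by simp
next
  case (insert i I)
  have c1: "f i \<in> J \<rightarrow> carrier R"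
    using insert.prems by auto
  have c2: "(\<lambda>j. \<Oplus>i\<in>I. f i j) \<in> J \<rightarrow> carrier R"
    by (intro Pi_I finsum_closed) (use insert.prems in auto)
  have c3: "(\<lambda>i. \<Oplus>j\<in>J. f i j) \<in> I \<rightarrow> carrier R" "(\<Oplus>j\<in>J. f i j) \<in> carrier R"
    by (intro Pi_I finsum_closed; use insert.prems in auto)+
  have "(\<Oplus>j\<in>J. \<Oplus>i\<in>insert i I. f i j) = (\<Oplus>j\<in>J. f i j \<oplus> (\<Oplus>i\<in>I. f i j))"
  proof (rule finsum_cong' [OF refl])
    show "(\<lambda>j. f i j \<oplus> (\<Oplus>i\<in>I. f i j)) \<in> J \<rightarrow> carrier R"
      using c1 c2 by blast
    fix j assume "j \<in> J"
    with insert.hyps insert.prems show "(\<Oplus>i\<in>insert i I. f i j) = f i j \<oplus> (\<Oplus>i\<in>I. f i j)"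
      by (intro finsum_insert) auto
  qed
  also have "\<dots> = (\<Oplus>j\<in>J. f i j) \<oplus> (\<Oplus>j\<in>J. \<Oplus>i\<in>I. f i j)"
    using c1 c2 by (rule finsum_addf)
  also have "(\<Oplus>j\<in>J. \<Oplus>i\<in>I. f i j) = (\<Oplus>i\<in>I. \<Oplus>j\<in>J. f i j)"
    by (rule insert.IH [symmetric]) (use insert.prems in auto)
  also have "(\<Oplus>j\<in>J. f i j) \<oplus> (\<Oplus>i\<in>I. \<Oplus>j\<in>J. f i j) = (\<Oplus>i\<in>insert i I. \<Oplus>j\<in>J. f i j)"
    using insert.hyps c3 by (rule finsum_insert [symmetric])
  finally show ?case by (rule sym)
qed

lemma add_pow_eq_of_int: "x \<in> carrier R \<Longrightarrow> [(n::nat)] \<cdot>\<^bsub>R\<^esub> x = \<guillemotleft>int n\<guillemotright> \<otimes> x"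
  by (induction n) (auto simp: l_distr a_comm)

lemma finsum_of_int:
  assumes "finite I"
  shows "(\<Oplus>i\<in>I. \<guillemotleft>f i\<guillemotright>) = \<guillemotleft>\<Sum>i\<in>I. f i\<guillemotright>"
  using assms by (induction I rule: finite_induct) auto

lemma finsum_shift_head:
  "f \<in> {..Suc n} \<rightarrow> carrier R \<Longrightarrow> (\<Oplus>i\<in>{..Suc n}. f i) = f 0 \<oplus> (\<Oplus>i\<in>{..n}. f (Suc i))"
  by (subst finsum_Suc2) (auto intro!: a_comm finsum_closed)

lemma binomial_theorem:
  assumes [simp]: "x \<in> carrier R" "y \<in> carrier R"
  shows "(x \<oplus> y) [^] (n::nat) = (\<Oplus>k\<in>{..n}. \<guillemotleft>int (n choose k)\<guillemotright> \<otimes> (x [^] k \<otimes> y [^] (n - k)))"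
proof (induction n)
  case 0
  then show ?case by simp
next
  case (Suc n)
  \<comment> \<open>Every row uses powers of \<open>y\<close> relative to \<open>Suc n\<close>, so
    that Pascal's rule compares terms with equal powers.\<close>
  define F where "F m k = \<guillemotleft>int (m choose k)\<guillemotright> \<otimes> (x [^] k \<otimes> y [^] (Suc n - k))" for m k
  have F [simp]: "F m k \<in> carrier R" for m k by (simp add: F_def)
  have pascal: "F (Suc n) (Suc k) = \<guillemotleft>int (n choose k)\<guillemotright> \<otimes> (x [^] k \<otimes> y [^] (n - k)) \<otimes> x \<oplus> F n (Suc k)" for k
  proof -
    have id: "\<And>a b xk z. \<lbrakk>a \<in> carrier R; b \<in> carrier R; xk \<in> carrier R; z \<in> carrier R\<rbrakk> \<Longrightarrow>
       (a \<oplus> b) \<otimes> (xk \<otimes> x \<otimes> z) = a \<otimes> (xk \<otimes> z) \<otimes> x \<oplus> b \<otimes> (xk \<otimes> x \<otimes> z)"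
      using assms by algebra
    show ?thesis by (simp add: F_def id)
  qed
  have last: "\<guillemotleft>int (n choose k)\<guillemotright> \<otimes> (x [^] k \<otimes> y [^] (n - k)) \<otimes> y = F n k" if "k \<le> n" for k
    using that by (simp add: F_def m_assoc Suc_diff_le)
  have "(x \<oplus> y) [^] Suc n = (\<Oplus>k\<in>{..n}. \<guillemotleft>int (n choose k)\<guillemotright> \<otimes> (x [^] k \<otimes> y [^] (n - k))) \<otimes> x
      \<oplus> (\<Oplus>k\<in>{..n}. \<guillemotleft>int (n choose k)\<guillemotright> \<otimes> (x [^] k \<otimes> y [^] (n - k))) \<otimes> y"
    by (simp add: Suc r_distr)
  also have "(\<Oplus>k\<in>{..n}. \<guillemotleft>int (n choose k)\<guillemotright> \<otimes> (x [^] k \<otimes> y [^] (n - k))) \<otimes> y = (\<Oplus>k\<in>{..n}. F n k)"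
    by (subst finsum_ldistr) (auto simp: last intro!: finsum_cong')
  also have "\<dots> = (\<Oplus>k\<in>{..Suc n}. F n k)"
  proof -
    have "F n (Suc n) = \<zero>" by (simp only: F_def binomial_eq_0 lessI of_nat_0 of_int_0) simp
    then show ?thesis by (subst finsum_Suc) auto
  qed
  also have "\<dots> = F n 0 \<oplus> (\<Oplus>k\<in>{..n}. F n (Suc k))"
    by (rule finsum_shift_head) auto
  also have "F n 0 = F (Suc n) 0" by (simp add: F_def)
  also have "(\<Oplus>k\<in>{..n}. \<guillemotleft>int (n choose k)\<guillemotright> \<otimes> (x [^] k \<otimes> y [^] (n - k))) \<otimes> x \<oplus> (F (Suc n) 0 \<oplus> (\<Oplus>k\<in>{..n}. F n (Suc k)))
     = F (Suc n) 0 \<oplus> (\<Oplus>k\<in>{..n}. F (Suc n) (Suc k))"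
    by (simp add: finsum_ldistr pascal finsum_addf a_ac del: binomial_Suc_Suc)
  also have "\<dots> = (\<Oplus>k\<in>{..Suc n}. F (Suc n) k)"
    by (rule finsum_shift_head [symmetric]) auto
  finally show ?case by (simp add: F_def)
qed

end

text \<open>Telescoping (i+1)^(k+1) - i^(k+1) over i < p writes p^(k+1) as a combination of the
  power sums with exponents up to k. The coefficient of the last one is k + 1 < p, which is prime to
  p, so the divisibility of the earlier sums isolates it.\<close>

lemma prime_dvd_power_sum:
  assumes p: "Factorial_Ring.prime (p::nat)" and k: "k < p - 1"
  shows "int p dvd (\<Sum>i<p. int i ^ k)"
  using k
proof (induction k rule: less_induct)
  case (less k)
  have "int p ^ Suc k = (\<Sum>i<p. int (Suc i) ^ Suc k - int i ^ Suc k)"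
    by (subst sum_lessThan_telescope) simp
  also have "\<dots> = (\<Sum>i<p. \<Sum>j\<le>k. int (Suc k choose j) * int i ^ j)"
  proof (rule sum.cong [OF refl])
    fix i
    have "int (Suc i) ^ Suc k = (\<Sum>j\<le>Suc k. int (Suc k choose j) * int i ^ j)"
      using binomial_ring [of "int i" 1 "Suc k"] by (simp only: of_nat_Suc power_one mult_1_right add.commute)
    then show "int (Suc i) ^ Suc k - int i ^ Suc k = (\<Sum>j\<le>k. int (Suc k choose j) * int i ^ j)"
      by (simp only: sum.atMost_Suc binomial_n_n)
  qed
  also have "\<dots> = (\<Sum>j\<le>k. int (Suc k choose j) * (\<Sum>i<p. int i ^ j))"
    by (subst sum.swap) (simp add: sum_distrib_left)
  also have "\<dots> = (\<Sum>j<k. int (Suc k choose j) * (\<Sum>i<p. int i ^ j)) + int (Suc k) * (\<Sum>i<p. int i ^ k)"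
    by (simp only: lessThan_Suc_atMost [symmetric] sum.lessThan_Suc binomial_Suc_n)
  finally have eq: "int p ^ Suc k = \<dots>" .
  have "int p dvd (\<Sum>j<k. int (Suc k choose j) * (\<Sum>i<p. int i ^ j))"
    by (rule dvd_sum, rule dvd_mult, rule less.IH) (use less.prems in auto)
  moreover have "int p dvd int p ^ Suc k" by simp
  ultimately have "int p dvd int (Suc k) * (\<Sum>i<p. int i ^ k)"
    by (simp only: eq dvd_add_right_iff)
  moreover have "\<not> int p dvd int (Suc k)"
    unfolding int_dvd_int_iff using less.prems by (auto dest: dvd_imp_le)
  moreover have "Factorial_Ring.prime (int p)" using p by simp
  ultimately show ?case by (auto simp only: prime_dvd_mult_iff)
qed

text \<open>Only p * 1 = 0 is asked, so that the zero ring is included: it occurs among the test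
  algebras of the functors of points.\<close>

locale cring_char = cring +
  fixes p :: nat
  assumes p: "Factorial_Ring.prime p" and char: "[p] \<cdot>\<^bsub>R\<^esub> \<one> = \<zero>"
begin

lemma p_gt_1: "1 < p" using p by (rule prime_gt_1_nat)

lemma of_int_p [simp]: "\<guillemotleft>int p\<guillemotright> = \<zero>"
  using add_pow_eq_of_int [of \<one> p] char by simp

lemma of_int_dvd: "int p dvd i \<Longrightarrow> \<guillemotleft>i\<guillemotright> = \<zero>"
  by (auto elim!: dvdE)

lemma of_int_mod: "\<guillemotleft>i mod int p\<guillemotright> = \<guillemotleft>i\<guillemotright>"
proof -
  have "\<guillemotleft>i\<guillemotright> = \<guillemotleft>i div int p * int p + i mod int p\<guillemotright>" by simp
  also have "\<dots> = \<guillemotleft>i mod int p\<guillemotright>" by (simp only: of_int_add of_int_mult) simp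
  finally show ?thesis by simp
qed

lemma of_int_cong: "[i = j] (mod int p) \<Longrightarrow> \<guillemotleft>i\<guillemotright> = \<guillemotleft>j\<guillemotright>"
  by (metis cong_def of_int_mod)

lemma frob_add:
  assumes [simp]: "x \<in> carrier R" "y \<in> carrier R"
  shows "(x \<oplus> y) [^] p = x [^] p \<oplus> y [^] p"
proof -
  \<comment> \<open>Since p is at least 2, both end terms of the expansion split off. The indices in
    between are \<open>Suc k\<close> with \<open>k \<le> q\<close>, where p divides the binomial
    coefficient.\<close>
  obtain q where q: "p = Suc (Suc q)"
    using p_gt_1 by (metis less_imp_Suc_add plus_1_eq_Suc add_Suc)
  let ?f = "\<lambda>k. \<guillemotleft>int (p choose k)\<guillemotright> \<otimes> (x [^] k \<otimes> y [^] (p - k))"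
  have "(\<Oplus>k\<in>{..q}. ?f (Suc k)) = (\<Oplus>k\<in>{..q}. \<zero>)"
  proof (rule finsum_cong')
    fix k assume "k \<in> {..q}"
    then have "\<guillemotleft>int (p choose Suc k)\<guillemotright> = \<zero>"
      using p q by (intro of_int_dvd, subst int_dvd_int_iff, intro dvd_choose_prime) auto
    then show "?f (Suc k) = \<zero>" by simp
  qed auto
  then have mid: "(\<Oplus>k\<in>{..q}. ?f (Suc k)) = \<zero>" by simp
  have "(x \<oplus> y) [^] p = (\<Oplus>k\<in>{..Suc (Suc q)}. ?f k)"
    using binomial_theorem [of x y p] q by simp
  also have "\<dots> = ?f (Suc (Suc q)) \<oplus> (\<Oplus>k\<in>{..Suc q}. ?f k)"
    by (subst finsum_Suc) auto
  also have "(\<Oplus>k\<in>{..Suc q}. ?f k) = ?f 0 \<oplus> (\<Oplus>k\<in>{..q}. ?f (Suc k))"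
    by (rule finsum_shift_head) auto
  finally have "(x \<oplus> y) [^] p = ?f (Suc (Suc q)) \<oplus> (?f 0 \<oplus> \<zero>)" unfolding mid .
  then show ?thesis unfolding q by (simp del: nat_pow_Suc)
qed

lemma frob_zero [simp]: "\<zero> [^] p = \<zero>"
  using p_gt_1 by (simp add: nat_pow_zero)

lemma frob_minus:
  assumes [simp]: "x \<in> carrier R" "y \<in> carrier R"
  shows "(x \<ominus> y) [^] p = x [^] p \<ominus> y [^] p"
proof -
  have "(x \<ominus> y) [^] p \<oplus> y [^] p = x [^] p"
    by (subst frob_add [symmetric]) (simp_all add: minus_eq a_assoc l_neg)
  then show ?thesis
    by (metis a_minus_def add.inv_solve_right assms minus_closed nat_pow_closed)
qed

lemma frob_neg:
  assumes [simp]: "x \<in> carrier R"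
  shows "(\<ominus> x) [^] p = \<ominus> (x [^] p)"
  using frob_minus [of \<zero> x] by simp

lemma frob_finsum:
  assumes "finite I" "f \<in> I \<rightarrow> carrier R"
  shows "(\<Oplus>i\<in>I. f i) [^] p = (\<Oplus>i\<in>I. f i [^] p)"
  using assms by (induction I rule: finite_induct) (auto simp: frob_add Pi_def)

lemma fermat_of_int: "\<guillemotleft>i\<guillemotright> [^] p = \<guillemotleft>i\<guillemotright>"
proof -
  have "\<guillemotleft>int n\<guillemotright> [^] p = \<guillemotleft>int n\<guillemotright>" for n
    by (induction n) (auto simp: frob_add)
  then have "\<guillemotleft>int (nat (i mod int p))\<guillemotright> [^] p = \<guillemotleft>int (nat (i mod int p))\<guillemotright>" by blast
  then show ?thesis using p_gt_1 by (simp add: of_int_mod)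
qed

lemma unit_of_int:
  assumes "\<not> int p dvd i"
  shows "\<guillemotleft>i\<guillemotright> \<in> Units R"
proof -
  have "coprime i (int p)"
    using assms p by (meson coprime_commute prime_imp_coprime_int prime_nat_int_transfer)
  then obtain j where "[i * j = 1] (mod int p)" using cong_solve_coprime_int by blast
  then have "\<guillemotleft>i\<guillemotright> \<otimes> \<guillemotleft>j\<guillemotright> = \<one>" using of_int_cong [of "i * j" 1] by simp
  then show ?thesis by (auto simp: Units_def m_comm intro!: bexI [of _ "\<guillemotleft>j\<guillemotright>"])
qed

lemma fermat_of_int_unit:
  assumes "\<not> int p dvd i"
  shows "\<guillemotleft>i\<guillemotright> [^] (p - 1) = \<one>"
proof -
  have "\<guillemotleft>i\<guillemotright> \<otimes> \<guillemotleft>i\<guillemotright> [^] (p - 1) = \<guillemotleft>i\<guillemotright> \<otimes> \<one>"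
    using fermat_of_int [of i] p_gt_1 nat_pow_Suc2 [of "\<guillemotleft>i\<guillemotright>" "p - 1"] by simp
  then show ?thesis using unit_of_int [OF assms] by (simp del: r_one add: Units_l_cancel)
qed

lemma power_sum_of_int:
  "(\<Oplus>i\<in>{..<p}. \<guillemotleft>int i\<guillemotright> [^] k) = (if k < p - 1 then \<zero> else \<ominus> \<one>)" if "k < p"
proof (cases "k < p - 1")
  case True
  have "(\<Oplus>i\<in>{..<p}. \<guillemotleft>int i\<guillemotright> [^] k) = \<guillemotleft>\<Sum>i<p. int i ^ k\<guillemotright>"
    by (simp flip: of_int_power finsum_of_int)
  with True show ?thesis using of_int_dvd [OF prime_dvd_power_sum [OF p True]] by simp
next
  case False
  with that have k: "k = p - 1" by simp
  have "(\<Oplus>i\<in>{..<p}. \<guillemotleft>int i\<guillemotright> [^] k) = (\<Oplus>i\<in>insert 0 {1..<p}. \<guillemotleft>int i\<guillemotright> [^] k)"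
    using p_gt_1 by (intro arg_cong2 [where f="finsum R"]) auto
  also have "\<dots> = (\<Oplus>i\<in>{1..<p}. \<guillemotleft>int i\<guillemotright> [^] k)"
    using k p_gt_1 by (subst finsum_insert) (auto simp: nat_pow_zero)
  also have "\<dots> = (\<Oplus>i\<in>{1..<p}. \<guillemotleft>1\<guillemotright>)"
  proof (rule finsum_cong')
    fix i assume i: "i \<in> {1..<p}"
    then have "\<not> int p dvd int i" by (auto simp: int_dvd_int_iff dest!: dvd_imp_le)
    then show "\<guillemotleft>int i\<guillemotright> [^] k = \<guillemotleft>1\<guillemotright>" unfolding k of_int_1 by (rule fermat_of_int_unit)
  qed auto
  also have "\<dots> = \<guillemotleft>int p - 1\<guillemotright>"
    using p_gt_1 by (subst finsum_of_int) (auto simp: of_nat_diff)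
  also have "\<dots> = \<ominus> \<one>" by (simp only: of_int_diff) simp
  finally show ?thesis using False by simp
qed

text \<open>Expansion in powers of i leaves power sums over the prime field, and these vanish for
  exponents below p - 1. With \<open>y\<close> a power of the uniformiser this computes the traces
  of the powers of \<theta>; with \<open>y\<close> equal to -1 it shows that the idempotents
  attached to a root of X^p = X add up to 1.\<close>

lemma shifted_power_sum:
  assumes [simp]: "x \<in> carrier R" "y \<in> carrier R" and l: "l < p"
  shows "(\<Oplus>i\<in>{..<p}. (x \<oplus> \<guillemotleft>int i\<guillemotright> \<otimes> y) [^] l) = (if l < p - 1 then \<zero> else \<ominus> (y [^] (p - 1)))"
proof -
  define G where "G k = \<guillemotleft>int (l choose k)\<guillemotright> \<otimes> (y [^] k \<otimes> x [^] (l - k))" for k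
  have G [simp]: "G k \<in> carrier R" for k by (simp add: G_def)
  have "(x \<oplus> \<guillemotleft>int i\<guillemotright> \<otimes> y) [^] l = (\<Oplus>k\<in>{..l}. \<guillemotleft>int i\<guillemotright> [^] k \<otimes> G k)" for i
    by (subst a_comm, simp, simp, subst binomial_theorem)
      (auto simp: G_def nat_pow_distrib m_ac intro!: finsum_cong')
  then have "(\<Oplus>i\<in>{..<p}. (x \<oplus> \<guillemotleft>int i\<guillemotright> \<otimes> y) [^] l) = (\<Oplus>i\<in>{..<p}. \<Oplus>k\<in>{..l}. \<guillemotleft>int i\<guillemotright> [^] k \<otimes> G k)"
    by simp
  also have "\<dots> = (\<Oplus>k\<in>{..l}. \<Oplus>i\<in>{..<p}. \<guillemotleft>int i\<guillemotright> [^] k \<otimes> G k)"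
    by (rule finsum_swap) auto
  also have "\<dots> = (\<Oplus>k\<in>{..l}. (if k < p - 1 then \<zero> else \<ominus> \<one>) \<otimes> G k)"
    using l by (intro finsum_cong') (auto simp: finsum_ldistr [symmetric] power_sum_of_int)
  \<comment> \<open>As \<open>k \<le> l < p\<close>, a nonzero power sum forces k = l = p -
    1.\<close>
  also have "\<dots> = (\<Oplus>k\<in>{..l}. if k = l then (if l < p - 1 then \<zero> else \<ominus> \<one>) \<otimes> G l else \<zero>)"
    using l by (intro finsum_cong') auto
  also have "\<dots> = (if l < p - 1 then \<zero> else \<ominus> \<one>) \<otimes> G l"
    by (subst add.finprod_singleton_swap) auto
  also have "\<dots> = (if l < p - 1 then \<zero> else \<ominus> (y [^] (p - 1)))"
  proof (cases "l < p - 1")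
    case False
    with l have "l = p - 1" by simp
    with False show ?thesis by (simp add: G_def l_minus)
  qed simp
  finally show ?thesis .
qed

end

section \<open>Adically complete rings\<close>

lemma (in cring) mem_cgenideal: "x \<in> PIdl a \<longleftrightarrow> (\<exists>c\<in>carrier R. x = c \<otimes> a)"
  unfolding cgenideal_def by blast

locale adic_ring = cring +
  fixes u assumes u [simp]: "u \<in> carrier R"
begin

text \<open>Congruence modulo \<open>u [^] N\<close>. Membership in the carrier is built in, so that
  a congruence also types both of its sides.\<close>

definition cg :: "nat \<Rightarrow> 'a \<Rightarrow> 'a \<Rightarrow> bool"
  where "cg N x y \<longleftrightarrow> x \<in> carrier R \<and> y \<in> carrier R \<and> (\<exists>c\<in>carrier R. x = y \<oplus> u [^] N \<otimes> c)"

lemma cgD: "cg N x y \<Longrightarrow> x \<in> carrier R" "cg N x y \<Longrightarrow> y \<in> carrier R"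
  by (simp_all add: cg_def)

lemma cgE:
  assumes "cg N x y"
  obtains c where "c \<in> carrier R" "x = y \<oplus> u [^] N \<otimes> c"
  using assms by (auto simp: cg_def)

lemma cgI: "y \<in> carrier R \<Longrightarrow> c \<in> carrier R \<Longrightarrow> x = y \<oplus> u [^] N \<otimes> c \<Longrightarrow> cg N x y"
  by (auto simp: cg_def)

lemma cg_refl [simp]: "x \<in> carrier R \<Longrightarrow> cg N x x"
  by (rule cgI [of _ \<zero>]) auto

lemma cg_sym:
  assumes "cg N x y" shows "cg N y x"
proof -
  obtain c where c [simp]: "c \<in> carrier R" and x: "x = y \<oplus> u [^] N \<otimes> c"
    using assms by (rule cgE)
  have y [simp]: "y \<in> carrier R" using assms by (rule cgD)
  have "\<And>a. a \<in> carrier R \<Longrightarrow> y = y \<oplus> a \<otimes> c \<oplus> a \<otimes> (\<ominus> c)"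
    using c y by algebra
  then show "cg N y x" by (intro cgI [of _ "\<ominus> c"]) (auto simp: x)
qed

lemma cg_trans [trans]:
  assumes "cg N x y" "cg N y z"
  shows "cg N x z"
proof -
  obtain c d where c: "c \<in> carrier R" "x = y \<oplus> u [^] N \<otimes> c"
    and d: "d \<in> carrier R" "y = z \<oplus> u [^] N \<otimes> d"
    using assms by (metis cgE)
  have z: "z \<in> carrier R" using assms by (auto dest: cgD)
  then show ?thesis
    using c d by (intro cgI [of _ "c \<oplus> d"]) (auto simp: r_distr a_ac)
qed

lemma cg_eq_trans [trans]: "cg N x y \<Longrightarrow> y = z \<Longrightarrow> cg N x z" "x = y \<Longrightarrow> cg N y z \<Longrightarrow> cg N x z"
  by auto

lemma cg_add:
  assumes "cg N x y" "cg N x' y'"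
  shows "cg N (x \<oplus> x') (y \<oplus> y')"
proof -
  obtain c d where c: "c \<in> carrier R" "x = y \<oplus> u [^] N \<otimes> c"
    and d: "d \<in> carrier R" "x' = y' \<oplus> u [^] N \<otimes> d"
    using assms by (metis cgE)
  have "y \<in> carrier R" "y' \<in> carrier R" using assms by (auto dest: cgD)
  then show ?thesis
    using c d by (intro cgI [of _ "c \<oplus> d"]) (auto simp: r_distr a_ac)
qed

lemma cg_mult:
  assumes "cg N x y" "cg N x' y'"
  shows "cg N (x \<otimes> x') (y \<otimes> y')"
proof -
  obtain c d where c: "c \<in> carrier R" "x = y \<oplus> u [^] N \<otimes> c"
    and d: "d \<in> carrier R" "x' = y' \<oplus> u [^] N \<otimes> d"
    using assms by (metis cgE)
  have y: "y \<in> carrier R" "y' \<in> carrier R" using assms by (auto dest: cgD)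
  have "\<And>a. a \<in> carrier R \<Longrightarrow> (y \<oplus> a \<otimes> c) \<otimes> (y' \<oplus> a \<otimes> d)
      = y \<otimes> y' \<oplus> a \<otimes> (c \<otimes> y' \<oplus> y \<otimes> d \<oplus> a \<otimes> c \<otimes> d)"
    using c(1) d(1) y by algebra
  then show ?thesis
    using c d y by (intro cgI [of _ "c \<otimes> y' \<oplus> y \<otimes> d \<oplus> u [^] N \<otimes> c \<otimes> d"]) auto
qed

lemma cg_neg:
  assumes "cg N x y" shows "cg N (\<ominus> x) (\<ominus> y)"
proof -
  have [simp]: "x \<in> carrier R" "y \<in> carrier R" using assms by (auto dest: cgD)
  have "cg N (\<ominus> \<one> \<otimes> x) (\<ominus> \<one> \<otimes> y)" using assms by (intro cg_mult) auto
  then show ?thesis by (simp add: l_minus)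
qed

lemma cg_diff: "cg N x y \<Longrightarrow> cg N x' y' \<Longrightarrow> cg N (x \<ominus> x') (y \<ominus> y')"
  unfolding minus_eq by (intro cg_add cg_neg)

lemma cg_pow: "cg N x y \<Longrightarrow> cg N (x [^] (n::nat)) (y [^] n)"
  by (induction n) (auto intro: cg_mult)

lemma cg_finsum:
  assumes "finite I" "\<And>i. i \<in> I \<Longrightarrow> cg N (f i) (g i)"
  shows "cg N (\<Oplus>i\<in>I. f i) (\<Oplus>i\<in>I. g i)"
  using assms
proof (induction I rule: finite_induct)
  case (insert i I)
  then have "f \<in> insert i I \<rightarrow> carrier R" "g \<in> insert i I \<rightarrow> carrier R" by (auto dest: cgD)
  with insert show ?case by (simp add: cg_add)
qed simp

lemma cg_mono:
  assumes "cg N x y" "M \<le> N" shows "cg M x y"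
proof -
  obtain c where c: "c \<in> carrier R" "x = y \<oplus> u [^] N \<otimes> c"
    using assms(1) by (rule cgE)
  have "u [^] N = u [^] M \<otimes> u [^] (N - M)" using assms(2) by (simp add: nat_pow_mult)
  with c assms show ?thesis
    by (intro cgI [of _ "u [^] (N - M) \<otimes> c"]) (auto simp: m_assoc dest: cgD)
qed

lemma cg_0 [simp]:
  assumes "x \<in> carrier R" "y \<in> carrier R" shows "cg 0 x y"
proof -
  have "x = y \<oplus> (x \<ominus> y)" using assms by algebra
  with assms show ?thesis by (intro cgI [of _ "x \<ominus> y"]) auto
qed

lemma cg_zero_iff: "cg N x \<zero> \<longleftrightarrow> (\<exists>c\<in>carrier R. x = u [^] N \<otimes> c)"
  by (auto simp: cg_def)

lemma cg_diff_zero_iff: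
  assumes [simp]: "x \<in> carrier R" "y \<in> carrier R"
  shows "cg N (x \<ominus> y) \<zero> \<longleftrightarrow> cg N x y"
proof
  assume "cg N (x \<ominus> y) \<zero>"
  then have "cg N (x \<ominus> y \<oplus> y) (\<zero> \<oplus> y)" by (intro cg_add) auto
  then show "cg N x y" by (simp add: minus_eq a_assoc l_neg)
next
  assume "cg N x y"
  then have "cg N (x \<ominus> y) (y \<ominus> y)" by (intro cg_diff) auto
  then show "cg N (x \<ominus> y) \<zero>" by (simp add: minus_eq r_neg)
qed

lemma cg_iff_diff_mem: 
  assumes "x \<in> carrier R" "y \<in> carrier R"
  shows "cg N x y \<longleftrightarrow> x \<ominus> y \<in> PIdl (u [^] N)"
  using assms by (auto simp: cg_diff_zero_iff [symmetric] cg_zero_iff mem_cgenideal m_comm)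

lemma cg_zero_mult:
  assumes "cg N x \<zero>" "cg M y \<zero>"
  shows "cg (N + M) (x \<otimes> y) \<zero>"
proof -
  obtain c d where c: "c \<in> carrier R" "x = u [^] N \<otimes> c" "d \<in> carrier R" "y = u [^] M \<otimes> d"
    using assms unfolding cg_zero_iff by blast
  then have "x \<otimes> y = u [^] (N + M) \<otimes> (c \<otimes> d)"
    by (simp add: m_ac flip: nat_pow_mult)
  with c show ?thesis by (auto simp: cg_zero_iff)
qed

lemma cg_zero_pow: "cg N x \<zero> \<Longrightarrow> cg (N * m) (x [^] m) \<zero>"
proof (induction m)
  case (Suc m)
  then show ?case using cg_zero_mult [of "N * m" "x [^] m" N x] by (simp add: add.commute)
qed simp

text \<open>The gained power of \<open>u\<close> is what makes maps with a factor \<open>u\<close>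
  in front of their variable part into contractions.\<close>

lemma cg_u_mult: "cg N x y \<Longrightarrow> cg (Suc N) (u \<otimes> x) (u \<otimes> y)"
proof -
  assume *: "cg N x y"
  then have [simp]: "x \<in> carrier R" "y \<in> carrier R" by (auto dest: cgD)
  have eq: "u \<otimes> x \<ominus> u \<otimes> y = u \<otimes> (x \<ominus> y)" using \<open>x \<in> carrier R\<close> \<open>y \<in> carrier R\<close> u by algebra
  have "cg (Suc 0) u \<zero>" unfolding cg_zero_iff by (intro bexI [of _ \<one>]) auto
  moreover have "cg N (x \<ominus> y) \<zero>" using * by (simp add: cg_diff_zero_iff)
  ultimately have "cg (Suc 0 + N) (u \<otimes> (x \<ominus> y)) \<zero>" by (rule cg_zero_mult)
  then have "cg (Suc N) (u \<otimes> x \<ominus> u \<otimes> y) \<zero>" by (simp add: eq)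
  then show ?thesis by (subst (asm) cg_diff_zero_iff) auto
qed

end

lemma (in ring) finsum_restrict_zero:
  assumes "finite J'" "J \<subseteq> J'" "f \<in> J \<rightarrow> carrier R"
  shows "(\<Oplus>i\<in>J'. if i \<in> J then f i else \<zero>) = (\<Oplus>i\<in>J. f i)"
  using assms by (intro add.finprod_mono_neutral_cong_left [symmetric]) auto

context adic_ring
begin

lemma cg_finsum_subset:
  assumes "finite J'" "J \<subseteq> J'" "f \<in> J' \<rightarrow> carrier R" "\<And>i. i \<in> J' - J \<Longrightarrow> cg N (f i) \<zero>"
  shows "cg N (\<Oplus>i\<in>J'. f i) (\<Oplus>i\<in>J. f i)"
proof -
  have "cg N (\<Oplus>i\<in>J'. f i) (\<Oplus>i\<in>J'. if i \<in> J then f i else \<zero>)"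
    using assms by (intro cg_finsum) (auto intro!: cg_refl)
  also have "(\<Oplus>i\<in>J'. if i \<in> J then f i else \<zero>) = (\<Oplus>i\<in>J. f i)"
    using assms by (intro finsum_restrict_zero) auto
  finally show ?thesis .
qed

end

text \<open>Completeness is asked for sequences whose N-th step is divisible by
  \<open>u [^] N\<close>, and the limit comes with the same rate. Iterates of a contraction have
  this form, so no subsequences need be extracted.\<close>

locale adic_complete = adic_ring +
  assumes separated: "\<lbrakk>x \<in> carrier R; \<And>N. cg N x \<zero>\<rbrakk> \<Longrightarrow> x = \<zero>"
    and complete: "(\<And>N. cg N (s N) (s (Suc N))) \<Longrightarrow> \<exists>l\<in>carrier R. \<forall>N. cg N (s N) l"
begin

lemma separated_eq:
  assumes "\<And>N. cg N x y" shows "x = y"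
proof -
  have [simp]: "x \<in> carrier R" "y \<in> carrier R" using assms cgD by blast+
  then have "x \<ominus> y = \<zero>" using assms by (intro separated) (auto simp: cg_diff_zero_iff)
  then show ?thesis by simp
qed

text \<open>The fixed point theorem of Banach for the u-adic metric, by iteration from 0. Inverses,
  Artin-Schreier roots and m-th roots all come from it.\<close>

lemma contraction_fixpoint:
  assumes F: "\<And>x. x \<in> carrier R \<Longrightarrow> F x \<in> carrier R"
    and contr: "\<And>N x y. cg N x y \<Longrightarrow> cg (Suc N) (F x) (F y)"
  shows "\<exists>x\<in>carrier R. F x = x"
proof -
  define s where "s n = (F ^^ n) \<zero>" for n
  have s [simp]: "s n \<in> carrier R" for n by (induction n) (auto simp: s_def F)
  have s_Suc: "s (Suc n) = F (s n)" for n by (simp add: s_def)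
  have s_step: "cg N (s N) (s (Suc N))" for N
  proof (induction N)
    case (Suc N)
    show ?case using contr [OF Suc.IH] unfolding s_Suc [of "Suc N"] s_Suc [of N] .
  qed simp
  obtain l where l: "l \<in> carrier R" "\<And>N. cg N (s N) l"
    using complete [of s, OF s_step] by blast
  have "cg N (F l) l" for N
  proof -
    have "cg N (F l) (s (Suc N))"
      unfolding s_Suc by (rule cg_mono [OF cg_sym [OF contr [OF l(2)]]]) simp
    also have "cg N (s (Suc N)) l" using l(2) [of "Suc N"] by (rule cg_mono) simp
    finally show ?thesis .
  qed
  then have "F l = l" by (rule separated_eq)
  with l(1) show ?thesis by (rule bexI [rotated])
qed

text \<open>An inverse of 1 + u y is a fixed point of x |-> 1 - u y x.\<close>

lemma unit_one_add:
  assumes [simp]: "y \<in> carrier R"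
  shows "\<one> \<oplus> u \<otimes> y \<in> Units R"
proof -
  define F where "F x = \<one> \<oplus> u \<otimes> (\<ominus> y \<otimes> x)" for x
  have F_closed: "F x \<in> carrier R" if "x \<in> carrier R" for x
    using that by (simp add: F_def)
  have F_contr: "cg (Suc N) (F x) (F z)" if "cg N x z" for N x z
      unfolding F_def using that by (intro cg_add cg_u_mult cg_mult) auto
  obtain x where x: "x \<in> carrier R" "F x = x"
    using contraction_fixpoint [of F, OF F_closed F_contr] by blast
  have "(\<one> \<oplus> u \<otimes> y) \<otimes> x = x \<oplus> u \<otimes> (y \<otimes> x)" using x(1) u assms by algebra
  also have "\<dots> = F x \<oplus> u \<otimes> (y \<otimes> x)" by (simp add: x)
  also have "\<dots> = \<one>" unfolding F_def using x(1) u assms by algebra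
  finally show ?thesis using x(1) by (auto simp: Units_def m_comm intro!: bexI [of _ x])
qed

end

locale adic_complete_char = adic_complete + cring_char
begin

lemma artin_schreier_solvable:
  assumes [simp]: "y \<in> carrier R"
  shows "\<exists>g\<in>carrier R. g [^] p \<ominus> g = u \<otimes> y"
proof -
  obtain q where q: "p = Suc (Suc q)"
    using p_gt_1 by (metis less_imp_Suc_add plus_1_eq_Suc add_Suc)
  \<comment> \<open>With g = u x the equation, divided by u, reads x = u^(p-1) x^p - y. Here p - 1
    is \<open>Suc q\<close>, and the positive power of u makes the right side a contraction.\<close>
  define F where "F x = u \<otimes> (u [^] q \<otimes> x [^] p) \<ominus> y" for x
  have F_closed: "F x \<in> carrier R" if "x \<in> carrier R" for x
    using that by (simp add: F_def)
  have F_contr: "cg (Suc N) (F x) (F z)" if "cg N x z" for N x z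
      unfolding F_def using that by (intro cg_diff cg_u_mult cg_mult cg_pow) auto
  obtain x where x [simp]: "x \<in> carrier R" and Fx: "F x = x"
    using contraction_fixpoint [of F, OF F_closed F_contr] by blast
  have id: "\<And>a b. a \<in> carrier R \<Longrightarrow> b \<in> carrier R \<Longrightarrow> u \<otimes> (u \<otimes> a \<otimes> b) \<ominus> u \<otimes> (u \<otimes> (a \<otimes> b) \<ominus> y) = u \<otimes> y"
    using u assms by algebra
  have "u [^] p = u \<otimes> u \<otimes> u [^] q"
    unfolding q nat_pow_Suc using m_ac(2)[of u] by (simp add: m_assoc m_comm)
  then have 1: "(u \<otimes> x) [^] p = u \<otimes> (u \<otimes> u [^] q \<otimes> x [^] p)"
    by (simp add: nat_pow_distrib m_assoc)
  have 2: "u \<otimes> x = u \<otimes> (u \<otimes> (u [^] q \<otimes> x [^] p) \<ominus> y)"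
    by (rule arg_cong [OF Fx [symmetric, unfolded F_def]])
  have "(u \<otimes> x) [^] p \<ominus> u \<otimes> x = u \<otimes> (u \<otimes> u [^] q \<otimes> x [^] p) \<ominus> u \<otimes> (u \<otimes> (u [^] q \<otimes> x [^] p) \<ominus> y)"
    by (rule arg_cong2 [OF 1 2])
  also have "\<dots> = u \<otimes> y" by (rule id) auto
  finally have "(u \<otimes> x) [^] p \<ominus> u \<otimes> x = u \<otimes> y" .
  then show ?thesis by (intro bexI [of _ "u \<otimes> x"]) auto
qed

text \<open>Expansion of the m-th power to first order. The remainder \<open>q\<close> is a
  polynomial in x, but only its compatibility with congruences is recorded, which is all that a
  contraction needs.\<close>

lemma pow_one_add_expansion:
  "\<exists>q. (\<forall>x\<in>carrier R. q x \<in> carrier R \<and>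
          (\<one> \<oplus> u \<otimes> x) [^] m = \<one> \<oplus> u \<otimes> (\<guillemotleft>int m\<guillemotright> \<otimes> x \<oplus> u \<otimes> q x)) \<and>
       (\<forall>N x y. cg N x y \<longrightarrow> cg N (q x) (q y))" for m :: nat
proof (induction m)
  case 0
  show ?case by (intro exI [of _ "\<lambda>_. \<zero>"]) auto
next
  case (Suc m)
  then obtain q where q: "\<And>x. x \<in> carrier R \<Longrightarrow> q x \<in> carrier R"
    "\<And>x. x \<in> carrier R \<Longrightarrow> (\<one> \<oplus> u \<otimes> x) [^] m = \<one> \<oplus> u \<otimes> (\<guillemotleft>int m\<guillemotright> \<otimes> x \<oplus> u \<otimes> q x)"
    "\<And>N x y. cg N x y \<Longrightarrow> cg N (q x) (q y)" by blast
  define q' where "q' x = \<guillemotleft>int m\<guillemotright> \<otimes> (x \<otimes> x) \<oplus> q x \<oplus> u \<otimes> (x \<otimes> q x)" for x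
  have "(\<one> \<oplus> u \<otimes> x) [^] Suc m = \<one> \<oplus> u \<otimes> (\<guillemotleft>int (Suc m)\<guillemotright> \<otimes> x \<oplus> u \<otimes> q' x)" if x: "x \<in> carrier R" for x
  proof -
    have id: "\<And>n v. n \<in> carrier R \<Longrightarrow> v \<in> carrier R \<Longrightarrow> (\<one> \<oplus> u \<otimes> (n \<otimes> x \<oplus> u \<otimes> v)) \<otimes> (\<one> \<oplus> u \<otimes> x)
      = \<one> \<oplus> u \<otimes> ((\<one> \<oplus> n) \<otimes> x \<oplus> u \<otimes> (n \<otimes> (x \<otimes> x) \<oplus> v \<oplus> u \<otimes> (x \<otimes> v)))"
      using x u by algebra
    show ?thesis using x q by (simp add: q'_def id)
  qed
  moreover have "cg N (q' x) (q' y)" if "cg N x y" for N x y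
    unfolding q'_def using that by (intro cg_add cg_mult q(3)) auto
  moreover have "q' x \<in> carrier R" if "x \<in> carrier R" for x using that q by (simp add: q'_def)
  ultimately show ?case by (intro exI [of _ q']) blast
qed

text \<open>A case of Hensel's lemma: m is invertible because it is prime to the characteristic, and
  with the first order expansion the equation becomes z = m^(-1) (v - u q(z)), whose right side is a
  contraction.\<close>

lemma root_of_one_add:
  assumes m: "coprime m p" and [simp]: "v \<in> carrier R"
  shows "\<exists>z\<in>carrier R. (\<one> \<oplus> u \<otimes> z) [^] (m::nat) = \<one> \<oplus> u \<otimes> v"
proof -
  obtain q where q: "\<And>x. x \<in> carrier R \<Longrightarrow> q x \<in> carrier R"
    "\<And>x. x \<in> carrier R \<Longrightarrow> (\<one> \<oplus> u \<otimes> x) [^] m = \<one> \<oplus> u \<otimes> (\<guillemotleft>int m\<guillemotright> \<otimes> x \<oplus> u \<otimes> q x)"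
    "\<And>N x y. cg N x y \<Longrightarrow> cg N (q x) (q y)"
    using pow_one_add_expansion [of m] by blast
  have "\<not> int p dvd int m"
    using m p by (metis coprime_absorb_right int_dvd_int_iff not_prime_unit)
  then have mU: "\<guillemotleft>int m\<guillemotright> \<in> Units R" by (rule unit_of_int)
  define F where "F x = inv \<guillemotleft>int m\<guillemotright> \<otimes> (v \<ominus> u \<otimes> q x)" for x
  have F_closed: "F x \<in> carrier R" if "x \<in> carrier R" for x
    using that q mU by (simp add: F_def)
  have F_contr: "cg (Suc N) (F x) (F z)" if *: "cg N x z" for N x z
  proof -
    have "cg (Suc N) (v \<ominus> u \<otimes> q x) (v \<ominus> u \<otimes> q z)"
      using * by (intro cg_diff cg_u_mult q) auto
    then show ?thesis
      unfolding F_def using mU by (intro cg_mult) auto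
  qed
  obtain x where x [simp]: "x \<in> carrier R" and Fx: "F x = x"
    using contraction_fixpoint [of F, OF F_closed F_contr] by blast
  have "\<guillemotleft>int m\<guillemotright> \<otimes> F x = (\<guillemotleft>int m\<guillemotright> \<otimes> inv \<guillemotleft>int m\<guillemotright>) \<otimes> (v \<ominus> u \<otimes> q x)"
    unfolding F_def using mU q by (subst m_assoc) auto
  then have "\<guillemotleft>int m\<guillemotright> \<otimes> x = v \<ominus> u \<otimes> q x" using mU q by (simp add: Fx)
  moreover have "\<And>a. a \<in> carrier R \<Longrightarrow> v \<ominus> a \<oplus> a = v" using assms(2) by algebra
  ultimately show ?thesis using q by (intro bexI [of _ x]) auto
qed

end

section \<open>Discrete valuation rings\<close>

locale dvr_unif = principal_domain R for R :: "'a ring" (structure) +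
  fixes u
  assumes dvr: "dvr R" and unif: "uniformiser R u"
begin

sublocale adic_ring R u
  by unfold_locales (use unif in \<open>auto simp: uniformiser_def\<close>)

lemma u_nonzero [simp]: "u \<noteq> \<zero>" and maximal_u: "maximalideal (PIdl u) R"
  using unif by (auto simp: uniformiser_def)

lemma prime_u: "primeideal (PIdl u) R"
  by (rule maximalideal_prime [OF maximal_u])

lemma u_not_unit: "u \<notin> Units R"
  using ideal_eq_carrier_iff [OF u] maximal_u maximalideal.I_notcarr by blast

lemma prime_ideal_eq:
  assumes "primeideal P R" "P \<noteq> {\<zero>}" shows "P = PIdl u"
proof -
  have "PIdl u \<noteq> {\<zero>}" using cgenideal_self [OF u] by auto
  then show ?thesis using dvr assms prime_u unfolding dvr_def by blast
qed

lemma unit_iff: "x \<in> carrier R \<Longrightarrow> x \<in> Units R \<longleftrightarrow> x \<notin> PIdl u"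
proof
  assume x: "x \<in> carrier R" "x \<notin> PIdl u"
  show "x \<in> Units R"
  proof (rule ccontr)
    assume nu: "x \<notin> Units R"
    have "\<zero> \<in> PIdl u" by (auto simp: mem_cgenideal intro!: bexI [of _ \<zero>])
    with x have "x \<in> carrier R - {\<zero>}" by auto
    \<comment> \<open>A nonzero nonunit has an irreducible divisor. Its ideal is maximal, hence
      equals the ideal of \<open>u\<close>, the only nonzero prime ideal.\<close>
    then obtain b where b: "b \<in> carrier R" "ring_irreducible b" "b divides x"
      using nu exists_irreducible_divisor by blast
    have "primeideal (PIdl b) R"
      by (rule maximalideal_prime [OF irreducible_imp_maximalideal [OF b(1,2)]])
    moreover have "PIdl b \<noteq> {\<zero>}"
      using b(2) cgenideal_self [OF b(1)] by (auto simp: ring_irreducible_def)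
    ultimately have "PIdl b = PIdl u" by (rule prime_ideal_eq)
    with b x show False
      using to_contain_is_to_divide [of b x] cgenideal_self [of x] by blast
  qed
next
  assume x: "x \<in> carrier R" "x \<in> Units R"
  show "x \<notin> PIdl u"
  proof
    assume "x \<in> PIdl u"
    then obtain c where c: "c \<in> carrier R" "x = c \<otimes> u" by (auto simp: mem_cgenideal)
    then have "u \<in> Units R" using x(2) u unit_factor [of u c] by (simp add: m_comm)
    then show False using u_not_unit by blast
  qed
qed

lemma unit_iff_cg: "x \<in> carrier R \<Longrightarrow> x \<in> Units R \<longleftrightarrow> \<not> cg 1 x \<zero>"
  unfolding unit_iff cg_zero_iff by (auto simp: mem_cgenideal m_comm)

lemma pow_u_nonzero [simp]: "u [^] (n::nat) \<noteq> \<zero>"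
  by (induction n) (auto simp: integral_iff)

lemma cg_one_prime:
  assumes "x \<in> carrier R" "y \<in> carrier R" "cg 1 (x \<otimes> y) \<zero>"
  shows "cg 1 x \<zero> \<or> cg 1 y \<zero>"
proof -
  have "x \<otimes> y \<in> PIdl u" using assms by (auto simp: cg_zero_iff mem_cgenideal m_comm)
  then have "x \<in> PIdl u \<or> y \<in> PIdl u"
    using primeideal.I_prime [OF prime_u] assms by blast
  then show ?thesis using assms by (auto simp: cg_zero_iff mem_cgenideal m_comm)
qed

text \<open>Write x = u^N y_N. The ideals of the y_N ascend, so they become stationary: y_(N+1) =
  y_N c = u y_(N+1) c. Unless x = 0 this makes u a unit.\<close>

lemma dvr_separated:
  assumes x: "x \<in> carrier R" and div: "\<And>N. cg N x \<zero>"
  shows "x = \<zero>"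
proof (rule ccontr)
  assume "x \<noteq> \<zero>"
  have "\<forall>N::nat. \<exists>c. c \<in> carrier R \<and> x = u [^] N \<otimes> c"
  proof
    fix N :: nat show "\<exists>c. c \<in> carrier R \<and> x = u [^] N \<otimes> c"
      using div [of N] by (simp only: cg_zero_iff Bex_def)
  qed
  from choice [OF this] obtain y :: "nat \<Rightarrow> 'a"
    where yy: "\<forall>N. y N \<in> carrier R \<and> x = u [^] N \<otimes> y N" ..
  have y: "y N \<in> carrier R" "x = u [^] N \<otimes> y N" for N
    using yy [rule_format, of N] by (rule conjunct1) (rule conjunct2 [OF yy [rule_format, of N]])
  have step: "y N = u \<otimes> y (Suc N)" for N
  proof -
    have "u [^] N \<otimes> y N = u [^] Suc N \<otimes> y (Suc N)"
      by (rule trans [OF y(2) [symmetric] y(2)])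
    also have "\<dots> = u [^] N \<otimes> (u \<otimes> y (Suc N))" using y(1) [of "Suc N"] by (simp add: m_assoc)
    finally show ?thesis using y(1) [of N] y(1) [of "Suc N"]
      by (simp only: m_lcancel m_closed u nat_pow_closed pow_u_nonzero not_False_eq_True)
  qed
  have mono: "PIdl (y N) \<subseteq> PIdl (y (Suc N))" for N
    using y(1) [of "Suc N"] step [of N] y(1) [of N] u
    by (metis dividesI m_comm to_contain_is_to_divide)
  have "mono (\<lambda>N. PIdl (y N))" by (rule incseq_SucI) (rule mono)
  then have lin: "PIdl (y M) \<subseteq> PIdl (y N) \<or> PIdl (y N) \<subseteq> PIdl (y M)" for M N
    using monoD [of "\<lambda>N. PIdl (y N)" M N] monoD [of "\<lambda>N. PIdl (y N)" N M] by (metis nat_le_linear)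
  have "subset.chain {I. ideal I R} (range (\<lambda>N. PIdl (y N)))"
    unfolding subset_chain_def
  proof (intro conjI ballI subsetI)
    fix I assume "I \<in> range (\<lambda>N. PIdl (y N))"
    then show "I \<in> {I. ideal I R}" using cgenideal_ideal [OF y(1)] by blast
  next
    fix I J assume "I \<in> range (\<lambda>N. PIdl (y N))" "J \<in> range (\<lambda>N. PIdl (y N))"
    then show "I \<subseteq> J \<or> J \<subseteq> I" using lin by blast
  qed
  then have "\<Union> (range (\<lambda>N. PIdl (y N))) \<in> range (\<lambda>N. PIdl (y N))"
    by (intro ideal_chain_is_trivial) auto
  then obtain N where "(\<Union>M. PIdl (y M)) = PIdl (y N)" by auto
  then have "PIdl (y (Suc N)) \<subseteq> PIdl (y N)" by blast
  then obtain c where c: "c \<in> carrier R" "y (Suc N) = y N \<otimes> c"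
    using to_contain_is_to_divide [OF y(1) y(1)] unfolding factor_def by blast
  have nz: "y (Suc N) \<noteq> \<zero>" using y(2) [of "Suc N"] \<open>x \<noteq> \<zero>\<close> by auto
  have "y (Suc N) \<otimes> (u \<otimes> c) = (u \<otimes> y (Suc N)) \<otimes> c"
    using c(1) y(1) by (simp add: m_ac)
  also have "\<dots> = y N \<otimes> c" by (simp only: step [of N, symmetric])
  also have "\<dots> = y (Suc N) \<otimes> \<one>" using c y(1) by simp
  finally have "u \<otimes> c = \<one>" using m_lcancel [OF nz y(1) _ one_closed] c(1) by simp
  then show False using u_not_unit c(1) by (auto simp: Units_def m_comm)
qed

lemma valuation_decomp:
  assumes x: "x \<in> carrier R" "x \<noteq> \<zero>"
  obtains n e where "e \<in> Units R" "x = u [^] (n::nat) \<otimes> e"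
proof -
  obtain N where N: "\<not> cg N x \<zero>" using x dvr_separated by blast
  define M where "M = (LEAST N. \<not> cg N x \<zero>)"
  have M: "\<not> cg M x \<zero>" unfolding M_def using N by (rule LeastI)
  then obtain n where n: "M = Suc n" using x by (cases M) auto
  have "cg n x \<zero>" using not_less_Least [of n "\<lambda>N. \<not> cg N x \<zero>"] n M_def by auto
  then obtain e where e: "e \<in> carrier R" "x = u [^] n \<otimes> e" by (auto simp: cg_zero_iff)
  have "\<not> cg 1 e \<zero>"
  proof
    assume "cg 1 e \<zero>"
    moreover have "cg n (u [^] n) \<zero>" by (auto simp: cg_zero_iff intro!: bexI [of _ \<one>])
    ultimately have "cg M x \<zero>" using cg_zero_mult [of n "u [^] n" 1 e] e n by simp
    with M show False ..
  qed
  then have "e \<in> Units R" using e unit_iff_cg by blast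
  with e that show thesis by blast
qed

text \<open>This gives the uniqueness of the exponents that \<open>ramification_index\<close> and
  \<open>different_degree\<close> pick with a definite description.\<close>

lemma pow_u_ideal_inj:
  assumes "PIdl (u [^] (a::nat)) = PIdl (u [^] (b::nat))" shows "a = b"
proof -
  have "a \<le> b" if sub: "PIdl (u [^] (b::nat)) \<subseteq> PIdl (u [^] (a::nat))" for a b
  proof (rule ccontr)
    assume "\<not> a \<le> b"
    then have a: "u [^] a = u [^] b \<otimes> (u \<otimes> u [^] (a - Suc b))"
      using nat_pow_mult [OF u, of b "Suc (a - Suc b)"] by (simp add: m_comm)
    obtain c where c: "c \<in> carrier R" "u [^] b = u [^] a \<otimes> c"
      using to_contain_is_to_divide [THEN iffD1, OF nat_pow_closed nat_pow_closed sub] u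
      unfolding factor_def by auto
    have "u [^] b \<otimes> (u \<otimes> (u [^] (a - Suc b) \<otimes> c)) = u [^] b \<otimes> \<one>"
      using c a by (simp add: m_assoc)
    then have "u \<otimes> (u [^] (a - Suc b) \<otimes> c) = \<one>" using c(1) by (subst (asm) m_lcancel) auto
    moreover have "u [^] (a - Suc b) \<otimes> c \<in> carrier R" using c(1) by simp
    ultimately show False using u_not_unit u unfolding Units_def by (auto simp: m_comm)
  qed
  then show ?thesis using assms by (metis order_refl antisym)
qed

lemma uniformiser_ideal: "uniformiser R v \<Longrightarrow> PIdl v = PIdl u"
  using cgenideal_self [of v] unfolding uniformiser_def
  by (intro prime_ideal_eq maximalideal_prime) auto

end

section \<open>The ring of convergent Laurent series\<close>

text \<open>The coefficient at n does not change when all sequences are cut off above n. After the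
  cut they are polynomials, and the claim becomes associativity in \<open>UP R\<close>.\<close>

lemma (in cring) cauchy_product_assoc:
  assumes f: "\<And>i. f i \<in> carrier R" and g: "\<And>i. g i \<in> carrier R" and h: "\<And>i. h i \<in> carrier R"
  shows "(\<Oplus>j\<in>{..n::nat}. (\<Oplus>i\<in>{..j}. f i \<otimes> g (j - i)) \<otimes> h (n - j)) =
         (\<Oplus>i\<in>{..n}. f i \<otimes> (\<Oplus>k\<in>{..n - i}. g k \<otimes> h (n - i - k)))"
proof -
  define tr where "tr f = (\<lambda>i. if i \<le> n then f i else \<zero>)" for f :: "nat \<Rightarrow> 'a"
  have tr: "tr f \<in> carrier (UP R)" "up_ring.coeff (UP R) (tr f) = tr f" if "\<And>i. f i \<in> carrier R" for f
  proof -
    have "tr f \<in> up R"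
    proof (rule mem_upI)
      show "tr f k \<in> carrier R" for k using that by (simp add: tr_def)
      have "bound \<zero> n (tr f)" by (rule bound.intro) (simp add: tr_def)
      then show "\<exists>n. bound \<zero> n (tr f)" ..
    qed
    then show "tr f \<in> carrier (UP R)" "up_ring.coeff (UP R) (tr f) = tr f"
      unfolding UP_def by (simp_all only: partial_object.simps up_ring.simps restrict_apply if_True eta_contract_eq)
  qed
  interpret P: UP_cring R "UP R" by unfold_locales
  note F = tr(1) [of f, OF f] tr(1) [of g, OF g] tr(1) [of h, OF h]
  note C = tr(2) [of f, OF f] tr(2) [of g, OF g] tr(2) [of h, OF h]
  have T: "tr f i = f i" if "i \<le> n" for i and f :: "nat \<Rightarrow> 'a"
    unfolding tr_def using that by (rule if_P)
  have "(\<Oplus>j\<in>{..n}. (\<Oplus>i\<in>{..j}. f i \<otimes> g (j - i)) \<otimes> h (n - j)) =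
      (\<Oplus>j\<in>{..n}. (\<Oplus>i\<in>{..j}. tr f i \<otimes> tr g (j - i)) \<otimes> tr h (n - j))"
  proof (rule finsum_cong' [OF refl])
    fix j assume j: "j \<in> {..n}"
    have "(\<Oplus>i\<in>{..j}. f i \<otimes> g (j - i)) = (\<Oplus>i\<in>{..j}. tr f i \<otimes> tr g (j - i))"
      by (rule finsum_cong' [OF refl]) (use j f g in \<open>auto simp: tr_def\<close>)
    then show "(\<Oplus>i\<in>{..j}. f i \<otimes> g (j - i)) \<otimes> h (n - j) =
      (\<Oplus>i\<in>{..j}. tr f i \<otimes> tr g (j - i)) \<otimes> tr h (n - j)" by (simp add: T)
  qed (auto simp: tr_def f g h intro!: finsum_closed m_closed)
  also have "\<dots> = up_ring.coeff (UP R) ((tr f \<otimes>\<^bsub>UP R\<^esub> tr g) \<otimes>\<^bsub>UP R\<^esub> tr h) n"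
    using F by (simp add: C)
  also have "\<dots> = up_ring.coeff (UP R) (tr f \<otimes>\<^bsub>UP R\<^esub> (tr g \<otimes>\<^bsub>UP R\<^esub> tr h)) n"
    using F by (simp only: P.UP_m_assoc)
  also have "\<dots> = (\<Oplus>i\<in>{..n}. tr f i \<otimes> (\<Oplus>k\<in>{..n - i}. tr g k \<otimes> tr h (n - i - k)))"
    using F by (simp add: C)
  also have "\<dots> = (\<Oplus>i\<in>{..n}. f i \<otimes> (\<Oplus>k\<in>{..n - i}. g k \<otimes> h (n - i - k)))"
  proof (rule finsum_cong' [OF refl])
    fix i assume i: "i \<in> {..n}"
    have "(\<Oplus>k\<in>{..n - i}. tr g k \<otimes> tr h (n - i - k)) = (\<Oplus>k\<in>{..n - i}. g k \<otimes> h (n - i - k))"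
      by (rule finsum_cong' [OF refl]) (use i h g in \<open>auto simp: tr_def\<close>)
    then show "tr f i \<otimes> (\<Oplus>k\<in>{..n - i}. tr g k \<otimes> tr h (n - i - k)) =
      f i \<otimes> (\<Oplus>k\<in>{..n - i}. g k \<otimes> h (n - i - k))" using i by (simp add: T)
  qed (auto simp: f g h intro!: finsum_closed m_closed)
  finally show ?thesis .
qed

locale complete_dvr_base = dvr_unif R \<pi> for R :: "'r ring" (structure) and \<pi> +
  assumes cdvr: "complete_dvr R \<pi>"
begin

lemma adic_limit_iff_cg:
  assumes "\<And>j. s j \<in> carrier R"
  shows "adic_limit R \<pi> s l \<longleftrightarrow> l \<in> carrier R \<and> (\<forall>N. \<exists>M. \<forall>j\<ge>M. cg N (s j) l)"
  using assms unfolding adic_limit_def by (auto simp: cg_iff_diff_mem)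

lemma cauchy_imp_limit:
  assumes s: "\<And>j. s j \<in> carrier R" and c: "\<And>N. \<exists>M. \<forall>i\<ge>M. \<forall>j\<ge>M. cg N (s i) (s j)"
  shows "\<exists>l. adic_limit R \<pi> s l"
proof -
  have "adic_cauchy R \<pi> s"
    unfolding adic_cauchy_def
  proof
    fix N :: nat
    show "\<exists>M. \<forall>i\<ge>M. \<forall>j\<ge>M. s i \<ominus> s j \<in> PIdl (\<pi> [^] N)"
      using c [of N] by (simp only: cg_iff_diff_mem [OF s s])
  qed
  moreover have "range s \<subseteq> carrier R" using s by auto
  ultimately show ?thesis using cdvr unfolding complete_dvr_def by simp
qed

text \<open>Consecutive congruences make the sequence Cauchy. From index N on all members are
  congruent modulo \<pi>^N, and the limit inherits the rate.\<close>

sublocale adic_complete R \<pi>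
proof
  fix x assume "x \<in> carrier R" "\<And>N. cg N x \<zero>"
  then show "x = \<zero>" by (rule dvr_separated)
next
  fix s assume step: "\<And>N. cg N (s N) (s (Suc N))"
  have s: "s N \<in> carrier R" for N using cgD(1) [OF step [of N]] .
  have mono: "cg N (s N) (s (N + k))" for N k
  proof (induction k)
    case (Suc k)
    have "cg N (s (N + k)) (s (Suc (N + k)))" by (rule cg_mono [OF step]) simp
    then show ?case using cg_trans [OF Suc.IH] by simp
  qed (use s in simp)
  have mono': "cg N (s N) (s j)" if "j \<ge> N" for N j
    using mono [of N "j - N"] that by simp
  have "\<exists>M. \<forall>i\<ge>M. \<forall>j\<ge>M. cg N (s i) (s j)" for N
    by (intro exI [of _ N] allI impI) (rule cg_trans [OF cg_sym [OF mono'] mono'])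
  then have "\<exists>l. adic_limit R \<pi> s l" by (intro cauchy_imp_limit s)
  then obtain l where l: "l \<in> carrier R" "\<forall>N. \<exists>M. \<forall>j\<ge>M. cg N (s j) l"
    unfolding adic_limit_iff_cg [OF s] by (elim exE conjE)
  have "cg N (s N) l" for N
  proof -
    obtain M where "\<forall>j\<ge>M. cg N (s j) l" using l(2) by blast
    then have "cg N (s (max M N)) l" by simp
    with mono' [of N "max M N"] show ?thesis by (auto intro: cg_trans)
  qed
  with l(1) show "\<exists>l\<in>carrier R. \<forall>N. cg N (s N) l" by blast
qed

lemma cg_cancel:
  assumes "c \<in> carrier R" "cg (N + M) (\<pi> [^] N \<otimes> c) \<zero>" shows "cg M c \<zero>"
proof -
  obtain d where d: "d \<in> carrier R" "\<pi> [^] N \<otimes> c = \<pi> [^] (N + M) \<otimes> d"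
    using assms(2) by (auto simp: cg_zero_iff)
  then have "\<pi> [^] N \<otimes> c = \<pi> [^] N \<otimes> (\<pi> [^] M \<otimes> d)" by (simp add: m_assoc flip: nat_pow_mult)
  then have "c = \<pi> [^] M \<otimes> d" using d assms by (simp add: m_lcancel)
  with d show ?thesis by (auto simp: cg_zero_iff)
qed

section \<open>Convolution of convergent series and the ring axioms\<close>

abbreviation A :: "(int \<Rightarrow> 'r) ring"
  where "A \<equiv> conv_laurent R \<pi>"

abbreviation plusA (infixl "\<oplus>\<^sub>A" 65) where "x \<oplus>\<^sub>A y \<equiv> x \<oplus>\<^bsub>A\<^esub> y"
abbreviation timesA (infixl "\<otimes>\<^sub>A" 70) where "x \<otimes>\<^sub>A y \<equiv> x \<otimes>\<^bsub>A\<^esub> y"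
abbreviation diffA (infixl "\<ominus>\<^sub>A" 65) where "x \<ominus>\<^sub>A y \<equiv> x \<ominus>\<^bsub>A\<^esub> y"
abbreviation negA ("\<ominus>\<^sub>A _" [81] 80) where "\<ominus>\<^sub>A x \<equiv> \<ominus>\<^bsub>A\<^esub> x"
abbreviation oneA ("\<one>\<^sub>A") where "\<one>\<^sub>A \<equiv> \<one>\<^bsub>A\<^esub>"
abbreviation zeroA ("\<zero>\<^sub>A") where "\<zero>\<^sub>A \<equiv> \<zero>\<^bsub>A\<^esub>"
abbreviation powA (infixr "[^]\<^sub>A" 75) where "x [^]\<^sub>A k \<equiv> x [^]\<^bsub>A\<^esub> k"

text \<open>Modulo \<pi>^N such a series is an ordinary Laurent series with exponents at least M.
  Limits below are controlled by these two numbers: N bounds the precision and M the range of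
  exponents.\<close>

definition lo :: "nat \<Rightarrow> int \<Rightarrow> (int \<Rightarrow> 'r) \<Rightarrow> bool"
  where "lo N M f \<longleftrightarrow> (\<forall>i<M. cg N (f i) \<zero>)"

lemma loD: "lo N M f \<Longrightarrow> i < M \<Longrightarrow> cg N (f i) \<zero>"
  by (simp add: lo_def)

lemma lo_mono: "lo N M f \<Longrightarrow> M' \<le> M \<Longrightarrow> lo N M' f"
  by (auto simp: lo_def)

lemma lo_mono_exp: "lo N M f \<Longrightarrow> N' \<le> N \<Longrightarrow> lo N' M f"
  by (auto simp: lo_def intro: cg_mono)

lemma A_carrier_iff: "f \<in> carrier A \<longleftrightarrow> (\<forall>i. f i \<in> carrier R) \<and> (\<forall>N. \<exists>M. lo N M f)"
proof -
  have "(\<exists>M. \<forall>i\<le>M. f i \<in> PIdl (\<pi> [^] N)) \<longleftrightarrow> (\<exists>M. lo N M f)" if "\<forall>i. f i \<in> carrier R" for N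
  proof
    assume "\<exists>M. \<forall>i\<le>M. f i \<in> PIdl (\<pi> [^] N)"
    then obtain M where "\<forall>i\<le>M. f i \<in> PIdl (\<pi> [^] N)" ..
    then have "lo N M f" by (auto simp: lo_def cg_zero_iff mem_cgenideal m_comm)
    then show "\<exists>M. lo N M f" ..
  next
    assume "\<exists>M. lo N M f"
    then obtain M where "lo N M f" ..
    then have "\<forall>i\<le>M - 1. f i \<in> PIdl (\<pi> [^] N)" by (auto simp: lo_def cg_zero_iff mem_cgenideal m_comm)
    then show "\<exists>M. \<forall>i\<le>M. f i \<in> PIdl (\<pi> [^] N)" ..
  qed
  then show ?thesis by (auto simp: conv_laurent_def)
qed

lemma A_coeff [simp]: "f \<in> carrier A \<Longrightarrow> f i \<in> carrier R"
  by (simp add: A_carrier_iff)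

lemma A_lo: "f \<in> carrier A \<Longrightarrow> \<exists>M. lo N M f"
  by (simp add: A_carrier_iff)

lemma AI: "(\<And>i. f i \<in> carrier R) \<Longrightarrow> (\<And>N. \<exists>M. lo N M f) \<Longrightarrow> f \<in> carrier A"
  by (simp add: A_carrier_iff)

lemma A_eqI:
  assumes "\<And>N n. cg N (f n) (g n)" shows "f = g"
  by (rule ext) (rule separated_eq [OF assms])

lemma A_zero: "\<zero>\<^sub>A = (\<lambda>i. \<zero>)" and A_add: "f \<oplus>\<^sub>A g = (\<lambda>i. f i \<oplus> g i)"
  and A_one: "\<one>\<^sub>A = (\<lambda>i. if i = 0 then \<one> else \<zero>)"
  and A_mult: "f \<otimes>\<^sub>A g = (\<lambda>n. THE l. adic_limit R \<pi>
                (\<lambda>N. \<Oplus>i\<in>{- int N..int N}. f i \<otimes> g (n - i)) l)"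
  by (simp_all only: conv_laurent_def monoid.simps ring.simps)

lemma conv_terms_vanish:
  assumes "f \<in> carrier A" "g \<in> carrier A" "lo N M1 f" "lo N M2 g" "i \<notin> {M1..n - M2}"
  shows "cg N (f i \<otimes> g (n - i)) \<zero>"
proof (cases "i < M1")
  case True
  have "cg N (f i \<otimes> g (n - i)) (\<zero> \<otimes> g (n - i))"
    by (rule cg_mult [OF loD [OF assms(3) True] cg_refl]) (use assms in simp)
  then show ?thesis using assms by simp
next
  case False
  then have "n - i < M2" using assms(5) by auto
  then have "cg N (f i \<otimes> g (n - i)) (f i \<otimes> \<zero>)"
    by (intro cg_mult [OF cg_refl loD [OF assms(4)]]) (use assms in simp)
  then show ?thesis using assms by simp
qed

text \<open>Modulo \<pi>^N a term can only count if its index lies between M1 and n - M2. So the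
  symmetric partial sums are Cauchy, and modulo \<pi>^N their limit is the sum over any finite index
  set that contains this interval.\<close>

lemma conv_mem_cg:
  assumes f: "f \<in> carrier A" and g: "g \<in> carrier A"
  shows "(f \<otimes>\<^sub>A g) n \<in> carrier R" (is ?c)
    and "\<lbrakk>lo N M1 f; lo N M2 g; finite J; {M1..n - M2} \<subseteq> J\<rbrakk>
           \<Longrightarrow> cg N ((f \<otimes>\<^sub>A g) n) (\<Oplus>i\<in>J. f i \<otimes> g (n - i))" (is "\<lbrakk>_; _; _; _\<rbrakk> \<Longrightarrow> ?s")
proof -
  have sub: "cg N (\<Oplus>i\<in>J. f i \<otimes> g (n - i)) (\<Oplus>i\<in>{M1..n - M2}. f i \<otimes> g (n - i))"
    if "lo N M1 f" "lo N M2 g" "finite J" "{M1..n - M2} \<subseteq> J" for N M1 M2 J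
    using that f g by (intro cg_finsum_subset conv_terms_vanish) auto
  define s where "s k = (\<Oplus>i\<in>{- int k..int k}. f i \<otimes> g (n - i))" for k :: nat
  have s: "s k \<in> carrier R" for k using f g by (auto simp: s_def intro!: finsum_closed)
  \<comment> \<open>From the stated \<open>k\<close> on, the symmetric window contains the interval
    {M1..n - M2}.\<close>
  have s_cg: "cg N (s k) (\<Oplus>i\<in>{M1..n - M2}. f i \<otimes> g (n - i))"
    if "lo N M1 f" "lo N M2 g" "k \<ge> nat (\<bar>M1\<bar> + \<bar>n - M2\<bar>)" for N M1 M2 k
    unfolding s_def using that by (intro sub) auto
  have "\<exists>M. \<forall>i\<ge>M. \<forall>j\<ge>M. cg N (s i) (s j)" for N
  proof -
    obtain M1 M2 where "lo N M1 f" "lo N M2 g" using A_lo [OF f] A_lo [OF g] by metis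
    note * = cg_trans [OF s_cg [OF this] cg_sym [OF s_cg [OF this]]]
    show ?thesis by (intro exI [of _ "nat (\<bar>M1\<bar> + \<bar>n - M2\<bar>)"] allI impI) (rule *)
  qed
  then have "\<exists>l. adic_limit R \<pi> s l" by (intro cauchy_imp_limit s)
  then obtain l where l: "adic_limit R \<pi> s l" ..
  have l_cg: "cg N l (\<Oplus>i\<in>{M1..n - M2}. f i \<otimes> g (n - i))"
    if lim: "adic_limit R \<pi> s l" and "lo N M1 f" "lo N M2 g" for N M1 M2 l
  proof -
    obtain M where M: "\<forall>j\<ge>M. cg N (s j) l"
      using lim unfolding adic_limit_iff_cg [OF s] by blast
    define k where "k = max M (nat (\<bar>M1\<bar> + \<bar>n - M2\<bar>))"
    have "cg N l (s k)" by (rule cg_sym) (use M in \<open>simp add: k_def\<close>)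
    also have "cg N (s k) (\<Oplus>i\<in>{M1..n - M2}. f i \<otimes> g (n - i))"
      using that(2,3) by (rule s_cg) (simp add: k_def)
    finally show ?thesis .
  qed
  have "(f \<otimes>\<^sub>A g) n = (THE l. adic_limit R \<pi> s l)"     unfolding A_mult s_def [abs_def] ..
  also have "\<dots> = l"
  proof (rule the_equality)
    show "adic_limit R \<pi> s l" by (rule l)
    fix l' assume l': "adic_limit R \<pi> s l'"
    show "l' = l"
    proof (rule separated_eq)
      fix N
      obtain M1 M2 where *: "lo N M1 f" "lo N M2 g" using A_lo [OF f] A_lo [OF g] by metis
      show "cg N l' l" using l_cg [OF l' *] cg_sym [OF l_cg [OF l *]] by (rule cg_trans)
    qed
  qed
  finally have eq: "(f \<otimes>\<^sub>A g) n = l" .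
  show ?c using l unfolding eq adic_limit_iff_cg [OF s] by blast
  show ?s if "lo N M1 f" "lo N M2 g" "finite J" "{M1..n - M2} \<subseteq> J"
    unfolding eq using l_cg [OF l that(1,2)] cg_sym [OF sub [OF that]] by (rule cg_trans)
qed

lemmas conv_cg = conv_mem_cg(2)

lemma lo_mult:
  assumes "f \<in> carrier A" "g \<in> carrier A" "lo N M1 f" "lo N M2 g"
  shows "lo N (M1 + M2) (f \<otimes>\<^sub>A g)"
  unfolding lo_def
proof (intro allI impI)
  fix n assume "n < M1 + M2"
  then have "cg N ((f \<otimes>\<^sub>A g) n) (\<Oplus>i\<in>{}. f i \<otimes> g (n - i))"
    using assms by (intro conv_cg [of f g N M1 M2]) auto
  then show "cg N ((f \<otimes>\<^sub>A g) n) \<zero>" by simp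
qed

lemma A_mult_closed:
  assumes f: "f \<in> carrier A" and g: "g \<in> carrier A"
  shows "f \<otimes>\<^sub>A g \<in> carrier A"
proof (rule AI)
  show "(f \<otimes>\<^sub>A g) i \<in> carrier R" for i using f g by (rule conv_mem_cg(1))
  show "\<exists>M. lo N M (f \<otimes>\<^sub>A g)" for N
  proof -
    obtain M1 where "lo N M1 f" using A_lo [OF f] ..
    moreover obtain M2 where "lo N M2 g" using A_lo [OF g] ..
    ultimately have "lo N (M1 + M2) (f \<otimes>\<^sub>A g)" by (rule lo_mult [OF f g])
    then show ?thesis ..
  qed
qed

text \<open>Shifting the exponents by lower bounds turns a coefficient of the product into a finite
  Cauchy product indexed by natural numbers; this is the link to
  \<open>cauchy_product_assoc\<close>.\<close>

lemma conv_cg_nat: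
  assumes f: "f \<in> carrier A" and g: "g \<in> carrier A" and "lo N (- a) f" "lo N (- b) g"
  shows "cg N ((f \<otimes>\<^sub>A g) (int n - a - b)) (\<Oplus>i\<in>{..n}. f (int i - a) \<otimes> g (int (n - i) - b))"
proof -
  have im: "{- a..int n - a} = (\<lambda>i. int i - a) ` {..n}"
  proof (intro equalityI subsetI)
    fix x assume "x \<in> {- a..int n - a}"
    then have "x = int (nat (x + a)) - a" "nat (x + a) \<in> {..n}" by auto
    then show "x \<in> (\<lambda>i. int i - a) ` {..n}" by (rule image_eqI)
  qed auto
  have "cg N ((f \<otimes>\<^sub>A g) (int n - a - b)) (\<Oplus>i\<in>{- a..int n - a}. f i \<otimes> g (int n - a - b - i))"
    using assms by (intro conv_cg [of f g N "- a" "- b"]) auto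
  also have "(\<Oplus>i\<in>{- a..int n - a}. f i \<otimes> g (int n - a - b - i)) =
      (\<Oplus>i\<in>{..n}. f (int i - a) \<otimes> g (int n - a - b - (int i - a)))"
    unfolding im using f g by (intro finsum_reindex) (auto simp: inj_on_def)
  also have "\<dots> = (\<Oplus>i\<in>{..n}. f (int i - a) \<otimes> g (int (n - i) - b))"
    using f g by (intro finsum_cong') (auto simp: of_nat_diff algebra_simps)
  finally show ?thesis .
qed

lemma A_m_assoc:
  assumes f: "f \<in> carrier A" and g: "g \<in> carrier A" and h: "h \<in> carrier A"
  shows "(f \<otimes>\<^sub>A g) \<otimes>\<^sub>A h = f \<otimes>\<^sub>A (g \<otimes>\<^sub>A h)"
proof (rule A_eqI)
  fix N m
  obtain M1 M2 M3 where M: "lo N M1 f" "lo N M2 g" "lo N M3 h" using A_lo [OF f] A_lo [OF g] A_lo [OF h] by metis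
  \<comment> \<open>A lower bound -K common to the three series modulo \<pi>^N. Coefficients below
    -3K vanish on both sides, and the others are Cauchy products after the shift.\<close>
  define K where "K = \<bar>M1\<bar> + \<bar>M2\<bar> + \<bar>M3\<bar>"
  have lo: "lo N (- K) f" "lo N (- K) g" "lo N (- K) h"
    by (rule lo_mono [OF M(1)] lo_mono [OF M(2)] lo_mono [OF M(3)]; simp add: K_def)+
  have fg: "f \<otimes>\<^sub>A g \<in> carrier A" and gh: "g \<otimes>\<^sub>A h \<in> carrier A" using f g h by (auto intro: A_mult_closed)
  have lofg: "lo N (- (K + K)) (f \<otimes>\<^sub>A g)" and logh: "lo N (- (K + K)) (g \<otimes>\<^sub>A h)"
    using lo_mult [OF f g lo(1,2)] lo_mult [OF g h lo(2,3)] by simp_all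
  show "cg N (((f \<otimes>\<^sub>A g) \<otimes>\<^sub>A h) m) ((f \<otimes>\<^sub>A (g \<otimes>\<^sub>A h)) m)"
  proof (cases "m < - (K + K) + - K")
    case True
    have "cg N (((f \<otimes>\<^sub>A g) \<otimes>\<^sub>A h) m) \<zero>"
      using lo_mult [OF fg h lofg lo(3)] True by (rule loD)
    moreover have "cg N ((f \<otimes>\<^sub>A (g \<otimes>\<^sub>A h)) m) \<zero>"
      using lo_mult [OF f gh lo(1) logh] True by (intro loD) (auto simp: add.commute)
    ultimately show ?thesis by (rule cg_trans [OF _ cg_sym])
  next
    case False
    define n where "n = nat (m + K + K + K)"
    have m: "m = int n - (K + K) - K" "m = int n - K - (K + K)" using False by (simp_all add: n_def)
    define F where "F i = f (int i - K)" for i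
    define G where "G i = g (int i - K)" for i
    define H where "H i = h (int i - K)" for i
    have [simp]: "F i \<in> carrier R" "G i \<in> carrier R" "H i \<in> carrier R" for i
      using f g h by (simp_all add: F_def G_def H_def)
    have "cg N (((f \<otimes>\<^sub>A g) \<otimes>\<^sub>A h) m) (\<Oplus>j\<in>{..n}. (f \<otimes>\<^sub>A g) (int j - (K + K)) \<otimes> H (n - j))"
      unfolding m(1) H_def by (rule conv_cg_nat [OF fg h lofg lo(3)])
    also have "cg N (\<Oplus>j\<in>{..n}. (f \<otimes>\<^sub>A g) (int j - (K + K)) \<otimes> H (n - j))
        (\<Oplus>j\<in>{..n}. (\<Oplus>i\<in>{..j}. F i \<otimes> G (j - i)) \<otimes> H (n - j))"
    proof (rule cg_finsum)
      fix j
      have "cg N ((f \<otimes>\<^sub>A g) (int j - (K + K))) (\<Oplus>i\<in>{..j}. F i \<otimes> G (j - i))"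
        using conv_cg_nat [OF f g lo(1,2), of j] by (simp add: F_def G_def diff_diff_eq)
      then show "cg N ((f \<otimes>\<^sub>A g) (int j - (K + K)) \<otimes> H (n - j))
        ((\<Oplus>i\<in>{..j}. F i \<otimes> G (j - i)) \<otimes> H (n - j))" by (rule cg_mult) simp
    qed simp
    also have "(\<Oplus>j\<in>{..n}. (\<Oplus>i\<in>{..j}. F i \<otimes> G (j - i)) \<otimes> H (n - j)) =
        (\<Oplus>i\<in>{..n}. F i \<otimes> (\<Oplus>k\<in>{..n - i}. G k \<otimes> H (n - i - k)))"
      by (rule cauchy_product_assoc) simp_all
    finally have 1: "cg N (((f \<otimes>\<^sub>A g) \<otimes>\<^sub>A h) m) \<dots>" .
    have "cg N ((f \<otimes>\<^sub>A (g \<otimes>\<^sub>A h)) m) (\<Oplus>i\<in>{..n}. F i \<otimes> (g \<otimes>\<^sub>A h) (int (n - i) - (K + K)))"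
      unfolding m(2) F_def by (rule conv_cg_nat [OF f gh lo(1) logh])
    also have "cg N (\<Oplus>i\<in>{..n}. F i \<otimes> (g \<otimes>\<^sub>A h) (int (n - i) - (K + K)))
        (\<Oplus>i\<in>{..n}. F i \<otimes> (\<Oplus>k\<in>{..n - i}. G k \<otimes> H (n - i - k)))"
    proof (rule cg_finsum)
      fix i
      have "cg N ((g \<otimes>\<^sub>A h) (int (n - i) - (K + K))) (\<Oplus>k\<in>{..n - i}. G k \<otimes> H (n - i - k))"
        using conv_cg_nat [OF g h lo(2,3), of "n - i"] by (simp add: G_def H_def diff_diff_eq)
      then show "cg N (F i \<otimes> (g \<otimes>\<^sub>A h) (int (n - i) - (K + K)))
        (F i \<otimes> (\<Oplus>k\<in>{..n - i}. G k \<otimes> H (n - i - k)))" by (intro cg_mult) simp_all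
    qed simp
    finally show ?thesis by (rule cg_trans [OF 1 cg_sym])
  qed
qed

lemma A_m_comm:
  assumes f: "f \<in> carrier A" and g: "g \<in> carrier A"
  shows "f \<otimes>\<^sub>A g = g \<otimes>\<^sub>A f"
proof (rule A_eqI)
  fix N n
  obtain M1 M2 where M: "lo N M1 f" "lo N M2 g" using A_lo [OF f] A_lo [OF g] by metis
  have im: "{M1..n - M2} = (\<lambda>i. n - i) ` {M2..n - M1}"
  proof (intro equalityI subsetI)
    fix x assume "x \<in> {M1..n - M2}"
    then show "x \<in> (\<lambda>i. n - i) ` {M2..n - M1}" by (intro image_eqI [of _ _ "n - x"]) auto
  qed auto
  have "cg N ((f \<otimes>\<^sub>A g) n) (\<Oplus>i\<in>{M1..n - M2}. f i \<otimes> g (n - i))"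
    using f g M by (intro conv_cg) auto
  also have "(\<Oplus>i\<in>{M1..n - M2}. f i \<otimes> g (n - i)) = (\<Oplus>i\<in>{M2..n - M1}. f (n - i) \<otimes> g (n - (n - i)))"
    unfolding im using f g by (intro finsum_reindex) (auto simp: inj_on_def)
  also have "\<dots> = (\<Oplus>i\<in>{M2..n - M1}. g i \<otimes> f (n - i))"
    using f g by (intro finsum_cong') (auto simp: m_comm)
  also have "cg N \<dots> ((g \<otimes>\<^sub>A f) n)"
    using f g M by (intro cg_sym [OF conv_cg]) auto
  finally show "cg N ((f \<otimes>\<^sub>A g) n) ((g \<otimes>\<^sub>A f) n)" .
qed

lemma lo_add: "lo N M f \<Longrightarrow> lo N M g \<Longrightarrow> lo N M (\<lambda>i. f i \<oplus> g i)"
  unfolding lo_def using cg_add [of N "f i" \<zero> "g i" \<zero> for i] by simp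

lemma lo_neg: "lo N M f \<Longrightarrow> lo N M (\<lambda>i. \<ominus> f i)"
  unfolding lo_def using cg_neg [of N "f i" \<zero> for i] by simp

lemma A_add_closed:
  assumes f: "f \<in> carrier A" and g: "g \<in> carrier A"
  shows "f \<oplus>\<^sub>A g \<in> carrier A"
  unfolding A_add
proof (rule AI)
  fix N
  obtain M1 M2 where "lo N M1 f" "lo N M2 g" using A_lo [OF f] A_lo [OF g] by metis
  then have "lo N (min M1 M2) (\<lambda>i. f i \<oplus> g i)" by (intro lo_add) (auto intro: lo_mono)
  then show "\<exists>M. lo N M (\<lambda>i. f i \<oplus> g i)" ..
qed (use f g in simp)

lemma A_neg_closed:
  assumes f: "f \<in> carrier A" shows "(\<lambda>i. \<ominus> f i) \<in> carrier A"
proof (rule AI)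
  fix N
  obtain M where "lo N M f" using A_lo [OF f] ..
  then have "lo N M (\<lambda>i. \<ominus> f i)" by (rule lo_neg)
  then show "\<exists>M. lo N M (\<lambda>i. \<ominus> f i)" ..
qed (use f in simp)

lemma A_zero_closed: "\<zero>\<^sub>A \<in> carrier A"
  unfolding A_zero by (rule AI) (auto simp: lo_def)

definition mon :: "'r \<Rightarrow> int \<Rightarrow> int \<Rightarrow> 'r"
  where "mon a k = (\<lambda>i. if i = k then a else \<zero>)"

lemma lo_mon: "a \<in> carrier R \<Longrightarrow> lo N k (mon a k)"
  by (auto simp: lo_def mon_def)

lemma mon_closed [simp]: "a \<in> carrier R \<Longrightarrow> mon a k \<in> carrier A"
  using lo_mon by (intro AI) (auto simp: mon_def)

lemma mon_mult:
  assumes a [simp]: "a \<in> carrier R" and f: "f \<in> carrier A"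
  shows "(mon a k \<otimes>\<^sub>A f) n = a \<otimes> f (n - k)"
proof (rule separated_eq)
  fix N
  obtain M where M: "lo N M f" using A_lo [OF f] ..
  \<comment> \<open>The index \<open>k\<close> is inserted because the interval may be
    empty.\<close>
  have "cg N ((mon a k \<otimes>\<^sub>A f) n) (\<Oplus>i\<in>insert k {k..n - M}. mon a k i \<otimes> f (n - i))"
    using f M lo_mon [OF a, of N k] by (intro conv_cg) auto
  also have "(\<Oplus>i\<in>insert k {k..n - M}. mon a k i \<otimes> f (n - i)) =
     (\<Oplus>i\<in>insert k {k..n - M}. if i = k then a \<otimes> f (n - k) else \<zero>)"
    using f by (intro finsum_cong') (auto simp: mon_def)
  also have "\<dots> = a \<otimes> f (n - k)"
    using f by (intro add.finprod_singleton_swap) auto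
  finally show "cg N ((mon a k \<otimes>\<^sub>A f) n) (a \<otimes> f (n - k))" .
qed

lemma A_one_mon: "\<one>\<^sub>A = mon \<one> 0" and const_ser_mon: "const_ser R a = mon a 0"
  and var_ser_mon: "var_ser R = mon \<one> 1"
  by (simp_all add: A_one mon_def const_ser_def var_ser_def)

theorem A_cring: "cring A"
proof (rule cringI)
  show "abelian_group A"
  proof (rule abelian_groupI)
    fix f assume f: "f \<in> carrier A"
    then have "(\<lambda>i. \<ominus> f i) \<oplus>\<^sub>A f = \<zero>\<^sub>A" by (simp add: A_add A_zero l_neg)
    with A_neg_closed [OF f] show "\<exists>g\<in>carrier A. g \<oplus>\<^sub>A f = \<zero>\<^sub>A" by blast
  qed (auto simp: A_add_closed A_zero_closed, auto simp: A_add A_zero a_ac)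
  show "comm_monoid A"
  proof (rule comm_monoidI)
    fix f assume "f \<in> carrier A"
    then show "\<one>\<^sub>A \<otimes>\<^sub>A f = f" unfolding A_one_mon by (intro ext) (simp add: mon_mult)
  qed (auto intro: A_mult_closed A_m_assoc A_m_comm simp: A_one_mon)
  fix f g h assume f: "f \<in> carrier A" and g: "g \<in> carrier A" and h: "h \<in> carrier A"
  show "(f \<oplus>\<^sub>A g) \<otimes>\<^sub>A h = f \<otimes>\<^sub>A h \<oplus>\<^sub>A g \<otimes>\<^sub>A h"
  proof (rule A_eqI)
    fix N n
    obtain M1 M2 M3 where M: "lo N M1 f" "lo N M2 g" "lo N M3 h" using A_lo [OF f] A_lo [OF g] A_lo [OF h] by metis
    define M where "M = min M1 M2"
    have lo: "lo N M f" "lo N M g"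
      by (rule lo_mono [OF M(1)] lo_mono [OF M(2)]; simp add: M_def)+
    then have loa: "lo N M (f \<oplus>\<^sub>A g)" unfolding A_add by (rule lo_add)
    have "cg N (((f \<oplus>\<^sub>A g) \<otimes>\<^sub>A h) n) (\<Oplus>i\<in>{M..n - M3}. (f \<oplus>\<^sub>A g) i \<otimes> h (n - i))"
      using A_add_closed [OF f g] h loa M(3) by (intro conv_cg) auto
    also have "(\<Oplus>i\<in>{M..n - M3}. (f \<oplus>\<^sub>A g) i \<otimes> h (n - i)) =
        (\<Oplus>i\<in>{M..n - M3}. f i \<otimes> h (n - i) \<oplus> g i \<otimes> h (n - i))"
      using f g h by (intro finsum_cong') (auto simp: A_add l_distr)
    also have "\<dots> = (\<Oplus>i\<in>{M..n - M3}. f i \<otimes> h (n - i)) \<oplus> (\<Oplus>i\<in>{M..n - M3}. g i \<otimes> h (n - i))"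
      using f g h by (intro finsum_addf) auto
    also have "cg N \<dots> ((f \<otimes>\<^sub>A h) n \<oplus> (g \<otimes>\<^sub>A h) n)"
      using f g h lo M(3) by (intro cg_add cg_sym [OF conv_cg]) auto
    finally show "cg N (((f \<oplus>\<^sub>A g) \<otimes>\<^sub>A h) n) ((f \<otimes>\<^sub>A h \<oplus>\<^sub>A g \<otimes>\<^sub>A h) n)"
      by (simp add: A_add)
  qed
qed

end

text \<open>f is the product of h and 1 + u h^(-1) c.\<close>

lemma (in adic_complete) unit_cong:
  assumes h: "h \<in> Units R" and f: "cg 1 f h"
  shows "f \<in> Units R"
proof -
  obtain c where c: "c \<in> carrier R" "f = h \<oplus> u [^] (1::nat) \<otimes> c" using f by (rule cgE)
  have hc: "h \<in> carrier R" "inv h \<in> carrier R" using h by auto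
  have "h \<otimes> (\<one> \<oplus> u \<otimes> (inv h \<otimes> c)) = h \<oplus> (h \<otimes> inv h) \<otimes> (u \<otimes> c)"
    using c(1) hc u by algebra
  also have "\<dots> = f" using c h by simp
  finally have "f = h \<otimes> (\<one> \<oplus> u \<otimes> (inv h \<otimes> c))" by (rule sym)
  moreover have "\<one> \<oplus> u \<otimes> (inv h \<otimes> c) \<in> Units R" using c(1) hc by (intro unit_one_add) simp
  ultimately show ?thesis using h by simp
qed

context complete_dvr_base
begin

sublocale A: cring A by (rule A_cring)

lemma A_neg: "f \<in> carrier A \<Longrightarrow> \<ominus>\<^sub>A f = (\<lambda>i. \<ominus> f i)"
  by (rule A.minus_equality) (auto simp: A_add A_zero l_neg A_neg_closed)

lemma A_minus: "f \<in> carrier A \<Longrightarrow> g \<in> carrier A \<Longrightarrow> f \<ominus>\<^sub>A g = (\<lambda>i. f i \<ominus> g i)"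
  by (simp add: a_minus_def A_neg A_add)

lemma A_finsum:
  assumes "finite I" "f \<in> I \<rightarrow> carrier A"
  shows "(\<Oplus>\<^bsub>A\<^esub>i\<in>I. f i) n = (\<Oplus>i\<in>I. f i n)"
  using assms
proof (induction I rule: finite_induct)
  case (insert i I)
  then have "(\<lambda>i. f i n) \<in> insert i I \<rightarrow> carrier R" by (simp add: Pi_iff A_coeff)
  with insert show ?case by (simp add: A_add)
qed (simp add: A_zero)

lemma mon_mon:
  assumes [simp]: "a \<in> carrier R" "b \<in> carrier R"
  shows "mon a k \<otimes>\<^sub>A mon b l = mon (a \<otimes> b) (k + l)"
proof
  fix n
  have "(mon a k \<otimes>\<^sub>A mon b l) n = a \<otimes> mon b l (n - k)" by (rule mon_mult) simp_all
  then show "(mon a k \<otimes>\<^sub>A mon b l) n = mon (a \<otimes> b) (k + l) n" by (auto simp: mon_def)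
qed

lemma mon_add: "a \<in> carrier R \<Longrightarrow> b \<in> carrier R \<Longrightarrow> mon a k \<oplus>\<^sub>A mon b k = mon (a \<oplus> b) k"
  by (rule ext) (simp add: A_add mon_def)

lemma mon_pow: "a \<in> carrier R \<Longrightarrow> mon a k [^]\<^sub>A (n::nat) = mon (a [^] n) (int n * k)"
  by (induction n) (simp_all add: A_one_mon mon_mon algebra_simps)

lemma mon_zero: "mon \<zero> k = \<zero>\<^sub>A"
  by (simp add: mon_def A_zero)

sublocale A: adic_ring A "mon \<pi> 0"
  by unfold_locales simp

lemma A_u_pow: "mon \<pi> 0 [^]\<^sub>A (N::nat) = mon (\<pi> [^] N) 0"
  by (simp add: mon_pow)

text \<open>The implication from right to left has content: the coefficientwise quotients by \<pi>^N
  must again form a series that converges towards negative exponents.\<close>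

lemma A_cg_iff: "A.cg N f g \<longleftrightarrow> f \<in> carrier A \<and> g \<in> carrier A \<and> (\<forall>i. cg N (f i) (g i))"
proof (intro iffI conjI allI)
  assume *: "A.cg N f g"
  show f: "f \<in> carrier A" and g: "g \<in> carrier A" using A.cgD [OF *] .
  fix i
  obtain c where c: "c \<in> carrier A" "f = g \<oplus>\<^sub>A mon \<pi> 0 [^]\<^sub>A N \<otimes>\<^sub>A c" using * by (rule A.cgE)
  have "f i = g i \<oplus> \<pi> [^] N \<otimes> c i" unfolding c(2) A_u_pow A_add using c(1) by (simp add: mon_mult)
  then show "cg N (f i) (g i)" using c(1) g by (intro cgI [of "g i" "c i"]) auto
next
  assume *: "f \<in> carrier A \<and> g \<in> carrier A \<and> (\<forall>i. cg N (f i) (g i))"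
  have "\<forall>i. \<exists>c. c \<in> carrier R \<and> f i = g i \<oplus> \<pi> [^] N \<otimes> c"
  proof
    fix i
    have "cg N (f i) (g i)" using * by simp
    then obtain c where "c \<in> carrier R" "f i = g i \<oplus> \<pi> [^] N \<otimes> c" by (rule cgE)
    then show "\<exists>c. c \<in> carrier R \<and> f i = g i \<oplus> \<pi> [^] N \<otimes> c" by (intro exI conjI)
  qed
  from choice [OF this] obtain c where c: "\<forall>i. c i \<in> carrier R \<and> f i = g i \<oplus> \<pi> [^] N \<otimes> c i" ..
  have f: "f \<in> carrier A" and g: "g \<in> carrier A" using * by simp_all
  have cA: "c \<in> carrier A"
  proof (rule AI)
    show "c i \<in> carrier R" for i using c by simp
    fix N'
    \<comment> \<open>Division by \<pi>^N loses N digits, so the bounds are taken at precision N +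
      N'.\<close>
    obtain M1 M2 where M: "lo (N + N') M1 f" "lo (N + N') M2 g" using A_lo [OF f] A_lo [OF g] by metis
    have "lo N' (min M1 M2) c"
      unfolding lo_def
    proof (intro allI impI)
      fix i assume i: "i < min M1 M2"
      have fi: "f i = g i \<oplus> \<pi> [^] N \<otimes> c i" and ci: "c i \<in> carrier R" using c by simp_all
      have "cg (N + N') (f i \<ominus> g i) (\<zero> \<ominus> \<zero>)"
        using i by (intro cg_diff loD [OF M(1)] loD [OF M(2)]) auto
      moreover have "f i \<ominus> g i = \<pi> [^] N \<otimes> c i"
      proof -
        have "\<And>a b. a \<in> carrier R \<Longrightarrow> b \<in> carrier R \<Longrightarrow> a \<oplus> b \<ominus> a = b"
          by (simp add: minus_eq a_comm [of _ "\<ominus> _"] r_neg1)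
        from this [of "g i" "\<pi> [^] N \<otimes> c i"] show ?thesis unfolding fi using g ci by simp
      qed
      ultimately have "cg (N + N') (\<pi> [^] N \<otimes> c i) \<zero>" by simp
      then show "cg N' (c i) \<zero>" by (rule cg_cancel [OF ci])
    qed
    then show "\<exists>M. lo N' M c" ..
  qed
  have "f = g \<oplus>\<^sub>A mon \<pi> 0 [^]\<^sub>A N \<otimes>\<^sub>A c"
  proof
    fix i
    show "f i = (g \<oplus>\<^sub>A mon \<pi> 0 [^]\<^sub>A N \<otimes>\<^sub>A c) i"
      unfolding A_add A_u_pow using c cA by (simp add: mon_mult)
  qed
  with g cA show "A.cg N f g" by (rule A.cgI)
qed

lemma A_cg_coeff: "A.cg N f g \<Longrightarrow> cg N (f i) (g i)"
  by (simp add: A_cg_iff)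

lemma A_cgI: "f \<in> carrier A \<Longrightarrow> g \<in> carrier A \<Longrightarrow> (\<And>i. cg N (f i) (g i)) \<Longrightarrow> A.cg N f g"
  by (simp add: A_cg_iff)

sublocale A: adic_complete A "mon \<pi> 0"
proof
  fix f assume "f \<in> carrier A" and *: "\<And>N. A.cg N f \<zero>\<^sub>A"
  show "f = \<zero>\<^sub>A"
    by (rule A_eqI) (rule A_cg_coeff [OF *])
next
  fix s assume step: "\<And>N. A.cg N (s N) (s (Suc N))"
  have s: "s N \<in> carrier A" for N using A.cgD(1) [OF step] .
  have "\<exists>l\<in>carrier R. \<forall>N. cg N (s N i) l" for i
    using complete [of "\<lambda>N. s N i", OF A_cg_coeff [OF step]] .
  then have "\<forall>i. \<exists>l. l \<in> carrier R \<and> (\<forall>N. cg N (s N i) l)" unfolding Bex_def ..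
  from choice [OF this] obtain l where l: "\<forall>i. l i \<in> carrier R \<and> (\<forall>N. cg N (s N i) (l i))" ..
  have lA: "l \<in> carrier A"
  proof (rule AI)
    show "l i \<in> carrier R" for i using l by simp
    fix N
    \<comment> \<open>The coefficientwise limit is congruent to \<open>s N\<close> modulo \<pi>^N
      and inherits its bound at this precision.\<close>
    obtain M where M: "lo N M (s N)" using A_lo [OF s] ..
    have "lo N M l" unfolding lo_def
    proof (intro allI impI)
      fix i assume "i < M"
      have "cg N (s N i) (l i)" using l by simp
      from cg_trans [OF cg_sym [OF this] loD [OF M \<open>i < M\<close>]] show "cg N (l i) \<zero>" .
    qed
    then show "\<exists>M. lo N M l" ..
  qed
  have "\<forall>N. A.cg N (s N) l" using s lA l by (simp add: A_cg_iff)
  then show "\<exists>l\<in>carrier A. \<forall>N. A.cg N (s N) l" using lA by (rule bexI)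
qed

section \<open>The order of the residue\<close>

lemma not_cg_one: "\<not> cg 1 \<one> \<zero>"
  using unit_iff_cg [of \<one>] by simp

text \<open>\<open>wt f m\<close> says that \<open>m\<close> is the order of the residue of \<open>f\<close> in \<open>k((t))\<close>.\<close>

definition wt :: "(int \<Rightarrow> 'r) \<Rightarrow> int \<Rightarrow> bool"
  where "wt f m \<longleftrightarrow> f \<in> carrier A \<and> lo 1 m f \<and> \<not> cg 1 (f m) \<zero>"

lemma wtD: "wt f m \<Longrightarrow> f \<in> carrier A" "wt f m \<Longrightarrow> lo 1 m f" "wt f m \<Longrightarrow> \<not> cg 1 (f m) \<zero>"
  by (simp_all add: wt_def)

lemma wt_exists:
  assumes f: "f \<in> carrier A" and nz: "\<not> A.cg 1 f \<zero>\<^sub>A"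
  shows "\<exists>m. wt f m"
proof -
  obtain M where M: "lo 1 M f" using A_lo [OF f] ..
  obtain i where i: "\<not> cg 1 (f i) \<zero>" using nz f A_zero_closed unfolding A_cg_iff A_zero by blast
  then have "M \<le> i" using loD [OF M] linorder_not_less by blast
  then have ex: "\<not> cg 1 (f (M + int (nat (i - M)))) \<zero>" using i by simp
  define k where "k = (LEAST k. \<not> cg 1 (f (M + int k)) \<zero>)"
  have k: "\<not> cg 1 (f (M + int k)) \<zero>" unfolding k_def by (rule LeastI) (rule ex)
  have "lo 1 (M + int k) f" unfolding lo_def
  proof (intro allI impI)
    fix j assume j: "j < M + int k"
    show "cg 1 (f j) \<zero>"
    proof (cases "j < M")
      case True
      then show ?thesis by (rule loD [OF M])
    next
      case False
      then have "nat (j - M) < k" using j by auto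
      then have "cg 1 (f (M + int (nat (j - M)))) \<zero>"
        unfolding k_def using not_less_Least by blast
      then show ?thesis using False by simp
    qed
  qed
  with f k have "wt f (M + int k)" by (simp add: wt_def)
  then show ?thesis ..
qed

lemma wt_unique: "wt f m \<Longrightarrow> wt f n \<Longrightarrow> m = n"
  using loD [OF wtD(2), of f m n] loD [OF wtD(2), of f n m] wtD(3) [of f m] wtD(3) [of f n]
  by (metis linorder_neqE)

lemma wt_not_cg_zero: "wt f m \<Longrightarrow> \<not> A.cg 1 f \<zero>\<^sub>A"
  using wtD(3) [of f m] A_cg_coeff [of 1 f "\<zero>\<^sub>A" m] by (auto simp: A_zero)

lemma conv_lowest_cg:
  assumes "f \<in> carrier A" "g \<in> carrier A" "lo N a f" "lo N b g"
  shows "cg N ((f \<otimes>\<^sub>A g) (a + b)) (f a \<otimes> g b)"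
proof -
  have "cg N ((f \<otimes>\<^sub>A g) (a + b)) (\<Oplus>i\<in>{a}. f i \<otimes> g (a + b - i))"
    using assms by (intro conv_cg [of f g N a b]) auto
  then show ?thesis using assms by simp
qed

text \<open>Only the two leading coefficients meet at exponent a + b, and their product stays
  nonzero modulo \<pi> because the ideal of \<pi> is prime.\<close>

lemma wt_mult:
  assumes f: "wt f a" and g: "wt g b"
  shows "wt (f \<otimes>\<^sub>A g) (a + b)"
proof -
  have *: "cg 1 ((f \<otimes>\<^sub>A g) (a + b)) (f a \<otimes> g b)"
    by (rule conv_lowest_cg [OF wtD(1) [OF f] wtD(1) [OF g] wtD(2) [OF f] wtD(2) [OF g]])
  have "\<not> cg 1 (f a \<otimes> g b) \<zero>"
    using cg_one_prime [of "f a" "g b"] wtD [OF f] wtD [OF g] by auto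
  then have "\<not> cg 1 ((f \<otimes>\<^sub>A g) (a + b)) \<zero>" using cg_trans [OF cg_sym [OF *]] by blast
  then show ?thesis
    unfolding wt_def using wtD [OF f] wtD [OF g] by (auto intro: lo_mult A_mult_closed)
qed

lemma wt_cong:
  assumes f: "wt f m" and fg: "A.cg 1 f g"
  shows "wt g m"
proof -
  have c: "cg 1 (g i) (f i)" for i by (rule cg_sym [OF A_cg_coeff [OF fg]])
  have "lo 1 m g" unfolding lo_def using cg_trans [OF c loD [OF wtD(2) [OF f]]] by blast
  moreover have "\<not> cg 1 (g m) \<zero>" using wtD(3) [OF f] cg_trans [OF cg_sym [OF c]] by blast
  ultimately show ?thesis using A.cgD(2) [OF fg] by (simp add: wt_def)
qed

lemma wt_mon: "a \<in> carrier R \<Longrightarrow> \<not> cg 1 a \<zero> \<Longrightarrow> wt (mon a k) k"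
  by (simp add: wt_def lo_mon) (simp add: mon_def)

lemma wt_one: "wt \<one>\<^sub>A 0"
  unfolding A_one_mon using not_cg_one by (intro wt_mon) auto

lemma wt_pow: "wt f m \<Longrightarrow> wt (f [^]\<^sub>A (n::nat)) (int n * m)"
proof (induction n)
  case (Suc n)
  then have "wt (f [^]\<^sub>A n \<otimes>\<^sub>A f) (int n * m + m)" by (intro wt_mult)
  then show ?case by (simp add: algebra_simps)
qed (simp add: wt_one)

section \<open>Power series and the T-adic topology\<close>

definition PS :: "(int \<Rightarrow> 'r) set"
  where "PS = {f. (\<forall>i. f i \<in> carrier R) \<and> (\<forall>i<0. f i = \<zero>)}"

text \<open>R[[T]] with the operations of A. It is complete for the powers of T, so the fixed point
  results apply to it with T in the role of \<open>u\<close>: they give the T-adic half of inverses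
  and roots, while the \<pi>-adic half is found in A.\<close>

abbreviation PSR :: "(int \<Rightarrow> 'r) ring"
  where "PSR \<equiv> A\<lparr>carrier := PS\<rparr>"

lemma PS_lo: "f \<in> PS \<Longrightarrow> lo N 0 f"
  by (simp add: PS_def lo_def)

lemma PS_A: "f \<in> PS \<Longrightarrow> f \<in> carrier A"
  using PS_lo by (intro AI) (auto simp: PS_def)

lemma PS_coeff: "f \<in> PS \<Longrightarrow> f i \<in> carrier R"
  by (simp add: PS_def)

lemma PS_neg: "f \<in> PS \<Longrightarrow> i < 0 \<Longrightarrow> f i = \<zero>"
  by (simp add: PS_def)

lemma PS_mult: assumes "f \<in> PS" "g \<in> PS" shows "f \<otimes>\<^sub>A g \<in> PS"
proof -
  have c: "f \<otimes>\<^sub>A g \<in> carrier A" using assms PS_A by simp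
  have "(f \<otimes>\<^sub>A g) i = \<zero>" if "i < 0" for i
  proof (rule separated_eq)
    fix N
    have "lo N (0 + 0) (f \<otimes>\<^sub>A g)" using assms by (intro lo_mult PS_A PS_lo)
    then show "cg N ((f \<otimes>\<^sub>A g) i) \<zero>" using that by (intro loD) auto
  qed
  then show ?thesis using c by (simp add: PS_def)
qed

lemma PS_subring: "subring PS A"
proof (rule A.subringI)
  show "PS \<subseteq> carrier A" using PS_A by blast
  show "\<one>\<^sub>A \<in> PS" by (simp add: PS_def A_one)
  show "\<ominus>\<^sub>A f \<in> PS" if "f \<in> PS" for f using that PS_A [OF that] by (simp add: A_neg PS_def)
  show "f \<oplus>\<^sub>A g \<in> PS" if "f \<in> PS" "g \<in> PS" for f g using that by (simp add: A_add PS_def)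
qed (rule PS_mult)

sublocale P: cring PSR
proof -
  have "PS \<subseteq> carrier A" using PS_A by blast
  then show "cring PSR" using A.subcringI' [OF PS_subring] A.subcring_iff by blast
qed

lemma var_PS: "mon \<one> 1 \<in> PS"
  by (simp add: PS_def mon_def)

sublocale P: adic_ring PSR "mon \<one> 1"
  by unfold_locales (simp add: var_PS)

lemma P_pow: "f [^]\<^bsub>PSR\<^esub> (n::nat) = f [^]\<^sub>A n"
  by (rule A.nat_pow_consistent [symmetric])

lemma P_cg_iff: "P.cg N f g \<longleftrightarrow> f \<in> PS \<and> g \<in> PS \<and> (\<forall>i<int N. f i = g i)"
proof (intro iffI conjI allI impI)
  assume *: "P.cg N f g"
  show f: "f \<in> PS" and g: "g \<in> PS" using P.cgD [OF *] by simp_all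
  fix i assume i: "i < int N"
  obtain c where c: "c \<in> carrier PSR" "f = g \<oplus>\<^bsub>PSR\<^esub> mon \<one> 1 [^]\<^bsub>PSR\<^esub> N \<otimes>\<^bsub>PSR\<^esub> c" using * by (rule P.cgE)
  have cP: "c \<in> PS" using c(1) by simp
  have "f = g \<oplus>\<^sub>A mon \<one> (int N) \<otimes>\<^sub>A c" using c(2) by (simp add: P_pow mon_pow)
  then have "f i = g i \<oplus> (mon \<one> (int N) \<otimes>\<^sub>A c) i" by (simp add: A_add)
  also have "\<dots> = g i \<oplus> \<one> \<otimes> c (i - int N)" using PS_A [OF cP] by (simp add: mon_mult)
  also have "\<dots> = g i" using i g cP by (simp add: PS_neg PS_coeff)
  finally show "f i = g i" .
next
  assume *: "f \<in> PS \<and> g \<in> PS \<and> (\<forall>i<int N. f i = g i)"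
  define c where "c i = (if i < 0 then \<zero> else f (i + int N) \<ominus> g (i + int N))" for i
  have cP: "c \<in> PS" using * by (simp add: PS_def c_def)
  have "f i = (g \<oplus>\<^sub>A mon \<one> (int N) \<otimes>\<^sub>A c) i" for i
  proof -
    have id: "\<And>a b. a \<in> carrier R \<Longrightarrow> b \<in> carrier R \<Longrightarrow> a = b \<oplus> (a \<ominus> b)" by algebra
    have "(g \<oplus>\<^sub>A mon \<one> (int N) \<otimes>\<^sub>A c) i = g i \<oplus> c (i - int N)"
      using PS_A [OF cP] cP by (simp add: A_add mon_mult)
    also have "\<dots> = f i"
    proof (cases "i < int N")
      case True
      then show ?thesis using * by (simp add: c_def PS_coeff)
    next
      case False
      then show ?thesis using * id [of "f i" "g i", symmetric] by (simp add: c_def PS_coeff)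
    qed
    finally show ?thesis by (rule sym)
  qed
  then have "f = g \<oplus>\<^bsub>PSR\<^esub> mon \<one> 1 [^]\<^bsub>PSR\<^esub> N \<otimes>\<^bsub>PSR\<^esub> c" by (auto simp: P_pow mon_pow)
  then show "P.cg N f g" using * cP by (intro P.cgI [of g c]) auto
qed

sublocale P: adic_complete PSR "mon \<one> 1"
proof
  fix f assume "f \<in> carrier PSR" and *: "\<And>N. P.cg N f \<zero>\<^bsub>PSR\<^esub>"
  have "f i = \<zero>" for i
  proof -
    have "P.cg (nat i + 1) f \<zero>\<^sub>A" using * [of "nat i + 1"] by simp
    then show ?thesis unfolding P_cg_iff A_zero by simp
  qed
  then show "f = \<zero>\<^bsub>PSR\<^esub>" by (simp add: A_zero ext)
next
  fix s assume step: "\<And>N. P.cg N (s N) (s (Suc N))"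
  have s: "s N \<in> PS" for N using P.cgD(1) [OF step] by simp
  have mono: "s (N + k) i = s N i" if "i < int N" for N k i
  proof (induction k)
    case (Suc k)
    have "P.cg (N + k) (s (N + k)) (s (Suc (N + k)))" by (rule step)
    then have "s (N + k) i = s (Suc (N + k)) i" using that by (simp add: P_cg_iff)
    then show ?case using Suc by simp
  qed simp
  \<comment> \<open>The coefficient at i no longer changes from step \<open>nat i + 1\<close>
    on.\<close>
  define l where "l i = s (nat i + 1) i" for i
  have lP: "l \<in> PS" using s by (auto simp: PS_def l_def)
  have "P.cg N (s N) l" for N
    unfolding P_cg_iff
  proof (intro conjI allI impI s lP)
    fix i assume i: "i < int N"
    show "s N i = l i"
    proof (cases "i < 0")
      case True
      then show ?thesis using s lP by (simp add: PS_neg)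
    next
      case False
      then have "s (nat i + 1 + (N - (nat i + 1))) i = s (nat i + 1) i" by (intro mono) simp
      moreover have "nat i + 1 + (N - (nat i + 1)) = N" using i False by simp
      ultimately show ?thesis by (simp add: l_def)
    qed
  qed
  with lP show "\<exists>l\<in>carrier PSR. \<forall>N. P.cg N (s N) l" by (intro bexI [of _ l]) auto
qed

lemma P_Units: "f \<in> Units PSR \<Longrightarrow> f \<in> Units A"
proof -
  assume "f \<in> Units PSR"
  then have f: "f \<in> PS" and "\<exists>g\<in>PS. g \<otimes>\<^sub>A f = \<one>\<^sub>A \<and> f \<otimes>\<^sub>A g = \<one>\<^sub>A" by (auto simp: Units_def)
  then obtain g where "g \<in> PS" "g \<otimes>\<^sub>A f = \<one>\<^sub>A" "f \<otimes>\<^sub>A g = \<one>\<^sub>A" by blast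
  with f show ?thesis unfolding Units_def using PS_A by blast
qed

lemma one_add_T_unit: "y \<in> PS \<Longrightarrow> \<one>\<^sub>A \<oplus>\<^sub>A mon \<one> 1 \<otimes>\<^sub>A y \<in> Units A"
  using P_Units [OF P.unit_one_add [of y]] by simp

lemma coeff_T_mult: "y \<in> PS \<Longrightarrow> (mon \<one> 1 \<otimes>\<^sub>A y) i = y (i - 1)"
  using PS_A [of y] by (simp add: mon_mult)

lemma wt_one_add_T: "y \<in> PS \<Longrightarrow> wt (\<one>\<^sub>A \<oplus>\<^sub>A mon \<one> 1 \<otimes>\<^sub>A y) 0"
proof -
  assume y: "y \<in> PS"
  then have c: "\<one>\<^sub>A \<oplus>\<^sub>A mon \<one> 1 \<otimes>\<^sub>A y \<in> carrier A" using PS_A by auto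
  have "(\<one>\<^sub>A \<oplus>\<^sub>A mon \<one> 1 \<otimes>\<^sub>A y) i = (if i = 0 then \<one> else \<zero>) \<oplus> y (i - 1)" for i
    using y by (simp add: A_add A_one coeff_T_mult)
  then show ?thesis using y c not_cg_one by (auto simp: wt_def lo_def PS_neg)
qed

lemma mon_unit: "a \<in> Units R \<Longrightarrow> mon a k \<in> Units A"
proof -
  assume a: "a \<in> Units R"
  have c: "a \<in> carrier R" "inv a \<in> carrier R" using a by auto
  have 1: "mon a k \<otimes>\<^sub>A mon (inv a) (- k) = \<one>\<^sub>A"
    unfolding mon_mon [OF c] A_one_mon using a by simp
  then have 2: "mon (inv a) (- k) \<otimes>\<^sub>A mon a k = \<one>\<^sub>A"
    using A.m_comm [of "mon a k" "mon (inv a) (- k)"] c by simp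
  show ?thesis unfolding Units_def using c 1 2 by (auto intro!: bexI [of _ "mon (inv a) (- k)"])
qed

text \<open>A series with nonzero residue is, modulo \<pi>, a monomial with unit coefficient times a
  principal unit of R[[T]]. This reduces units and roots in A to the residue field, to R[[T]] and to
  principal units modulo \<pi>.\<close>

lemma wt_leading:
  assumes f: "wt f m"
  shows "\<exists>y\<in>PS. A.cg 1 f (mon (f m) m \<otimes>\<^sub>A (\<one>\<^sub>A \<oplus>\<^sub>A mon \<one> 1 \<otimes>\<^sub>A y))"
proof -
  have fA: "f \<in> carrier A" and fm: "f m \<in> Units R"
    using wtD [OF f] unit_iff_cg [of "f m"] by auto
  define y where "y i = (if i < 0 then \<zero> else inv (f m) \<otimes> f (i + 1 + m))" for i
  have yP: "y \<in> PS" using fA fm by (simp add: PS_def y_def)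
  have yA: "mon \<one> 1 \<otimes>\<^sub>A y \<in> carrier A" using PS_A [OF yP] by simp
  have "cg 1 (f i) ((mon (f m) m \<otimes>\<^sub>A (\<one>\<^sub>A \<oplus>\<^sub>A mon \<one> 1 \<otimes>\<^sub>A y)) i)" for i
  proof -
    have eq: "(mon (f m) m \<otimes>\<^sub>A (\<one>\<^sub>A \<oplus>\<^sub>A mon \<one> 1 \<otimes>\<^sub>A y)) i =
        f m \<otimes> ((if i - m = 0 then \<one> else \<zero>) \<oplus> y (i - m - 1))"
    proof -
      have "\<one>\<^sub>A \<oplus>\<^sub>A mon \<one> 1 \<otimes>\<^sub>A y \<in> carrier A" using yA by simp
      then have "(mon (f m) m \<otimes>\<^sub>A (\<one>\<^sub>A \<oplus>\<^sub>A mon \<one> 1 \<otimes>\<^sub>A y)) i =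
        f m \<otimes> (\<one>\<^sub>A \<oplus>\<^sub>A mon \<one> 1 \<otimes>\<^sub>A y) (i - m)" using fA by (intro mon_mult) auto
      then show ?thesis using yP by (simp add: A_add A_one coeff_T_mult)
    qed
    consider "i < m" | "i = m" | "i > m" by linarith
    then show ?thesis
    proof cases
      case 1
      then show ?thesis unfolding eq using loD [OF wtD(2) [OF f] 1] fA by (simp add: y_def)
    next
      case 2
      then show ?thesis unfolding eq using fA by (simp add: y_def)
    next
      case 3
      then have "f m \<otimes> ((if i - m = 0 then \<one> else \<zero>) \<oplus> y (i - m - 1)) = f m \<otimes> (inv (f m) \<otimes> f i)"
        using fA fm by (simp add: y_def)
      also have "\<dots> = f i" using fA fm by (simp flip: m_assoc)
      finally show ?thesis unfolding eq using fA by simp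
    qed
  qed
  then have "A.cg 1 f (mon (f m) m \<otimes>\<^sub>A (\<one>\<^sub>A \<oplus>\<^sub>A mon \<one> 1 \<otimes>\<^sub>A y))"
    using fA yA by (intro A_cgI) auto
  then show ?thesis using yP by (rule bexI)
qed

lemma wt_unit:
  assumes f: "wt f m" shows "f \<in> Units A"
proof -
  obtain y where y: "y \<in> PS" "A.cg 1 f (mon (f m) m \<otimes>\<^sub>A (\<one>\<^sub>A \<oplus>\<^sub>A mon \<one> 1 \<otimes>\<^sub>A y))"
    using wt_leading [OF f] ..
  have "f m \<in> Units R" using wtD [OF f] unit_iff_cg [of "f m"] by auto
  then have "mon (f m) m \<otimes>\<^sub>A (\<one>\<^sub>A \<oplus>\<^sub>A mon \<one> 1 \<otimes>\<^sub>A y) \<in> Units A"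
    by (intro A.Units_m_closed mon_unit one_add_T_unit y)
  then show ?thesis using y(2) by (rule A.unit_cong)
qed

lemma A_not_cg_one: "\<not> A.cg 1 \<one>\<^sub>A \<zero>\<^sub>A"
  by (rule wt_not_cg_zero [OF wt_one])

text \<open>A series that is nonzero modulo \<pi> has an order, and series with an order are units.
  So A is local and \<pi> generates its maximal ideal.\<close>

lemma A_unit_iff:
  assumes f: "f \<in> carrier A" shows "f \<in> Units A \<longleftrightarrow> \<not> A.cg 1 f \<zero>\<^sub>A"
proof
  assume u: "f \<in> Units A"
  show "\<not> A.cg 1 f \<zero>\<^sub>A"
  proof
    assume "A.cg 1 f \<zero>\<^sub>A"
    then have "A.cg 1 (f \<otimes>\<^sub>A inv\<^bsub>A\<^esub> f) (\<zero>\<^sub>A \<otimes>\<^sub>A inv\<^bsub>A\<^esub> f)" using u by (intro A.cg_mult) auto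
    then show False using u A_not_cg_one by simp
  qed
next
  assume "\<not> A.cg 1 f \<zero>\<^sub>A"
  then obtain m where "wt f m" using wt_exists [OF f] by blast
  then show "f \<in> Units A" by (rule wt_unit)
qed

lemma wt_inv:
  assumes f: "wt f m" shows "wt (inv\<^bsub>A\<^esub> f) (- m)"
proof -
  have u: "f \<in> Units A" using f by (rule wt_unit)
  then have "inv\<^bsub>A\<^esub> f \<in> Units A" by simp
  then obtain n where n: "wt (inv\<^bsub>A\<^esub> f) n"
    using A_unit_iff [of "inv\<^bsub>A\<^esub> f"] wt_exists [of "inv\<^bsub>A\<^esub> f"] A.Units_closed by blast
  have "wt (f \<otimes>\<^sub>A inv\<^bsub>A\<^esub> f) (m + n)" using f n by (rule wt_mult)
  then have "m + n = 0" using u wt_unique [OF _ wt_one] by simp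
  then have "n = - m" by simp
  with n show ?thesis by simp
qed

text \<open>The analogue of \<open>valuation_decomp\<close> for A. It uses separatedness and
  \<open>A_unit_iff\<close>, without the principal ideal property of A.\<close>

lemma A_nonzero_decomp:
  assumes f: "f \<in> carrier A" "f \<noteq> \<zero>\<^sub>A"
  shows "\<exists>n e. e \<in> Units A \<and> f = mon \<pi> 0 [^]\<^sub>A (n::nat) \<otimes>\<^sub>A e"
proof -
  obtain N where N: "\<not> A.cg N f \<zero>\<^sub>A" using f A.separated by blast
  define M where "M = (LEAST N. \<not> A.cg N f \<zero>\<^sub>A)"
  have M: "\<not> A.cg M f \<zero>\<^sub>A" unfolding M_def using N by (rule LeastI)
  then obtain n where n: "M = Suc n" using f by (cases M) auto
  have "A.cg n f \<zero>\<^sub>A" using not_less_Least [of n "\<lambda>N. \<not> A.cg N f \<zero>\<^sub>A"] n M_def by auto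
  then obtain e where e: "e \<in> carrier A" "f = mon \<pi> 0 [^]\<^sub>A n \<otimes>\<^sub>A e" unfolding A.cg_zero_iff by (elim bexE)
  have "\<not> A.cg 1 e \<zero>\<^sub>A"
  proof
    assume "A.cg 1 e \<zero>\<^sub>A"
    moreover have "A.cg n (mon \<pi> 0 [^]\<^sub>A n) \<zero>\<^sub>A"
      unfolding A.cg_zero_iff by (rule bexI [of _ "\<one>\<^sub>A"]) auto
    ultimately have "A.cg (n + 1) (mon \<pi> 0 [^]\<^sub>A n \<otimes>\<^sub>A e) \<zero>\<^sub>A" by (intro A.cg_zero_mult)
    with M e n show False by simp
  qed
  then have "e \<in> Units A" using e(1) A_unit_iff by blast
  with e show ?thesis by blast
qed

end

lemma (in abelian_group) eq_add_if_minus_eq: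
  assumes "x \<ominus> y = z" "x \<in> carrier G" "y \<in> carrier G" shows "x = y \<oplus> z"
proof -
  have "y \<oplus> (x \<ominus> y) = x" using assms(2,3) by (simp add: minus_eq a_comm [of x] r_neg2)
  then show ?thesis using assms(1) by simp
qed

lemma (in abelian_group) add_diff_cancel_common:
  assumes [simp]: "x \<in> carrier G" "b \<in> carrier G" "e \<in> carrier G"
  shows "(x \<oplus> b) \<ominus> (e \<oplus> b) = x \<ominus> e"
  by (simp add: minus_eq minus_add a_assoc a_comm [of "\<ominus> e" "\<ominus> b"] r_neg2)

lemma (in adic_complete_char) artin_schreier_root:
  assumes "y \<in> carrier R" shows "\<exists>g\<in>carrier R. g [^] p = g \<oplus> u \<otimes> y"
proof -
  obtain g where g: "g \<in> carrier R" "g [^] p \<ominus> g = u \<otimes> y" using artin_schreier_solvable [OF assms] ..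
  have "g [^] p = g \<oplus> u \<otimes> y" using g by (intro eq_add_if_minus_eq) auto
  then show ?thesis using g(1) by (rule bexI)
qed

text \<open>The polynomial X^k - b X - a splits and has positive degree. For
  \<open>2 \<le> k\<close> its three coefficients occupy different positions of the coefficient
  list.\<close>

lemma (in algebraically_closed) monic_trinomial_root:
  assumes k: "2 \<le> k" and a: "a \<in> carrier L" and b: "b \<in> carrier L"
  shows "\<exists>x\<in>carrier L. x [^] (k::nat) = b \<otimes> x \<oplus> a"
proof -
  define q where "q = \<one> # replicate (k - 2) \<zero> @ [\<ominus> b, \<ominus> a]"
  have q: "q \<in> carrier (poly_ring L)"
    unfolding sym [OF univ_poly_carrier] polynomial_def q_def using a b by auto
  have dq: "length q - 1 = k" using k by (simp add: q_def)
  have "splitted q" using q by (rule roots_over_carrier)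
  then have "size (roots q) \<noteq> 0" unfolding splitted_def dq using k by simp
  then obtain x where "x \<in># roots q" by (metis multiset_nonemptyE size_empty)
  then have "is_root q x" using roots_mem_iff_is_root [OF q] by simp
  then have x: "x \<in> carrier L" "eval q x = \<zero>" by (simp_all add: is_root_def)
  have rep: "eval (replicate n \<zero> @ [\<ominus> b, \<ominus> a]) x = \<ominus> b \<otimes> x \<oplus> \<ominus> a" for n
    using a b x(1) by (induction n) auto
  have eq: "x [^] k \<oplus> (\<ominus> b \<otimes> x \<oplus> \<ominus> a) = \<zero>"
  proof -
    obtain j where "k = 2 + j" using le_Suc_ex [OF k] by blast
    then have j: "k = Suc (Suc j)" by simp
    show ?thesis using x rep [of "k - 2"] unfolding q_def by (simp add: j)
  qed
  have id: "\<And>y. y \<in> carrier L \<Longrightarrow> y = y \<oplus> (\<ominus> b \<otimes> x \<oplus> \<ominus> a) \<oplus> (b \<otimes> x \<oplus> a)"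
    using a b x(1) by algebra
  have "x [^] k = b \<otimes> x \<oplus> a"
    using id [of "x [^] k"] x(1) a b unfolding eq by simp
  then show ?thesis using x(1) by (rule bexI)
qed

lemma (in monoid) int_pow_unit_neg:
  "a \<in> Units G \<Longrightarrow> a [^] (- int n) = inv (a [^] n)"
  by (cases "n = 0") (auto simp: int_pow_def2)

locale complete_dvr_char = complete_dvr_base R \<pi> + cring_char R p
  for R :: "'r ring" (structure) and \<pi> and p
begin

lemma A_add_pow: "f \<in> carrier A \<Longrightarrow> [(n::nat)] \<cdot>\<^bsub>A\<^esub> f = (\<lambda>i. [n] \<cdot>\<^bsub>R\<^esub> f i)"
  by (induction n) (simp_all add: A_zero A_add)

sublocale A: adic_complete_char A "mon \<pi> 0" p
proof
  show "Factorial_Ring.prime p" by (rule p)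
  show "[p] \<cdot>\<^bsub>A\<^esub> \<one>\<^sub>A = \<zero>\<^sub>A"
  proof -
    have "[p] \<cdot>\<^bsub>R\<^esub> \<zero> = \<zero>" by (simp add: add_pow_eq_of_int)
    then show ?thesis
      unfolding A_add_pow [OF A.one_closed] by (simp add: A_one A_zero char if_distrib [of "add_pow R p"] cong: if_cong)
  qed
qed

sublocale P: adic_complete_char PSR "mon \<one> 1" p
proof
  show "Factorial_Ring.prime p" by (rule p)
  have "[p] \<cdot>\<^bsub>PSR\<^esub> \<one>\<^bsub>PSR\<^esub> = [p] \<cdot>\<^bsub>A\<^esub> \<one>\<^sub>A" by (simp add: add_pow_def nat_pow_def)
  then show "[p] \<cdot>\<^bsub>PSR\<^esub> \<one>\<^bsub>PSR\<^esub> = \<zero>\<^bsub>PSR\<^esub>" using A.char by simp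
qed

lemma PS_artin_schreier_root:
  "y \<in> PS \<Longrightarrow> \<exists>g\<in>PS. g [^]\<^sub>A p = g \<oplus>\<^sub>A mon \<one> 1 \<otimes>\<^sub>A y"
  using P.artin_schreier_root [of y] by (simp add: P_pow)

lemma PS_root:
  "coprime k p \<Longrightarrow> v \<in> PS \<Longrightarrow>
   \<exists>z\<in>PS. (\<one>\<^sub>A \<oplus>\<^sub>A mon \<one> 1 \<otimes>\<^sub>A z) [^]\<^sub>A (k::nat) = \<one>\<^sub>A \<oplus>\<^sub>A mon \<one> 1 \<otimes>\<^sub>A v"
  using P.root_of_one_add [of k v] by (simp add: P_pow)

text \<open>On residues the p-th power map sends t to t^p and raises coefficients to the p-th power.
  Additivity of Frobenius is available for finite sums only, so h is cut to a finite sum F. Modulo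
  \<pi> the rest D starts above K = |j|, hence its p-th power starts above j.\<close>

lemma frob_coeff_cg:
  assumes h: "h \<in> carrier A"
  shows "cg 1 ((h [^]\<^sub>A p) j) (if int p dvd j then h (j div int p) [^] p else \<zero>)"
proof -
  obtain M where M: "lo 1 M h" using A_lo [OF h] ..
  define L where "L = \<bar>M\<bar>"
  define K where "K = \<bar>j\<bar>"
  have loL: "lo 1 (- L) h" by (rule lo_mono [OF M]) (simp add: L_def)
  define F where "F = (\<Oplus>\<^bsub>A\<^esub>i\<in>{- L..K}. mon (h i) i)"
  have FA: "F \<in> carrier A" unfolding F_def using h by (intro A.finsum_closed) auto
  have F: "F i = (if i \<in> {- L..K} then h i else \<zero>)" for i
  proof -
    have "F i = (\<Oplus>k\<in>{- L..K}. mon (h k) k i)"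
      unfolding F_def using h by (intro A_finsum) auto
    also have "\<dots> = (\<Oplus>k\<in>{- L..K}. if k = i then h i else \<zero>)"
      using h by (intro finsum_cong') (auto simp: mon_def)
    also have "\<dots> = (if i \<in> {- L..K} then h i else \<zero>)"
    proof (cases "i \<in> {- L..K}")
      case True
      then show ?thesis using h by (simp add: add.finprod_singleton_swap [of i "{- L..K}" "\<lambda>_. h i"])
    next
      case False
      then have "(\<Oplus>k\<in>{- L..K}. if k = i then h i else \<zero>) = (\<Oplus>k\<in>{- L..K}. \<zero>)"
        by (intro finsum_cong') auto
      then have s0: "(\<Oplus>k\<in>{- L..K}. if k = i then h i else \<zero>) = \<zero>" by simp
      show ?thesis unfolding s0 using False by (rule if_not_P [symmetric])
    qed
    finally show ?thesis .
  qed
  define D where "D = h \<ominus>\<^sub>A F"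
  have DA: "D \<in> carrier A" unfolding D_def using h FA by simp
  have "lo 1 (K + 1) D" unfolding lo_def
  proof (intro allI impI)
    fix i assume i: "i < K + 1"
    have Di: "D i = h i \<ominus> F i" unfolding D_def using h FA by (simp add: A_minus)
    show "cg 1 (D i) \<zero>"
    proof (cases "i < - L")
      case True
      then show ?thesis unfolding Di F using loD [OF loL True] h by (simp add: minus_eq)
    next
      case False
      then show ?thesis unfolding Di F using i h by (simp add: minus_eq r_neg)
    qed
  qed
  then have Dp: "lo 1 (int n * (K + 1)) (D [^]\<^sub>A n)" for n
  proof (induction n)
    case 0
    show ?case using wtD(2) [OF wt_one] by simp
  next
    case (Suc n)
    then have "lo 1 (int n * (K + 1) + (K + 1)) (D [^]\<^sub>A n \<otimes>\<^sub>A D)" using DA by (intro lo_mult) auto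
    then show ?case by (simp add: algebra_simps)
  qed
  have j: "j < int p * (K + 1)"
  proof -
    have "1 * (K + 1) \<le> int p * (K + 1)" using p_gt_1 by (intro mult_right_mono) (auto simp: K_def)
    moreover have "j < 1 * (K + 1)" by (simp add: K_def)
    ultimately show ?thesis by linarith
  qed
  have hFD: "h = F \<oplus>\<^sub>A D" by (rule A.eq_add_if_minus_eq) (simp_all add: D_def h FA)
  have hp: "h [^]\<^sub>A p = F [^]\<^sub>A p \<oplus>\<^sub>A D [^]\<^sub>A p" unfolding hFD by (rule A.frob_add [OF FA DA])
  have "F [^]\<^sub>A p = (\<Oplus>\<^bsub>A\<^esub>i\<in>{- L..K}. mon (h i) i [^]\<^sub>A p)"
    unfolding F_def using h by (intro A.frob_finsum) auto
  also have "\<dots> = (\<Oplus>\<^bsub>A\<^esub>i\<in>{- L..K}. mon (h i [^] p) (int p * i))"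
    using h by (intro A.finsum_cong') (auto simp: mon_pow)
  finally have "(F [^]\<^sub>A p) j = (\<Oplus>\<^bsub>A\<^esub>i\<in>{- L..K}. mon (h i [^] p) (int p * i)) j" by simp
  also have "\<dots> = (\<Oplus>i\<in>{- L..K}. mon (h i [^] p) (int p * i) j)"
    using h by (intro A_finsum) auto
  finally have Fp: "(F [^]\<^sub>A p) j = \<dots>" .
  have "cg 1 ((F [^]\<^sub>A p) j) (if int p dvd j then h (j div int p) [^] p else \<zero>)"
  proof (cases "int p dvd j \<and> j div int p \<in> {- L..K}")
    case True
    define q where "q = j div int p"
    have "(F [^]\<^sub>A p) j = (\<Oplus>i\<in>{- L..K}. if i = q then h q [^] p else \<zero>)"
      unfolding Fp using h True p_gt_1 by (intro finsum_cong') (auto simp: mon_def q_def)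
    also have "\<dots> = h q [^] p"
      using True h by (intro add.finprod_singleton_swap) (auto simp: q_def)
    finally show ?thesis using True h by (simp add: q_def)
  next
    case False
    have "(F [^]\<^sub>A p) j = (\<Oplus>i\<in>{- L..K}. \<zero>)"
      unfolding Fp using h False p_gt_1 by (intro finsum_cong') (auto simp: mon_def)
    then have 0: "(F [^]\<^sub>A p) j = \<zero>" by simp
    show ?thesis
    proof (cases "int p dvd j")
      case True
      then obtain q where q: "j = int p * q" ..
      then have q': "j div int p = q" using p_gt_1 by simp
      have "q \<le> K"
      proof (cases "q \<le> 0")
        case False
        then have "1 * q \<le> int p * q" using p_gt_1 by (intro mult_right_mono) auto
        then show ?thesis by (simp add: K_def q)
      qed (simp add: K_def)
      then have "q < - L" using False True q' by auto
      then have "cg 1 (h q) \<zero>" by (rule loD [OF loL])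
      then have "cg 1 (h q [^] p) (\<zero> [^] p)" by (rule cg_pow)
      then have "cg 1 \<zero> (h q [^] p)" by (intro cg_sym [of 1 "h q [^] p" \<zero>]) simp
      then show ?thesis using True unfolding 0 q' by simp
    qed (use 0 in simp)
  qed
  moreover have "cg 1 ((D [^]\<^sub>A p) j) \<zero>" using loD [OF Dp j] .
  ultimately have "cg 1 ((F [^]\<^sub>A p) j \<oplus> (D [^]\<^sub>A p) j)
      ((if int p dvd j then h (j div int p) [^] p else \<zero>) \<oplus> \<zero>)" by (rule cg_add)
  then show ?thesis unfolding hp using h by (simp add: A_add)
qed

end

section \<open>Roots and normal forms over the algebraically closed residue field\<close>

locale complete_dvr_closed = complete_dvr_char +
  assumes closed: "algebraically_closed (R Quot (PIdl \<pi>))"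
begin

text \<open>The hypothesis on the residue field enters through this congruence: with b = 0 it yields
  k-th roots modulo \<pi>, with b = 1 the constant terms of Artin-Schreier roots.\<close>

lemma residue_root:
  assumes k: "2 \<le> k" and a: "a \<in> carrier R" and b: "b \<in> carrier R"
  shows "\<exists>c\<in>carrier R. cg 1 (c [^] (k::nat)) (b \<otimes> c \<oplus> a)"
proof -
  define I where "I = PIdl \<pi>"
  interpret I: ideal I R unfolding I_def by (rule cgenideal_ideal) simp
  interpret L: algebraically_closed "R Quot I" using closed unfolding I_def .
  interpret h: ring_hom_cring R "R Quot I" "(+>) I" by (rule ring_hom_cringI) (rule is_cring, rule L.is_cring, rule I.rcos_ring_hom)
  obtain x where x: "x \<in> carrier (R Quot I)"
    "x [^]\<^bsub>R Quot I\<^esub> k = (I +> b) \<otimes>\<^bsub>R Quot I\<^esub> x \<oplus>\<^bsub>R Quot I\<^esub> (I +> a)"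
    using L.monic_trinomial_root [OF k h.hom_closed [OF a] h.hom_closed [OF b]] ..
  obtain c where c: "c \<in> carrier R" "x = I +> c"
    using x(1) by (auto simp: FactRing_def A_RCOSETS_defs a_r_coset_def)
  have "I +> (c [^] k) = (I +> c) [^]\<^bsub>R Quot I\<^esub> k" by (rule h.hom_pow [OF c(1)])
  also have "\<dots> = (I +> b) \<otimes>\<^bsub>R Quot I\<^esub> (I +> c) \<oplus>\<^bsub>R Quot I\<^esub> (I +> a)" by (rule x(2) [unfolded c(2)])
  also have "\<dots> = I +> (b \<otimes> c \<oplus> a)"
    by (simp only: h.hom_mult [OF b c(1)] h.hom_add [OF m_closed [OF b c(1)] a])
  finally have "c [^] k \<ominus> (b \<otimes> c \<oplus> a) \<in> I"
    using quotient_eq_iff_same_a_r_cos [OF I.is_ideal, of "c [^] k" "b \<otimes> c \<oplus> a"] a b c(1) by simp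
  then have "cg 1 (c [^] k) (b \<otimes> c \<oplus> a)"
    using a b c(1) by (subst cg_iff_diff_mem) (auto simp: I_def)
  then show ?thesis using c(1) by (rule bexI)
qed

lemma residue_kth_root:
  assumes k: "0 < k" and a: "a \<in> carrier R"
  shows "\<exists>c\<in>carrier R. cg 1 (c [^] (k::nat)) a"
proof (cases "k = 1")
  case True
  then show ?thesis using a by (intro bexI [of _ a]) auto
next
  case False
  then have "\<exists>c\<in>carrier R. cg 1 (c [^] k) (\<zero> \<otimes> c \<oplus> a)" using k a by (intro residue_root) auto
  then obtain c where "c \<in> carrier R" "cg 1 (c [^] k) (\<zero> \<otimes> c \<oplus> a)" ..
  then show ?thesis using a by (intro bexI [of _ c]) auto
qed

lemma cg_pow_nonzero: "c \<in> carrier R \<Longrightarrow> cg 1 c \<zero> \<Longrightarrow> 0 < n \<Longrightarrow> cg 1 (c [^] (n::nat)) \<zero>"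
  using cg_pow [of 1 c \<zero> n] by (simp add: nat_pow_zero)

text \<open>The root is taken in three factors: of the leading coefficient in the residue field, of
  the principal unit of R[[T]] T-adically, and of the remaining factor, which is 1 modulo \<pi>,
  inside A. The last two need k prime to p.\<close>

lemma wt_root_nat:
  assumes u: "wt u (int k * r)" and k: "coprime k p" "0 < k"
  shows "\<exists>T. wt T r \<and> T [^]\<^sub>A k = u"
proof -
  have uA: "u \<in> carrier A" using u by (rule wtD)
  define a where "a = u (int k * r)"
  have a: "a \<in> carrier R" "\<not> cg 1 a \<zero>" using wtD [OF u] by (simp_all add: a_def)
  obtain y where y: "y \<in> PS"
    "A.cg 1 u (mon a (int k * r) \<otimes>\<^sub>A (\<one>\<^sub>A \<oplus>\<^sub>A mon \<one> 1 \<otimes>\<^sub>A y))"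
    unfolding a_def using wt_leading [OF u] ..
  obtain c where c: "c \<in> carrier R" "cg 1 (c [^] k) a" using residue_kth_root [OF k(2) a(1)] ..
  have c_nz: "\<not> cg 1 c \<zero>"
    using cg_pow_nonzero [OF c(1) _ k(2)] cg_trans [OF cg_sym [OF c(2)]] a(2) by blast
  obtain z where z: "z \<in> PS"
    "(\<one>\<^sub>A \<oplus>\<^sub>A mon \<one> 1 \<otimes>\<^sub>A z) [^]\<^sub>A k = \<one>\<^sub>A \<oplus>\<^sub>A mon \<one> 1 \<otimes>\<^sub>A y"
    using PS_root [OF k(1) y(1)] ..
  define w where "w = \<one>\<^sub>A \<oplus>\<^sub>A mon \<one> 1 \<otimes>\<^sub>A z"
  define S where "S = mon c r \<otimes>\<^sub>A w"
  have "wt S (r + 0)" unfolding S_def w_def by (intro wt_mult wt_mon wt_one_add_T z c c_nz)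
  then have S: "wt S r" by simp
  have wA: "w \<in> carrier A" unfolding w_def using PS_A [OF z(1)] by simp
  have SA: "S \<in> carrier A" using S by (rule wtD)
  have SkU: "S [^]\<^sub>A k \<in> Units A" by (rule wt_unit [OF wt_pow [OF S]])
  have Sk: "S [^]\<^sub>A k = mon (c [^] k) (int k * r) \<otimes>\<^sub>A (\<one>\<^sub>A \<oplus>\<^sub>A mon \<one> 1 \<otimes>\<^sub>A y)"
    unfolding S_def using wA c(1) z(2) by (subst A.nat_pow_distrib) (auto simp: mon_pow w_def)
  have "A.cg 1 (mon (c [^] k) (int k * r)) (mon a (int k * r))"
    using c a by (intro A_cgI mon_closed) (auto simp: mon_def)
  then have "A.cg 1 (S [^]\<^sub>A k) (mon a (int k * r) \<otimes>\<^sub>A (\<one>\<^sub>A \<oplus>\<^sub>A mon \<one> 1 \<otimes>\<^sub>A y))"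
    unfolding Sk using PS_A [OF y(1)] by (intro A.cg_mult A.cg_refl) auto
  then have "A.cg 1 u (S [^]\<^sub>A k)" using y(2) by (blast intro: A.cg_trans A.cg_sym)
  then obtain d where d: "d \<in> carrier A" "u = S [^]\<^sub>A k \<oplus>\<^sub>A mon \<pi> 0 [^]\<^sub>A (1::nat) \<otimes>\<^sub>A d"
    by (rule A.cgE)
  \<comment> \<open>So far S^k agrees with u modulo \<pi>. Since S^k is a unit, u = S^k (1 + \<pi>
    v).\<close>
  define v where "v = inv\<^bsub>A\<^esub> (S [^]\<^sub>A k) \<otimes>\<^sub>A d"
  have vA: "v \<in> carrier A" unfolding v_def using SkU d(1) by simp
  obtain x where x: "x \<in> carrier A"
    "(\<one>\<^sub>A \<oplus>\<^sub>A mon \<pi> 0 \<otimes>\<^sub>A x) [^]\<^sub>A k = \<one>\<^sub>A \<oplus>\<^sub>A mon \<pi> 0 \<otimes>\<^sub>A v"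
    using A.root_of_one_add [OF k(1) vA] ..
  define T where "T = S \<otimes>\<^sub>A (\<one>\<^sub>A \<oplus>\<^sub>A mon \<pi> 0 \<otimes>\<^sub>A x)"
  have "T [^]\<^sub>A k = S [^]\<^sub>A k \<otimes>\<^sub>A (\<one>\<^sub>A \<oplus>\<^sub>A mon \<pi> 0 \<otimes>\<^sub>A v)"
    unfolding T_def using SA x by (subst A.nat_pow_distrib) auto
  also have "\<dots> = S [^]\<^sub>A k \<oplus>\<^sub>A (S [^]\<^sub>A k \<otimes>\<^sub>A inv\<^bsub>A\<^esub> (S [^]\<^sub>A k)) \<otimes>\<^sub>A (mon \<pi> 0 \<otimes>\<^sub>A d)"
  proof -
    have "\<And>s i w. \<lbrakk>s \<in> carrier A; i \<in> carrier A; w \<in> carrier A\<rbrakk> \<Longrightarrow>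
      s \<otimes>\<^sub>A (\<one>\<^sub>A \<oplus>\<^sub>A w \<otimes>\<^sub>A (i \<otimes>\<^sub>A d)) = s \<oplus>\<^sub>A (s \<otimes>\<^sub>A i) \<otimes>\<^sub>A (w \<otimes>\<^sub>A d)"
      using d(1) by (simp add: A.r_distr A.m_ac)
    then show ?thesis unfolding v_def using SkU SA by simp
  qed
  also have "\<dots> = u" using d SkU by simp
  finally have Tk: "T [^]\<^sub>A k = u" .
  have "A.cg 1 \<one>\<^sub>A (\<one>\<^sub>A \<oplus>\<^sub>A mon \<pi> 0 \<otimes>\<^sub>A x)"
    by (rule A.cg_sym, rule A.cgI [of _ x]) (use x(1) in auto)
  then have "A.cg 1 (S \<otimes>\<^sub>A \<one>\<^sub>A) T" unfolding T_def using SA by (intro A.cg_mult A.cg_refl)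
  then have "wt T r" using SA by (intro wt_cong [OF S]) simp
  with Tk show ?thesis by blast
qed

lemma wt_root:
  assumes u: "wt u (k * r)" and k: "coprime k (int p)"
  shows "\<exists>T. wt T r \<and> T [^]\<^sub>A (k::int) = u"
proof -
  have uU: "u \<in> Units A" by (rule wt_unit [OF u])
  have k0: "k \<noteq> 0" using k p_gt_1 by auto
  define n where "n = nat \<bar>k\<bar>"
  have n: "coprime n p" "0 < n"
  proof -
    have "coprime (int n) (int p)" using k by (simp add: n_def)
    then show "coprime n p" by (simp only: coprime_int_iff)
  qed (use k0 in \<open>simp add: n_def\<close>)
  show ?thesis
  proof (cases "k > 0")
    case True
    then have kn: "k = int n" by (simp add: n_def)
    obtain T where "wt T r" "T [^]\<^sub>A n = u" using wt_root_nat [of u n r] u n kn by auto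
    then show ?thesis unfolding kn int_pow_int by blast
  next
    case False
    then have kn: "k = - int n" using k0 by (simp add: n_def)
    have "wt (inv\<^bsub>A\<^esub> u) (int n * r)" using wt_inv [OF u] kn by simp
    then obtain T where T: "wt T r" "T [^]\<^sub>A n = inv\<^bsub>A\<^esub> u" using wt_root_nat n by blast
    have "T [^]\<^sub>A k = u" unfolding kn A.int_pow_unit_neg [OF wt_unit [OF T(1)]] T(2) using uU by simp
    with T(1) show ?thesis by blast
  qed
qed

lemma wt_int_pow:
  assumes T: "wt T r" shows "wt (T [^]\<^sub>A (k::int)) (k * r)"
proof (cases "k < 0")
  case True
  then have k: "- (int (nat (- k)) * r) = k * r" by simp
  show ?thesis using wt_inv [OF wt_pow [OF T, of "nat (- k)"]] True unfolding k int_pow_def2 by simp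
next
  case False
  then have k: "int (nat k) * r = k * r" by simp
  show ?thesis using wt_pow [OF T, of "nat k"] False unfolding k int_pow_def2 by simp
qed

text \<open>One p-th power removes the coefficients at all multiples of p from the residue at once:
  the coefficient of h at i is a p-th root modulo \<pi> of the coefficient of u at p i. What remains
  has an order prime to p or vanishes modulo \<pi>.\<close>

lemma kummer_normal_form:
  assumes u: "u \<in> carrier A"
  shows "\<exists>h\<in>carrier A. A.cg 1 (u \<ominus>\<^sub>A h [^]\<^sub>A p) \<zero>\<^sub>A \<or>
    (\<exists>m. coprime m (int p) \<and> wt (u \<ominus>\<^sub>A h [^]\<^sub>A p) m)"
proof -
  obtain M where M: "lo 1 M u" using A_lo [OF u] ..
  \<comment> \<open>The last clause takes the root of a coefficient that vanishes modulo \<pi> to be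
    exactly 0. Therefore h has only finitely many negative exponents and lies in A.\<close>
  have "\<exists>c. c \<in> carrier R \<and> cg 1 (c [^] p) a \<and> (cg 1 a \<zero> \<longrightarrow> c = \<zero>)" if a: "a \<in> carrier R" for a
  proof (cases "cg 1 a \<zero>")
    case True
    then show ?thesis using cg_sym [OF True] by (intro exI [of _ \<zero>]) simp
  next
    case False
    obtain c where "c \<in> carrier R" "cg 1 (c [^] p) a" using residue_kth_root [of p a] a p_gt_1 by auto
    with False show ?thesis by blast
  qed
  then have "\<forall>i. \<exists>c. c \<in> carrier R \<and> cg 1 (c [^] p) (u (int p * i)) \<and> (cg 1 (u (int p * i)) \<zero> \<longrightarrow> c = \<zero>)"
    using u by simp
  from choice [OF this] obtain h where
    h: "\<forall>i. h i \<in> carrier R \<and> cg 1 (h i [^] p) (u (int p * i)) \<and> (cg 1 (u (int p * i)) \<zero> \<longrightarrow> h i = \<zero>)" ..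
  have hA: "h \<in> carrier A"
  proof (rule AI)
    show "h i \<in> carrier R" for i using h by simp
    have "lo N (- \<bar>M\<bar>) h" for N unfolding lo_def
    proof (intro allI impI)
      fix i assume i: "i < - \<bar>M\<bar>"
      have "int p * i \<le> 1 * i" using i p_gt_1 by (intro mult_right_mono_neg) auto
      then have "cg 1 (u (int p * i)) \<zero>" using i by (intro loD [OF M]) auto
      then show "cg N (h i) \<zero>" using h by simp
    qed
    then show "\<exists>M. lo N M h" for N ..
  qed
  define v where "v = u \<ominus>\<^sub>A h [^]\<^sub>A p"
  have vA: "v \<in> carrier A" unfolding v_def using u hA by simp
  have v0: "cg 1 (v j) \<zero>" if dvd: "int p dvd j" for j
  proof -
    obtain q where q: "j = int p * q" using dvd ..
    have "cg 1 ((h [^]\<^sub>A p) j) (h q [^] p)" using frob_coeff_cg [OF hA, of j] p_gt_1 by (simp add: q)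
    also have "cg 1 (h q [^] p) (u j)" using h by (simp add: q)
    finally have "cg 1 (u j) ((h [^]\<^sub>A p) j)" by (rule cg_sym)
    then have "cg 1 (u j \<ominus> (h [^]\<^sub>A p) j) \<zero>" using u hA by (simp add: cg_diff_zero_iff)
    then show ?thesis unfolding v_def using u hA by (simp add: A_minus)
  qed
  have "A.cg 1 v \<zero>\<^sub>A \<or> (\<exists>m. coprime m (int p) \<and> wt v m)"
  proof (cases "A.cg 1 v \<zero>\<^sub>A")
    case False
    then obtain m where m: "wt v m" using wt_exists [OF vA] by blast
    then have "\<not> int p dvd m" using v0 wtD(3) by blast
    moreover have "Factorial_Ring.prime (int p)" using p by simp
    ultimately have "coprime m (int p)" using prime_imp_coprime [of "int p" m] by (simp add: coprime_commute)
    with m show ?thesis by blast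
  qed simp
  with hA show ?thesis unfolding v_def by blast
qed

text \<open>Induction on the pole order n of the residue. If p divides n, subtracting g^p - g with g
  = c T^(-n/p) trades the pole of order n for one of order n/p. Without a pole the whole residue has
  the form h^p - h.\<close>

lemma artin_schreier_normal_form:
  assumes u: "u \<in> carrier A"
  shows "\<exists>h\<in>carrier A. A.cg 1 (u \<ominus>\<^sub>A (h [^]\<^sub>A p \<ominus>\<^sub>A h)) \<zero>\<^sub>A \<or>
    (\<exists>m<0. coprime m (int p) \<and> wt (u \<ominus>\<^sub>A (h [^]\<^sub>A p \<ominus>\<^sub>A h)) m)"
proof -
  have key: "\<exists>h\<in>carrier A. A.cg 1 (u \<ominus>\<^sub>A (h [^]\<^sub>A p \<ominus>\<^sub>A h)) \<zero>\<^sub>A \<or>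
    (\<exists>m<0. coprime m (int p) \<and> wt (u \<ominus>\<^sub>A (h [^]\<^sub>A p \<ominus>\<^sub>A h)) m)"
    if "u \<in> carrier A" "lo 1 (- int n) u" for n u
    using that
  proof (induction n arbitrary: u rule: less_induct)
    case (less n)
    have uA: "u \<in> carrier A" by (rule less.prems)
    consider (zero) "n = 0" | (drop) "n > 0" "cg 1 (u (- int n)) \<zero>"
      | (wt) "n > 0" "\<not> cg 1 (u (- int n)) \<zero>" by blast
    then show ?case
    proof cases
      case zero
      \<comment> \<open>The constant term is absorbed by an Artin-Schreier root over the residue
        field. The positive exponents form T y, which is handled T-adically in R[[T]].\<close>
      obtain c where c: "c \<in> carrier R" "cg 1 (c [^] p) (\<one> \<otimes> c \<oplus> u 0)"
        using residue_root [of p "u 0" \<one>] p_gt_1 uA by auto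
      define y where "y i = (if i < 0 then \<zero> else u (i + 1))" for i
      have yP: "y \<in> PS" using uA by (simp add: PS_def y_def)
      obtain g where g: "g \<in> PS" "g [^]\<^sub>A p = g \<oplus>\<^sub>A mon \<one> 1 \<otimes>\<^sub>A y" using PS_artin_schreier_root [OF yP] ..
      have gA: "g \<in> carrier A" and yA: "y \<in> carrier A" using g yP PS_A by auto
      define h where "h = mon c 0 \<oplus>\<^sub>A g"
      have hA: "h \<in> carrier A" unfolding h_def using c gA by simp
      have hp: "h [^]\<^sub>A p = mon (c [^] p) 0 \<oplus>\<^sub>A (g \<oplus>\<^sub>A mon \<one> 1 \<otimes>\<^sub>A y)"
        unfolding h_def using c gA g(2) by (subst A.frob_add) (auto simp: mon_pow)
      have "cg 1 (u i) ((h [^]\<^sub>A p \<ominus>\<^sub>A h) i)" for i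
      proof -
        have "(h [^]\<^sub>A p \<ominus>\<^sub>A h) i = (h [^]\<^sub>A p) i \<ominus> h i" using hA by (simp add: A_minus)
        also have "\<dots> = (mon (c [^] p) 0 i \<oplus> (g i \<oplus> y (i - 1))) \<ominus> (mon c 0 i \<oplus> g i)"
          unfolding hp by (simp add: A_add h_def coeff_T_mult yP)
        also have "\<dots> = (mon (c [^] p) 0 i \<ominus> mon c 0 i) \<oplus> y (i - 1)"
        proof -
          have "\<And>a b d e. \<lbrakk>a \<in> carrier R; b \<in> carrier R; d \<in> carrier R; e \<in> carrier R\<rbrakk> \<Longrightarrow>
            (a \<oplus> (b \<oplus> d)) \<ominus> (e \<oplus> b) = (a \<ominus> e) \<oplus> d"
          proof -
            fix a b d e assume *: "a \<in> carrier R" "b \<in> carrier R" "d \<in> carrier R" "e \<in> carrier R"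
            then have "a \<oplus> (b \<oplus> d) = (a \<oplus> d) \<oplus> b" by (simp add: a_ac)
            then have "(a \<oplus> (b \<oplus> d)) \<ominus> (e \<oplus> b) = (a \<oplus> d) \<ominus> e"
              using * by (simp only: add_diff_cancel_common a_closed)
            also have "\<dots> = (a \<ominus> e) \<oplus> d" using * by (simp add: minus_eq a_ac)
            finally show "(a \<oplus> (b \<oplus> d)) \<ominus> (e \<oplus> b) = (a \<ominus> e) \<oplus> d" .
          qed
          then show ?thesis using gA yA c by simp
        qed
        finally have eq: "(h [^]\<^sub>A p \<ominus>\<^sub>A h) i = (mon (c [^] p) 0 i \<ominus> mon c 0 i) \<oplus> y (i - 1)" .
        consider "i < 0" | "i = 0" | "i > 0" by linarith
        then show ?thesis
        proof cases
          case 1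
          then have "cg 1 (u i) \<zero>" using less.prems zero by (intro loD [of 1 0 u]) auto
          then show ?thesis unfolding eq using 1 by (simp add: mon_def y_def minus_eq)
        next
          case 2
          have "cg 1 (c [^] p \<ominus> c) (\<one> \<otimes> c \<oplus> u 0 \<ominus> c)" using c by (intro cg_diff) auto
          moreover have "\<one> \<otimes> c \<oplus> u 0 \<ominus> c = u 0"
            using c uA by (simp add: minus_eq a_comm [of _ "\<ominus> c"] r_neg1)
          ultimately have "cg 1 (u 0) (c [^] p \<ominus> c)" by (simp add: cg_sym)
          then show ?thesis unfolding eq using 2 c by (simp add: mon_def y_def)
        next
          case 3
          then show ?thesis unfolding eq using uA by (simp add: mon_def y_def minus_eq)
        qed
      qed
      then have "A.cg 1 u (h [^]\<^sub>A p \<ominus>\<^sub>A h)" using uA hA by (intro A_cgI) auto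
      then have "A.cg 1 (u \<ominus>\<^sub>A (h [^]\<^sub>A p \<ominus>\<^sub>A h)) \<zero>\<^sub>A" using uA hA by (subst A.cg_diff_zero_iff) auto
      with hA show ?thesis by blast
    next
      case drop
      have "lo 1 (- int (n - 1)) u" unfolding lo_def
      proof (intro allI impI)
        fix i assume "i < - int (n - 1)"
        then have "i < - int n \<or> i = - int n" using drop(1) by auto
        then show "cg 1 (u i) \<zero>" using drop(2) loD [OF less.prems(2)] by auto
      qed
      then show ?thesis using less.IH [of "n - 1" u] drop(1) uA by simp
    next
      case wt
      then have w: "wt u (- int n)" using less.prems by (simp add: wt_def)
      show ?thesis
      proof (cases "p dvd n")
        case False
        have "coprime p n" using False p by (rule prime_imp_coprime [rotated])
        then have "coprime (- int n) (int p)" by (simp add: coprime_commute coprime_int_iff)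
        moreover have "u \<ominus>\<^sub>A (\<zero>\<^sub>A [^]\<^sub>A p \<ominus>\<^sub>A \<zero>\<^sub>A) = u" using uA by (simp add: A.minus_eq)
        moreover have "- int n < 0" using wt(1) by simp
        ultimately show ?thesis using w by (intro bexI [of _ "\<zero>\<^sub>A"]) auto
      next
        case True
        then obtain l where l: "n = p * l" ..
        then have "0 < l" using wt(1) by (cases l) auto
        then have ln: "l < n" using p_gt_1 l by simp
        obtain c where c: "c \<in> carrier R" "cg 1 (c [^] p) (u (- int n))"
          using residue_kth_root [of p "u (- int n)"] p_gt_1 uA by auto
        \<comment> \<open>Its p-th power cancels the coefficient at -n, and g itself contributes
          only at the exponent -l, where l < n.\<close>
        define g where "g = mon c (- int l)"
        have gA: "g \<in> carrier A" using c by (simp add: g_def)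
        have gp: "g [^]\<^sub>A p = mon (c [^] p) (- int n)" using c l by (simp add: g_def mon_pow)
        define v where "v = u \<ominus>\<^sub>A (g [^]\<^sub>A p \<ominus>\<^sub>A g)"
        have vA: "v \<in> carrier A" unfolding v_def using uA gA by simp
        have "lo 1 (- int (n - 1)) v" unfolding lo_def
        proof (intro allI impI)
          fix i assume i: "i < - int (n - 1)"
          have vi: "v i = u i \<ominus> (mon (c [^] p) (- int n) i \<ominus> g i)"
          proof -
            have w: "g [^]\<^sub>A p \<ominus>\<^sub>A g \<in> carrier A" "g [^]\<^sub>A p \<in> carrier A" using gA by auto
            have "v i = u i \<ominus> (g [^]\<^sub>A p \<ominus>\<^sub>A g) i" unfolding v_def A_minus [OF uA w(1)] ..
            also have "(g [^]\<^sub>A p \<ominus>\<^sub>A g) i = (g [^]\<^sub>A p) i \<ominus> g i" unfolding A_minus [OF w(2) gA] ..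
            finally show ?thesis unfolding gp .
          qed
          have gi: "g i = \<zero>" using i ln by (auto simp: g_def mon_def)
          show "cg 1 (v i) \<zero>"
          proof (cases "i = - int n")
            case True
            then have "v i = u i \<ominus> c [^] p" unfolding vi gi using c by (simp add: mon_def minus_eq)
            then show ?thesis using True c uA by (simp add: cg_diff_zero_iff cg_sym)
          next
            case False
            then have "i < - int n" using i by auto
            then have "cg 1 (u i) \<zero>" by (rule loD [OF less.prems(2)])
            then show ?thesis unfolding vi gi using False uA by (simp add: mon_def minus_eq)
          qed
        qed
        then obtain h where h: "h \<in> carrier A" "A.cg 1 (v \<ominus>\<^sub>A (h [^]\<^sub>A p \<ominus>\<^sub>A h)) \<zero>\<^sub>A \<or>
            (\<exists>m<0. coprime m (int p) \<and> wt (v \<ominus>\<^sub>A (h [^]\<^sub>A p \<ominus>\<^sub>A h)) m)"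
          using less.IH [of "n - 1" v] wt(1) vA by auto
        have "v \<ominus>\<^sub>A (h [^]\<^sub>A p \<ominus>\<^sub>A h) = u \<ominus>\<^sub>A ((g \<oplus>\<^sub>A h) [^]\<^sub>A p \<ominus>\<^sub>A (g \<oplus>\<^sub>A h))"
        proof -
          have "\<And>a b x y. \<lbrakk>a \<in> carrier A; b \<in> carrier A; x \<in> carrier A; y \<in> carrier A\<rbrakk> \<Longrightarrow>
            u \<ominus>\<^sub>A (a \<ominus>\<^sub>A b) \<ominus>\<^sub>A (x \<ominus>\<^sub>A y) = u \<ominus>\<^sub>A (a \<oplus>\<^sub>A x \<ominus>\<^sub>A (b \<oplus>\<^sub>A y))"
            using uA by (simp add: A.minus_eq A.minus_add A.a_ac)
          then show ?thesis unfolding v_def using gA h(1) by (simp add: A.frob_add)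
        qed
        with h gA show ?thesis by (intro bexI [of _ "g \<oplus>\<^sub>A h"]) auto
      qed
    qed
  qed
  obtain M where M: "lo 1 M u" using A_lo [OF u] ..
  have "lo 1 (- int (nat \<bar>M\<bar>)) u" by (rule lo_mono [OF M]) simp
  with u show ?thesis by (rule key)
qed

end

section \<open>Substitution in convergent Laurent series\<close>

lemma (in monoid) units_of_int_pow:
  assumes a: "a \<in> Units G" shows "a [^]\<^bsub>units_of G\<^esub> (i::int) = a [^] i"
proof (cases "i < 0")
  case True
  have "a [^] nat (- i) \<in> Units G" using a by (rule Units_pow_closed)
  then show ?thesis unfolding int_pow_def2 units_of_pow [OF a] using True by (simp add: units_of_inv)
next
  case False
  then show ?thesis unfolding int_pow_def2 units_of_pow [OF a] by simp
qed

lemma (in monoid) unit_int_pow_closed: "a \<in> Units G \<Longrightarrow> a [^] (i::int) \<in> Units G"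
  using group.int_pow_closed [OF units_group, of a i] by (simp add: units_of_int_pow units_of_carrier)

lemma (in monoid) unit_int_pow_add: "a \<in> Units G \<Longrightarrow> a [^] (i + j :: int) = a [^] i \<otimes> a [^] j"
  using group.int_pow_mult [OF units_group, of a i j] by (simp add: units_of_int_pow units_of_carrier units_of_mult)

lemma (in monoid) unit_int_pow_1: "a \<in> Units G \<Longrightarrow> a [^] (1::int) = a"
  by (simp add: int_pow_def2 Units_closed)

context complete_dvr_base
begin

lemma lo_pow:
  assumes "f \<in> carrier A" "lo N M f" shows "lo N (int n * M) (f [^]\<^sub>A n)"
proof (induction n)
  case 0
  show ?case unfolding lo_def by (simp add: A_one)
next
  case (Suc n)
  then have "lo N (int n * M + M) (f [^]\<^sub>A n \<otimes>\<^sub>A f)" using assms by (intro lo_mult) auto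
  then show ?case by (simp add: algebra_simps)
qed

lemma lo_decomp:
  assumes f: "f \<in> carrier A" and lo: "lo N M f"
  shows "\<exists>x\<in>carrier A. \<exists>y\<in>carrier A. (\<forall>i<M. x i = \<zero>) \<and> f = x \<oplus>\<^sub>A mon \<pi> 0 [^]\<^sub>A N \<otimes>\<^sub>A y"
proof -
  define x where "x i = (if i < M then \<zero> else f i)" for i
  have xA: "x \<in> carrier A"
  proof (rule AI)
    show "x i \<in> carrier R" for i using f by (simp add: x_def)
    have "lo K M x" for K by (simp add: lo_def x_def)
    then show "\<exists>M. lo K M x" for K ..
  qed
  have "A.cg N f x" using f xA lo by (intro A_cgI) (auto simp: x_def loD)
  then obtain y where "y \<in> carrier A" "f = x \<oplus>\<^sub>A mon \<pi> 0 [^]\<^sub>A N \<otimes>\<^sub>A y" by (rule A.cgE)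
  moreover have "\<forall>i<M. x i = \<zero>" by (simp add: x_def)
  ultimately show ?thesis using xA by blast
qed

lemma lo_A_add: "lo N M f \<Longrightarrow> lo N M g \<Longrightarrow> lo N M (f \<oplus>\<^sub>A g)"
  unfolding A_add by (rule lo_add)

lemma lo_A_diff:
  assumes "f \<in> carrier A" "g \<in> carrier A" "lo N M f" "lo N M g" shows "lo N M (f \<ominus>\<^sub>A g)"
  unfolding A_minus [OF assms(1,2)] lo_def
  using cg_diff [OF loD [OF assms(3)] loD [OF assms(4)]] by simp

lemma lo_A_zero: "lo N M \<zero>\<^sub>A" by (simp add: lo_def A_zero)

lemma lo_A_finsum:
  assumes "finite J" "\<And>i. i \<in> J \<Longrightarrow> t i \<in> carrier A" "\<And>i. i \<in> J \<Longrightarrow> lo N M (t i)"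
  shows "lo N M (\<Oplus>\<^bsub>A\<^esub>i\<in>J. t i)"
  using assms
proof (induction J rule: finite_induct)
  case (insert i J)
  then have "t \<in> J \<rightarrow> carrier A" by auto
  with insert show ?case by (simp add: lo_A_add)
qed (simp add: lo_A_zero)

lemma A_cg_zero_lo: "A.cg N f \<zero>\<^sub>A \<Longrightarrow> lo N M f"
  using A_cg_coeff [of N f "\<zero>\<^sub>A"] by (simp add: lo_def A_zero)

lemma A_cg_zero_if_lo: "f \<in> carrier A \<Longrightarrow> (\<And>n. lo N (int n) f) \<Longrightarrow> A.cg N f \<zero>\<^sub>A"
proof (rule A_cgI)
  fix i assume lo: "\<And>n. lo N (int n) f"
  have "cg N (f i) \<zero>" by (rule loD [OF lo [of "nat i + 1"]]) simp
  then show "cg N (f i) (\<zero>\<^sub>A i)" by (simp add: A_zero)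
qed simp_all

text \<open>Unconditional convergence for the topology of coefficientwise convergence, uniform on
  bounded above sets of exponents.\<close>

definition wsum :: "(int \<Rightarrow> int \<Rightarrow> 'r) \<Rightarrow> (int \<Rightarrow> 'r) \<Rightarrow> bool"
  where "wsum t g \<longleftrightarrow> g \<in> carrier A \<and> (\<forall>i. t i \<in> carrier A) \<and>
    (\<forall>N M. \<exists>J0. finite J0 \<and> (\<forall>J. finite J \<and> J0 \<subseteq> J \<longrightarrow> lo N M (g \<ominus>\<^sub>A (\<Oplus>\<^bsub>A\<^esub>i\<in>J. t i))))"

lemma wsumD: "wsum t g \<Longrightarrow> g \<in> carrier A" "wsum t g \<Longrightarrow> t i \<in> carrier A"
  by (simp_all add: wsum_def)

lemma wsum_ex:
  assumes "wsum t g"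
  shows "\<exists>J0. finite J0 \<and> (\<forall>J. finite J \<and> J0 \<subseteq> J \<longrightarrow> lo N M (g \<ominus>\<^sub>A (\<Oplus>\<^bsub>A\<^esub>i\<in>J. t i)))"
  using assms unfolding wsum_def by simp

lemma wsumI:
  assumes "g \<in> carrier A" "\<And>i. t i \<in> carrier A"
    "\<And>N M. \<exists>J0. finite J0 \<and> (\<forall>J. finite J \<and> J0 \<subseteq> J \<longrightarrow> lo N M (g \<ominus>\<^sub>A (\<Oplus>\<^bsub>A\<^esub>i\<in>J. t i)))"
  shows "wsum t g"
  using assms unfolding wsum_def by simp

lemma A_eq_if_lo_diff:
  assumes "f \<in> carrier A" "g \<in> carrier A" "\<And>N M. lo N M (f \<ominus>\<^sub>A g)" shows "f = g"
proof (rule A_eqI)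
  fix N n
  have "cg N ((f \<ominus>\<^sub>A g) n) \<zero>" by (rule loD [OF assms(3) [of N "n + 1"]]) simp
  then show "cg N (f n) (g n)" unfolding A_minus [OF assms(1,2)] using assms(1,2) by (simp add: cg_diff_zero_iff)
qed

lemma wsum_eqI: "t = s \<Longrightarrow> wsum s g \<Longrightarrow> wsum t g"
  by simp

lemma wsum_unique:
  assumes g: "wsum t g" and h: "wsum t h" shows "g = h"
proof (rule A_eq_if_lo_diff)
  show gA: "g \<in> carrier A" and hA: "h \<in> carrier A" using g h wsumD by auto
  fix N M
  obtain J0 where J0: "finite J0" "\<And>J. finite J \<Longrightarrow> J0 \<subseteq> J \<Longrightarrow> lo N M (g \<ominus>\<^sub>A (\<Oplus>\<^bsub>A\<^esub>i\<in>J. t i))"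
    using wsum_ex [OF g, of N M] by blast
  obtain J1 where J1: "finite J1" "\<And>J. finite J \<Longrightarrow> J1 \<subseteq> J \<Longrightarrow> lo N M (h \<ominus>\<^sub>A (\<Oplus>\<^bsub>A\<^esub>i\<in>J. t i))"
    using wsum_ex [OF h, of N M] by blast
  define s where "s = (\<Oplus>\<^bsub>A\<^esub>i\<in>J0 \<union> J1. t i)"
  have sA: "s \<in> carrier A" unfolding s_def using wsumD(2) [OF g] by (intro A.finsum_closed) auto
  have l: "lo N M (g \<ominus>\<^sub>A s)" "lo N M (h \<ominus>\<^sub>A s)" unfolding s_def using J0 J1 by auto
  have "lo N M ((g \<ominus>\<^sub>A s) \<ominus>\<^sub>A (h \<ominus>\<^sub>A s))" using gA hA sA by (intro lo_A_diff l) auto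
  also have "(g \<ominus>\<^sub>A s) \<ominus>\<^sub>A (h \<ominus>\<^sub>A s) = g \<ominus>\<^sub>A h"
    using A.add_diff_cancel_common [OF gA _ hA, of "\<ominus>\<^sub>A s"] sA by (simp add: A.minus_eq)
  finally show "lo N M (g \<ominus>\<^sub>A h)" .
qed

text \<open>Each coefficient is the limit in R of its partial sums over {-n..n}. Almost all terms
  are small up to a given exponent, which makes these sums Cauchy and also shows that the limit does
  not depend on the order of summation.\<close>

lemma wsum_exists:
  assumes t: "\<And>i. t i \<in> carrier A"
    and small: "\<And>N M. \<exists>J0. finite J0 \<and> (\<forall>i. i \<notin> J0 \<longrightarrow> lo N M (t i))"
  shows "\<exists>g. wsum t g"
proof -
  define S where "S J = (\<Oplus>\<^bsub>A\<^esub>i\<in>J. t i)" for J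
  have SA: "S J \<in> carrier A" for J unfolding S_def using t by (intro A.finsum_closed) auto
  have lsub: "cg N (S J i) (S J0 i)"
    if "finite J" "J0 \<subseteq> J" "\<forall>i. i \<notin> J0 \<longrightarrow> lo N M (t i)" "i < M" for N M J J0 i
  proof -
    have "finite J0" using that finite_subset by blast
    then have "S J i = (\<Oplus>k\<in>J. t k i)" "S J0 i = (\<Oplus>k\<in>J0. t k i)"
      unfolding S_def using that t by (auto intro!: A_finsum)
    moreover have "cg N (\<Oplus>k\<in>J. t k i) (\<Oplus>k\<in>J0. t k i)"
      using that t by (intro cg_finsum_subset) (auto intro: loD)
    ultimately show ?thesis by simp
  qed
  have int_sup: "\<exists>n0. \<forall>n\<ge>n0. J0 \<subseteq> {- int n..int n}" if "finite J0" for J0 :: "int set"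
  proof -
    define m where "m = (\<Sum>x\<in>J0. \<bar>x\<bar>)"
    have "x \<in> {- int n..int n}" if x: "x \<in> J0" and n: "nat m \<le> n" for x n
    proof -
      have "\<bar>x\<bar> \<le> m" unfolding m_def using x \<open>finite J0\<close> by (intro member_le_sum) auto
      moreover have "m \<le> int n" using n by (simp add: nat_le_iff)
      ultimately have "- int n \<le> x" "x \<le> int n" by linarith+
      then show ?thesis by simp
    qed
    then show ?thesis by (intro exI [of _ "nat m"] allI impI subsetI)
  qed
  have "\<exists>l. l \<in> carrier R \<and> (\<forall>N. \<exists>n0. \<forall>n\<ge>n0. cg N (S {- int n..int n} i) l)" for i
  proof -
    have cs: "S {- int n..int n} i \<in> carrier R" for n using SA by simp
    have "\<exists>n0. \<forall>m\<ge>n0. \<forall>n\<ge>n0. cg N (S {- int m..int m} i) (S {- int n..int n} i)" for N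
    proof -
      \<comment> \<open>Since \<open>lo\<close> bounds exponents strictly, i + 1 is the bound that
        covers the exponent i.\<close>
      obtain J0 where J0': "finite J0 \<and> (\<forall>k. k \<notin> J0 \<longrightarrow> lo N (i + 1) (t k))" using small ..
    note J0 = conjunct1 [OF J0'] conjunct2 [OF J0']
      obtain n0 where n0: "\<forall>n\<ge>n0. J0 \<subseteq> {- int n..int n}" using int_sup [OF J0(1)] ..
      have *: "cg N (S {- int n..int n} i) (S J0 i)" if "n \<ge> n0" for n
        by (rule lsub [OF _ _ J0(2)]) (use n0 that in auto)
      show ?thesis by (intro exI [of _ n0] allI impI) (rule cg_trans [OF * cg_sym [OF *]])
    qed
    then have "\<exists>l. adic_limit R \<pi> (\<lambda>n. S {- int n..int n} i) l" by (intro cauchy_imp_limit cs)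
    then show ?thesis unfolding adic_limit_iff_cg [OF cs] .
  qed
  then have "\<forall>i. \<exists>l. l \<in> carrier R \<and> (\<forall>N. \<exists>n0. \<forall>n\<ge>n0. cg N (S {- int n..int n} i) l)" ..
  from choice [OF this] obtain g where
    g: "\<forall>i. g i \<in> carrier R \<and> (\<forall>N. \<exists>n0. \<forall>n\<ge>n0. cg N (S {- int n..int n} i) (g i))" ..
  have gS: "cg N (g i) (S J i)"
    if J: "finite J" "J0 \<subseteq> J" "\<forall>i. i \<notin> J0 \<longrightarrow> lo N M (t i)" "i < M" for N M J J0 i
  proof -
    obtain n0 where n0: "\<forall>n\<ge>n0. J \<subseteq> {- int n..int n}" using int_sup [OF J(1)] ..
    obtain n1 where n1: "\<forall>n\<ge>n1. cg N (S {- int n..int n} i) (g i)" using g by blast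
    define n where "n = max n0 n1"
    have out: "\<forall>i. i \<notin> J \<longrightarrow> lo N M (t i)" using J by auto
    have "cg N (g i) (S {- int n..int n} i)" by (rule cg_sym) (use n1 in \<open>simp add: n_def\<close>)
    also have "cg N (S {- int n..int n} i) (S J i)"
      by (rule lsub [OF _ _ out J(4)]) (use n0 in \<open>auto simp: n_def\<close>)
    finally show ?thesis .
  qed
  have gA: "g \<in> carrier A"
  proof (rule AI)
    show "g i \<in> carrier R" for i using g by simp
    fix N
    obtain J0 where J0': "finite J0 \<and> (\<forall>k. k \<notin> J0 \<longrightarrow> lo N 0 (t k))" using small ..
    note J0 = conjunct1 [OF J0'] conjunct2 [OF J0']
    obtain M where M: "lo N M (S J0)" using A_lo [OF SA] ..
    have "lo N (min 0 M) g" unfolding lo_def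
    proof (intro allI impI)
      fix i assume i: "i < min 0 M"
      have "cg N (g i) (S J0 i)" by (rule gS [OF J0(1) subset_refl J0(2)]) (use i in simp)
      also have "cg N (S J0 i) \<zero>" by (rule loD [OF M]) (use i in simp)
      finally show "cg N (g i) \<zero>" .
    qed
    then show "\<exists>M. lo N M g" ..
  qed
  have "wsum t g"
  proof (rule wsumI [OF gA t])
    fix N M
    obtain J0 where J0': "finite J0 \<and> (\<forall>k. k \<notin> J0 \<longrightarrow> lo N M (t k))" using small ..
    note J0 = conjunct1 [OF J0'] conjunct2 [OF J0']
    have "lo N M (g \<ominus>\<^sub>A S J)" if "finite J" "J0 \<subseteq> J" for J
      unfolding A_minus [OF gA SA] lo_def
    proof (intro allI impI)
      fix i assume "i < M"
      then have "cg N (g i) (S J i)" by (rule gS [OF that J0(2)])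
      then show "cg N (g i \<ominus> S J i) \<zero>" using gA SA by (simp add: cg_diff_zero_iff)
    qed
    then show "\<exists>J0. finite J0 \<and> (\<forall>J. finite J \<and> J0 \<subseteq> J \<longrightarrow> lo N M (g \<ominus>\<^sub>A (\<Oplus>\<^bsub>A\<^esub>i\<in>J. t i)))"
      using J0(1) unfolding S_def by blast
  qed
  then show ?thesis by (rule exI [of _ g])
qed

lemma wsum_add:
  assumes g: "wsum t g" and h: "wsum s h"
  shows "wsum (\<lambda>i. t i \<oplus>\<^sub>A s i) (g \<oplus>\<^sub>A h)"
proof (rule wsumI)
  have c: "g \<in> carrier A" "h \<in> carrier A" "\<And>i. t i \<in> carrier A" "\<And>i. s i \<in> carrier A" using g h wsumD by auto
  then show "g \<oplus>\<^sub>A h \<in> carrier A" "\<And>i. t i \<oplus>\<^sub>A s i \<in> carrier A" by auto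
  fix N M
  obtain J0 where J0: "finite J0" "\<And>J. finite J \<Longrightarrow> J0 \<subseteq> J \<Longrightarrow> lo N M (g \<ominus>\<^sub>A (\<Oplus>\<^bsub>A\<^esub>i\<in>J. t i))"
    using wsum_ex [OF g, of N M] by blast
  obtain J1 where J1: "finite J1" "\<And>J. finite J \<Longrightarrow> J1 \<subseteq> J \<Longrightarrow> lo N M (h \<ominus>\<^sub>A (\<Oplus>\<^bsub>A\<^esub>i\<in>J. s i))"
    using wsum_ex [OF h, of N M] by blast
  have "lo N M (g \<oplus>\<^sub>A h \<ominus>\<^sub>A (\<Oplus>\<^bsub>A\<^esub>i\<in>J. t i \<oplus>\<^sub>A s i))" if "finite J" "J0 \<union> J1 \<subseteq> J" for J
  proof -
    have s: "(\<Oplus>\<^bsub>A\<^esub>i\<in>J. t i) \<in> carrier A" "(\<Oplus>\<^bsub>A\<^esub>i\<in>J. s i) \<in> carrier A" using c by (auto intro!: A.finsum_closed)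
    have "(\<Oplus>\<^bsub>A\<^esub>i\<in>J. t i \<oplus>\<^sub>A s i) = (\<Oplus>\<^bsub>A\<^esub>i\<in>J. t i) \<oplus>\<^sub>A (\<Oplus>\<^bsub>A\<^esub>i\<in>J. s i)" using c by (intro A.finsum_addf) auto
    then have "g \<oplus>\<^sub>A h \<ominus>\<^sub>A (\<Oplus>\<^bsub>A\<^esub>i\<in>J. t i \<oplus>\<^sub>A s i) =
      (g \<ominus>\<^sub>A (\<Oplus>\<^bsub>A\<^esub>i\<in>J. t i)) \<oplus>\<^sub>A (h \<ominus>\<^sub>A (\<Oplus>\<^bsub>A\<^esub>i\<in>J. s i))"
      using c s by (simp add: A.minus_eq A.minus_add A.a_ac)
    moreover have "lo N M ((g \<ominus>\<^sub>A (\<Oplus>\<^bsub>A\<^esub>i\<in>J. t i)) \<oplus>\<^sub>A (h \<ominus>\<^sub>A (\<Oplus>\<^bsub>A\<^esub>i\<in>J. s i)))"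
      using that J0 J1 by (intro lo_A_add) auto
    ultimately show ?thesis by simp
  qed
  then show "\<exists>J0. finite J0 \<and> (\<forall>J. finite J \<and> J0 \<subseteq> J \<longrightarrow> lo N M (g \<oplus>\<^sub>A h \<ominus>\<^sub>A (\<Oplus>\<^bsub>A\<^esub>i\<in>J. t i \<oplus>\<^sub>A s i)))"
    using J0(1) J1(1) by (intro exI [of _ "J0 \<union> J1"]) blast
qed

lemma wsum_mult:
  assumes g: "wsum t g" and h: "h \<in> carrier A"
  shows "wsum (\<lambda>i. h \<otimes>\<^sub>A t i) (h \<otimes>\<^sub>A g)"
proof (rule wsumI)
  have c: "g \<in> carrier A" "\<And>i. t i \<in> carrier A" using g wsumD by auto
  with h show "h \<otimes>\<^sub>A g \<in> carrier A" "\<And>i. h \<otimes>\<^sub>A t i \<in> carrier A" by auto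
  fix N M
  obtain K where K: "lo N K h" using A_lo [OF h] ..
  \<comment> \<open>Multiplication by h shifts the bound by K, hence the compensation by M -
    K.\<close>
  obtain J0 where J0: "finite J0" "\<And>J. finite J \<Longrightarrow> J0 \<subseteq> J \<Longrightarrow> lo N (M - K) (g \<ominus>\<^sub>A (\<Oplus>\<^bsub>A\<^esub>i\<in>J. t i))"
    using wsum_ex [OF g, of N "M - K"] by blast
  have "lo N M (h \<otimes>\<^sub>A g \<ominus>\<^sub>A (\<Oplus>\<^bsub>A\<^esub>i\<in>J. h \<otimes>\<^sub>A t i))" if "finite J" "J0 \<subseteq> J" for J
  proof -
    have s: "(\<Oplus>\<^bsub>A\<^esub>i\<in>J. t i) \<in> carrier A" using c by (auto intro!: A.finsum_closed)
    have "(\<Oplus>\<^bsub>A\<^esub>i\<in>J. h \<otimes>\<^sub>A t i) = h \<otimes>\<^sub>A (\<Oplus>\<^bsub>A\<^esub>i\<in>J. t i)"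
      using that c h by (intro A.finsum_rdistr [symmetric]) auto
    then have "h \<otimes>\<^sub>A g \<ominus>\<^sub>A (\<Oplus>\<^bsub>A\<^esub>i\<in>J. h \<otimes>\<^sub>A t i) = h \<otimes>\<^sub>A (g \<ominus>\<^sub>A (\<Oplus>\<^bsub>A\<^esub>i\<in>J. t i))"
      using c s h by (simp add: A.minus_eq A.r_distr A.r_minus)
    moreover have "lo N (K + (M - K)) (h \<otimes>\<^sub>A (g \<ominus>\<^sub>A (\<Oplus>\<^bsub>A\<^esub>i\<in>J. t i)))"
      using that J0 c s h K by (intro lo_mult) auto
    ultimately show ?thesis by simp
  qed
  then show "\<exists>J0. finite J0 \<and> (\<forall>J. finite J \<and> J0 \<subseteq> J \<longrightarrow> lo N M (h \<otimes>\<^sub>A g \<ominus>\<^sub>A (\<Oplus>\<^bsub>A\<^esub>i\<in>J. h \<otimes>\<^sub>A t i)))"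
    using J0(1) by blast
qed

lemma wsum_shift:
  assumes g: "wsum t g" shows "wsum (\<lambda>i. t (i - k)) g"
proof (rule wsumI)
  have c: "g \<in> carrier A" "\<And>i. t i \<in> carrier A" using g wsumD by auto
  then show "g \<in> carrier A" "\<And>i. t (i - k) \<in> carrier A" by auto
  fix N M
  obtain J0 where J0: "finite J0" "\<And>J. finite J \<Longrightarrow> J0 \<subseteq> J \<Longrightarrow> lo N M (g \<ominus>\<^sub>A (\<Oplus>\<^bsub>A\<^esub>i\<in>J. t i))"
    using wsum_ex [OF g, of N M] by blast
  have "lo N M (g \<ominus>\<^sub>A (\<Oplus>\<^bsub>A\<^esub>i\<in>J. t (i - k)))" if "finite J" "(\<lambda>i. i + k) ` J0 \<subseteq> J" for J
  proof -
    have "(\<Oplus>\<^bsub>A\<^esub>i\<in>(\<lambda>i. i - k) ` J. t i) = (\<Oplus>\<^bsub>A\<^esub>i\<in>J. t (i - k))"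
      using c by (intro A.finsum_reindex) (auto simp: inj_on_def)
    moreover have "J0 \<subseteq> (\<lambda>i. i - k) ` J"
    proof
      fix x assume "x \<in> J0"
      then have "x + k \<in> J" using that(2) by blast
      then show "x \<in> (\<lambda>i. i - k) ` J" by (intro image_eqI [of _ _ "x + k"]) auto
    qed
    ultimately show ?thesis using J0(2) [of "(\<lambda>i. i - k) ` J"] that(1) by simp
  qed
  then show "\<exists>J0. finite J0 \<and> (\<forall>J. finite J \<and> J0 \<subseteq> J \<longrightarrow> lo N M (g \<ominus>\<^sub>A (\<Oplus>\<^bsub>A\<^esub>i\<in>J. t (i - k))))"
    using J0(1) by (intro exI [of _ "(\<lambda>i. i + k) ` J0"]) blast
qed

lemma wsum_single:
  assumes c: "c \<in> carrier A" shows "wsum (\<lambda>i. if i = k then c else \<zero>\<^sub>A) c"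
proof (rule wsumI)
  show "c \<in> carrier A" "\<And>i. (if i = k then c else \<zero>\<^sub>A) \<in> carrier A" using c by auto
  have "lo N M (c \<ominus>\<^sub>A (\<Oplus>\<^bsub>A\<^esub>i\<in>J. if i = k then c else \<zero>\<^sub>A))" if "finite J" "{k} \<subseteq> J" for N M J
  proof -
    have "(\<Oplus>\<^bsub>A\<^esub>i\<in>J. if i = k then c else \<zero>\<^sub>A) = c"
      using that c by (intro A.add.finprod_singleton_swap) auto
    then show ?thesis using c by (simp add: A.minus_eq A.r_neg lo_A_zero)
  qed
  then show "\<exists>J0. finite J0 \<and> (\<forall>J. finite J \<and> J0 \<subseteq> J \<longrightarrow>
      lo N M (c \<ominus>\<^sub>A (\<Oplus>\<^bsub>A\<^esub>i\<in>J. if i = k then c else \<zero>\<^sub>A)))" for N M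
    by (intro exI [of _ "{k}"]) blast
qed

lemma wsum_monomials:
  assumes f: "f \<in> carrier A" shows "wsum (\<lambda>i. mon (f i) i) f"
proof (rule wsumI)
  show "f \<in> carrier A" "\<And>i. mon (f i) i \<in> carrier A" using f by auto
  fix N M
  obtain a where a: "lo N a f" using A_lo [OF f] ..
  have "lo N M (f \<ominus>\<^sub>A (\<Oplus>\<^bsub>A\<^esub>i\<in>J. mon (f i) i))" if J: "finite J" "{a..M} \<subseteq> J" for J
    unfolding lo_def
  proof (intro allI impI)
    fix i assume i: "i < M"
    have s: "(\<Oplus>\<^bsub>A\<^esub>i\<in>J. mon (f i) i) \<in> carrier A" using f by (auto intro!: A.finsum_closed)
    have "(\<Oplus>\<^bsub>A\<^esub>i\<in>J. mon (f i) i) i = (\<Oplus>k\<in>J. mon (f k) k i)" using f J by (intro A_finsum) auto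
    also have "\<dots> = (\<Oplus>k\<in>J. if k = i then f i else \<zero>)" using f by (intro finsum_cong') (auto simp: mon_def)
    finally have si: "(\<Oplus>\<^bsub>A\<^esub>i\<in>J. mon (f i) i) i = \<dots>" .
    show "cg N ((f \<ominus>\<^sub>A (\<Oplus>\<^bsub>A\<^esub>i\<in>J. mon (f i) i)) i) \<zero>"
    proof (cases "i \<in> J")
      case True
      have "(\<Oplus>k\<in>J. if k = i then f i else \<zero>) = f i" using True J f by (intro add.finprod_singleton_swap) auto
      then show ?thesis unfolding A_minus [OF f s] si using f by (simp add: minus_eq r_neg)
    next
      case False
      have "(\<Oplus>k\<in>J. if k = i then f i else \<zero>) = (\<Oplus>k\<in>J. \<zero>)" using False by (intro finsum_cong') auto
      then have z: "(\<Oplus>k\<in>J. if k = i then f i else \<zero>) = \<zero>" by simp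
      have "i \<notin> {a..M}" using False J(2) by blast
      then have "i < a" using i by simp
      then show ?thesis unfolding A_minus [OF f s] si z using f loD [OF a] by (simp add: minus_eq)
    qed
  qed
  then show "\<exists>J0. finite J0 \<and> (\<forall>J. finite J \<and> J0 \<subseteq> J \<longrightarrow> lo N M (f \<ominus>\<^sub>A (\<Oplus>\<^bsub>A\<^esub>i\<in>J. mon (f i) i)))"
    by (intro exI [of _ "{a..M}"]) blast
qed

end

text \<open>Substitution of a series T of residual order r for the variable. The case r = 1 is a
  change of parameter. The case r = p describes the cover: A is then generated by p elements over
  the image.\<close>

locale laurent_subst = complete_dvr_char R \<pi> p for R :: "'r ring" (structure) and \<pi> p +
  fixes T :: "int \<Rightarrow> 'r" and r :: int
  assumes T: "wt T r" and r: "1 \<le> r"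
begin

lemma T_unit: "T \<in> Units A" and T_A [simp]: "T \<in> carrier A"
  using wt_unit [OF T] wtD(1) [OF T] .

lemma T_pow_A [simp]: "T [^]\<^sub>A (i::int) \<in> carrier A"
  using A.unit_int_pow_closed [OF T_unit] by blast

lemma T_pow_nat: "0 \<le> i \<Longrightarrow> T [^]\<^sub>A (i::int) = T [^]\<^sub>A nat i"
  unfolding int_pow_def2 by (rule if_not_P) linarith

text \<open>Write f = x + \<pi>^(N+1) y with x supported in exponents at least 1. By additivity of
  Frobenius f^p = x^p + \<pi>^((N+1)p) y^p, and (N+1)p is at least N + 2: one digit of precision is
  gained.\<close>

lemma lo_frob:
  assumes f: "f \<in> carrier A" and lo: "lo (Suc N) 1 f" shows "lo (Suc (Suc N)) 1 (f [^]\<^sub>A p)"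
proof -
  obtain x y where xy: "x \<in> carrier A" "y \<in> carrier A" "\<forall>i<1. x i = \<zero>"
    "f = x \<oplus>\<^sub>A mon \<pi> 0 [^]\<^sub>A Suc N \<otimes>\<^sub>A y"
    using lo_decomp [OF f lo] by blast
  define z where "z = mon \<pi> 0 [^]\<^sub>A Suc N \<otimes>\<^sub>A y"
  have zA: "z \<in> carrier A" using xy by (simp add: z_def)
  have "A.cg (Suc N) z \<zero>\<^sub>A" unfolding A.cg_zero_iff z_def using xy(2) by blast
  then have "A.cg (Suc N * p) (z [^]\<^sub>A p) \<zero>\<^sub>A" by (rule A.cg_zero_pow)
  moreover have "Suc (Suc N) \<le> Suc N * p"
  proof -
    have "Suc N * 2 \<le> Suc N * p" using p_gt_1 by (intro mult_le_mono2) simp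
    then show ?thesis by simp
  qed
  ultimately have "A.cg (Suc (Suc N)) (z [^]\<^sub>A p) \<zero>\<^sub>A" by (rule A.cg_mono)
  then have lz: "lo (Suc (Suc N)) 1 (z [^]\<^sub>A p)" by (rule A_cg_zero_lo)
  have "lo (Suc (Suc N)) 1 x" using xy(3) by (simp add: lo_def)
  then have "lo (Suc (Suc N)) (int p * 1) (x [^]\<^sub>A p)" using xy(1) by (intro lo_pow)
  then have "lo (Suc (Suc N)) 1 (x [^]\<^sub>A p)" using p_gt_1 by (rule_tac lo_mono) auto
  with lz have "lo (Suc (Suc N)) 1 (x [^]\<^sub>A p \<oplus>\<^sub>A z [^]\<^sub>A p)" by (intro lo_A_add)
  then show ?thesis unfolding xy(4) z_def [symmetric] A.frob_add [OF xy(1) zA] .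
qed

lemma lo_T_frob: "lo (Suc N) 1 (T [^]\<^sub>A (p ^ N))"
proof (induction N)
  case 0
  show ?case using lo_mono [OF wtD(2) [OF T] r] by simp
next
  case (Suc N)
  have "lo (Suc (Suc N)) 1 ((T [^]\<^sub>A (p ^ N)) [^]\<^sub>A p)" by (rule lo_frob [OF _ Suc]) simp
  then show ?case by (simp add: A.nat_pow_pow mult.commute)
qed

text \<open>Modulo \<pi>^N the power T^q with q = p^N has exponents at least 1 only. Dividing i by q
  writes T^i as a high power of T^q times one of finitely many remainders, so its exponents grow
  with i.\<close>

lemma lo_T_pow_eventually: "\<exists>I. \<forall>i\<ge>I. lo N M (T [^]\<^sub>A (i::nat))"
proof -
  define q where "q = p ^ N"
  have q: "0 < q" using p_gt_1 by (simp add: q_def)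
  have lq: "lo N 1 (T [^]\<^sub>A q)" unfolding q_def by (rule lo_mono_exp [OF lo_T_frob]) simp
  have "\<forall>s. \<exists>K. lo N K (T [^]\<^sub>A (s::nat))" by (intro allI A_lo) simp
  from choice [OF this] obtain K where K: "\<forall>s. lo N (K s) (T [^]\<^sub>A (s::nat))" ..
  \<comment> \<open>The number -k bounds the exponents of all remainders T^s with s < q from below,
    modulo \<pi>^N.\<close>
  define k where "k = (\<Sum>s<q. \<bar>K s\<bar>)"
  have k: "lo N (- k) (T [^]\<^sub>A s)" if "s < q" for s
  proof -
    have "\<bar>K s\<bar> \<le> k" unfolding k_def using that by (intro member_le_sum) auto
    then have "- k \<le> K s" by linarith
    with K show ?thesis using lo_mono by blast
  qed
  have "lo N M (T [^]\<^sub>A i)" if i: "i \<ge> q * nat (M + k)" for i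
  proof -
    have j: "nat (M + k) \<le> i div q" using i q by (simp add: less_eq_div_iff_mult_less_eq mult.commute)
    have "T [^]\<^sub>A i = (T [^]\<^sub>A q) [^]\<^sub>A (i div q) \<otimes>\<^sub>A T [^]\<^sub>A (i mod q)"
      by (simp add: A.nat_pow_pow A.nat_pow_mult)
    moreover have "lo N (int (i div q) * 1 + - k) ((T [^]\<^sub>A q) [^]\<^sub>A (i div q) \<otimes>\<^sub>A T [^]\<^sub>A (i mod q))"
      using lq k q by (intro lo_mult lo_pow) auto
    ultimately have "lo N (int (i div q) - k) (T [^]\<^sub>A i)" by simp
    then show ?thesis by (rule lo_mono) (use j in linarith)
  qed
  then show ?thesis by blast
qed

text \<open>The terms of the series f(T), whose sum in the sense of \<open>wsum\<close> will be
  \<open>lsub f\<close>.\<close>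

definition trm :: "(int \<Rightarrow> 'r) \<Rightarrow> int \<Rightarrow> int \<Rightarrow> 'r"
  where "trm f i = mon (f i) 0 \<otimes>\<^sub>A T [^]\<^sub>A i"

lemma trm_A [simp]: "f \<in> carrier A \<Longrightarrow> trm f i \<in> carrier A"
  by (simp add: trm_def)

lemma trm_small_exp: "f \<in> carrier A \<Longrightarrow> cg N (f i) \<zero> \<Longrightarrow> lo N M (trm f i)"
proof -
  assume f: "f \<in> carrier A" and c: "cg N (f i) \<zero>"
  have "cg N (f i \<otimes> (T [^]\<^sub>A i) n) (\<zero> \<otimes> (T [^]\<^sub>A i) n)" for n
    by (rule cg_mult [OF c cg_refl]) (rule A_coeff [OF T_pow_A])
  then show ?thesis using f A_coeff [OF T_pow_A] unfolding trm_def lo_def by (simp add: mon_mult)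
qed

lemma lo_mon_mult: "a \<in> carrier R \<Longrightarrow> g \<in> carrier A \<Longrightarrow> lo N M g \<Longrightarrow> lo N M (mon a 0 \<otimes>\<^sub>A g)"
  using lo_mult [of "mon a 0" g N 0 M] lo_mon [of a N 0] by simp

text \<open>For very negative i the coefficient of f is divisible by \<pi>^N; for large i the power
  of T is small by \<open>lo_T_pow_eventually\<close>. Only finitely many i remain.\<close>

lemma trm_small: 
  assumes f: "f \<in> carrier A" shows "\<exists>J0. finite J0 \<and> (\<forall>i. i \<notin> J0 \<longrightarrow> lo N M (trm f i))"
proof -
  obtain a where a: "lo N a f" using A_lo [OF f] ..
  obtain I where I: "\<forall>i\<ge>I. lo N M (T [^]\<^sub>A (i::nat))" using lo_T_pow_eventually ..
  have "lo N M (trm f i)" if "i \<notin> {a..int I}" for i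
  proof (cases "i < a")
    case True
    then show ?thesis using f loD [OF a] by (intro trm_small_exp) auto
  next
    case False
    then have i: "int I < i" using that by auto
    then have "T [^]\<^sub>A i = T [^]\<^sub>A nat i" by (intro T_pow_nat) linarith
    moreover have "lo N M (T [^]\<^sub>A nat i)" by (rule I [rule_format]) (use i in linarith)
    ultimately show ?thesis unfolding trm_def using f by (intro lo_mon_mult) auto
  qed
  then show ?thesis by (intro exI [of _ "{a..int I}"]) auto
qed

definition lsub :: "(int \<Rightarrow> 'r) \<Rightarrow> int \<Rightarrow> 'r"
  where "lsub f = (THE g. wsum (trm f) g)"

lemma lsub_wsum: assumes f: "f \<in> carrier A" shows "wsum (trm f) (lsub f)"
proof -
  have "\<exists>g. wsum (trm f) g" by (rule wsum_exists [OF trm_A [OF f] trm_small [OF f]])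
  then have "\<exists>!g. wsum (trm f) g" using wsum_unique by blast
  then show ?thesis unfolding lsub_def by (rule theI')
qed

lemma sub_A [simp]: "f \<in> carrier A \<Longrightarrow> lsub f \<in> carrier A"
  using wsumD(1) [OF lsub_wsum] .

lemma lsub_eqI: "f \<in> carrier A \<Longrightarrow> wsum (trm f) g \<Longrightarrow> lsub f = g"
  using wsum_unique [OF lsub_wsum] .

lemma lsub_add:
  assumes f: "f \<in> carrier A" and g: "g \<in> carrier A" shows "lsub (f \<oplus>\<^sub>A g) = lsub f \<oplus>\<^sub>A lsub g"
proof (rule lsub_eqI)
  have "trm (f \<oplus>\<^sub>A g) i = trm f i \<oplus>\<^sub>A trm g i" for i
  proof -
    have "mon ((f \<oplus>\<^sub>A g) i) 0 = mon (f i) 0 \<oplus>\<^sub>A mon (g i) 0"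
      using f g by (subst mon_add) (auto simp: A_add)
    then show ?thesis unfolding trm_def using f g by (simp add: A.l_distr)
  qed
  then have "trm (f \<oplus>\<^sub>A g) = (\<lambda>i. trm f i \<oplus>\<^sub>A trm g i)" by (rule ext)
  then show "wsum (trm (f \<oplus>\<^sub>A g)) (lsub f \<oplus>\<^sub>A lsub g)"
    using wsum_add [OF lsub_wsum [OF f] lsub_wsum [OF g]] by (rule wsum_eqI)
qed (use f g in simp)

text \<open>A shift of the summation index by k matches the factor T^k. This is multiplicativity for
  monomials, from which \<open>lsub_mult\<close> is deduced.\<close>

lemma lsub_mon_mult:
  assumes a: "a \<in> carrier R" and f: "f \<in> carrier A"
  shows "lsub (mon a k \<otimes>\<^sub>A f) = (mon a 0 \<otimes>\<^sub>A T [^]\<^sub>A k) \<otimes>\<^sub>A lsub f"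
proof (rule lsub_eqI)
  have "trm (mon a k \<otimes>\<^sub>A f) i = (mon a 0 \<otimes>\<^sub>A T [^]\<^sub>A k) \<otimes>\<^sub>A trm f (i - k)" for i
  proof -
    have "mon a 0 \<otimes>\<^sub>A mon (f (i - k)) 0 = mon (a \<otimes> f (i - k)) (0 + 0)" using a f by (intro mon_mon) auto
    then have "trm (mon a k \<otimes>\<^sub>A f) i = (mon a 0 \<otimes>\<^sub>A mon (f (i - k)) 0) \<otimes>\<^sub>A T [^]\<^sub>A (k + (i - k))"
      unfolding trm_def mon_mult [OF a f] by simp
    also have "T [^]\<^sub>A (k + (i - k)) = T [^]\<^sub>A k \<otimes>\<^sub>A T [^]\<^sub>A (i - k)"
      by (rule A.unit_int_pow_add [OF T_unit])
    finally show ?thesis unfolding trm_def using a f by (simp add: A.m_ac)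
  qed
  then have "trm (mon a k \<otimes>\<^sub>A f) = (\<lambda>i. (mon a 0 \<otimes>\<^sub>A T [^]\<^sub>A k) \<otimes>\<^sub>A trm f (i - k))" by (rule ext)
  moreover have "wsum (\<lambda>i. (mon a 0 \<otimes>\<^sub>A T [^]\<^sub>A k) \<otimes>\<^sub>A trm f (i - k)) ((mon a 0 \<otimes>\<^sub>A T [^]\<^sub>A k) \<otimes>\<^sub>A lsub f)"
    using a f by (intro wsum_mult wsum_shift lsub_wsum) auto
  ultimately show "wsum (trm (mon a k \<otimes>\<^sub>A f)) ((mon a 0 \<otimes>\<^sub>A T [^]\<^sub>A k) \<otimes>\<^sub>A lsub f)" by (rule wsum_eqI)
qed (use a f in simp)

lemma lsub_mon: "a \<in> carrier R \<Longrightarrow> lsub (mon a k) = mon a 0 \<otimes>\<^sub>A T [^]\<^sub>A k"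
proof (rule lsub_eqI)
  assume a: "a \<in> carrier R"
  have "trm (mon a k) = (\<lambda>i. if i = k then mon a 0 \<otimes>\<^sub>A T [^]\<^sub>A k else \<zero>\<^sub>A)"
  proof
    fix i
    have "mon (mon a k i) 0 = (if i = k then mon a 0 else \<zero>\<^sub>A)" by (simp add: mon_def A_zero)
    then show "trm (mon a k) i = (if i = k then mon a 0 \<otimes>\<^sub>A T [^]\<^sub>A k else \<zero>\<^sub>A)"
      unfolding trm_def by simp
  qed
  moreover have "wsum (\<lambda>i. if i = k then mon a 0 \<otimes>\<^sub>A T [^]\<^sub>A k else \<zero>\<^sub>A) (mon a 0 \<otimes>\<^sub>A T [^]\<^sub>A k)"
    using a by (intro wsum_single) auto
  ultimately show "wsum (trm (mon a k)) (mon a 0 \<otimes>\<^sub>A T [^]\<^sub>A k)" by (rule wsum_eqI)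
qed simp

lemma lsub_const: "a \<in> carrier R \<Longrightarrow> lsub (mon a 0) = mon a 0"
  by (simp add: lsub_mon int_pow_def2)

lemma lsub_one: "lsub \<one>\<^sub>A = \<one>\<^sub>A"
  unfolding A_one_mon by (rule lsub_const) simp

lemma lsub_const_mult:
  "a \<in> carrier R \<Longrightarrow> f \<in> carrier A \<Longrightarrow> lsub (mon a 0 \<otimes>\<^sub>A f) = mon a 0 \<otimes>\<^sub>A lsub f"
  by (simp add: lsub_mon_mult int_pow_def2)

lemma lsub_zero: "lsub \<zero>\<^sub>A = \<zero>\<^sub>A"
  using lsub_const [of \<zero>] by (simp add: mon_zero)

lemma lsub_diff:
  assumes f: "f \<in> carrier A" and g: "g \<in> carrier A" shows "lsub (f \<ominus>\<^sub>A g) = lsub f \<ominus>\<^sub>A lsub g"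
proof -
  have "f = g \<oplus>\<^sub>A (f \<ominus>\<^sub>A g)" by (rule A.eq_add_if_minus_eq [OF refl f g])
  then have "lsub f = lsub g \<oplus>\<^sub>A lsub (f \<ominus>\<^sub>A g)" using lsub_add [OF g, of "f \<ominus>\<^sub>A g"] f g by simp
  then show ?thesis using f g by (simp add: A.minus_eq A.a_comm [of _ "\<ominus>\<^sub>A _"] A.r_neg1)
qed

lemma lsub_finsum:
  assumes "finite J" "\<And>i. i \<in> J \<Longrightarrow> t i \<in> carrier A"
  shows "lsub (\<Oplus>\<^bsub>A\<^esub>i\<in>J. t i) = (\<Oplus>\<^bsub>A\<^esub>i\<in>J. lsub (t i))"
  using assms
proof (induction J rule: finite_induct)
  case (insert i J)
  then have "t \<in> J \<rightarrow> carrier A" "(\<lambda>i. lsub (t i)) \<in> J \<rightarrow> carrier A" by auto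
  with insert show ?case by (simp add: lsub_add)
qed (simp add: lsub_zero)

lemma lo_sub:
  assumes f: "f \<in> carrier A" and t: "\<And>i. lo N M (trm f i)" shows "lo N M (lsub f)"
proof -
  obtain J0 where J0: "finite J0" "\<And>J. finite J \<Longrightarrow> J0 \<subseteq> J \<Longrightarrow> lo N M (lsub f \<ominus>\<^sub>A (\<Oplus>\<^bsub>A\<^esub>i\<in>J. trm f i))"
    using wsum_ex [OF lsub_wsum [OF f], of N M] by blast
  define s where "s = (\<Oplus>\<^bsub>A\<^esub>i\<in>J0. trm f i)"
  have sA: "s \<in> carrier A" unfolding s_def using f by (auto intro!: A.finsum_closed)
  have "lo N M s" unfolding s_def using f t J0(1) by (intro lo_A_finsum) auto
  moreover have "lo N M (lsub f \<ominus>\<^sub>A s)" unfolding s_def by (rule J0(2) [OF J0(1)]) simp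
  ultimately have "lo N M (s \<oplus>\<^sub>A (lsub f \<ominus>\<^sub>A s))" by (rule lo_A_add)
  moreover have "lsub f = s \<oplus>\<^sub>A (lsub f \<ominus>\<^sub>A s)" by (rule A.eq_add_if_minus_eq [OF refl]) (use f sA in auto)
  ultimately show ?thesis by simp
qed

text \<open>Up to a multiple of \<pi>^N, which substitution preserves, f is supported in exponents
  at least I, and there the powers of T are already small.\<close>

lemma lsub_continuous: "\<exists>M'. \<forall>f\<in>carrier A. lo N M' f \<longrightarrow> lo N M (lsub f)"
proof -
  obtain I where I: "\<forall>i\<ge>I. lo N M (T [^]\<^sub>A (i::nat))" using lo_T_pow_eventually ..
  have "lo N M (lsub f)" if f: "f \<in> carrier A" and lo: "lo N (int I) f" for f
  proof -
    obtain x y where xy: "x \<in> carrier A" "y \<in> carrier A" "\<forall>i<int I. x i = \<zero>"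
      "f = x \<oplus>\<^sub>A mon \<pi> 0 [^]\<^sub>A N \<otimes>\<^sub>A y" using lo_decomp [OF f lo] by blast
    have "lo N M (trm x i)" for i
    proof (cases "i < int I")
      case True
      then show ?thesis using xy by (intro trm_small_exp) auto
    next
      case False
      then have "T [^]\<^sub>A i = T [^]\<^sub>A nat i" by (intro T_pow_nat) linarith
      moreover have "lo N M (T [^]\<^sub>A nat i)" by (rule I [rule_format]) (use False in linarith)
      ultimately show ?thesis unfolding trm_def using xy by (intro lo_mon_mult) auto
    qed
    then have "lo N M (lsub x)" by (rule lo_sub [OF xy(1)])
    moreover have "lo N M (mon \<pi> 0 [^]\<^sub>A N \<otimes>\<^sub>A lsub y)"
    proof (rule A_cg_zero_lo)
      show "A.cg N (mon \<pi> 0 [^]\<^sub>A N \<otimes>\<^sub>A lsub y) \<zero>\<^sub>A"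
        unfolding A.cg_zero_iff using sub_A [OF xy(2)] by blast
    qed
    ultimately have "lo N M (lsub x \<oplus>\<^sub>A mon \<pi> 0 [^]\<^sub>A N \<otimes>\<^sub>A lsub y)" by (rule lo_A_add)
    then show ?thesis unfolding xy(4) A_u_pow using xy(1,2) by (simp add: lsub_add lsub_const_mult)
  qed
  then show ?thesis by blast
qed

lemma lsub_wsum_comp: assumes g: "wsum t g" shows "wsum (\<lambda>i. lsub (t i)) (lsub g)"
proof (rule wsumI)
  have c: "g \<in> carrier A" "\<And>i. t i \<in> carrier A" using g wsumD by auto
  then show "lsub g \<in> carrier A" "\<And>i. lsub (t i) \<in> carrier A" by auto
  fix N M
  obtain M' where M': "\<forall>f\<in>carrier A. lo N M' f \<longrightarrow> lo N M (lsub f)" using lsub_continuous ..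
  obtain J0 where J0: "finite J0" "\<And>J. finite J \<Longrightarrow> J0 \<subseteq> J \<Longrightarrow> lo N M' (g \<ominus>\<^sub>A (\<Oplus>\<^bsub>A\<^esub>i\<in>J. t i))"
    using wsum_ex [OF g, of N M'] by blast
  have "lo N M (lsub g \<ominus>\<^sub>A (\<Oplus>\<^bsub>A\<^esub>i\<in>J. lsub (t i)))" if J: "finite J" "J0 \<subseteq> J" for J
  proof -
    have s: "(\<Oplus>\<^bsub>A\<^esub>i\<in>J. t i) \<in> carrier A" using c by (auto intro!: A.finsum_closed)
    have "lo N M (lsub (g \<ominus>\<^sub>A (\<Oplus>\<^bsub>A\<^esub>i\<in>J. t i)))" using M' J0(2) [OF J] c(1) s by simp
    then show ?thesis using c s J(1) by (simp add: lsub_diff lsub_finsum)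
  qed
  then show "\<exists>J0. finite J0 \<and> (\<forall>J. finite J \<and> J0 \<subseteq> J \<longrightarrow> lo N M (lsub g \<ominus>\<^sub>A (\<Oplus>\<^bsub>A\<^esub>i\<in>J. lsub (t i))))"
    using J0(1) by blast
qed

text \<open>Expand f into monomials, so that f g is the sum of the series g * (f_i T^i). By
  continuity substitution may be applied to each of them, where it is multiplicative, and sums are
  unique.\<close>

lemma lsub_mult:
  assumes f: "f \<in> carrier A" and g: "g \<in> carrier A"
  shows "lsub (f \<otimes>\<^sub>A g) = lsub f \<otimes>\<^sub>A lsub g"
proof -
  have "wsum (\<lambda>i. g \<otimes>\<^sub>A mon (f i) i) (g \<otimes>\<^sub>A f)" by (rule wsum_mult [OF wsum_monomials [OF f] g])
  then have 1: "wsum (\<lambda>i. lsub (g \<otimes>\<^sub>A mon (f i) i)) (lsub (g \<otimes>\<^sub>A f))" by (rule lsub_wsum_comp)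
  have 2: "wsum (\<lambda>i. lsub g \<otimes>\<^sub>A trm f i) (lsub g \<otimes>\<^sub>A lsub f)"
    by (rule wsum_mult [OF lsub_wsum [OF f] sub_A [OF g]])
  have "lsub (g \<otimes>\<^sub>A mon (f i) i) = lsub g \<otimes>\<^sub>A trm f i" for i
  proof -
    have "lsub (g \<otimes>\<^sub>A mon (f i) i) = lsub (mon (f i) i \<otimes>\<^sub>A g)" using f g by (simp add: A.m_comm)
    also have "\<dots> = trm f i \<otimes>\<^sub>A lsub g" unfolding trm_def using f g by (intro lsub_mon_mult) auto
    finally show ?thesis using f g by (simp add: A.m_comm)
  qed
  then have "(\<lambda>i. lsub (g \<otimes>\<^sub>A mon (f i) i)) = (\<lambda>i. lsub g \<otimes>\<^sub>A trm f i)" by (rule ext)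
  from wsum_eqI [OF this [symmetric] 1] have "wsum (\<lambda>i. lsub g \<otimes>\<^sub>A trm f i) (lsub (g \<otimes>\<^sub>A f))" .
  then have "lsub (g \<otimes>\<^sub>A f) = lsub g \<otimes>\<^sub>A lsub f" using 2 by (rule wsum_unique)
  then show ?thesis using f g by (simp add: A.m_comm)
qed

lemma lsub_hom: "lsub \<in> ring_hom A A"
  by (rule ring_hom_memI) (simp_all add: lsub_mult lsub_add lsub_one)

lemma lsub_var: "lsub (mon \<one> 1) = T"
  using lsub_mon [of \<one> 1] A.unit_int_pow_1 [OF T_unit] by (simp flip: A_one_mon)

lemma lo_sub_PS: assumes g: "g \<in> PS" shows "lo 1 0 (lsub g)"
proof (rule lo_sub [OF PS_A [OF g]])
  fix i
  show "lo 1 0 (trm g i)"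
  proof (cases "i < 0")
    case True
    then show ?thesis using PS_A [OF g] PS_neg [OF g] by (intro trm_small_exp) auto
  next
    case False
    then have "T [^]\<^sub>A i = T [^]\<^sub>A nat i" by (intro T_pow_nat) linarith
    moreover have "lo 1 0 (T [^]\<^sub>A nat i)"
      by (rule lo_mono [OF wtD(2) [OF wt_pow [OF T]]]) (use r in simp)
    ultimately show ?thesis unfolding trm_def using PS_A [OF g] by (intro lo_mon_mult) auto
  qed
qed

text \<open>A nonzero f is a power of \<pi> times a unit. Substitution fixes \<pi> and preserves
  units, so the image would make a power of \<pi> vanish.\<close>

lemma lsub_eq_zero_iff: assumes f: "f \<in> carrier A" "lsub f = \<zero>\<^sub>A" shows "f = \<zero>\<^sub>A"
proof (rule ccontr)
  assume "f \<noteq> \<zero>\<^sub>A"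
  then obtain n e where e: "e \<in> Units A" "f = mon \<pi> 0 [^]\<^sub>A (n::nat) \<otimes>\<^sub>A e"
    using A_nonzero_decomp [OF f(1)] by blast
  have eA: "e \<in> carrier A" using e by blast
  have "lsub e \<otimes>\<^sub>A lsub (inv\<^bsub>A\<^esub> e) = \<one>\<^sub>A" using e eA by (simp flip: lsub_mult add: lsub_one)
  moreover have "mon (\<pi> [^] n) 0 \<otimes>\<^sub>A lsub e = \<zero>\<^sub>A"
    using f(2) eA unfolding e(2) A_u_pow by (simp add: lsub_const_mult)
  ultimately have "mon (\<pi> [^] n) 0 \<otimes>\<^sub>A \<one>\<^sub>A = \<zero>\<^sub>A \<otimes>\<^sub>A lsub (inv\<^bsub>A\<^esub> e)"
    using eA e(1) by (metis A.Units_inv_closed A.m_assoc mon_closed nat_pow_closed sub_A u)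
  then have "mon (\<pi> [^] n) 0 0 = \<zero>\<^sub>A 0" using e(1) by simp
  then show False by (simp add: mon_def A_zero)
qed

end

section \<open>Algebras given by an equation\<close>

definition eqn_poly :: "'a ring \<Rightarrow> nat \<Rightarrow> 'a \<Rightarrow> 'a \<Rightarrow> nat \<Rightarrow> 'a"
  where "eqn_poly A p c u = up_ring.monom (UP A) \<one>\<^bsub>A\<^esub> p \<ominus>\<^bsub>UP A\<^esub> up_ring.monom (UP A) c 1
    \<ominus>\<^bsub>UP A\<^esub> up_ring.monom (UP A) u 0"

lemma given_by_equation_iff:
  "given_by_equation A B \<beta> p c u x \<longleftrightarrow> x \<in> carrier B \<and>
    UnivPoly.eval A B \<beta> x ` carrier (UP A) = carrier B \<and>
    a_kernel (UP A) B (UnivPoly.eval A B \<beta> x) = PIdl\<^bsub>UP A\<^esub> (eqn_poly A p c u)"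
  by (simp add: given_by_equation_def eqn_poly_def)

locale alg = A?: cring A + B: cring B for A :: "'a ring" (structure) and B :: "'b ring" and \<beta> +
  assumes \<beta>: "\<beta> \<in> ring_hom A B"
begin

abbreviation ev where "ev \<equiv> UnivPoly.eval A B \<beta>"

sublocale U: UP_pre_univ_prop A B \<beta> "UP A"
  by (rule UP_pre_univ_propI) (rule A.is_cring, rule B.is_cring, rule \<beta>)

sublocale \<beta>: ring_hom_cring A B \<beta>
  by (rule ring_hom_cringI) (rule A.is_cring, rule B.is_cring, rule \<beta>)

lemma algebra_over: "algebra_over A B \<beta>"
  using B.is_cring \<beta> by (simp add: algebra_over_def)

lemma eval_hom: "x \<in> carrier B \<Longrightarrow> ring_hom_cring (UP A) B (ev x)"
  by (rule ring_hom_cringI [OF U.UP_cring B.is_cring U.eval_ring_hom])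

lemma eval_upto:
  assumes f: "f \<in> carrier (UP A)" and x: "x \<in> carrier B"
    and z: "\<And>i. n \<le> i \<Longrightarrow> up_ring.coeff (UP A) f i = \<zero>"
  shows "ev x f = (\<Oplus>\<^bsub>B\<^esub>i\<in>{..<n}. \<beta> (up_ring.coeff (UP A) f i) \<otimes>\<^bsub>B\<^esub> x [^]\<^bsub>B\<^esub> i)"
proof -
  let ?t = "\<lambda>i. \<beta> (up_ring.coeff (UP A) f i) \<otimes>\<^bsub>B\<^esub> x [^]\<^bsub>B\<^esub> i"
  have t: "?t i \<in> carrier B" for i using f x by simp
  have "ev x f = (\<Oplus>\<^bsub>B\<^esub>i\<in>{..deg A f}. ?t i)" by (rule U.eval_on_carrier [OF f])
  also have "\<dots> = (\<Oplus>\<^bsub>B\<^esub>i\<in>{..deg A f} \<union> {..<n}. ?t i)"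
    using t x U.deg_aboveD [OF _ f] by (intro B.add.finprod_mono_neutral_cong_left) auto
  also have "\<dots> = (\<Oplus>\<^bsub>B\<^esub>i\<in>{..<n}. ?t i)"
    using t x z by (intro B.add.finprod_mono_neutral_cong_left [symmetric]) auto
  finally show ?thesis .
qed

definition pol :: "nat \<Rightarrow> (nat \<Rightarrow> 'a) \<Rightarrow> nat \<Rightarrow> 'a"
  where "pol n a = (\<lambda>i. if i < n then a i else \<zero>)"

lemma pol:
  assumes "\<And>i. i < n \<Longrightarrow> a i \<in> carrier A"
  shows "pol n a \<in> carrier (UP A)" "up_ring.coeff (UP A) (pol n a) i = pol n a i"
proof -
  have "pol n a \<in> up A"
  proof (rule mem_upI)
    show "pol n a k \<in> carrier A" for k using assms by (simp add: pol_def)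
    have "bound \<zero> n (pol n a)" by (rule bound.intro) (simp add: pol_def)
    then show "\<exists>m. bound \<zero> m (pol n a)" ..
  qed
  then show "pol n a \<in> carrier (UP A)" "up_ring.coeff (UP A) (pol n a) i = pol n a i"
    unfolding UP_def by (simp_all only: partial_object.simps up_ring.simps restrict_apply if_True eta_contract_eq)
qed

lemma eval_pol:
  assumes a: "\<And>i. i < n \<Longrightarrow> a i \<in> carrier A" and x: "x \<in> carrier B"
  shows "ev x (pol n a) = (\<Oplus>\<^bsub>B\<^esub>i\<in>{..<n}. \<beta> (a i) \<otimes>\<^bsub>B\<^esub> x [^]\<^bsub>B\<^esub> i)"
proof -
  have cf: "up_ring.coeff (UP A) (pol n a) i = (if i < n then a i else \<zero>)" for i
    using pol(2) [where n = n and a = a and i = i, OF a] by (simp only: pol_def)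
  have "ev x (pol n a) = (\<Oplus>\<^bsub>B\<^esub>i\<in>{..<n}. \<beta> (up_ring.coeff (UP A) (pol n a) i) \<otimes>\<^bsub>B\<^esub> x [^]\<^bsub>B\<^esub> i)"
    using pol(1) [where n = n and a = a, OF a] x by (intro eval_upto) (simp_all add: cf)
  also have "\<dots> = (\<Oplus>\<^bsub>B\<^esub>i\<in>{..<n}. \<beta> (a i) \<otimes>\<^bsub>B\<^esub> x [^]\<^bsub>B\<^esub> i)"
    using a x by (intro B.finsum_cong') (auto simp: cf)
  finally show ?thesis .
qed

lemma eqn_poly_closed:
  "c \<in> carrier A \<Longrightarrow> u \<in> carrier A \<Longrightarrow> eqn_poly A p c u \<in> carrier (UP A)"
  by (simp add: eqn_poly_def)

lemma eval_eqn_poly: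
  assumes c: "c \<in> carrier A" and u: "u \<in> carrier A" and x: "x \<in> carrier B"
  shows "ev x (eqn_poly A p c u) = x [^]\<^bsub>B\<^esub> p \<ominus>\<^bsub>B\<^esub> \<beta> c \<otimes>\<^bsub>B\<^esub> x \<ominus>\<^bsub>B\<^esub> \<beta> u"
proof -
  interpret e: ring_hom_cring "UP A" B "ev x" by (rule eval_hom [OF x])
  show ?thesis
    unfolding eqn_poly_def a_minus_def using assms by (simp add: U.eval_monom)
qed

lemma eval_eqn_poly_zero_iff:
  assumes c: "c \<in> carrier A" and u: "u \<in> carrier A" and x: "x \<in> carrier B"
  shows "ev x (eqn_poly A p c u) = \<zero>\<^bsub>B\<^esub> \<longleftrightarrow> x [^]\<^bsub>B\<^esub> p = \<beta> c \<otimes>\<^bsub>B\<^esub> x \<oplus>\<^bsub>B\<^esub> \<beta> u"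
proof -
  have cl: "\<beta> c \<otimes>\<^bsub>B\<^esub> x \<in> carrier B" "\<beta> u \<in> carrier B" "x [^]\<^bsub>B\<^esub> p \<in> carrier B" using assms by auto
  have "x [^]\<^bsub>B\<^esub> p \<ominus>\<^bsub>B\<^esub> \<beta> c \<otimes>\<^bsub>B\<^esub> x \<ominus>\<^bsub>B\<^esub> \<beta> u = x [^]\<^bsub>B\<^esub> p \<ominus>\<^bsub>B\<^esub> (\<beta> c \<otimes>\<^bsub>B\<^esub> x \<oplus>\<^bsub>B\<^esub> \<beta> u)"
    using cl by (simp add: B.minus_eq B.minus_add B.a_ac)
  then show ?thesis unfolding eval_eqn_poly [OF assms] using cl by (simp only: B.r_right_minus_eq B.a_closed)
qed

lemma eqn_poly_coeff:
  assumes "c \<in> carrier A" "u \<in> carrier A"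
  shows "up_ring.coeff (UP A) (eqn_poly A p c u) i =
    (if p = i then \<one> else \<zero>) \<ominus> (if 1 = i then c else \<zero>) \<ominus> (if 0 = i then u else \<zero>)"
  unfolding eqn_poly_def using assms by simp

lemma eqn_poly_deg:
  assumes c: "c \<in> carrier A" and u: "u \<in> carrier A" and p: "1 < p" and nt: "\<one> \<noteq> \<zero>"
  shows "deg A (eqn_poly A p c u) = p" "up_ring.coeff (UP A) (eqn_poly A p c u) p = \<one>"
proof -
  show cp: "up_ring.coeff (UP A) (eqn_poly A p c u) p = \<one>"
    unfolding eqn_poly_coeff [OF c u] using p by (simp add: A.minus_eq)
  show "deg A (eqn_poly A p c u) = p"
  proof (rule antisym)
    have "up_ring.coeff (UP A) (eqn_poly A p c u) m = \<zero>" if "p < m" for m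
      unfolding eqn_poly_coeff [OF c u] using p that by (simp add: A.minus_eq)
    then show "deg A (eqn_poly A p c u) \<le> p" by (rule U.deg_aboveI [OF _ eqn_poly_closed [OF c u]])
    have "up_ring.coeff (UP A) (eqn_poly A p c u) p \<noteq> \<zero>" unfolding cp by (rule nt)
    then show "p \<le> deg A (eqn_poly A p c u)" by (rule U.deg_belowI [OF _ eqn_poly_closed [OF c u]])
  qed
qed

lemma eqn_poly_division:
  assumes c: "c \<in> carrier A" and u: "u \<in> carrier A" and p: "1 < p" and nt: "\<one> \<noteq> \<zero>"
    and f: "f \<in> carrier (UP A)"
  shows "\<exists>q\<in>carrier (UP A). \<exists>r\<in>carrier (UP A). f = eqn_poly A p c u \<otimes>\<^bsub>UP A\<^esub> q \<oplus>\<^bsub>UP A\<^esub> r \<and>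
    (\<forall>i\<ge>p. up_ring.coeff (UP A) r i = \<zero>)"
proof -
  let ?g = "eqn_poly A p c u"
  have g: "?g \<in> carrier (UP A)" by (rule eqn_poly_closed [OF c u])
  note d = eqn_poly_deg [OF c u p nt]
  have "?g \<noteq> \<zero>\<^bsub>UP A\<^esub>" using d(2) nt by (metis U.coeff_zero)
  \<comment> \<open>The division theorem multiplies f by a power of the leading coefficient of the
    divisor, which is 1 here.\<close>
  from U.long_div_theorem [OF g f this] obtain q r k where qr: "q \<in> carrier (UP A)" "r \<in> carrier (UP A)"
    "up_ring.coeff (UP A) ?g (deg A ?g) [^] (k::nat) \<odot>\<^bsub>UP A\<^esub> f = ?g \<otimes>\<^bsub>UP A\<^esub> q \<oplus>\<^bsub>UP A\<^esub> r"
    "r = \<zero>\<^bsub>UP A\<^esub> \<or> deg A r < deg A ?g" by blast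
  have "f = ?g \<otimes>\<^bsub>UP A\<^esub> q \<oplus>\<^bsub>UP A\<^esub> r" using qr(3) f unfolding d by simp
  moreover have "\<forall>i\<ge>p. up_ring.coeff (UP A) r i = \<zero>"
    using qr(2,4) U.deg_aboveD [of r] unfolding d by auto
  ultimately show ?thesis using qr(1,2) by blast
qed

lemma ker_iff: "f \<in> a_kernel (UP A) B h \<longleftrightarrow> f \<in> carrier (UP A) \<and> h f = \<zero>\<^bsub>B\<^esub>"
  by (simp add: a_kernel_def')

text \<open>Division by the monic polynomial leaves a remainder of degree less than p, which
  evaluates to a combination of 1, x, ..., x^(p-1). Spanning gives surjectivity of the evaluation,
  and independence kills the remainder of a polynomial in its kernel.\<close>

lemma given_by_equationI:
  assumes c: "c \<in> carrier A" and u: "u \<in> carrier A" and p: "1 < p" and nt: "\<one> \<noteq> \<zero>"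
    and x: "x \<in> carrier B" and eq: "x [^]\<^bsub>B\<^esub> p = \<beta> c \<otimes>\<^bsub>B\<^esub> x \<oplus>\<^bsub>B\<^esub> \<beta> u"
    and span: "\<And>b. b \<in> carrier B \<Longrightarrow> \<exists>a. (\<forall>i<p. a i \<in> carrier A) \<and> b = (\<Oplus>\<^bsub>B\<^esub>i\<in>{..<p}. \<beta> (a i) \<otimes>\<^bsub>B\<^esub> x [^]\<^bsub>B\<^esub> i)"
    and indep: "\<And>a. \<lbrakk>\<forall>i<p. a i \<in> carrier A; (\<Oplus>\<^bsub>B\<^esub>i\<in>{..<p}. \<beta> (a i) \<otimes>\<^bsub>B\<^esub> x [^]\<^bsub>B\<^esub> i) = \<zero>\<^bsub>B\<^esub>\<rbrakk> \<Longrightarrow> \<forall>i<p. a i = \<zero>"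
  shows "given_by_equation A B \<beta> p c u x"
proof -
  interpret e: ring_hom_cring "UP A" B "ev x" by (rule eval_hom [OF x])
  let ?g = "eqn_poly A p c u"
  have g: "?g \<in> carrier (UP A)" by (rule eqn_poly_closed [OF c u])
  have g0: "ev x ?g = \<zero>\<^bsub>B\<^esub>" using eq by (simp only: eval_eqn_poly_zero_iff [OF c u x])
  have "ev x ` carrier (UP A) = carrier B"
  proof (intro equalityI subsetI)
    fix b assume "b \<in> carrier B"
    then obtain a where a: "\<forall>i<p. a i \<in> carrier A" "b = (\<Oplus>\<^bsub>B\<^esub>i\<in>{..<p}. \<beta> (a i) \<otimes>\<^bsub>B\<^esub> x [^]\<^bsub>B\<^esub> i)" using span by blast
    then have "b = ev x (pol p a)" using eval_pol [of p a x] x by simp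
    moreover have "pol p a \<in> carrier (UP A)" using a(1) by (intro pol) simp
    ultimately show "b \<in> ev x ` carrier (UP A)" by (rule image_eqI)
  qed auto
  moreover have "a_kernel (UP A) B (ev x) = PIdl\<^bsub>UP A\<^esub> ?g"
  proof (intro equalityI subsetI)
    fix f assume "f \<in> a_kernel (UP A) B (ev x)"
    then have f: "f \<in> carrier (UP A)" "ev x f = \<zero>\<^bsub>B\<^esub>" by (simp_all add: ker_iff)
    obtain q r where qr: "q \<in> carrier (UP A)" "r \<in> carrier (UP A)" "f = ?g \<otimes>\<^bsub>UP A\<^esub> q \<oplus>\<^bsub>UP A\<^esub> r"
      "\<forall>i\<ge>p. up_ring.coeff (UP A) r i = \<zero>" using eqn_poly_division [OF c u p nt f(1)] by blast
    have "ev x r = \<zero>\<^bsub>B\<^esub>" using f(2) unfolding qr(3) using qr(1,2) g g0 by simp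
    then have "(\<Oplus>\<^bsub>B\<^esub>i\<in>{..<p}. \<beta> (up_ring.coeff (UP A) r i) \<otimes>\<^bsub>B\<^esub> x [^]\<^bsub>B\<^esub> i) = \<zero>\<^bsub>B\<^esub>"
      using eval_upto [of r x p] qr x by simp
    then have "\<forall>i<p. up_ring.coeff (UP A) r i = \<zero>" using qr(2) by (intro indep) auto
    then have "up_ring.coeff (UP A) r i = \<zero>" for i using qr(4) by (cases "i < p") auto
    then have "r = \<zero>\<^bsub>UP A\<^esub>" using qr(2) by (intro U.up_eqI) auto
    then have "f = q \<otimes>\<^bsub>UP A\<^esub> ?g" using qr g by (simp add: U.P.m_comm)
    then show "f \<in> PIdl\<^bsub>UP A\<^esub> ?g" unfolding U.P.mem_cgenideal using qr(1) by blast
  next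
    fix f assume "f \<in> PIdl\<^bsub>UP A\<^esub> ?g"
    then obtain q where "q \<in> carrier (UP A)" "f = q \<otimes>\<^bsub>UP A\<^esub> ?g" unfolding U.P.mem_cgenideal by blast
    then show "f \<in> a_kernel (UP A) B (ev x)" using g g0 by (simp add: ker_iff)
  qed
  ultimately show ?thesis using x by (simp add: given_by_equation_iff)
qed

end

locale eqn_alg = alg +
  fixes p c u x
  assumes c: "c \<in> carrier A" and u: "u \<in> carrier A" and p: "1 < p"
    and gbe: "given_by_equation A B \<beta> p c u x"
begin

lemma x: "x \<in> carrier B" and surj: "ev x ` carrier (UP A) = carrier B"
  and ker: "a_kernel (UP A) B (ev x) = PIdl\<^bsub>UP A\<^esub> (eqn_poly A p c u)"
  using gbe by (simp_all add: given_by_equation_iff)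

lemma eqn: "x [^]\<^bsub>B\<^esub> p = \<beta> c \<otimes>\<^bsub>B\<^esub> x \<oplus>\<^bsub>B\<^esub> \<beta> u"
proof -
  have "eqn_poly A p c u \<in> a_kernel (UP A) B (ev x)"
    unfolding ker by (rule U.P.cgenideal_self [OF eqn_poly_closed [OF c u]])
  then show ?thesis by (simp only: ker_iff eval_eqn_poly_zero_iff [OF c u x])
qed

lemma alg_homD:
  assumes \<phi>: "\<phi> \<in> alg_homs A B \<beta> S \<alpha>" and S: "algebra_over A S \<alpha>"
  shows "ring_hom_cring B S \<phi>" "\<phi> x \<in> carrier S" "(\<phi> x) [^]\<^bsub>S\<^esub> p = \<alpha> c \<otimes>\<^bsub>S\<^esub> \<phi> x \<oplus>\<^bsub>S\<^esub> \<alpha> u"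
    "f \<in> carrier (UP A) \<Longrightarrow> \<phi> (ev x f) = UnivPoly.eval A S \<alpha> (\<phi> x) f"
proof -
  have S': "cring S" "\<alpha> \<in> ring_hom A S" using S by (auto simp: algebra_over_def)
  interpret S: alg A S \<alpha> by (intro alg.intro alg_axioms.intro) (rule A.is_cring, rule S', rule S')
  have h: "\<phi> \<in> ring_hom B S" "\<And>a. a \<in> carrier A \<Longrightarrow> \<phi> (\<beta> a) = \<alpha> a" using \<phi> by (auto simp: alg_homs_def)
  show r: "ring_hom_cring B S \<phi>" by (rule ring_hom_cringI [OF B.is_cring S'(1) h(1)])
  interpret \<phi>: ring_hom_cring B S \<phi> by (rule r)
  show "\<phi> x \<in> carrier S" using x by simp
  have "\<phi> (x [^]\<^bsub>B\<^esub> p) = \<phi> (\<beta> c \<otimes>\<^bsub>B\<^esub> x \<oplus>\<^bsub>B\<^esub> \<beta> u)" by (simp only: eqn)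
  then show "(\<phi> x) [^]\<^bsub>S\<^esub> p = \<alpha> c \<otimes>\<^bsub>S\<^esub> \<phi> x \<oplus>\<^bsub>S\<^esub> \<alpha> u" using x c u by (simp add: h(2))
  show "\<phi> (ev x f) = UnivPoly.eval A S \<alpha> (\<phi> x) f" if f: "f \<in> carrier (UP A)"
  proof -
    have "\<phi> (ev x f) = (\<Oplus>\<^bsub>S\<^esub>i\<in>{..deg A f}. \<phi> (\<beta> (up_ring.coeff (UP A) f i) \<otimes>\<^bsub>B\<^esub> x [^]\<^bsub>B\<^esub> i))"
      unfolding U.eval_on_carrier [OF f] using f x by (subst \<phi>.hom_finsum) (auto simp: comp_def)
    also have "\<dots> = (\<Oplus>\<^bsub>S\<^esub>i\<in>{..deg A f}. \<alpha> (up_ring.coeff (UP A) f i) \<otimes>\<^bsub>S\<^esub> \<phi> x [^]\<^bsub>S\<^esub> i)"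
      using f x by (intro S.B.finsum_cong') (auto simp: h(2))
    finally show ?thesis unfolding U.eval_on_carrier [OF f] .
  qed
qed

lemma alg_hom_eqI:
  assumes \<phi>: "\<phi> \<in> alg_homs A B \<beta> S \<alpha>" and \<psi>: "\<psi> \<in> alg_homs A B \<beta> S \<alpha>"
    and S: "algebra_over A S \<alpha>" and eq: "\<phi> x = \<psi> x"
  shows "\<phi> = \<psi>"
proof (rule extensionalityI [of _ "carrier B"])
  show "\<phi> \<in> extensional (carrier B)" "\<psi> \<in> extensional (carrier B)" using \<phi> \<psi> by (auto simp: alg_homs_def)
  fix b assume "b \<in> carrier B"
  then obtain f where f: "f \<in> carrier (UP A)" "b = ev x f" using surj by blast
  show "\<phi> b = \<psi> b" unfolding f(2) alg_homD(4) [OF \<phi> S f(1)] alg_homD(4) [OF \<psi> S f(1)] eq ..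
qed

text \<open>The universal property of A[X]/(X^p - c X - u): every root s in S is the image of x.
  Together with \<open>alg_hom_eqI\<close> it identifies the S-points of Spec B with the roots of
  the equation in S.\<close>

lemma alg_hom_exists:
  assumes S: "algebra_over A S \<alpha>" and s: "s \<in> carrier S" "s [^]\<^bsub>S\<^esub> p = \<alpha> c \<otimes>\<^bsub>S\<^esub> s \<oplus>\<^bsub>S\<^esub> \<alpha> u"
  shows "\<exists>\<phi>\<in>alg_homs A B \<beta> S \<alpha>. \<phi> x = s"
proof -
  have S': "cring S" "\<alpha> \<in> ring_hom A S" using S by (auto simp: algebra_over_def)
  interpret S: alg A S \<alpha> by (intro alg.intro alg_axioms.intro) (rule A.is_cring, rule S', rule S')
  interpret e: ring_hom_cring "UP A" B "ev x" by (rule eval_hom [OF x])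
  interpret k: ring_hom_cring "UP A" S "UnivPoly.eval A S \<alpha> s" by (rule S.eval_hom [OF s(1)])
  let ?g = "eqn_poly A p c u"
  have g: "?g \<in> carrier (UP A)" by (rule eqn_poly_closed [OF c u])
  have g0: "UnivPoly.eval A S \<alpha> s ?g = \<zero>\<^bsub>S\<^esub>" using s by (simp only: S.eval_eqn_poly_zero_iff [OF c u s(1)])
  have wd: "UnivPoly.eval A S \<alpha> s f = UnivPoly.eval A S \<alpha> s h"
    if f: "f \<in> carrier (UP A)" and h: "h \<in> carrier (UP A)" and eq: "ev x f = ev x h" for f h
  proof -
    have "ev x (f \<ominus>\<^bsub>UP A\<^esub> h) = ev x h \<oplus>\<^bsub>B\<^esub> \<ominus>\<^bsub>B\<^esub> ev x h"
      unfolding U.P.minus_eq using f h by (simp only: e.hom_add e.hom_a_inv U.P.a_inv_closed eq)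
    also have "\<dots> = \<zero>\<^bsub>B\<^esub>" by (rule B.r_neg) (use h in simp)
    finally have "ev x (f \<ominus>\<^bsub>UP A\<^esub> h) = \<zero>\<^bsub>B\<^esub>" .
    then have "f \<ominus>\<^bsub>UP A\<^esub> h \<in> PIdl\<^bsub>UP A\<^esub> ?g" unfolding ker [symmetric] ker_iff using f h by simp
    then obtain q where q: "q \<in> carrier (UP A)" "f \<ominus>\<^bsub>UP A\<^esub> h = q \<otimes>\<^bsub>UP A\<^esub> ?g" unfolding U.P.mem_cgenideal by blast
    have "f = h \<oplus>\<^bsub>UP A\<^esub> q \<otimes>\<^bsub>UP A\<^esub> ?g" by (rule U.P.eq_add_if_minus_eq [OF q(2) f h])
    then have "UnivPoly.eval A S \<alpha> s f = UnivPoly.eval A S \<alpha> s (h \<oplus>\<^bsub>UP A\<^esub> q \<otimes>\<^bsub>UP A\<^esub> ?g)" by (rule arg_cong)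
    also have "\<dots> = UnivPoly.eval A S \<alpha> s h" using h q(1) g g0 by simp
    finally show ?thesis .
  qed
  \<comment> \<open>An arbitrary polynomial that represents b. By \<open>wd\<close> its value at s
    does not depend on the choice.\<close>
  define rep where "rep b = (SOME f. f \<in> carrier (UP A) \<and> ev x f = b)" for b
  have rep: "rep b \<in> carrier (UP A)" "ev x (rep b) = b" if bB: "b \<in> carrier B" for b
  proof -
    obtain f where f: "b = ev x f" "f \<in> carrier (UP A)"
      using bB [folded surj] by (rule imageE)
    then have "f \<in> carrier (UP A) \<and> ev x f = b" by simp
    then have "rep b \<in> carrier (UP A) \<and> ev x (rep b) = b" unfolding rep_def by (rule someI [of "\<lambda>f. f \<in> carrier (UP A) \<and> ev x f = b"])
    then show "rep b \<in> carrier (UP A)" "ev x (rep b) = b" by simp_all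
  qed
  define \<phi> where "\<phi> = (\<lambda>b\<in>carrier B. UnivPoly.eval A S \<alpha> s (rep b))"
  have \<phi>: "\<phi> (ev x f) = UnivPoly.eval A S \<alpha> s f" if f: "f \<in> carrier (UP A)" for f
  proof -
    have b: "ev x f \<in> carrier B" using f by simp
    then have "\<phi> (ev x f) = UnivPoly.eval A S \<alpha> s (rep (ev x f))" by (simp add: \<phi>_def)
    also have "\<dots> = UnivPoly.eval A S \<alpha> s f" by (rule wd [OF rep(1) [OF b] f rep(2) [OF b]])
    finally show ?thesis .
  qed
  have "\<phi> \<in> ring_hom B S"
  proof (rule ring_hom_memI)
    fix b assume b: "b \<in> carrier B"
    show "\<phi> b \<in> carrier S" using rep(1) [OF b] b by (simp add: \<phi>_def)
    fix d assume d: "d \<in> carrier B"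
    note r = rep(1) [OF b] rep(1) [OF d]
    have "\<phi> (ev x (rep b \<otimes>\<^bsub>UP A\<^esub> rep d)) = \<phi> (ev x (rep b)) \<otimes>\<^bsub>S\<^esub> \<phi> (ev x (rep d))"
      using r by (simp only: \<phi> U.P.m_closed k.hom_mult)
    then show "\<phi> (b \<otimes>\<^bsub>B\<^esub> d) = \<phi> b \<otimes>\<^bsub>S\<^esub> \<phi> d" using r by (simp only: e.hom_mult rep(2) [OF b] rep(2) [OF d])
    have "\<phi> (ev x (rep b \<oplus>\<^bsub>UP A\<^esub> rep d)) = \<phi> (ev x (rep b)) \<oplus>\<^bsub>S\<^esub> \<phi> (ev x (rep d))"
      using r by (simp only: \<phi> U.P.a_closed k.hom_add)
    then show "\<phi> (b \<oplus>\<^bsub>B\<^esub> d) = \<phi> b \<oplus>\<^bsub>S\<^esub> \<phi> d" using r by (simp only: e.hom_add rep(2) [OF b] rep(2) [OF d])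
  next
    have "\<phi> (ev x \<one>\<^bsub>UP A\<^esub>) = \<one>\<^bsub>S\<^esub>" by (simp only: \<phi> U.P.one_closed k.hom_one)
    then show "\<phi> \<one>\<^bsub>B\<^esub> = \<one>\<^bsub>S\<^esub>" by (simp only: e.hom_one)
  qed
  moreover have "\<phi> (\<beta> a) = \<alpha> a" if a: "a \<in> carrier A" for a
    using \<phi> [of "up_ring.monom (UP A) a 0"] a U.eval_const [OF x a] S.U.eval_const [OF s(1) a] by simp
  moreover have "\<phi> \<in> extensional (carrier B)" by (simp add: \<phi>_def)
  ultimately have "\<phi> \<in> alg_homs A B \<beta> S \<alpha>" by (simp add: alg_homs_def)
  moreover have "\<phi> x = s"
    using \<phi> [of "up_ring.monom (UP A) \<one> 1"] U.eval_monom1 [OF x] S.U.eval_monom1 [OF s(1)] by simp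
  ultimately have "\<phi> \<in> alg_homs A B \<beta> S \<alpha> \<and> \<phi> x = s" by (rule conjI)
  then have "\<exists>\<psi>. \<psi> \<in> alg_homs A B \<beta> S \<alpha> \<and> \<psi> x = s" by (rule exI [of "\<lambda>\<psi>. \<psi> \<in> alg_homs A B \<beta> S \<alpha> \<and> \<psi> x = s"])
  then show ?thesis unfolding Bex_def .
qed

text \<open>Existence of coefficients is division with remainder. For uniqueness, the difference of
  two polynomials of degree less than p lies in the ideal of a polynomial of degree p, and degrees
  add over a domain.\<close>

lemma free:
  assumes dom: "domain A"
  shows "module_free A B \<beta> p"
proof -
  interpret D: "domain" A by (rule dom)
  interpret UD: UP_domain A "UP A" by (intro UP_domain.intro dom)
  interpret e: ring_hom_cring "UP A" B "ev x" by (rule eval_hom [OF x])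
  let ?g = "eqn_poly A p c u"
  have g: "?g \<in> carrier (UP A)" by (rule eqn_poly_closed [OF c u])
  note nt = D.one_not_zero
  note dg = eqn_poly_deg [OF c u p nt]
  have g0: "ev x ?g = \<zero>\<^bsub>B\<^esub>" using eqn by (simp only: eval_eqn_poly_zero_iff [OF c u x])
  have ex: "\<exists>a. a \<in> {..<p} \<rightarrow>\<^sub>E carrier A \<and> b = (\<Oplus>\<^bsub>B\<^esub>i\<in>{..<p}. \<beta> (a i) \<otimes>\<^bsub>B\<^esub> x [^]\<^bsub>B\<^esub> i)" if b: "b \<in> carrier B" for b
  proof -
    obtain f where f: "f \<in> carrier (UP A)" "b = ev x f" using surj b by blast
    obtain q r where qr: "q \<in> carrier (UP A)" "r \<in> carrier (UP A)" "f = ?g \<otimes>\<^bsub>UP A\<^esub> q \<oplus>\<^bsub>UP A\<^esub> r"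
      "\<forall>i\<ge>p. up_ring.coeff (UP A) r i = \<zero>" using eqn_poly_division [OF c u p nt f(1)] by blast
    have "b = ev x r" unfolding f(2) qr(3) using qr(1,2) g g0 by simp
    also have "\<dots> = (\<Oplus>\<^bsub>B\<^esub>i\<in>{..<p}. \<beta> (up_ring.coeff (UP A) r i) \<otimes>\<^bsub>B\<^esub> x [^]\<^bsub>B\<^esub> i)"
      using qr x by (intro eval_upto) auto
    also have "\<dots> = (\<Oplus>\<^bsub>B\<^esub>i\<in>{..<p}. \<beta> ((\<lambda>i\<in>{..<p}. up_ring.coeff (UP A) r i) i) \<otimes>\<^bsub>B\<^esub> x [^]\<^bsub>B\<^esub> i)"
      using qr x by (intro B.finsum_cong') auto
    finally show ?thesis using qr(2) by (intro exI [of _ "\<lambda>i\<in>{..<p}. up_ring.coeff (UP A) r i"]) auto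
  qed
  have un: "a = a'"
    if a: "a \<in> {..<p} \<rightarrow>\<^sub>E carrier A" and a': "a' \<in> {..<p} \<rightarrow>\<^sub>E carrier A"
      and eq: "(\<Oplus>\<^bsub>B\<^esub>i\<in>{..<p}. \<beta> (a i) \<otimes>\<^bsub>B\<^esub> x [^]\<^bsub>B\<^esub> i) = (\<Oplus>\<^bsub>B\<^esub>i\<in>{..<p}. \<beta> (a' i) \<otimes>\<^bsub>B\<^esub> x [^]\<^bsub>B\<^esub> i)" for a a'
  proof -
    have ac: "\<And>i. i < p \<Longrightarrow> a i \<in> carrier A" "\<And>i. i < p \<Longrightarrow> a' i \<in> carrier A" using a a' by auto
    note P = pol [OF ac(1)] pol [OF ac(2)]
    define d where "d = pol p a \<ominus>\<^bsub>UP A\<^esub> pol p a'"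
    have dA: "d \<in> carrier (UP A)" unfolding d_def using P by simp
    have dc: "up_ring.coeff (UP A) d i = pol p a i \<ominus> pol p a' i" for i unfolding d_def using P by simp
    have "ev x d = \<zero>\<^bsub>B\<^esub>"
      unfolding d_def a_minus_def using P(1,3) eq
      by (simp add: eval_pol [OF ac(1) x] eval_pol [OF ac(2) x] B.r_neg)
         (use ac x in \<open>auto simp: B.r_neg intro!: B.finsum_closed B.r_neg\<close>)
    then have "d \<in> PIdl\<^bsub>UP A\<^esub> ?g" unfolding ker [symmetric] ker_iff using dA by simp
    then obtain q where q: "q \<in> carrier (UP A)" "d = q \<otimes>\<^bsub>UP A\<^esub> ?g" unfolding U.P.mem_cgenideal by blast
    have "d = \<zero>\<^bsub>UP A\<^esub>"
    proof (rule ccontr)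
      assume nz: "d \<noteq> \<zero>\<^bsub>UP A\<^esub>"
      then have "q \<noteq> \<zero>\<^bsub>UP A\<^esub>" "?g \<noteq> \<zero>\<^bsub>UP A\<^esub>" using q g by auto
      then have deg: "deg A d = deg A q + p" unfolding q(2) using q(1) g dg(1) by simp
      have "up_ring.coeff (UP A) d (deg A d) \<noteq> \<zero>" using nz dA by (rule U.lcoeff_nonzero)
      moreover have "up_ring.coeff (UP A) d (deg A d) = \<zero>" unfolding dc deg by (simp add: pol_def A.minus_eq)
      ultimately show False by simp
    qed
    then have z: "pol p a i \<ominus> pol p a' i = \<zero>" for i unfolding dc [symmetric] by simp
    show "a = a'"
    proof (rule PiE_ext [OF a a'])
      fix i assume i: "i \<in> {..<p}"
      then have "a i \<ominus> a' i = \<zero>" using z [of i] by (simp add: pol_def)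
      then show "a i = a' i" using ac i by simp
    qed
  qed
  show ?thesis
    unfolding module_free_def
  proof (intro bexI [of _ "\<lambda>i. x [^]\<^bsub>B\<^esub> i"] ballI)
    fix b assume "b \<in> carrier B"
    then show "\<exists>!a. a \<in> {..<p} \<rightarrow>\<^sub>E carrier A \<and> b = (\<Oplus>\<^bsub>B\<^esub>i\<in>{..<p}. \<beta> (a i) \<otimes>\<^bsub>B\<^esub> x [^]\<^bsub>B\<^esub> i)"
      using ex [of b] un by blast
  qed (use x in simp)
qed

end

text \<open>The quotient \<open>A[X]/(X\<^sup>p - c X - u)\<close> is realised on representatives, hence on a type
  of functions.\<close>

lemma exists_given_by_equation:
  fixes R :: "'a ring" (structure)
  assumes "cring R" and c: "c \<in> carrier R" and u: "u \<in> carrier R"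
  shows "\<exists>(H :: (nat \<Rightarrow> 'a) ring) \<eta> x. algebra_over R H \<eta> \<and> given_by_equation R H \<eta> p c u x"
proof -
  interpret R: cring R by fact
  interpret a: alg R R id by (intro alg.intro alg_axioms.intro R.is_cring id_ring_hom)
  define I where "I = PIdl\<^bsub>UP R\<^esub> (eqn_poly R p c u)"
  have g: "eqn_poly R p c u \<in> carrier (UP R)" by (rule a.eqn_poly_closed [OF c u])
  interpret I: ideal I "UP R" unfolding I_def by (rule a.U.P.cgenideal_ideal [OF g])
  interpret Q: cring "UP R Quot I" by (rule I.quotient_is_cring [OF a.U.UP_cring])
  \<comment> \<open>A coset is determined by any of its elements, so \<open>f\<close> is injective
    and the ring structure of the quotient can be carried over.\<close>
  define f where "f P = (SOME q. q \<in> P)" for P :: "(nat \<Rightarrow> 'a) set"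
  define H where "H = image_ring f (UP R Quot I)"
  have carr: "carrier (UP R Quot I) = {I +>\<^bsub>UP R\<^esub> q | q. q \<in> carrier (UP R)}"
    by (auto simp: FactRing_def A_RCOSETS_defs a_r_coset_def)
  have inj: "inj_on f (carrier (UP R Quot I))"
  proof (rule inj_onI)
    fix P Q assume P: "P \<in> carrier (UP R Quot I)" and Q: "Q \<in> carrier (UP R Quot I)" and eq: "f P = f Q"
    obtain q where q: "q \<in> carrier (UP R)" "P = I +>\<^bsub>UP R\<^esub> q" using P carr by blast
    obtain r where r: "r \<in> carrier (UP R)" "Q = I +>\<^bsub>UP R\<^esub> r" using Q carr by blast
    have "q \<in> P" unfolding q(2) by (rule I.a_rcos_self [OF q(1)])
    then have fP: "f P \<in> I +>\<^bsub>UP R\<^esub> q" unfolding f_def q(2) [symmetric] by (rule someI [of "\<lambda>y. y \<in> P"])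
    have "r \<in> Q" unfolding r(2) by (rule I.a_rcos_self [OF r(1)])
    then have fQ: "f Q \<in> I +>\<^bsub>UP R\<^esub> r" unfolding f_def r(2) [symmetric] by (rule someI [of "\<lambda>y. y \<in> Q"])
    have "I +>\<^bsub>UP R\<^esub> q = I +>\<^bsub>UP R\<^esub> f P"
      by (rule a.U.P.a_repr_independence [OF fP q(1) I.a_subgroup])
    also have "\<dots> = I +>\<^bsub>UP R\<^esub> r" unfolding eq
      by (rule a.U.P.a_repr_independence [OF fQ r(1) I.a_subgroup, symmetric])
    finally show "P = Q" unfolding q(2) r(2) .
  qed
  have iso: "f \<in> ring_iso (UP R Quot I) H" unfolding H_def by (rule inj_imp_image_ring_iso [OF inj])
  have fh: "f \<in> ring_hom (UP R Quot I) H" and fb: "bij_betw f (carrier (UP R Quot I)) (carrier H)"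
    using iso by (auto simp: ring_iso_def)
  have "H\<lparr>ring.zero := f \<zero>\<^bsub>UP R Quot I\<^esub>\<rparr> = H"
    by (simp add: H_def image_ring_def image_group_def monoid.defs)
  then have Hc: "cring H" using Q.ring_iso_imp_img_cring [OF iso] by simp
  interpret H: cring H by (rule Hc)
  define \<Psi> where "\<Psi> q = f (I +>\<^bsub>UP R\<^esub> q)" for q
  have \<Psi>: "\<Psi> \<in> ring_hom (UP R) H"
    using ring_hom_trans [OF I.rcos_ring_hom fh] by (simp add: \<Psi>_def [abs_def] comp_def)
  interpret \<Psi>: ring_hom_cring "UP R" H \<Psi> by (rule ring_hom_cringI [OF a.U.UP_cring Hc \<Psi>])
  define \<eta> where "\<eta> r = \<Psi> (up_ring.monom (UP R) r 0)" for r
  define x where "x = \<Psi> (up_ring.monom (UP R) \<one> 1)"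
  have x: "x \<in> carrier H" by (simp add: x_def)
  have \<eta>: "\<eta> \<in> ring_hom R H"
    using ring_hom_trans [OF a.U.const_ring_hom \<Psi>] by (simp add: \<eta>_def [abs_def] comp_def)
  interpret h: alg R H \<eta> by (intro alg.intro alg_axioms.intro R.is_cring Hc \<eta>)
  interpret ex: ring_hom_cring "UP R" H "UnivPoly.eval R H \<eta> x" by (rule h.eval_hom [OF x])
  have ev1: "UnivPoly.eval R H \<eta> x (up_ring.monom (UP R) \<one> (Suc 0)) = x" using h.U.eval_monom1 [OF x] by simp
  have ev2: "\<Psi> (up_ring.monom (UP R) \<one> (Suc 0)) = x" by (simp add: x_def)
  have ev3: "\<Psi> (up_ring.monom (UP R) r 0) = \<eta> r" for r by (simp add: \<eta>_def)
  have ev: "UnivPoly.eval R H \<eta> x q = \<Psi> q" if q: "q \<in> carrier (UP R)" for q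
    by (rule h.U.UP_hom_unique [OF ex.ring_hom_cring_axioms ev1 h.U.eval_const [OF x]
      \<Psi>.ring_hom_cring_axioms ev2 ev3 q x])
  have "UnivPoly.eval R H \<eta> x ` carrier (UP R) = carrier H"
  proof -
    have "UnivPoly.eval R H \<eta> x ` carrier (UP R) = \<Psi> ` carrier (UP R)" using ev by (intro image_cong) auto
    also have "\<dots> = f ` carrier (UP R Quot I)" unfolding carr by (auto simp: \<Psi>_def)
    also have "\<dots> = carrier H" using fb by (simp add: bij_betw_def)
    finally show ?thesis .
  qed
  moreover have "a_kernel (UP R) H (UnivPoly.eval R H \<eta> x) = I"
  proof (intro equalityI subsetI)
    fix q assume "q \<in> a_kernel (UP R) H (UnivPoly.eval R H \<eta> x)"
    then have q0: "q \<in> carrier (UP R) \<and> UnivPoly.eval R H \<eta> x q = \<zero>\<^bsub>H\<^esub>" by (simp only: h.ker_iff)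
    then have q: "q \<in> carrier (UP R)" "\<Psi> q = \<zero>\<^bsub>H\<^esub>" using ev [of q] by metis+
    have "f (I +>\<^bsub>UP R\<^esub> q) = f \<zero>\<^bsub>UP R Quot I\<^esub>" using q(2) by (simp add: \<Psi>_def H_def image_ring_zero)
    moreover have "I +>\<^bsub>UP R\<^esub> q \<in> carrier (UP R Quot I)" using q(1) carr by blast
    ultimately have "I +>\<^bsub>UP R\<^esub> q = \<zero>\<^bsub>UP R Quot I\<^esub>" using inj Q.zero_closed by (simp add: inj_on_eq_iff)
    then have "I +>\<^bsub>UP R\<^esub> q = I" by (simp add: FactRing_def)
    then show "q \<in> I" by (rule I.rcos_const_imp_mem [OF q(1)])
  next
    fix q assume q: "q \<in> I"
    then have qc: "q \<in> carrier (UP R)" by (rule I.Icarr)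
    have "I +>\<^bsub>UP R\<^esub> q = \<zero>\<^bsub>UP R Quot I\<^esub>" using a.U.P.a_rcos_zero [OF I.is_ideal q] by (simp add: FactRing_def)
    then have "\<Psi> q = \<zero>\<^bsub>H\<^esub>" by (simp add: \<Psi>_def H_def image_ring_zero)
    then show "q \<in> a_kernel (UP R) H (UnivPoly.eval R H \<eta> x)" using qc by (simp only: h.ker_iff ev simp_thms)
  qed
  ultimately have "given_by_equation R H \<eta> p c u x" using x by (simp add: given_by_equation_iff I_def)
  then show ?thesis using h.algebra_over by blast
qed

section \<open>Bases over the image of a substitution\<close>

text \<open>Two solutions of the recursion X_l = s_l + t X_(l+1) differ at 0 by a multiple of t^l.
  It compares the result of repeated division with the series that collects the quotients, first for
  t = T and then for t = \<pi>.\<close>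

lemma (in cring) iterated_quotient:
  assumes t: "t \<in> carrier R" and c: "\<And>l. F l \<in> carrier R" "\<And>l. Q l \<in> carrier R" "\<And>l. s l \<in> carrier R"
    and F: "\<And>l. F l = s l \<oplus> t \<otimes> F (Suc l)" and Q: "\<And>l. Q l = s l \<oplus> t \<otimes> Q (Suc l)"
  shows "F 0 \<ominus> Q 0 = t [^] (l::nat) \<otimes> (F l \<ominus> Q l)"
proof (induction l)
  case 0
  show ?case using c by simp
next
  case (Suc l)
  have e: "F l \<ominus> Q l = (s l \<oplus> t \<otimes> F (Suc l)) \<ominus> (s l \<oplus> t \<otimes> Q (Suc l))"
    by (simp only: F [of l, symmetric] Q [of l, symmetric])
  have "(s l \<oplus> t \<otimes> F (Suc l)) \<ominus> (s l \<oplus> t \<otimes> Q (Suc l)) = t \<otimes> (F (Suc l) \<ominus> Q (Suc l))"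
    using t c(1) [of "Suc l"] c(2) [of "Suc l"] c(3) [of l] by algebra
  then show ?case unfolding Suc e using t c by (simp add: m_assoc)
qed

text \<open>Y_l is the sum of u^i a_(l+i) over all i, that is, every tail of a geometric-type series
  simultaneously.\<close>

lemma (in adic_complete) geometric_limit:
  assumes a: "\<And>l. a l \<in> carrier R"
  shows "\<exists>Y. \<forall>l. Y l \<in> carrier R \<and> Y l = a l \<oplus> u \<otimes> Y (Suc l)"
proof -
  \<comment> \<open>\<open>s n l\<close> consists of the first n terms of the l-th tail. The
    recursion on n steps from the tail at \<open>Suc l\<close> to the tail at l.\<close>
  define s where "s = rec_nat (\<lambda>l. \<zero>) (\<lambda>n sn l. a l \<oplus> u \<otimes> sn (Suc l))"
  have s0: "s 0 l = \<zero>" and sS: "s (Suc n) l = a l \<oplus> u \<otimes> s n (Suc l)" for n l by (simp_all add: s_def)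
  have sc: "s n l \<in> carrier R" for n l by (induction n arbitrary: l) (simp_all add: s0 sS a)
  have cs: "cg n (s n l) (s (Suc n) l)" for n l
  proof (induction n arbitrary: l)
    case 0
    show ?case by (rule cg_0) (rule sc)+
  next
    case (Suc n)
    have "cg (Suc n) (a l \<oplus> u \<otimes> s n (Suc l)) (a l \<oplus> u \<otimes> s (Suc n) (Suc l))"
      by (rule cg_add [OF cg_refl [OF a] cg_u_mult [OF Suc]])
    then show ?case by (simp only: sS [of n l] sS [of "Suc n" l])
  qed
  have "\<exists>y. y \<in> carrier R \<and> (\<forall>n. cg n (s n l) y)" for l
    using complete [of "\<lambda>n. s n l", OF cs] by (simp only: Bex_def)
  then have "\<forall>l. \<exists>y. y \<in> carrier R \<and> (\<forall>n. cg n (s n l) y)" ..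
  from choice [OF this] obtain Y where Y: "\<forall>l. Y l \<in> carrier R \<and> (\<forall>n. cg n (s n l) (Y l))" ..
  have eq: "Y l = a l \<oplus> u \<otimes> Y (Suc l)" for l
  proof (rule separated_eq)
    fix N
    have "cg (Suc N) (s (Suc N) l) (Y l)" using Y by simp
    then have 1: "cg N (s (Suc N) l) (Y l)" by (rule cg_mono) simp
    have "cg N (s N (Suc l)) (Y (Suc l))" using Y by simp
    then have "cg (Suc N) (a l \<oplus> u \<otimes> s N (Suc l)) (a l \<oplus> u \<otimes> Y (Suc l))"
      by (rule cg_add [OF cg_refl [OF a] cg_u_mult])
    then have "cg N (s (Suc N) l) (a l \<oplus> u \<otimes> Y (Suc l))" unfolding sS by (rule cg_mono) simp
    with cg_sym [OF 1] show "cg N (Y l) (a l \<oplus> u \<otimes> Y (Suc l))" by (rule cg_trans)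
  qed
  have "\<forall>l. Y l \<in> carrier R \<and> Y l = a l \<oplus> u \<otimes> Y (Suc l)"
  proof (intro allI conjI)
    show "Y l \<in> carrier R" for l using Y by simp
    show "Y l = a l \<oplus> u \<otimes> Y (Suc l)" for l by (rule eq)
  qed
  then show ?thesis by (rule exI [of "\<lambda>Y. \<forall>l. Y l \<in> carrier R \<and> Y l = a l \<oplus> u \<otimes> Y (Suc l)"])
qed

context laurent_subst
begin

text \<open>A combination of the E_j with coefficients in the image of the substitution. The
  families are total functions, of which only the indices below r are read.\<close>

definition comb :: "(nat \<Rightarrow> int \<Rightarrow> 'r) \<Rightarrow> (nat \<Rightarrow> int \<Rightarrow> 'r) \<Rightarrow> int \<Rightarrow> 'r"
  where "comb E g = (\<Oplus>\<^bsub>A\<^esub>j\<in>{..<nat r}. lsub (g j) \<otimes>\<^sub>A E j)"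

lemma comb_closed:
  assumes "\<And>j. E j \<in> carrier A" "\<And>j. g j \<in> carrier A" shows "comb E g \<in> carrier A"
  unfolding comb_def using assms by (intro A.finsum_closed) auto

lemma comb_add:
  assumes "\<And>j. E j \<in> carrier A" "\<And>j. g j \<in> carrier A" "\<And>j. h j \<in> carrier A"
  shows "comb E (\<lambda>j. g j \<oplus>\<^sub>A h j) = comb E g \<oplus>\<^sub>A comb E h"
proof -
  have "comb E (\<lambda>j. g j \<oplus>\<^sub>A h j) = (\<Oplus>\<^bsub>A\<^esub>j\<in>{..<nat r}. lsub (g j) \<otimes>\<^sub>A E j \<oplus>\<^sub>A lsub (h j) \<otimes>\<^sub>A E j)"
    unfolding comb_def using assms by (intro A.finsum_cong') (auto simp: lsub_add A.l_distr)
  also have "\<dots> = comb E g \<oplus>\<^sub>A comb E h" unfolding comb_def using assms by (intro A.finsum_addf) auto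
  finally show ?thesis .
qed

lemma comb_mon_mult:
  assumes "\<And>j. E j \<in> carrier A" "\<And>j. g j \<in> carrier A" "a \<in> carrier R"
  shows "comb E (\<lambda>j. mon a k \<otimes>\<^sub>A g j) = (mon a 0 \<otimes>\<^sub>A T [^]\<^sub>A k) \<otimes>\<^sub>A comb E g"
proof -
  have "comb E (\<lambda>j. mon a k \<otimes>\<^sub>A g j) =
      (\<Oplus>\<^bsub>A\<^esub>j\<in>{..<nat r}. (mon a 0 \<otimes>\<^sub>A T [^]\<^sub>A k) \<otimes>\<^sub>A (lsub (g j) \<otimes>\<^sub>A E j))"
    unfolding comb_def using assms by (intro A.finsum_cong') (auto simp: lsub_mon_mult A.m_assoc)
  also have "\<dots> = (mon a 0 \<otimes>\<^sub>A T [^]\<^sub>A k) \<otimes>\<^sub>A comb E g"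
    unfolding comb_def using assms by (intro A.finsum_rdistr [symmetric]) auto
  finally show ?thesis .
qed

lemma comb_var_mult:
  assumes "\<And>j. E j \<in> carrier A" "\<And>j. g j \<in> carrier A"
  shows "comb E (\<lambda>j. mon \<one> k \<otimes>\<^sub>A g j) = T [^]\<^sub>A k \<otimes>\<^sub>A comb E g"
  using comb_mon_mult [where E = E and g = g and a = \<one> and k = k] assms by (simp flip: A_one_mon)

lemma comb_const_mult:
  assumes "\<And>j. E j \<in> carrier A" "\<And>j. g j \<in> carrier A" "a \<in> carrier R"
  shows "comb E (\<lambda>j. mon a 0 \<otimes>\<^sub>A g j) = mon a 0 \<otimes>\<^sub>A comb E g"
  using comb_mon_mult [where E = E and g = g and a = a and k = 0] assms by (simp add: int_pow_def2)

lemma comb_const: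
  assumes "\<And>j. E j \<in> carrier A" "\<And>j. c j \<in> carrier R"
  shows "comb E (\<lambda>j. mon (c j) 0) = (\<Oplus>\<^bsub>A\<^esub>j\<in>{..<nat r}. mon (c j) 0 \<otimes>\<^sub>A E j)"
  unfolding comb_def using assms by (intro A.finsum_cong') (auto simp: lsub_const)

text \<open>Since E_j has order j, the coefficients at 0, ..., r - 1 can be cleared in turn modulo
  \<pi> by constant multiples of E_0, ..., E_(r-1). The rest has order at least r modulo \<pi>, so
  division by T keeps it without a pole.\<close>

lemma leading_terms:
  assumes EA: "\<And>j. E j \<in> carrier A" and E: "\<And>j. j < nat r \<Longrightarrow> wt (E j) (int j)"
    and f: "f \<in> carrier A" and lo: "lo 1 0 f"
  shows "\<exists>c f'. (\<forall>j. c j \<in> carrier R) \<and> f' \<in> carrier A \<and> lo 1 0 f' \<and>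
    f = comb E (\<lambda>j. mon (c j) 0) \<oplus>\<^sub>A T \<otimes>\<^sub>A f'"
proof -
  define S where "S c n = (\<Oplus>\<^bsub>A\<^esub>j\<in>{..<n}. mon (c j) 0 \<otimes>\<^sub>A E j)" for c :: "nat \<Rightarrow> 'r" and n
  have SA: "S c n \<in> carrier A" if "\<forall>j. c j \<in> carrier R" for c n
    unfolding S_def using that EA by (intro A.finsum_closed) auto
  have ex: "\<exists>c. (\<forall>j. c j \<in> carrier R) \<and> lo 1 (int n) (f \<ominus>\<^sub>A S c n)" if "n \<le> nat r" for n
    using that
  proof (induction n)
    case 0
    have "f \<ominus>\<^sub>A S (\<lambda>_. \<zero>) 0 = f" unfolding S_def using f by (simp add: A.minus_eq)
    then show ?case using lo by (intro exI [of _ "\<lambda>_. \<zero>"]) simp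
  next
    case (Suc n)
    then obtain c where c: "\<forall>j. c j \<in> carrier R" "lo 1 (int n) (f \<ominus>\<^sub>A S c n)" by auto
    define d where "d = f \<ominus>\<^sub>A S c n"
    have dA: "d \<in> carrier A" unfolding d_def using f SA [OF c(1)] by simp
    have En: "wt (E n) (int n)" using E Suc.prems by simp
    have aU: "E n (int n) \<in> Units R"
      using wtD [OF En] unit_iff_cg [of "E n (int n)"] A_coeff [OF EA] by auto
    \<comment> \<open>The multiple of E_n that cancels the coefficient of \<open>d\<close> at n; the
      leading coefficient of E_n is a unit of R.\<close>
    define b where "b = d (int n) \<otimes> inv (E n (int n))"
    have bR: "b \<in> carrier R" unfolding b_def using aU dA by simp
    define c' where "c' = c(n := b)"
    have c': "\<forall>j. c' j \<in> carrier R" using c(1) bR by (simp add: c'_def)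
    have tA: "mon b 0 \<otimes>\<^sub>A E n \<in> carrier A" using bR EA by simp
    have cn: "c' n = b" by (simp add: c'_def)
    have "S c' (Suc n) = mon b 0 \<otimes>\<^sub>A E n \<oplus>\<^sub>A (\<Oplus>\<^bsub>A\<^esub>j\<in>{..<n}. mon (c' j) 0 \<otimes>\<^sub>A E j)"
      unfolding S_def lessThan_Suc cn [symmetric] using c' EA by (subst A.finsum_insert) auto
    also have "(\<Oplus>\<^bsub>A\<^esub>j\<in>{..<n}. mon (c' j) 0 \<otimes>\<^sub>A E j) = S c n"
      unfolding S_def using c(1) EA by (intro A.finsum_cong') (auto simp: c'_def)
    finally have "f \<ominus>\<^sub>A S c' (Suc n) = d \<ominus>\<^sub>A mon b 0 \<otimes>\<^sub>A E n"
      unfolding d_def using f SA [OF c(1), of n] tA by (simp add: A.minus_eq A.minus_add A.a_ac)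
    moreover have "lo 1 (int (Suc n)) (d \<ominus>\<^sub>A mon b 0 \<otimes>\<^sub>A E n)"
      unfolding lo_def
    proof (intro allI impI)
      fix i assume i: "i < int (Suc n)"
      show "cg 1 ((d \<ominus>\<^sub>A mon b 0 \<otimes>\<^sub>A E n) i) \<zero>"
      proof (cases "i = int n")
        case True
        have "(mon b 0 \<otimes>\<^sub>A E n) i = b \<otimes> E n (int n)" unfolding mon_mult [OF bR EA] True by simp
        also have "\<dots> = d i" unfolding b_def True using aU dA EA by (simp add: m_assoc)
        finally have "(mon b 0 \<otimes>\<^sub>A E n) i = d i" .
        then show ?thesis unfolding A_minus [OF dA tA] using dA by (simp add: minus_eq r_neg)
      next
        case False
        have "lo 1 (int n) (d \<ominus>\<^sub>A mon b 0 \<otimes>\<^sub>A E n)"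
          using c(2) unfolding d_def [symmetric]
          by (intro lo_A_diff dA tA lo_mon_mult bR EA wtD(2) [OF En])
        then show ?thesis by (rule loD) (use i False in simp)
      qed
    qed
    ultimately show ?case using c' by (intro exI [of _ c']) simp
  qed
  obtain c where c: "\<forall>j. c j \<in> carrier R" "lo 1 r (f \<ominus>\<^sub>A S c (nat r))"
    using ex [of "nat r"] r by auto
  define d where "d = f \<ominus>\<^sub>A S c (nat r)"
  have dA: "d \<in> carrier A" unfolding d_def using f SA [OF c(1)] by simp
  define f' where "f' = inv\<^bsub>A\<^esub> T \<otimes>\<^sub>A d"
  have f'A: "f' \<in> carrier A" unfolding f'_def using T_unit dA by simp
  have "lo 1 (- r + r) f'" unfolding f'_def using T_unit dA c(2) [folded d_def] wtD(2) [OF wt_inv [OF T]]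
    by (intro lo_mult) auto
  then have lf: "lo 1 0 f'" by simp
  have "T \<otimes>\<^sub>A f' = d" unfolding f'_def using T_unit dA by (simp add: A.m_assoc [symmetric])
  then have "f = S c (nat r) \<oplus>\<^sub>A T \<otimes>\<^sub>A f'"
    using A.eq_add_if_minus_eq [OF d_def [symmetric] f SA [OF c(1)]] by simp
  then have "f = comb E (\<lambda>j. mon (c j) 0) \<oplus>\<^sub>A T \<otimes>\<^sub>A f'"
    using comb_const [of E c, OF EA] c(1) by (simp only: S_def)
  with c(1) f'A lf show ?thesis by blast
qed

text \<open>Iterating \<open>leading_terms\<close> is an expansion in powers of T with constant
  digits. The digits are collected into power series in the variable, and since f and the resulting
  combination differ modulo \<pi> by arbitrarily high powers of T, they agree modulo \<pi>.\<close>

lemma comb_cg_nonneg: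
  assumes EA: "\<And>j. E j \<in> carrier A" and E: "\<And>j. j < nat r \<Longrightarrow> wt (E j) (int j)"
    and f: "f \<in> carrier A" and lo: "lo 1 0 f"
  shows "\<exists>g. (\<forall>j. g j \<in> carrier A) \<and> A.cg 1 f (comb E g)"
proof -
  define P where "P f cf \<longleftrightarrow> (\<forall>j. fst cf j \<in> carrier R) \<and> snd cf \<in> carrier A \<and> lo 1 0 (snd cf) \<and>
    f = comb E (\<lambda>j. mon (fst cf j) 0) \<oplus>\<^sub>A T \<otimes>\<^sub>A snd cf" for f and cf :: "(nat \<Rightarrow> 'r) \<times> (int \<Rightarrow> 'r)"
  define nx where "nx f = (SOME cf. P f cf)" for f
  have nx: "P f (nx f)" if f: "f \<in> carrier A" and lo: "lo 1 0 f" for f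
  proof -
    obtain c f' where "(\<forall>j. c j \<in> carrier R) \<and> f' \<in> carrier A \<and> lo 1 0 f' \<and>
      f = comb E (\<lambda>j. mon (c j) 0) \<oplus>\<^sub>A T \<otimes>\<^sub>A f'" using leading_terms [OF EA E f lo] by blast
    then have "P f (c, f')" unfolding P_def fst_conv snd_conv .
    then show ?thesis unfolding nx_def by (rule someI [of "P f"])
  qed
  define F where "F l = ((\<lambda>f. snd (nx f)) ^^ l) f" for l :: nat
  have F0: "F 0 = f" and FS: "F (Suc l) = snd (nx (F l))" for l by (simp_all add: F_def)
  have FL: "F l \<in> carrier A \<and> lo 1 0 (F l)" for l
  proof (induction l)
    case 0
    show ?case unfolding F0 using f lo ..
  next
    case (Suc l)
    then show ?case unfolding FS using nx [of "F l"] by (simp add: P_def)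
  qed
  define c where "c l = fst (nx (F l))" for l
  have cR: "c l j \<in> carrier R" for l j using nx [of "F l"] FL [of l] by (simp add: P_def c_def)
  define s where "s l = comb E (\<lambda>j. mon (c l j) 0)" for l
  have Fs: "F l = s l \<oplus>\<^sub>A T \<otimes>\<^sub>A F (Suc l)" for l
    using nx [of "F l"] FL [of l] unfolding P_def s_def c_def FS by blast
  \<comment> \<open>The l-th tail of the digits as a power series, so that G_l = c_l + T G_(l+1)
    with T the variable. All tails are needed for the comparison with the remainders
    \<open>F l\<close>.\<close>
  define G where "G l j = (\<lambda>i. if i < 0 then \<zero> else c (l + nat i) j)" for l j
  have GP: "G l j \<in> PS" for l j by (simp add: PS_def G_def cR)
  have GA: "G l j \<in> carrier A" for l j using PS_A [OF GP] .
  have Gs: "G l j = mon (c l j) 0 \<oplus>\<^sub>A mon \<one> 1 \<otimes>\<^sub>A G (Suc l) j" for l j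
  proof
    fix i :: int
    have e: "(mon (c l j) 0 \<oplus>\<^sub>A mon \<one> 1 \<otimes>\<^sub>A G (Suc l) j) i = mon (c l j) 0 i \<oplus> G (Suc l) j (i - 1)"
      unfolding A_add mon_mult [OF one_closed GA] using GA by simp
    consider "i < 0" | "i = 0" | "0 < i" by linarith
    then show "G l j i = (mon (c l j) 0 \<oplus>\<^sub>A mon \<one> 1 \<otimes>\<^sub>A G (Suc l) j) i" unfolding e
    proof cases
      case 3
      then have "l + nat i = Suc l + nat (i - 1)" by linarith
      then show "G l j i = mon (c l j) 0 i \<oplus> G (Suc l) j (i - 1)" using 3 cR by (simp add: G_def mon_def)
    qed (simp_all add: G_def mon_def cR)
  qed
  define Q where "Q l = comb E (G l)" for l
  have sA: "s l \<in> carrier A" and QA: "Q l \<in> carrier A" for l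
    unfolding s_def Q_def using EA cR GA by (auto intro!: comb_closed)
  have Qs: "Q l = s l \<oplus>\<^sub>A T \<otimes>\<^sub>A Q (Suc l)" for l
  proof -
    have "G l = (\<lambda>j. mon (c l j) 0 \<oplus>\<^sub>A mon \<one> 1 \<otimes>\<^sub>A G (Suc l) j)" using Gs by (rule ext)
    then have "Q l = comb E (\<lambda>j. mon (c l j) 0 \<oplus>\<^sub>A mon \<one> 1 \<otimes>\<^sub>A G (Suc l) j)" unfolding Q_def by (rule arg_cong)
    also have "\<dots> = s l \<oplus>\<^sub>A comb E (\<lambda>j. mon \<one> 1 \<otimes>\<^sub>A G (Suc l) j)"
      unfolding s_def using EA cR GA by (intro comb_add) auto
    also have "comb E (\<lambda>j. mon \<one> 1 \<otimes>\<^sub>A G (Suc l) j) = T [^]\<^sub>A (1::int) \<otimes>\<^sub>A Q (Suc l)"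
      unfolding Q_def by (rule comb_var_mult [OF EA GA])
    finally show ?thesis unfolding A.unit_int_pow_1 [OF T_unit] .
  qed
  have loQ: "lo 1 0 (Q l)" for l
    unfolding Q_def comb_def
  proof (rule lo_A_finsum)
    fix j assume j: "j \<in> {..<nat r}"
    have "lo 1 (int j) (E j)" using j by (intro wtD(2) E) simp
    then have "lo 1 0 (E j)" by (rule lo_mono) simp
    then have "lo 1 (0 + 0) (lsub (G l j) \<otimes>\<^sub>A E j)"
      by (intro lo_mult lo_sub_PS GP EA sub_A GA)
    then show "lo 1 0 (lsub (G l j) \<otimes>\<^sub>A E j)" by simp
  qed (use EA GA in auto)
  have "lo 1 (int l) (f \<ominus>\<^sub>A Q 0)" for l
  proof -
    have "F 0 \<ominus>\<^sub>A Q 0 = T [^]\<^sub>A l \<otimes>\<^sub>A (F l \<ominus>\<^sub>A Q l)"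
      by (rule A.iterated_quotient [where F = F and Q = Q and s = s, OF T_A FL [THEN conjunct1] QA sA Fs Qs])
    moreover have "lo 1 (int l * r + 0) (T [^]\<^sub>A l \<otimes>\<^sub>A (F l \<ominus>\<^sub>A Q l))"
    proof (rule lo_mult)
      show "lo 1 (int l * r) (T [^]\<^sub>A l)" by (rule lo_pow [OF T_A wtD(2) [OF T]])
      show "lo 1 0 (F l \<ominus>\<^sub>A Q l)" using FL [of l] by (intro lo_A_diff QA loQ) auto
    qed (use FL [of l] QA in auto)
    moreover have "int l \<le> int l * r + 0" using mult_left_mono [OF r, of "int l"] by simp
    ultimately show ?thesis unfolding F0 by (simp add: lo_mono)
  qed
  then have "A.cg 1 (f \<ominus>\<^sub>A Q 0) \<zero>\<^sub>A" using f QA by (intro A_cg_zero_if_lo) auto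
  then have "A.cg 1 f (Q 0)" using A.cg_diff_zero_iff [OF f QA] by simp
  then show ?thesis unfolding Q_def using GA by (intro exI [of _ "G 0"] conjI allI)
qed

lemma comb_cg:
  assumes EA: "\<And>j. E j \<in> carrier A" and E: "\<And>j. j < nat r \<Longrightarrow> wt (E j) (int j)"
    and f: "f \<in> carrier A"
  shows "\<exists>g. (\<forall>j. g j \<in> carrier A) \<and> A.cg 1 f (comb E g)"
proof -
  obtain M where M: "lo 1 M f" using A_lo [OF f] ..
  \<comment> \<open>As r is at least 1, multiplication by T^a raises the order by at least a, which
    removes the pole modulo \<pi>.\<close>
  define a where "a = nat (- M)"
  define h where "h = T [^]\<^sub>A a \<otimes>\<^sub>A f"
  have hA: "h \<in> carrier A" using f by (simp add: h_def)
  have "lo 1 (int a * r + M) h" unfolding h_def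
    by (rule lo_mult [OF _ f lo_pow [OF T_A wtD(2) [OF T]] M]) simp
  moreover have "0 \<le> int a * r + M"
  proof -
    have "int a \<le> int a * r" using mult_left_mono [OF r, of "int a"] by simp
    moreover have "- M \<le> int a" by (simp add: a_def)
    ultimately show ?thesis by linarith
  qed
  ultimately have "lo 1 0 h" by (rule lo_mono)
  from comb_cg_nonneg [OF EA E hA this] obtain g where g: "\<forall>j. g j \<in> carrier A" "A.cg 1 h (comb E g)" by blast
  have Ti: "T [^]\<^sub>A (- int a) \<otimes>\<^sub>A T [^]\<^sub>A a = \<one>\<^sub>A"
    using A.unit_int_pow_add [OF T_unit, of "- int a" "int a"] by (simp add: int_pow_int)
  have "A.cg 1 (T [^]\<^sub>A (- int a) \<otimes>\<^sub>A h) (T [^]\<^sub>A (- int a) \<otimes>\<^sub>A comb E g)"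
    by (rule A.cg_mult [OF A.cg_refl [OF T_pow_A] g(2)])
  also have "T [^]\<^sub>A (- int a) \<otimes>\<^sub>A comb E g = comb E (\<lambda>j. mon \<one> (- int a) \<otimes>\<^sub>A g j)"
    using comb_var_mult [of E g "- int a", OF EA] g(1) by simp
  finally have "A.cg 1 (T [^]\<^sub>A (- int a) \<otimes>\<^sub>A h) (comb E (\<lambda>j. mon \<one> (- int a) \<otimes>\<^sub>A g j))" .
  moreover have "T [^]\<^sub>A (- int a) \<otimes>\<^sub>A h = f"
  proof -
    have "T [^]\<^sub>A (- int a) \<otimes>\<^sub>A h = (T [^]\<^sub>A (- int a) \<otimes>\<^sub>A T [^]\<^sub>A a) \<otimes>\<^sub>A f"
      unfolding h_def by (rule A.m_assoc [symmetric]) (use f in simp_all)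
    then show ?thesis unfolding Ti using f by simp
  qed
  ultimately show ?thesis using g(1)
    by (intro exI [of _ "\<lambda>j. mon \<one> (- int a) \<otimes>\<^sub>A g j"]) simp
qed

text \<open>From generation modulo \<pi> to generation: the argument of Nakayama's lemma in complete
  form. Each step divides the error by \<pi>, and \<open>geometric_limit\<close> sums the
  coefficients.\<close>

lemma comb_surj:
  assumes EA: "\<And>j. E j \<in> carrier A" and E: "\<And>j. j < nat r \<Longrightarrow> wt (E j) (int j)"
    and f: "f \<in> carrier A"
  shows "\<exists>g. (\<forall>j. g j \<in> carrier A) \<and> f = comb E g"
proof -
  define P where "P f cf \<longleftrightarrow> (\<forall>j. fst cf j \<in> carrier A) \<and> snd cf \<in> carrier A \<and>
    f = comb E (fst cf) \<oplus>\<^sub>A mon \<pi> 0 \<otimes>\<^sub>A snd cf" for f and cf :: "(nat \<Rightarrow> int \<Rightarrow> 'r) \<times> (int \<Rightarrow> 'r)"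
  define nx where "nx f = (SOME cf. P f cf)" for f
  have nx: "P f (nx f)" if f: "f \<in> carrier A" for f
  proof -
    obtain g where g: "\<forall>j. g j \<in> carrier A" "A.cg 1 f (comb E g)" using comb_cg [OF EA E f] by blast
    obtain y where y: "y \<in> carrier A" "f = comb E g \<oplus>\<^sub>A mon \<pi> 0 [^]\<^sub>A (1::nat) \<otimes>\<^sub>A y"
      using g(2) by (rule A.cgE)
    have "P f (g, y)" unfolding P_def fst_conv snd_conv using g(1) y by simp
    then show ?thesis unfolding nx_def by (rule someI [of "P f"])
  qed
  define F where "F l = ((\<lambda>f. snd (nx f)) ^^ l) f" for l :: nat
  have F0: "F 0 = f" and FS: "F (Suc l) = snd (nx (F l))" for l by (simp_all add: F_def)
  have FA: "F l \<in> carrier A" for l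
  proof (induction l)
    case (Suc l)
    then show ?case unfolding FS using nx [of "F l"] by (simp add: P_def)
  qed (simp add: F0 f)
  define g where "g l = fst (nx (F l))" for l
  have gA: "g l j \<in> carrier A" for l j using nx [OF FA, of l] by (simp add: P_def g_def)
  have Fs: "F l = comb E (g l) \<oplus>\<^sub>A mon \<pi> 0 \<otimes>\<^sub>A F (Suc l)" for l
    using nx [OF FA, of l] unfolding P_def g_def FS by blast
  have "\<forall>j. \<exists>Y. \<forall>l. Y l \<in> carrier A \<and> Y l = g l j \<oplus>\<^sub>A mon \<pi> 0 \<otimes>\<^sub>A Y (Suc l)"
    by (intro allI A.geometric_limit gA)
  from choice [OF this] obtain Y where
    Y: "\<forall>j l. Y j l \<in> carrier A \<and> Y j l = g l j \<oplus>\<^sub>A mon \<pi> 0 \<otimes>\<^sub>A Y j (Suc l)" ..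
  have YA: "Y j l \<in> carrier A" for j l using Y by blast
  define Q where "Q l = comb E (\<lambda>j. Y j l)" for l
  have QA: "Q l \<in> carrier A" and cA: "comb E (g l) \<in> carrier A" for l
    unfolding Q_def using EA YA gA by (auto intro!: comb_closed)
  have Qs: "Q l = comb E (g l) \<oplus>\<^sub>A mon \<pi> 0 \<otimes>\<^sub>A Q (Suc l)" for l
  proof -
    have "(\<lambda>j. Y j l) = (\<lambda>j. g l j \<oplus>\<^sub>A mon \<pi> 0 \<otimes>\<^sub>A Y j (Suc l))" by (rule ext) (use Y in blast)
    then have "Q l = comb E (\<lambda>j. g l j \<oplus>\<^sub>A mon \<pi> 0 \<otimes>\<^sub>A Y j (Suc l))" unfolding Q_def by (rule arg_cong)
    also have "\<dots> = comb E (g l) \<oplus>\<^sub>A comb E (\<lambda>j. mon \<pi> 0 \<otimes>\<^sub>A Y j (Suc l))"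
      using EA gA YA by (intro comb_add) auto
    also have "comb E (\<lambda>j. mon \<pi> 0 \<otimes>\<^sub>A Y j (Suc l)) = mon \<pi> 0 \<otimes>\<^sub>A Q (Suc l)"
      unfolding Q_def by (rule comb_const_mult [OF EA YA u])
    finally show ?thesis .
  qed
  have "f = Q 0"
  proof (rule A.separated_eq)
    fix N
    have "F 0 \<ominus>\<^sub>A Q 0 = mon \<pi> 0 [^]\<^sub>A N \<otimes>\<^sub>A (F N \<ominus>\<^sub>A Q N)"
      by (rule A.iterated_quotient [where F = F and Q = Q and s = "\<lambda>l. comb E (g l)", OF mon_closed [OF u] FA QA cA Fs Qs])
    then have "A.cg N (f \<ominus>\<^sub>A Q 0) \<zero>\<^sub>A" unfolding F0 A.cg_zero_iff using FA QA by blast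
    then show "A.cg N f (Q 0)" using A.cg_diff_zero_iff [OF f QA] by simp
  qed
  then show ?thesis unfolding Q_def using YA by (intro exI [of _ "\<lambda>j. Y j 0"] conjI allI)
qed

lemma lsub_inj: "inj_on lsub (carrier A)"
proof (rule inj_onI)
  fix f g assume fg: "f \<in> carrier A" "g \<in> carrier A" "lsub f = lsub g"
  have "lsub (f \<ominus>\<^sub>A g) = lsub g \<ominus>\<^sub>A lsub g" using lsub_diff [OF fg(1,2)] fg(3) by simp
  also have "\<dots> = \<zero>\<^sub>A" using fg(2) by (simp add: A.minus_eq A.r_neg)
  finally have "f \<ominus>\<^sub>A g = \<zero>\<^sub>A" by (rule lsub_eq_zero_iff [OF A.minus_closed [OF fg(1,2)]])
  then show "f = g" using fg by simp
qed

lemma lsub_iso: assumes r1: "r = 1" shows "lsub \<in> ring_iso A A"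
proof -
  have "lsub ` carrier A = carrier A"
  proof (intro equalityI subsetI)
    fix f assume f: "f \<in> carrier A"
    \<comment> \<open>For r = 1 the family consisting of 1 alone satisfies the order condition of
      \<open>comb_surj\<close>.\<close>
    have "wt \<one>\<^sub>A (int j)" if "j < nat r" for j using that r1 wt_one by simp
    from comb_surj [of "\<lambda>_. \<one>\<^sub>A" f, OF _ this f] obtain g where
      g: "\<forall>j. g j \<in> carrier A" "f = comb (\<lambda>_. \<one>\<^sub>A) g" by auto
    have "nat r = Suc 0" using r1 by simp
    then have "comb (\<lambda>_. \<one>\<^sub>A) g = lsub (g 0)" using g(1) by (simp add: comb_def lessThan_Suc)
    with g(2) have "f = lsub (g 0)" by simp
    then show "f \<in> lsub ` carrier A" using g(1) by blast
  qed auto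
  then show ?thesis using lsub_hom lsub_inj by (simp add: ring_iso_def bij_betw_def)
qed

lemma parameter_if_wt_one: "r = 1 \<Longrightarrow> parameter R \<pi> A (const_ser R) T"
  unfolding parameter_def
  by (rule bexI [OF _ lsub_iso]) (simp_all add: const_ser_mon var_ser_mon lsub_const lsub_var)

end

section \<open>Torsors under group schemes given by additive polynomials\<close>

lemma ring_hom_char:
  assumes "cring R" "algebra_over R S \<sigma>" "[(p::nat)] \<cdot>\<^bsub>R\<^esub> \<one>\<^bsub>R\<^esub> = \<zero>\<^bsub>R\<^esub>"
  shows "[p] \<cdot>\<^bsub>S\<^esub> \<one>\<^bsub>S\<^esub> = \<zero>\<^bsub>S\<^esub>"
proof -
  interpret R: cring R by fact
  interpret S: cring S using assms(2) by (simp add: algebra_over_def)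
  interpret h: ring_hom_cring R S \<sigma>
    by (rule ring_hom_cringI) (use assms(2) R.is_cring in \<open>auto simp: algebra_over_def\<close>)
  have "\<sigma> ([n] \<cdot>\<^bsub>R\<^esub> \<one>\<^bsub>R\<^esub>) = [n] \<cdot>\<^bsub>S\<^esub> \<one>\<^bsub>S\<^esub>" for n :: nat
    by (induction n) simp_all
  from this [of p] show ?thesis unfolding assms(3) by simp
qed

text \<open>The group axioms are pulled back along \<theta> from the additive group of the ring.
  That sums of elements of K lie in K is contained in the closure of G.\<close>

lemma (in cring) group_by_additive_bijection:
  assumes bij: "bij_betw \<theta> (carrier G) K" and K: "K \<subseteq> carrier R"
    and neg: "\<And>s. s \<in> K \<Longrightarrow> \<ominus> s \<in> K"
    and closed: "\<And>g h. g \<in> carrier G \<Longrightarrow> h \<in> carrier G \<Longrightarrow> g \<otimes>\<^bsub>G\<^esub> h \<in> carrier G"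
    and mult: "\<And>g h. g \<in> carrier G \<Longrightarrow> h \<in> carrier G \<Longrightarrow> \<theta> (g \<otimes>\<^bsub>G\<^esub> h) = \<theta> g \<oplus> \<theta> h"
    and one: "\<one>\<^bsub>G\<^esub> \<in> carrier G" "\<theta> \<one>\<^bsub>G\<^esub> = \<zero>"
  shows "group G"
proof (rule groupI)
  have inj: "g = h" if "g \<in> carrier G" "h \<in> carrier G" "\<theta> g = \<theta> h" for g h
    using inj_onD [OF bij_betw_imp_inj_on [OF bij]] that by simp
  have c: "\<theta> g \<in> carrier R" if "g \<in> carrier G" for g
    using bij_betwE [OF bij] that K by blast
  show "g \<otimes>\<^bsub>G\<^esub> h \<otimes>\<^bsub>G\<^esub> k = g \<otimes>\<^bsub>G\<^esub> (h \<otimes>\<^bsub>G\<^esub> k)"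
    if "g \<in> carrier G" "h \<in> carrier G" "k \<in> carrier G" for g h k
    by (rule inj) (use that c in \<open>simp_all add: closed mult a_assoc\<close>)
  show "\<one>\<^bsub>G\<^esub> \<otimes>\<^bsub>G\<^esub> g = g" if "g \<in> carrier G" for g
    by (rule inj) (use that c one in \<open>simp_all add: closed mult\<close>)
  show "\<exists>h\<in>carrier G. h \<otimes>\<^bsub>G\<^esub> g = \<one>\<^bsub>G\<^esub>" if g: "g \<in> carrier G" for g
  proof -
    have "\<ominus> \<theta> g \<in> K" using bij_betwE [OF bij] g neg by blast
    then have "\<ominus> \<theta> g \<in> \<theta> ` carrier G" using bij by (simp add: bij_betw_def)
    then obtain h where h: "h \<in> carrier G" "\<theta> h = \<ominus> \<theta> g" by (metis imageE)
    have "h \<otimes>\<^bsub>G\<^esub> g = \<one>\<^bsub>G\<^esub>" by (rule inj) (use g h c one in \<open>simp_all add: closed mult l_neg\<close>)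
    with h(1) show ?thesis by (rule bexI [rotated])
  qed
qed (use closed one in simp_all)

lemma (in eqn_alg) compose_alg_hom:
  assumes y: "y \<in> alg_homs A B \<beta> S \<alpha>" and \<phi>: "\<phi> \<in> alg_homs A S \<alpha> S' \<alpha>'"
  shows "compose (carrier B) \<phi> y \<in> alg_homs A B \<beta> S' \<alpha>'"
proof -
  have yh: "y \<in> ring_hom B S" and yb: "\<And>a. a \<in> carrier A \<Longrightarrow> y (\<beta> a) = \<alpha> a" using y by (auto simp: alg_homs_def)
  have \<phi>h: "\<phi> \<in> ring_hom S S'" using \<phi> by (simp add: alg_homs_def)
  have "compose (carrier B) \<phi> y \<in> ring_hom B S'"
    by (rule ring_hom_memI)
       (simp_all add: compose_eq ring_hom_closed [OF yh] ring_hom_closed [OF \<phi>h] ring_hom_mult [OF yh] ring_hom_mult [OF \<phi>h]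
         ring_hom_add [OF yh] ring_hom_add [OF \<phi>h] ring_hom_one [OF yh] ring_hom_one [OF \<phi>h])
  moreover have "compose (carrier B) \<phi> y (\<beta> a) = \<alpha>' a" if "a \<in> carrier A" for a
    using that yb \<phi> by (simp add: compose_eq alg_homs_def)
  ultimately show ?thesis by (simp add: alg_homs_def)
qed

text \<open>By additivity of Frobenius two roots of X^p = c X + u differ by a root of X^p = c X.
  Hence every group functor that \<theta> identifies additively and naturally with the roots of the
  latter equation acts simply transitively by translation. The lemma serves three groups:
  \<open>M_group\<close>, \<open>const_Zp\<close> and \<open>root_group\<close>.\<close>

lemma (in eqn_alg) torsor_exists:
  fixes R :: "'r ring" and G :: "('r, 'c, 'g) group_fun"
  assumes pr: "Factorial_Ring.prime p" and ch: "[p] \<cdot>\<^bsub>A\<^esub> \<one>\<^bsub>A\<^esub> = \<zero>\<^bsub>A\<^esub>"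
    and \<iota>: "\<iota> \<in> ring_hom R A" and c0: "c = \<iota> c0"
    and free: "module_free A B \<beta> p"
    and grp: "\<And>S \<sigma>. algebra_over R S \<sigma> \<Longrightarrow> group (pts G S \<sigma>)"
    and \<theta>: "\<And>S \<sigma>. algebra_over R S \<sigma> \<Longrightarrow>
      bij_betw (\<theta> S \<sigma>) (carrier (pts G S \<sigma>)) {s \<in> carrier S. s [^]\<^bsub>S\<^esub> p = \<sigma> c0 \<otimes>\<^bsub>S\<^esub> s}"
    and mult: "\<And>S \<sigma> g h. \<lbrakk>algebra_over R S \<sigma>; g \<in> carrier (pts G S \<sigma>); h \<in> carrier (pts G S \<sigma>)\<rbrakk> \<Longrightarrow>
      \<theta> S \<sigma> (g \<otimes>\<^bsub>pts G S \<sigma>\<^esub> h) = \<theta> S \<sigma> g \<oplus>\<^bsub>S\<^esub> \<theta> S \<sigma> h"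
    and nat: "\<And>S \<sigma> S' \<sigma>' \<phi> g. \<lbrakk>algebra_over R S \<sigma>; algebra_over R S' \<sigma>'; \<phi> \<in> alg_homs R S \<sigma> S' \<sigma>';
      g \<in> carrier (pts G S \<sigma>)\<rbrakk> \<Longrightarrow> pmap G \<phi> g \<in> carrier (pts G S' \<sigma>') \<and> \<theta> S' \<sigma>' (pmap G \<phi> g) = \<phi> (\<theta> S \<sigma> g)"
  shows "\<exists>act. torsor A \<iota> B \<beta> G act \<and>
    (\<forall>S \<alpha> g y. algebra_over A S \<alpha> \<and> g \<in> carrier (pts G S (\<alpha> \<circ> \<iota>)) \<and> y \<in> alg_homs A B \<beta> S \<alpha> \<longrightarrow>
      act S \<alpha> g y x = y x \<oplus>\<^bsub>S\<^esub> \<theta> S (\<alpha> \<circ> \<iota>) g)"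
proof -
  define act where "act S \<alpha> g = (\<lambda>y\<in>alg_homs A B \<beta> S \<alpha>.
    THE z. z \<in> alg_homs A B \<beta> S \<alpha> \<and> z x = y x \<oplus>\<^bsub>S\<^esub> \<theta> S (\<alpha> \<circ> \<iota>) g)" for S \<alpha> g
  have alg: "algebra_over R S (\<alpha> \<circ> \<iota>)" if "algebra_over A S \<alpha>" for S :: "'c ring" and \<alpha>
    using that ring_hom_trans [OF \<iota>, of \<alpha> S] by (simp add: algebra_over_def)
  have chS: "cring_char S p" if S: "algebra_over A S \<alpha>" for S :: "'c ring" and \<alpha>
  proof (intro cring_char.intro cring_char_axioms.intro)
    show "cring S" using S by (simp add: algebra_over_def)
    show "[p] \<cdot>\<^bsub>S\<^esub> \<one>\<^bsub>S\<^esub> = \<zero>\<^bsub>S\<^esub>" by (rule ring_hom_char [OF A.is_cring S ch])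
  qed (rule pr)
  have \<theta>K: "\<theta> S (\<alpha> \<circ> \<iota>) g \<in> carrier S \<and> (\<theta> S (\<alpha> \<circ> \<iota>) g) [^]\<^bsub>S\<^esub> p = \<alpha> c \<otimes>\<^bsub>S\<^esub> \<theta> S (\<alpha> \<circ> \<iota>) g"
    if "algebra_over A S \<alpha>" "g \<in> carrier (pts G S (\<alpha> \<circ> \<iota>))" for S \<alpha> g
    using bij_betwE [OF \<theta> [OF alg [OF that(1)]]] that(2) by (auto simp: c0)
  have ac: "act S \<alpha> g y \<in> alg_homs A B \<beta> S \<alpha> \<and> act S \<alpha> g y x = y x \<oplus>\<^bsub>S\<^esub> \<theta> S (\<alpha> \<circ> \<iota>) g"
    if S: "algebra_over A S \<alpha>" and g: "g \<in> carrier (pts G S (\<alpha> \<circ> \<iota>))" and y: "y \<in> alg_homs A B \<beta> S \<alpha>"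
    for S \<alpha> g y
  proof -
    interpret S: cring_char S p by (rule chS [OF S])
    let ?t = "\<theta> S (\<alpha> \<circ> \<iota>) g"
    have t: "?t \<in> carrier S" "?t [^]\<^bsub>S\<^esub> p = \<alpha> c \<otimes>\<^bsub>S\<^esub> ?t" using \<theta>K [OF S g] by auto
    note yx = alg_homD(2,3) [OF y S]
    have cu: "\<alpha> c \<in> carrier S" "\<alpha> u \<in> carrier S"
      using S c u ring_hom_closed [of \<alpha> A S] by (auto simp: algebra_over_def)
    have "(y x \<oplus>\<^bsub>S\<^esub> ?t) [^]\<^bsub>S\<^esub> p = \<alpha> c \<otimes>\<^bsub>S\<^esub> (y x \<oplus>\<^bsub>S\<^esub> ?t) \<oplus>\<^bsub>S\<^esub> \<alpha> u"
      unfolding S.frob_add [OF yx(1) t(1)] yx(2) t(2) using yx(1) t(1) cu by (simp add: S.r_distr S.a_ac)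
    then obtain z where z: "z \<in> alg_homs A B \<beta> S \<alpha>" "z x = y x \<oplus>\<^bsub>S\<^esub> ?t"
      using alg_hom_exists [OF S, of "y x \<oplus>\<^bsub>S\<^esub> ?t"] yx(1) t(1) by auto
    have "\<exists>!z. z \<in> alg_homs A B \<beta> S \<alpha> \<and> z x = y x \<oplus>\<^bsub>S\<^esub> ?t"
    proof (rule ex1I [of _ z])
      show "z \<in> alg_homs A B \<beta> S \<alpha> \<and> z x = y x \<oplus>\<^bsub>S\<^esub> ?t" using z ..
      fix w assume w: "w \<in> alg_homs A B \<beta> S \<alpha> \<and> w x = y x \<oplus>\<^bsub>S\<^esub> ?t"
      show "w = z" by (rule alg_hom_eqI [OF _ z(1) S]) (use w z(2) in simp_all)
    qed
    from theI' [OF this] show ?thesis using y by (simp add: act_def)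
  qed
  have tors: "torsor A \<iota> B \<beta> G act"
    unfolding torsor_def
  proof (intro conjI allI impI)
    show "algebra_over A B \<beta>" by (rule algebra_over)
    show "\<exists>d>0. module_free A B \<beta> d" using free p by (intro exI [of _ p]) simp
  next
    fix S :: "'c ring" and \<alpha> assume S: "algebra_over A S \<alpha>"
    interpret S: cring_char S p by (rule chS [OF S])
    interpret G: group "pts G S (\<alpha> \<circ> \<iota>)" by (rule grp [OF alg [OF S]])
    let ?E = "alg_homs A B \<beta> S \<alpha>" and ?\<theta> = "\<theta> S (\<alpha> \<circ> \<iota>)" and ?G = "pts G S (\<alpha> \<circ> \<iota>)"
    note a = ac [OF S, THEN conjunct1] ac [OF S, THEN conjunct2]
    note tc = \<theta>K [OF S, THEN conjunct1]
    note yc = alg_homD(2) [OF _ S]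
    have one: "?\<theta> \<one>\<^bsub>?G\<^esub> = \<zero>\<^bsub>S\<^esub>"
      using mult [OF alg [OF S], of "\<one>\<^bsub>?G\<^esub>" "\<one>\<^bsub>?G\<^esub>"] tc [of "\<one>\<^bsub>?G\<^esub>"] by simp
    have inv: "act S \<alpha> g (act S \<alpha> (inv\<^bsub>?G\<^esub> g) y) = y" if g: "g \<in> carrier ?G" and y: "y \<in> ?E" for g y
    proof (rule alg_hom_eqI [OF _ y S])
      have gi: "inv\<^bsub>?G\<^esub> g \<in> carrier ?G" using g by simp
      show "act S \<alpha> g (act S \<alpha> (inv\<^bsub>?G\<^esub> g) y) \<in> ?E" using g y gi by (intro a)
      have "?\<theta> (inv\<^bsub>?G\<^esub> g) \<oplus>\<^bsub>S\<^esub> ?\<theta> g = \<zero>\<^bsub>S\<^esub>"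
        using mult [OF alg [OF S] gi g] one g by simp
      then show "act S \<alpha> g (act S \<alpha> (inv\<^bsub>?G\<^esub> g) y) x = y x"
        using g y gi a(1) [OF gi y] yc [OF y] tc [OF g] tc [OF gi] by (simp add: a(2) S.a_assoc)
    qed
    have bij: "act S \<alpha> g \<in> Bij ?E" if g: "g \<in> carrier ?G" for g
    proof -
      have "bij_betw (act S \<alpha> g) ?E ?E"
      proof (rule bij_betwI')
        fix y z assume y: "y \<in> ?E" and z: "z \<in> ?E"
        show "act S \<alpha> g y = act S \<alpha> g z \<longleftrightarrow> y = z"
        proof
          assume "act S \<alpha> g y = act S \<alpha> g z"
          then have "y x \<oplus>\<^bsub>S\<^esub> ?\<theta> g = z x \<oplus>\<^bsub>S\<^esub> ?\<theta> g" using a(2) [OF g y] a(2) [OF g z] by simp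
          then have "y x = z x" using yc [OF y] yc [OF z] tc [OF g] by simp
          then show "y = z" by (rule alg_hom_eqI [OF y z S])
        qed simp
      next
        fix y assume "y \<in> ?E" then show "act S \<alpha> g y \<in> ?E" by (rule a(1) [OF g])
      next
        fix y assume y: "y \<in> ?E"
        have "act S \<alpha> (inv\<^bsub>?G\<^esub> g) y \<in> ?E" using g y by (intro a) simp_all
        then show "\<exists>z\<in>?E. y = act S \<alpha> g z" using inv [OF g y, symmetric]
          by (intro bexI [of _ "act S \<alpha> (inv\<^bsub>?G\<^esub> g) y"])
      qed
      then show ?thesis by (simp add: Bij_def act_def)
    qed
    show "group_action ?G ?E (act S \<alpha>)"
      unfolding group_action_def
    proof (intro group_hom.intro group_hom_axioms.intro grp [OF alg [OF S]] group_BijGroup homI)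
      fix g h assume g: "g \<in> carrier ?G" and h: "h \<in> carrier ?G"
      have "act S \<alpha> (g \<otimes>\<^bsub>?G\<^esub> h) = compose ?E (act S \<alpha> g) (act S \<alpha> h)"
      proof (rule extensionalityI [of _ ?E])
        show "act S \<alpha> (g \<otimes>\<^bsub>?G\<^esub> h) \<in> extensional ?E" by (simp add: act_def)
        show "compose ?E (act S \<alpha> g) (act S \<alpha> h) \<in> extensional ?E" by simp
        fix y assume y: "y \<in> ?E"
        have gh: "g \<otimes>\<^bsub>?G\<^esub> h \<in> carrier ?G" using g h by simp
        have "act S \<alpha> (g \<otimes>\<^bsub>?G\<^esub> h) y = act S \<alpha> g (act S \<alpha> h y)"
          by (rule alg_hom_eqI [OF a(1) [OF gh y] a(1) [OF g a(1) [OF h y]] S])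
             (use a(2) [OF gh y] a(2) [OF g a(1) [OF h y]] a(2) [OF h y] mult [OF alg [OF S] g h] yc [OF y] tc [OF g] tc [OF h]
               in \<open>simp add: S.a_ac\<close>)
        then show "act S \<alpha> (g \<otimes>\<^bsub>?G\<^esub> h) y = compose ?E (act S \<alpha> g) (act S \<alpha> h) y" using y by (simp add: compose_eq)
      qed
      then show "act S \<alpha> (g \<otimes>\<^bsub>?G\<^esub> h) = act S \<alpha> g \<otimes>\<^bsub>BijGroup ?E\<^esub> act S \<alpha> h"
        using bij [OF g] bij [OF h] by (simp add: BijGroup_def)
    next
      fix g assume "g \<in> carrier ?G"
      then show "act S \<alpha> g \<in> carrier (BijGroup ?E)" using bij by (simp add: BijGroup_def)
    qed
    show "\<forall>y\<in>?E. \<forall>z\<in>?E. \<exists>!g. g \<in> carrier ?G \<and> act S \<alpha> g y = z"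
    proof (intro ballI)
      fix y z assume y: "y \<in> ?E" and z: "z \<in> ?E"
      have cu: "\<alpha> c \<in> carrier S" "\<alpha> u \<in> carrier S"
        using S c u ring_hom_closed [of \<alpha> A S] by (auto simp: algebra_over_def)
      \<comment> \<open>The difference of the two roots is the only possible value of \<theta> at
        the group element sought.\<close>
      let ?d = "z x \<ominus>\<^bsub>S\<^esub> y x"
      have "?d [^]\<^bsub>S\<^esub> p = (\<alpha> c \<otimes>\<^bsub>S\<^esub> z x \<oplus>\<^bsub>S\<^esub> \<alpha> u) \<ominus>\<^bsub>S\<^esub> (\<alpha> c \<otimes>\<^bsub>S\<^esub> y x \<oplus>\<^bsub>S\<^esub> \<alpha> u)"
        unfolding S.frob_minus [OF yc [OF z] yc [OF y]] alg_homD(3) [OF y S] alg_homD(3) [OF z S] ..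
      also have "\<dots> = \<alpha> c \<otimes>\<^bsub>S\<^esub> ?d" using cu yc [OF y] yc [OF z] by algebra
      finally have "?d \<in> {s \<in> carrier S. s [^]\<^bsub>S\<^esub> p = (\<alpha> \<circ> \<iota>) c0 \<otimes>\<^bsub>S\<^esub> s}"
        using yc [OF y] yc [OF z] by (simp add: c0)
      then have "?d \<in> ?\<theta> ` carrier ?G" using \<theta> [OF alg [OF S]] by (simp add: bij_betw_def)
      then obtain g where g: "?d = ?\<theta> g" "g \<in> carrier ?G" by (rule imageE)
      have e: "z x = y x \<oplus>\<^bsub>S\<^esub> ?\<theta> g" using S.eq_add_if_minus_eq [OF g(1)] yc [OF y] yc [OF z] tc [OF g(2)] by simp
      show "\<exists>!g. g \<in> carrier ?G \<and> act S \<alpha> g y = z"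
      proof (rule ex1I [of _ g])
        have "act S \<alpha> g y = z" by (rule alg_hom_eqI [OF a(1) [OF g(2) y] z S]) (simp only: a(2) [OF g(2) y] e)
        with g(2) show "g \<in> carrier ?G \<and> act S \<alpha> g y = z" ..
        fix h assume h: "h \<in> carrier ?G \<and> act S \<alpha> h y = z"
        then have "z x = y x \<oplus>\<^bsub>S\<^esub> ?\<theta> h" using a(2) [of h y] y by auto
        then have "\<ominus>\<^bsub>S\<^esub> y x \<oplus>\<^bsub>S\<^esub> (y x \<oplus>\<^bsub>S\<^esub> ?\<theta> h) = \<ominus>\<^bsub>S\<^esub> y x \<oplus>\<^bsub>S\<^esub> (y x \<oplus>\<^bsub>S\<^esub> ?\<theta> g)" using e by simp
        then have "?\<theta> h = ?\<theta> g" using yc [OF y] tc [OF g(2)] tc [of h] h by (simp add: S.r_neg1)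
        then show "h = g" using inj_onD [OF bij_betw_imp_inj_on [OF \<theta> [OF alg [OF S]]]] h g(2) by blast
      qed
    qed
  next
    fix S S' :: "'c ring" and \<alpha> \<alpha>' \<phi>
    assume "algebra_over A S \<alpha> \<and> algebra_over A S' \<alpha>' \<and> \<phi> \<in> alg_homs A S \<alpha> S' \<alpha>'"
    then have S: "algebra_over A S \<alpha>" and S': "algebra_over A S' \<alpha>'" and \<phi>: "\<phi> \<in> alg_homs A S \<alpha> S' \<alpha>'" by auto
    have \<phi>R: "\<phi> \<in> alg_homs R S (\<alpha> \<circ> \<iota>) S' (\<alpha>' \<circ> \<iota>)"
      using \<phi> ring_hom_closed [OF \<iota>] by (simp add: alg_homs_def)
    have \<phi>h: "\<phi> \<in> ring_hom S S'" using \<phi> by (simp add: alg_homs_def)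
    note comp = compose_alg_hom [OF _ \<phi>]
    show "\<forall>g\<in>carrier (pts G S (\<alpha> \<circ> \<iota>)). \<forall>y\<in>alg_homs A B \<beta> S \<alpha>.
      act S' \<alpha>' (pmap G \<phi> g) (compose (carrier B) \<phi> y) = compose (carrier B) \<phi> (act S \<alpha> g y)"
    proof (intro ballI)
      fix g y assume g: "g \<in> carrier (pts G S (\<alpha> \<circ> \<iota>))" and y: "y \<in> alg_homs A B \<beta> S \<alpha>"
      have pg: "pmap G \<phi> g \<in> carrier (pts G S' (\<alpha>' \<circ> \<iota>))" "\<theta> S' (\<alpha>' \<circ> \<iota>) (pmap G \<phi> g) = \<phi> (\<theta> S (\<alpha> \<circ> \<iota>) g)"
        using nat [OF alg [OF S] alg [OF S'] \<phi>R g] by auto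
      show "act S' \<alpha>' (pmap G \<phi> g) (compose (carrier B) \<phi> y) = compose (carrier B) \<phi> (act S \<alpha> g y)"
      proof (rule alg_hom_eqI [OF _ _ S'])
        show "act S' \<alpha>' (pmap G \<phi> g) (compose (carrier B) \<phi> y) \<in> alg_homs A B \<beta> S' \<alpha>'"
          using ac [OF S' pg(1) comp [OF y]] ..
        show "compose (carrier B) \<phi> (act S \<alpha> g y) \<in> alg_homs A B \<beta> S' \<alpha>'"
          using ac [OF S g y] by (intro comp) simp
        have "act S' \<alpha>' (pmap G \<phi> g) (compose (carrier B) \<phi> y) x = \<phi> (y x) \<oplus>\<^bsub>S'\<^esub> \<phi> (\<theta> S (\<alpha> \<circ> \<iota>) g)"
          using ac [OF S' pg(1) comp [OF y]] pg(2) x by (simp add: compose_eq)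
        also have "\<dots> = \<phi> (y x \<oplus>\<^bsub>S\<^esub> \<theta> S (\<alpha> \<circ> \<iota>) g)"
          using ring_hom_add [OF \<phi>h alg_homD(2) [OF y S]] \<theta>K [OF S g] by simp
        also have "\<dots> = compose (carrier B) \<phi> (act S \<alpha> g y) x"
          using ac [OF S g y] x by (simp add: compose_eq)
        finally show "act S' \<alpha>' (pmap G \<phi> g) (compose (carrier B) \<phi> y) x = compose (carrier B) \<phi> (act S \<alpha> g y) x" .
      qed
    qed
  qed
  show ?thesis
  proof (intro exI [of _ act] conjI allI impI tors)
    fix S :: "'c ring" and \<alpha> g y
    assume "algebra_over A S \<alpha> \<and> g \<in> carrier (pts G S (\<alpha> \<circ> \<iota>)) \<and> y \<in> alg_homs A B \<beta> S \<alpha>"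
    then show "act S \<alpha> g y x = y x \<oplus>\<^bsub>S\<^esub> \<theta> S (\<alpha> \<circ> \<iota>) g" using ac by blast
  qed
qed

section \<open>Idempotent families and the constant group scheme\<close>

context cring_char
begin

text \<open>The points of \<open>const_Zp p\<close>, which do not involve the structure map of the
  algebra.\<close>

definition zp :: "(nat \<Rightarrow> 'a) set"
  where "zp = {e \<in> {..<p} \<rightarrow>\<^sub>E carrier R. (\<forall>i<p. \<forall>j<p. e i \<otimes> e j = (if i = j then e i else \<zero>)) \<and>
    (\<Oplus>i\<in>{..<p}. e i) = \<one>}"

text \<open>The locally constant function itself, with its values read in the prime field. It embeds
  the constant group in the additive group as the kernel of X^p - X.\<close>

definition zth :: "(nat \<Rightarrow> 'a) \<Rightarrow> 'a"
  where "zth e = (\<Oplus>i\<in>{..<p}. \<guillemotleft>int i\<guillemotright> \<otimes> e i)"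

text \<open>For a root s of X^p = X this is, by Fermat, the indicator of the locus where s takes the
  value j.\<close>

definition idem :: "'a \<Rightarrow> nat \<Rightarrow> 'a"
  where "idem s j = \<one> \<ominus> (s \<ominus> \<guillemotleft>int j\<guillemotright>) [^] (p - 1)"

lemma zpD:
  assumes "e \<in> zp"
  shows "i < p \<Longrightarrow> e i \<in> carrier R" "i < p \<Longrightarrow> j < p \<Longrightarrow> e i \<otimes> e j = (if i = j then e i else \<zero>)"
    "(\<Oplus>i\<in>{..<p}. e i) = \<one>" "e \<in> extensional {..<p}"
  using assms by (auto simp: zp_def PiE_def)

lemma zth_closed: "e \<in> zp \<Longrightarrow> zth e \<in> carrier R"
  unfolding zth_def using zpD(1) by (intro finsum_closed) auto

lemma idem_closed: "s \<in> carrier R \<Longrightarrow> idem s j \<in> carrier R"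
  by (simp add: idem_def)

lemma sum_single:
  assumes j: "j < p" and w: "w \<in> carrier R"
  shows "(\<Oplus>i\<in>{..<p}. if i = j then w else \<zero>) = w"
  using j w by (intro add.finprod_singleton_swap) auto

lemma zth_mult:
  assumes e: "e \<in> zp" and j: "j < p" shows "zth e \<otimes> e j = \<guillemotleft>int j\<guillemotright> \<otimes> e j"
proof -
  note c = zpD(1) [OF e]
  have "zth e \<otimes> e j = (\<Oplus>i\<in>{..<p}. (\<guillemotleft>int i\<guillemotright> \<otimes> e i) \<otimes> e j)"
    unfolding zth_def using c j by (intro finsum_ldistr) auto
  also have "\<dots> = (\<Oplus>i\<in>{..<p}. if i = j then \<guillemotleft>int j\<guillemotright> \<otimes> e j else \<zero>)"
    using c j zpD(2) [OF e] by (intro finsum_cong') (auto simp: m_assoc)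
  also have "\<dots> = \<guillemotleft>int j\<guillemotright> \<otimes> e j" using c j by (intro sum_single) auto
  finally show ?thesis .
qed

lemma zth_pow: assumes e: "e \<in> zp" shows "zth e [^] p = zth e"
proof -
  have pw: "e i [^] Suc n = e i" if i: "i < p" for i n
    using zpD(1,2) [OF e] i by (induction n) auto
  have "e i [^] p = e i" if "i < p" for i using pw [OF that, of "p - 1"] p_gt_1 by simp
  then have "(\<guillemotleft>int i\<guillemotright> \<otimes> e i) [^] p = \<guillemotleft>int i\<guillemotright> \<otimes> e i" if "i < p" for i
    using that zpD(1) [OF e] by (subst nat_pow_distrib) (auto simp: fermat_of_int)
  then show ?thesis unfolding zth_def using zpD(1) [OF e]
    by (subst frob_finsum) (auto intro!: finsum_cong')
qed

text \<open>If s acts on w as the integer m, then \<open>idem s k\<close> acts as 1 - (m - k)^(p-1),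
  which is 1 or 0 by Fermat.\<close>

lemma idem_mult:
  assumes s: "s \<in> carrier R" and w: "w \<in> carrier R" and eq: "s \<otimes> w = \<guillemotleft>m\<guillemotright> \<otimes> w"
  shows "idem s k \<otimes> w = (if [m = int k] (mod int p) then w else \<zero>)"
proof -
  define d where "d = s \<ominus> \<guillemotleft>int k\<guillemotright>"
  have d: "d \<in> carrier R" using s by (simp add: d_def)
  have "d \<otimes> w = s \<otimes> w \<ominus> \<guillemotleft>int k\<guillemotright> \<otimes> w" unfolding d_def using s w by (simp add: minus_eq l_distr l_minus)
  also have "\<dots> = \<guillemotleft>m - int k\<guillemotright> \<otimes> w" unfolding eq using w by (simp add: minus_eq l_distr l_minus of_int_diff)
  finally have dw: "d \<otimes> w = \<guillemotleft>m - int k\<guillemotright> \<otimes> w" .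
  have pow: "d [^] n \<otimes> w = \<guillemotleft>m - int k\<guillemotright> [^] n \<otimes> w" for n :: nat
  proof (induction n)
    case (Suc n)
    have "d [^] Suc n \<otimes> w = d [^] n \<otimes> (d \<otimes> w)" using d w by (simp add: m_assoc)
    also have "\<dots> = \<guillemotleft>m - int k\<guillemotright> \<otimes> (d [^] n \<otimes> w)" unfolding dw using d w by (simp only: m_lcomm nat_pow_closed of_int_closed)
    also have "\<dots> = \<guillemotleft>m - int k\<guillemotright> [^] Suc n \<otimes> w" unfolding Suc using w by (simp only: nat_pow_Suc m_ac nat_pow_closed of_int_closed)
    finally show ?case .
  qed (use w in simp)
  have e: "idem s k \<otimes> w = w \<ominus> \<guillemotleft>m - int k\<guillemotright> [^] (p - 1) \<otimes> w"
    unfolding idem_def d_def [symmetric] pow [symmetric] using d w by (simp add: minus_eq l_distr l_minus)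
  show ?thesis
  proof (cases "[m = int k] (mod int p)")
    case True
    then have "int p dvd m - int k" by (simp add: cong_iff_dvd_diff)
    then have z: "\<guillemotleft>m - int k\<guillemotright> = \<zero>" by (rule of_int_dvd)
    have "p - 1 \<noteq> 0" using p_gt_1 by simp
    then have "\<zero> [^] (p - 1) = \<zero>" by (simp add: nat_pow_zero)
    then show ?thesis unfolding e z using True w by (simp add: minus_eq)
  next
    case False
    then have "\<not> int p dvd m - int k" by (simp add: cong_iff_dvd_diff)
    from fermat_of_int_unit [OF this] show ?thesis unfolding e using False w by (simp add: minus_eq r_neg)
  qed
qed

lemma cong_small: "i < p \<Longrightarrow> j < p \<Longrightarrow> [int i = int j] (mod int p) \<longleftrightarrow> i = j"
  by (simp add: cong_int_iff cong_def)

text \<open>Multiply by 1, written as the sum of the e_i: \<open>zth e\<close> acts on e_i as the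
  integer i, so only the summand with i = j survives.\<close>

lemma idem_zth:
  assumes e: "e \<in> zp" and j: "j < p" shows "idem (zth e) j = e j"
proof -
  note c = zpD(1) [OF e] and t = zth_closed [OF e]
  have "idem (zth e) j = idem (zth e) j \<otimes> (\<Oplus>i\<in>{..<p}. e i)"
    unfolding zpD(3) [OF e] using idem_closed [OF t] by simp
  also have "\<dots> = (\<Oplus>i\<in>{..<p}. idem (zth e) j \<otimes> e i)"
    using c idem_closed [OF t] by (intro finsum_rdistr) auto
  also have "\<dots> = (\<Oplus>i\<in>{..<p}. if i = j then e j else \<zero>)"
    using c j idem_mult [OF t c zth_mult [OF e]] cong_small [of _ j] by (intro finsum_cong') auto
  also have "\<dots> = e j" using c j by (intro sum_single) auto
  finally show ?thesis .
qed

lemma idem_family: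
  assumes s: "s \<in> carrier R" and root: "s [^] p = s"
  shows "(\<lambda>j\<in>{..<p}. idem s j) \<in> zp" "zth (\<lambda>j\<in>{..<p}. idem s j) = s"
proof -
  note ic = idem_closed [OF s]
  have si: "s \<otimes> idem s j = \<guillemotleft>int j\<guillemotright> \<otimes> idem s j" for j
  proof -
    define d where "d = s \<ominus> \<guillemotleft>int j\<guillemotright>"
    have d: "d \<in> carrier R" using s by (simp add: d_def)
    have "d [^] p = d" unfolding d_def using s root by (simp add: frob_minus fermat_of_int)
    moreover have "d \<otimes> d [^] (p - 1) = d [^] p"
      using d p_gt_1 nat_pow_Suc2 [OF d, of "p - 1"] by simp
    ultimately have "d \<otimes> idem s j = \<zero>"
      unfolding idem_def d_def [symmetric] using d by (simp add: minus_eq r_distr r_minus r_neg)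
    moreover have "d \<otimes> idem s j = s \<otimes> idem s j \<ominus> \<guillemotleft>int j\<guillemotright> \<otimes> idem s j"
      unfolding d_def using s ic by (simp add: minus_eq l_distr l_minus)
    ultimately show ?thesis using s ic by simp
  qed
  have prod: "idem s i \<otimes> idem s j = (if i = j then idem s i else \<zero>)" if "i < p" "j < p" for i j
    using idem_mult [OF s ic si, of i j] cong_small [OF that(2,1)] by auto
  have "\<guillemotleft>-1\<guillemotright> [^] (p - 1) = \<one>"
    using p_gt_1 by (intro fermat_of_int_unit) (auto dest: zdvd_imp_le)
  then have m1: "(\<ominus> \<one>) [^] (p - 1) = \<one>" by simp
  have "(\<Oplus>i\<in>{..<p}. \<one>) = (\<Oplus>i\<in>{..<p}. \<guillemotleft>1\<guillemotright>)" by simp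
  also have "\<dots> = \<guillemotleft>int p\<guillemotright>" by (subst finsum_of_int) simp_all
  finally have sum1: "(\<Oplus>i\<in>{..<p}. \<one>) = \<zero>" by simp
  have sm: "(\<Oplus>j\<in>{..<p}. idem s j) = \<one>"
  proof -
    \<comment> \<open>The sum of all (s - j)^(p-1) is -1 by \<open>shifted_power_sum\<close> with y
      = -1, while the p summands 1 add up to 0.\<close>
    let ?t = "\<lambda>i. (s \<oplus> \<guillemotleft>int i\<guillemotright> \<otimes> \<ominus> \<one>) [^] (p - 1)"
    have t: "?t i \<in> carrier R" for i using s by simp
    have "(\<Oplus>j\<in>{..<p}. idem s j) \<oplus> (\<Oplus>j\<in>{..<p}. ?t j) = (\<Oplus>j\<in>{..<p}. idem s j \<oplus> ?t j)"
      using ic t by (intro finsum_addf [symmetric]) auto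
    also have "\<dots> = (\<Oplus>j\<in>{..<p}. \<one>)"
    proof (rule finsum_cong')
      fix j
      have "?t j = (s \<ominus> \<guillemotleft>int j\<guillemotright>) [^] (p - 1)" using s by (simp add: minus_eq r_minus)
      then show "idem s j \<oplus> ?t j = \<one>" unfolding idem_def using s by (simp add: minus_eq a_assoc l_neg)
    qed auto
    finally have a: "(\<Oplus>j\<in>{..<p}. idem s j) \<oplus> (\<Oplus>j\<in>{..<p}. ?t j) = \<zero>" unfolding sum1 .
    have "(\<Oplus>j\<in>{..<p}. ?t j) = \<ominus> \<one>"
      using shifted_power_sum [OF s, of "\<ominus> \<one>" "p - 1"] p_gt_1 m1 by simp
    with a have "(\<Oplus>j\<in>{..<p}. idem s j) \<oplus> \<ominus> \<one> = \<zero>" by simp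
    moreover have sc: "(\<Oplus>j\<in>{..<p}. idem s j) \<in> carrier R" using ic by (intro finsum_closed) auto
    ultimately show ?thesis using r_right_minus_eq [of "\<Oplus>j\<in>{..<p}. idem s j" \<one>] by (simp add: minus_eq)
  qed
  have rs: "(\<Oplus>j\<in>{..<p}. (\<lambda>j\<in>{..<p}. idem s j) j) = (\<Oplus>j\<in>{..<p}. idem s j)"
    using ic by (intro finsum_cong') auto
  show "(\<lambda>j\<in>{..<p}. idem s j) \<in> zp" unfolding zp_def mem_Collect_eq rs using ic prod sm by auto
  have "zth (\<lambda>j\<in>{..<p}. idem s j) = (\<Oplus>j\<in>{..<p}. s \<otimes> idem s j)"
    unfolding zth_def using ic s si by (intro finsum_cong') auto
  also have "\<dots> = s \<otimes> (\<Oplus>j\<in>{..<p}. idem s j)" using ic s by (intro finsum_rdistr [symmetric]) auto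
  finally show "zth (\<lambda>j\<in>{..<p}. idem s j) = s" unfolding sm using s by simp
qed

lemma zth_bij: "bij_betw zth zp {s \<in> carrier R. s [^] p = s}"
proof (rule bij_betw_byWitness [where f' = "\<lambda>s. \<lambda>j\<in>{..<p}. idem s j"])
  show "\<forall>e\<in>zp. (\<lambda>j\<in>{..<p}. idem (zth e) j) = e"
  proof
    fix e assume e: "e \<in> zp"
    show "(\<lambda>j\<in>{..<p}. idem (zth e) j) = e"
      by (rule extensionalityI [of _ "{..<p}"]) (use zpD(4) [OF e] idem_zth [OF e] in auto)
  qed
qed (use idem_family zth_closed zth_pow in auto)

definition zmult :: "(nat \<Rightarrow> 'a) \<Rightarrow> (nat \<Rightarrow> 'a) \<Rightarrow> nat \<Rightarrow> 'a"
  where "zmult e f = (\<lambda>k\<in>{..<p}. \<Oplus>i\<in>{..<p}. e i \<otimes> f ((k + p - i) mod p))"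

text \<open>The index that \<open>const_Zp\<close> pairs with i in the k-th value of a product.
  Adding p first keeps the natural subtraction from being cut off.\<close>

lemma cong_sum_small:
  assumes "i < p" "j < p" "k < p"
  shows "[int i + int j = int k] (mod int p) \<longleftrightarrow> j = (k + p - i) mod p"
proof -
  have m1: "(i + j) mod p = (if i + j < p then i + j else i + j - p)"
    using assms by (auto simp: mod_if)
  have m2: "(k + p - i) mod p = (if i \<le> k then k - i else k + p - i)"
  proof (cases "i \<le> k")
    case True
    then have e: "k + p - i = (k - i) + p" by simp
    have "(k + p - i) mod p = (k - i) mod p" unfolding e by (rule mod_add_self2)
    also have "\<dots> = k - i" using assms by (intro mod_less) linarith
    finally show ?thesis using True by (simp only: if_True)
  qed (use assms in simp)
  have "[int i + int j = int k] (mod int p) \<longleftrightarrow> (i + j) mod p = k"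
    using assms cong_int_iff [of "i + j" k p] by (simp add: cong_def)
  then show ?thesis unfolding m1 m2 using assms by auto
qed

text \<open>The k-th idempotent of s = zth e + zth f is multiplied by 1 = (sum of the e_i)(sum of
  the f_j). Since s acts on e_i f_j as i + j, exactly the pairs with i + j = k modulo p remain, and
  these form the convolution.\<close>

lemma zmult:
  assumes e: "e \<in> zp" and f: "f \<in> zp"
  shows "zmult e f \<in> zp" "zth (zmult e f) = zth e \<oplus> zth f"
proof -
  define s where "s = zth e \<oplus> zth f"
  note ec = zpD(1) [OF e] and fc = zpD(1) [OF f] and te = zth_closed [OF e] and tf = zth_closed [OF f]
  have s: "s \<in> carrier R" using te tf by (simp add: s_def)
  have root: "s [^] p = s" unfolding s_def using te tf by (simp add: frob_add zth_pow e f)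
  have sef: "s \<otimes> (e i \<otimes> f j) = \<guillemotleft>int i + int j\<guillemotright> \<otimes> (e i \<otimes> f j)" if i: "i < p" and j: "j < p" for i j
  proof -
    have c: "zth e \<in> carrier R" "zth f \<in> carrier R" "e i \<in> carrier R" "f j \<in> carrier R" using te tf ec fc i j by auto
    have "s \<otimes> (e i \<otimes> f j) = (zth e \<otimes> e i) \<otimes> f j \<oplus> e i \<otimes> (zth f \<otimes> f j)"
      unfolding s_def using c by algebra
    also have "\<dots> = (\<guillemotleft>int i\<guillemotright> \<otimes> e i) \<otimes> f j \<oplus> e i \<otimes> (\<guillemotleft>int j\<guillemotright> \<otimes> f j)"
      unfolding zth_mult [OF e i] zth_mult [OF f j] ..
    also have "\<dots> = (\<guillemotleft>int i\<guillemotright> \<oplus> \<guillemotleft>int j\<guillemotright>) \<otimes> (e i \<otimes> f j)"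
      using c(3,4) of_int_closed [of "int i"] of_int_closed [of "int j"] by algebra
    finally show ?thesis by simp
  qed
  have id: "idem s k = (\<Oplus>i\<in>{..<p}. e i \<otimes> f ((k + p - i) mod p))" if k: "k < p" for k
  proof -
    note ik = idem_closed [OF s, of k]
    have m: "(k + p - i) mod p < p" for i using p_gt_1 by simp
    have "idem s k = idem s k \<otimes> ((\<Oplus>i\<in>{..<p}. e i) \<otimes> (\<Oplus>j\<in>{..<p}. f j))"
      unfolding zpD(3) [OF e] zpD(3) [OF f] using ik by simp
    also have "(\<Oplus>i\<in>{..<p}. e i) \<otimes> (\<Oplus>j\<in>{..<p}. f j) = (\<Oplus>i\<in>{..<p}. e i \<otimes> (\<Oplus>j\<in>{..<p}. f j))"
      using ec fc by (intro finsum_ldistr finsum_closed) auto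
    also have "idem s k \<otimes> \<dots> = (\<Oplus>i\<in>{..<p}. idem s k \<otimes> (e i \<otimes> (\<Oplus>j\<in>{..<p}. f j)))"
      using ec fc ik by (intro finsum_rdistr) (auto intro!: finsum_closed)
    also have "\<dots> = (\<Oplus>i\<in>{..<p}. e i \<otimes> f ((k + p - i) mod p))"
    proof (rule finsum_cong')
      fix i assume "i \<in> {..<p}"
      then have i: "i < p" by simp
      have "e i \<otimes> (\<Oplus>j\<in>{..<p}. f j) = (\<Oplus>j\<in>{..<p}. e i \<otimes> f j)"
        using ec [OF i] fc by (intro finsum_rdistr) auto
      then have "idem s k \<otimes> (e i \<otimes> (\<Oplus>j\<in>{..<p}. f j)) = idem s k \<otimes> (\<Oplus>j\<in>{..<p}. e i \<otimes> f j)" by simp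
      also have "\<dots> = (\<Oplus>j\<in>{..<p}. idem s k \<otimes> (e i \<otimes> f j))"
        using ik ec [OF i] fc by (intro finsum_rdistr) auto
      also have "\<dots> = (\<Oplus>j\<in>{..<p}. if j = (k + p - i) mod p then e i \<otimes> f ((k + p - i) mod p) else \<zero>)"
      proof (rule finsum_cong')
        fix j assume "j \<in> {..<p}"
        then have j: "j < p" by simp
        have "idem s k \<otimes> (e i \<otimes> f j) = (if [int i + int j = int k] (mod int p) then e i \<otimes> f j else \<zero>)"
          using ec [OF i] fc [OF j] by (intro idem_mult [OF s _ sef [OF i j]]) simp
        then show "idem s k \<otimes> (e i \<otimes> f j) = (if j = (k + p - i) mod p then e i \<otimes> f ((k + p - i) mod p) else \<zero>)"
          unfolding cong_sum_small [OF i j k] by auto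
      qed (use ec [OF i] fc [OF m] in auto)
      also have "\<dots> = e i \<otimes> f ((k + p - i) mod p)"
        using ec [OF i] fc [OF m] by (intro sum_single [OF m]) simp
      finally show "idem s k \<otimes> (e i \<otimes> (\<Oplus>j\<in>{..<p}. f j)) = e i \<otimes> f ((k + p - i) mod p)" .
    qed (use ec fc [OF m] in auto)
    finally show ?thesis .
  qed
  have "zmult e f = (\<lambda>k\<in>{..<p}. idem s k)" unfolding zmult_def by (rule restrict_ext) (use id in simp)
  then show "zmult e f \<in> zp" "zth (zmult e f) = zth e \<oplus> zth f"
    using idem_family [OF s root] by (simp_all add: s_def)
qed

lemma zp_one: "(\<lambda>i\<in>{..<p}. if i = 0 then \<one> else \<zero>) \<in> zp" "zth (\<lambda>i\<in>{..<p}. if i = 0 then \<one> else \<zero>) = \<zero>"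
proof -
  have "(\<Oplus>i\<in>{..<p}. (\<lambda>i\<in>{..<p}. if i = 0 then \<one> else \<zero>) i) = (\<Oplus>i\<in>{..<p}. if i = 0 then \<one> else \<zero>)"
    by (intro finsum_cong') auto
  also have "\<dots> = \<one>" using p_gt_1 by (intro sum_single) auto
  finally have s: "(\<Oplus>i\<in>{..<p}. (\<lambda>i\<in>{..<p}. if i = 0 then \<one> else \<zero>) i) = \<one>" .
  show "(\<lambda>i\<in>{..<p}. if i = 0 then \<one> else \<zero>) \<in> zp" unfolding zp_def mem_Collect_eq s by auto
  have "zth (\<lambda>i\<in>{..<p}. if i = 0 then \<one> else \<zero>) = (\<Oplus>i\<in>{..<p}. \<zero>)"
    unfolding zth_def by (intro finsum_cong') auto
  then show "zth (\<lambda>i\<in>{..<p}. if i = 0 then \<one> else \<zero>) = \<zero>" by simp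
qed

lemma zth_add_pow: "e \<in> zp \<Longrightarrow> (\<Oplus>i\<in>{..<p}. [i] \<cdot> e i) = zth e"
  unfolding zth_def using zpD(1) by (intro finsum_cong') (auto simp: add_pow_eq_of_int)

end

locale char_ring = cring_char R p for R :: "'a ring" (structure) and p
begin

lemma const_Zp_pts:
  fixes \<tau> :: "'k \<Rightarrow> 'a"
  shows
  "carrier (pts (const_Zp p) R \<tau>) = zp" "e \<otimes>\<^bsub>pts (const_Zp p) R \<tau>\<^esub> f = zmult e f"
  "\<one>\<^bsub>pts (const_Zp p) R \<tau>\<^esub> = (\<lambda>i\<in>{..<p}. if i = 0 then \<one> else \<zero>)"
  by (simp_all add: const_Zp_def zp_def zmult_def)

lemma group_const_Zp:
  fixes \<tau> :: "'k \<Rightarrow> 'a"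
  shows "group (pts (const_Zp p) R \<tau>)"
proof (rule group_by_additive_bijection)
  show "bij_betw zth (carrier (pts (const_Zp p) R \<tau>)) {s \<in> carrier R. s [^] p = s}"
    unfolding const_Zp_pts by (rule zth_bij)
qed (auto simp: const_Zp_pts frob_neg zmult zp_one)

lemma M_group_pts:
  fixes K :: "'k ring" and \<sigma> :: "'k \<Rightarrow> 'a"
  assumes "\<sigma> (\<pi> [^]\<^bsub>K\<^esub> ((p - 1) * n)) \<in> carrier R"
  shows "carrier (pts (M_group K \<pi> p n) R \<sigma>) = {s \<in> carrier R. s [^] p = \<sigma> (\<pi> [^]\<^bsub>K\<^esub> ((p - 1) * n)) \<otimes> s}"
    "s \<otimes>\<^bsub>pts (M_group K \<pi> p n) R \<sigma>\<^esub> t = s \<oplus> t" "\<one>\<^bsub>pts (M_group K \<pi> p n) R \<sigma>\<^esub> = \<zero>"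
  using assms by (auto simp: M_group_def kernel_def)

lemma group_M_group:
  fixes K :: "'k ring" and \<sigma> :: "'k \<Rightarrow> 'a"
  assumes c: "\<sigma> (\<pi> [^]\<^bsub>K\<^esub> ((p - 1) * n)) \<in> carrier R"
  shows "group (pts (M_group K \<pi> p n) R \<sigma>)"
proof (rule group_by_additive_bijection [of "\<lambda>s. s"])
  show "bij_betw (\<lambda>s. s) (carrier (pts (M_group K \<pi> p n) R \<sigma>))
      {s \<in> carrier R. s [^] p = \<sigma> (\<pi> [^]\<^bsub>K\<^esub> ((p - 1) * n)) \<otimes> s}"
    unfolding M_group_pts [where K = K and \<sigma> = \<sigma> and \<pi> = \<pi> and n = n, OF c] by (simp add: bij_betw_def)
qed (use c in \<open>auto simp: M_group_pts [where K = K and \<sigma> = \<sigma> and \<pi> = \<pi> and n = n, OF c] frob_neg frob_add r_minus r_distr\<close>)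

end

lemma char_ring_algebra:
  assumes "cring R" "Factorial_Ring.prime p" "[p] \<cdot>\<^bsub>R\<^esub> \<one>\<^bsub>R\<^esub> = \<zero>\<^bsub>R\<^esub>" "algebra_over R S \<sigma>"
  shows "char_ring S p"
proof (intro char_ring.intro cring_char.intro cring_char_axioms.intro)
  show "cring S" using assms(4) by (simp add: algebra_over_def)
  show "[p] \<cdot>\<^bsub>S\<^esub> \<one>\<^bsub>S\<^esub> = \<zero>\<^bsub>S\<^esub>" by (rule ring_hom_char [OF assms(1,4,3)])
qed (rule assms(2))

lemma ring_hom_add_pow:
  assumes "cring R" "cring S" "h \<in> ring_hom R S" "a \<in> carrier R"
  shows "h ([(n::nat)] \<cdot>\<^bsub>R\<^esub> a) = [n] \<cdot>\<^bsub>S\<^esub> h a"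
proof -
  interpret ring_hom_cring R S h by (rule ring_hom_cringI) (rule assms)+
  show ?thesis using assms(4) by (induction n) simp_all
qed

context eqn_alg
begin

lemma torsor_M_group:
  fixes R :: "'r ring"
  assumes R: "cring R" and pr: "Factorial_Ring.prime p" and ch: "[p] \<cdot>\<^bsub>R\<^esub> \<one>\<^bsub>R\<^esub> = \<zero>\<^bsub>R\<^esub>"
    and \<iota>: "\<iota> \<in> ring_hom R A" and \<pi>: "\<pi> \<in> carrier R" and c0: "c = \<iota> (\<pi> [^]\<^bsub>R\<^esub> ((p - 1) * n))"
    and free: "module_free A B \<beta> p"
  shows "\<exists>act. torsor A \<iota> B \<beta> (M_group R \<pi> p n :: ('r, 'c, 'c) group_fun) act \<and>
    (\<forall>S \<alpha> g y. algebra_over A S \<alpha> \<and> g \<in> carrier (pts (M_group R \<pi> p n) S (\<alpha> \<circ> \<iota>)) \<and> y \<in> alg_homs A B \<beta> S \<alpha> \<longrightarrow>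
      act S \<alpha> g y x = y x \<oplus>\<^bsub>S\<^esub> g)"
proof -
  interpret R: cring R by (rule R)
  have chA: "[p] \<cdot>\<^bsub>A\<^esub> \<one>\<^bsub>A\<^esub> = \<zero>\<^bsub>A\<^esub>"
    by (rule ring_hom_char [OF R _ ch]) (use \<iota> A.is_cring in \<open>simp add: algebra_over_def\<close>)
  have pc: "\<pi> [^]\<^bsub>R\<^esub> ((p - 1) * n) \<in> carrier R" using \<pi> by simp
  have cr: "\<sigma> (\<pi> [^]\<^bsub>R\<^esub> ((p - 1) * n)) \<in> carrier S" if "algebra_over R S \<sigma>" for S :: "'c ring" and \<sigma>
    using that ring_hom_closed [OF _ pc, of \<sigma> S] by (simp add: algebra_over_def)
  note ci = char_ring_algebra [OF R pr ch]
  show ?thesis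
  proof (rule torsor_exists [where \<theta> = "\<lambda>S \<sigma> g. g" and ?c0.0 = "\<pi> [^]\<^bsub>R\<^esub> ((p - 1) * n)", OF pr chA \<iota> c0 free])
    fix S :: "'c ring" and \<sigma> assume S: "algebra_over R S \<sigma>"
    interpret S: char_ring S p by (rule ci [OF S])
    note pts = S.M_group_pts [where K = R and \<sigma> = \<sigma> and \<pi> = \<pi> and n = n, OF cr [OF S]]
    show "group (pts (M_group R \<pi> p n) S \<sigma>)" by (rule S.group_M_group [where K = R and \<sigma> = \<sigma> and \<pi> = \<pi> and n = n, OF cr [OF S]])
    show "bij_betw (\<lambda>g. g) (carrier (pts (M_group R \<pi> p n) S \<sigma>))
      {s \<in> carrier S. s [^]\<^bsub>S\<^esub> p = \<sigma> (\<pi> [^]\<^bsub>R\<^esub> ((p - 1) * n)) \<otimes>\<^bsub>S\<^esub> s}"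
      unfolding pts by (simp add: bij_betw_def)
    show "g \<otimes>\<^bsub>pts (M_group R \<pi> p n) S \<sigma>\<^esub> h = g \<oplus>\<^bsub>S\<^esub> h" for g h by (rule pts(2))
    fix S' :: "'c ring" and \<sigma>' \<phi> g
    assume S': "algebra_over R S' \<sigma>'" and \<phi>: "\<phi> \<in> alg_homs R S \<sigma> S' \<sigma>'"
      and g: "g \<in> carrier (pts (M_group R \<pi> p n) S \<sigma>)"
    interpret S': char_ring S' p by (rule ci [OF S'])
    have \<phi>': "\<phi> \<in> ring_hom S S'" "\<phi> (\<sigma> (\<pi> [^]\<^bsub>R\<^esub> ((p - 1) * n))) = \<sigma>' (\<pi> [^]\<^bsub>R\<^esub> ((p - 1) * n))"
      using \<phi> pc by (auto simp: alg_homs_def)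
    interpret \<phi>: ring_hom_cring S S' \<phi> by (rule ring_hom_cringI [OF S.is_cring S'.is_cring \<phi>'(1)])
    have g': "g \<in> carrier S" "g [^]\<^bsub>S\<^esub> p = \<sigma> (\<pi> [^]\<^bsub>R\<^esub> ((p - 1) * n)) \<otimes>\<^bsub>S\<^esub> g" using g by (auto simp: pts)
    have "\<phi> (g [^]\<^bsub>S\<^esub> p) = \<phi> (\<sigma> (\<pi> [^]\<^bsub>R\<^esub> ((p - 1) * n)) \<otimes>\<^bsub>S\<^esub> g)" by (simp only: g'(2))
    then have "\<phi> g [^]\<^bsub>S'\<^esub> p = \<sigma>' (\<pi> [^]\<^bsub>R\<^esub> ((p - 1) * n)) \<otimes>\<^bsub>S'\<^esub> \<phi> g"
      using g'(1) cr [OF S] \<phi>'(2) by simp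
    then show "pmap (M_group R \<pi> p n) \<phi> g \<in> carrier (pts (M_group R \<pi> p n) S' \<sigma>') \<and>
        pmap (M_group R \<pi> p n) \<phi> g = \<phi> g"
      unfolding S'.M_group_pts [where K = R and \<sigma> = \<sigma>' and \<pi> = \<pi> and n = n, OF cr [OF S']] using g'(1) by (simp add: M_group_def)
  qed
qed

text \<open>The identification with the roots of X^p = X is \<open>zth\<close>, written with
  multiples [i] in place of the integers of the ring.\<close>

lemma torsor_const_Zp:
  fixes R :: "'r ring"
  assumes R: "cring R" and pr: "Factorial_Ring.prime p" and ch: "[p] \<cdot>\<^bsub>R\<^esub> \<one>\<^bsub>R\<^esub> = \<zero>\<^bsub>R\<^esub>"
    and \<iota>: "\<iota> \<in> ring_hom R A" and c1: "c = \<one>" and free: "module_free A B \<beta> p"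
  shows "\<exists>act. torsor A \<iota> B \<beta> (const_Zp p :: ('r, 'c, nat \<Rightarrow> 'c) group_fun) act \<and>
    (\<forall>S \<alpha> e y. algebra_over A S \<alpha> \<and> e \<in> carrier (pts (const_Zp p) S (\<alpha> \<circ> \<iota>)) \<and> y \<in> alg_homs A B \<beta> S \<alpha> \<longrightarrow>
      act S \<alpha> e y x = y x \<oplus>\<^bsub>S\<^esub> (\<Oplus>\<^bsub>S\<^esub>i\<in>{..<p}. [i] \<cdot>\<^bsub>S\<^esub> e i))"
proof -
  interpret R: cring R by (rule R)
  have chA: "[p] \<cdot>\<^bsub>A\<^esub> \<one>\<^bsub>A\<^esub> = \<zero>\<^bsub>A\<^esub>"
    by (rule ring_hom_char [OF R _ ch]) (use \<iota> A.is_cring in \<open>simp add: algebra_over_def\<close>)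
  have c0: "c = \<iota> \<one>\<^bsub>R\<^esub>" using ring_hom_one [OF \<iota>] c1 by simp
  note ci = char_ring_algebra [OF R pr ch]
  show ?thesis
  proof (rule torsor_exists [where \<theta> = "\<lambda>S \<sigma> e. \<Oplus>\<^bsub>S\<^esub>i\<in>{..<p}. [i] \<cdot>\<^bsub>S\<^esub> e i" and ?c0.0 = "\<one>\<^bsub>R\<^esub>", OF pr chA \<iota> c0 free])
    fix S :: "'c ring" and \<sigma> assume S: "algebra_over R S \<sigma>"
    interpret S: char_ring S p by (rule ci [OF S])
    have \<sigma>1: "\<sigma> \<one>\<^bsub>R\<^esub> = \<one>\<^bsub>S\<^esub>" using S by (simp add: algebra_over_def ring_hom_one)
    note pts = S.const_Zp_pts [where \<tau> = \<sigma>]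
    show "group (pts (const_Zp p) S \<sigma>)" by (rule S.group_const_Zp)
    have "bij_betw (\<lambda>e. \<Oplus>\<^bsub>S\<^esub>i\<in>{..<p}. [i] \<cdot>\<^bsub>S\<^esub> e i) S.zp {s \<in> carrier S. s [^]\<^bsub>S\<^esub> p = s}"
      using S.zth_bij by (subst bij_betw_cong [of _ _ S.zth]) (auto simp: S.zth_add_pow)
    moreover have "{s \<in> carrier S. s [^]\<^bsub>S\<^esub> p = s} = {s \<in> carrier S. s [^]\<^bsub>S\<^esub> p = \<sigma> \<one>\<^bsub>R\<^esub> \<otimes>\<^bsub>S\<^esub> s}"
      unfolding \<sigma>1 by auto
    ultimately show "bij_betw (\<lambda>e. \<Oplus>\<^bsub>S\<^esub>i\<in>{..<p}. [i] \<cdot>\<^bsub>S\<^esub> e i) (carrier (pts (const_Zp p) S \<sigma>))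
      {s \<in> carrier S. s [^]\<^bsub>S\<^esub> p = \<sigma> \<one>\<^bsub>R\<^esub> \<otimes>\<^bsub>S\<^esub> s}" unfolding pts by simp
    show "(\<Oplus>\<^bsub>S\<^esub>i\<in>{..<p}. [i] \<cdot>\<^bsub>S\<^esub> (g \<otimes>\<^bsub>pts (const_Zp p) S \<sigma>\<^esub> h) i) =
        (\<Oplus>\<^bsub>S\<^esub>i\<in>{..<p}. [i] \<cdot>\<^bsub>S\<^esub> g i) \<oplus>\<^bsub>S\<^esub> (\<Oplus>\<^bsub>S\<^esub>i\<in>{..<p}. [i] \<cdot>\<^bsub>S\<^esub> h i)"
      if "g \<in> carrier (pts (const_Zp p) S \<sigma>)" "h \<in> carrier (pts (const_Zp p) S \<sigma>)" for g h
      using that unfolding pts by (simp add: S.zth_add_pow S.zmult)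
    fix S' :: "'c ring" and \<sigma>' \<phi> g
    assume S': "algebra_over R S' \<sigma>'" and \<phi>: "\<phi> \<in> alg_homs R S \<sigma> S' \<sigma>'"
      and g: "g \<in> carrier (pts (const_Zp p) S \<sigma>)"
    interpret S': char_ring S' p by (rule ci [OF S'])
    have \<phi>': "\<phi> \<in> ring_hom S S'" using \<phi> by (auto simp: alg_homs_def)
    interpret \<phi>: ring_hom_cring S S' \<phi> by (rule ring_hom_cringI [OF S.is_cring S'.is_cring \<phi>'])
    have gz: "g \<in> S.zp" using g unfolding pts .
    let ?h = "\<lambda>i\<in>{..<p}. \<phi> (g i)"
    have gc: "\<And>i. i < p \<Longrightarrow> g i \<in> carrier S" using S.zpD(1) [OF gz] .
    have "(\<Oplus>\<^bsub>S'\<^esub>i\<in>{..<p}. ?h i) = (\<Oplus>\<^bsub>S'\<^esub>i\<in>{..<p}. \<phi> (g i))" using gc by (intro S'.finsum_cong') auto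
    also have "\<dots> = \<phi> (\<Oplus>\<^bsub>S\<^esub>i\<in>{..<p}. g i)" using gc by (subst \<phi>.hom_finsum) (auto simp: comp_def)
    finally have s1: "(\<Oplus>\<^bsub>S'\<^esub>i\<in>{..<p}. ?h i) = \<one>\<^bsub>S'\<^esub>" unfolding S.zpD(3) [OF gz] by simp
    have "\<phi> (g i) \<otimes>\<^bsub>S'\<^esub> \<phi> (g j) = (if i = j then \<phi> (g i) else \<zero>\<^bsub>S'\<^esub>)" if ij: "i < p" "j < p" for i j
    proof -
      have "\<phi> (g i) \<otimes>\<^bsub>S'\<^esub> \<phi> (g j) = \<phi> (g i \<otimes>\<^bsub>S\<^esub> g j)" using gc ij by simp
      then show ?thesis unfolding S.zpD(2) [OF gz ij] by simp
    qed
    then have hz: "?h \<in> S'.zp" unfolding S'.zp_def mem_Collect_eq s1 using gc by auto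
    have "(\<Oplus>\<^bsub>S'\<^esub>i\<in>{..<p}. [i] \<cdot>\<^bsub>S'\<^esub> ?h i) = (\<Oplus>\<^bsub>S'\<^esub>i\<in>{..<p}. \<phi> ([i] \<cdot>\<^bsub>S\<^esub> g i))"
      using gc by (intro S'.finsum_cong') (auto simp: ring_hom_add_pow [OF S.is_cring S'.is_cring \<phi>'])
    also have "\<dots> = \<phi> (\<Oplus>\<^bsub>S\<^esub>i\<in>{..<p}. [i] \<cdot>\<^bsub>S\<^esub> g i)" using gc by (subst \<phi>.hom_finsum) (auto simp: comp_def)
    finally show "pmap (const_Zp p) \<phi> g \<in> carrier (pts (const_Zp p) S' \<sigma>') \<and>
        (\<Oplus>\<^bsub>S'\<^esub>i\<in>{..<p}. [i] \<cdot>\<^bsub>S'\<^esub> pmap (const_Zp p) \<phi> g i) = \<phi> (\<Oplus>\<^bsub>S\<^esub>i\<in>{..<p}. [i] \<cdot>\<^bsub>S\<^esub> g i)"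
      unfolding S'.const_Zp_pts using hz by (simp add: const_Zp_def)
  qed
qed

text \<open>For \<open>u = 0\<close> the functor of points of \<open>B\<close> is the kernel of \<open>X\<^sup>p - c X\<close> on the additive group.\<close>

definition root_group :: "('a, 'c, 'b \<Rightarrow> 'c) group_fun"
  where "root_group = \<lparr> pts = (\<lambda>S \<sigma>. \<lparr> carrier = alg_homs A B \<beta> S \<sigma>,
      monoid.mult = (\<lambda>f g. THE h. h \<in> alg_homs A B \<beta> S \<sigma> \<and> h x = f x \<oplus>\<^bsub>S\<^esub> g x),
      one = (THE h. h \<in> alg_homs A B \<beta> S \<sigma> \<and> h x = \<zero>\<^bsub>S\<^esub>) \<rparr>),
    pmap = (\<lambda>\<phi> f. compose (carrier B) \<phi> f) \<rparr>"

lemma alg_hom_the: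
  fixes S :: "'c ring" and \<sigma> :: "'a \<Rightarrow> 'c"
  assumes S: "algebra_over A S \<sigma>" and s: "s \<in> carrier S" "s [^]\<^bsub>S\<^esub> p = \<sigma> c \<otimes>\<^bsub>S\<^esub> s \<oplus>\<^bsub>S\<^esub> \<sigma> u"
  shows "(THE h. h \<in> alg_homs A B \<beta> S \<sigma> \<and> h x = s) \<in> alg_homs A B \<beta> S \<sigma> \<and>
    (THE h. h \<in> alg_homs A B \<beta> S \<sigma> \<and> h x = s) x = s"
proof -
  obtain z where z: "z \<in> alg_homs A B \<beta> S \<sigma>" "z x = s" using alg_hom_exists [OF S s] by auto
  have "\<exists>!h. h \<in> alg_homs A B \<beta> S \<sigma> \<and> h x = s"
  proof (rule ex1I [of _ z])
    show "z \<in> alg_homs A B \<beta> S \<sigma> \<and> z x = s" using z ..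
    fix w assume w: "w \<in> alg_homs A B \<beta> S \<sigma> \<and> w x = s"
    show "w = z" by (rule alg_hom_eqI [OF _ z(1) S]) (use w z(2) in simp_all)
  qed
  from theI' [OF this] show ?thesis .
qed

context
  assumes u0: "u = \<zero>" and pr: "Factorial_Ring.prime p" and ch: "[p] \<cdot>\<^bsub>A\<^esub> \<one> = \<zero>"
begin

lemma root_group_pts:
  fixes S :: "'c ring" and \<sigma> :: "'a \<Rightarrow> 'c"
  assumes S: "algebra_over A S \<sigma>"
  shows "carrier (pts root_group S \<sigma>) = alg_homs A B \<beta> S \<sigma>"
    "f \<in> alg_homs A B \<beta> S \<sigma> \<Longrightarrow> g \<in> alg_homs A B \<beta> S \<sigma> \<Longrightarrow>
      f \<otimes>\<^bsub>pts root_group S \<sigma>\<^esub> g \<in> alg_homs A B \<beta> S \<sigma> \<and> (f \<otimes>\<^bsub>pts root_group S \<sigma>\<^esub> g) x = f x \<oplus>\<^bsub>S\<^esub> g x"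
    "\<one>\<^bsub>pts root_group S \<sigma>\<^esub> \<in> alg_homs A B \<beta> S \<sigma> \<and> \<one>\<^bsub>pts root_group S \<sigma>\<^esub> x = \<zero>\<^bsub>S\<^esub>"
    "bij_betw (\<lambda>f. f x) (alg_homs A B \<beta> S \<sigma>) {s \<in> carrier S. s [^]\<^bsub>S\<^esub> p = \<sigma> c \<otimes>\<^bsub>S\<^esub> s}"
    "group (pts root_group S \<sigma>)"
proof -
  interpret S: char_ring S p by (rule char_ring_algebra [OF A.is_cring pr ch S])
  have \<sigma>: "\<sigma> \<in> ring_hom A S" using S by (simp add: algebra_over_def)
  interpret \<sigma>: ring_hom_cring A S \<sigma> by (rule ring_hom_cringI [OF A.is_cring S.is_cring \<sigma>])
  have eq: "s [^]\<^bsub>S\<^esub> p = \<sigma> c \<otimes>\<^bsub>S\<^esub> s \<oplus>\<^bsub>S\<^esub> \<sigma> u \<longleftrightarrow> s [^]\<^bsub>S\<^esub> p = \<sigma> c \<otimes>\<^bsub>S\<^esub> s" if "s \<in> carrier S" for s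
    unfolding u0 using that c by simp
  show carr: "carrier (pts root_group S \<sigma>) = alg_homs A B \<beta> S \<sigma>" by (simp add: root_group_def)
  have val: "f x \<in> carrier S" "f x [^]\<^bsub>S\<^esub> p = \<sigma> c \<otimes>\<^bsub>S\<^esub> f x" if "f \<in> alg_homs A B \<beta> S \<sigma>" for f
    using alg_homD(2,3) [OF that S] eq by auto
  show mul: "f \<otimes>\<^bsub>pts root_group S \<sigma>\<^esub> g \<in> alg_homs A B \<beta> S \<sigma> \<and> (f \<otimes>\<^bsub>pts root_group S \<sigma>\<^esub> g) x = f x \<oplus>\<^bsub>S\<^esub> g x"
    if f: "f \<in> alg_homs A B \<beta> S \<sigma>" and g: "g \<in> alg_homs A B \<beta> S \<sigma>" for f g
  proof -
    have "f \<otimes>\<^bsub>pts root_group S \<sigma>\<^esub> g = (THE h. h \<in> alg_homs A B \<beta> S \<sigma> \<and> h x = f x \<oplus>\<^bsub>S\<^esub> g x)"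
      by (simp add: root_group_def)
    moreover have rt: "(f x \<oplus>\<^bsub>S\<^esub> g x) [^]\<^bsub>S\<^esub> p = \<sigma> c \<otimes>\<^bsub>S\<^esub> (f x \<oplus>\<^bsub>S\<^esub> g x)"
      using val [OF f] val [OF g] c by (simp add: S.frob_add S.r_distr)
    moreover have cl: "f x \<oplus>\<^bsub>S\<^esub> g x \<in> carrier S" using val(1) [OF f] val(1) [OF g] by simp
    ultimately show ?thesis using alg_hom_the [OF S cl iffD2 [OF eq [OF cl] rt]] by simp
  qed
  show one: "\<one>\<^bsub>pts root_group S \<sigma>\<^esub> \<in> alg_homs A B \<beta> S \<sigma> \<and> \<one>\<^bsub>pts root_group S \<sigma>\<^esub> x = \<zero>\<^bsub>S\<^esub>"
  proof -
    have "\<one>\<^bsub>pts root_group S \<sigma>\<^esub> = (THE h. h \<in> alg_homs A B \<beta> S \<sigma> \<and> h x = \<zero>\<^bsub>S\<^esub>)" by (simp add: root_group_def)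
    moreover have "\<zero>\<^bsub>S\<^esub> [^]\<^bsub>S\<^esub> p = \<sigma> c \<otimes>\<^bsub>S\<^esub> \<zero>\<^bsub>S\<^esub>" using c by simp
    ultimately show ?thesis using alg_hom_the [OF S S.zero_closed iffD2 [OF eq [OF S.zero_closed]]] by simp
  qed
  show bij: "bij_betw (\<lambda>f. f x) (alg_homs A B \<beta> S \<sigma>) {s \<in> carrier S. s [^]\<^bsub>S\<^esub> p = \<sigma> c \<otimes>\<^bsub>S\<^esub> s}"
    unfolding bij_betw_def
  proof (intro conjI inj_onI equalityI subsetI)
    fix f g assume "f \<in> alg_homs A B \<beta> S \<sigma>" "g \<in> alg_homs A B \<beta> S \<sigma>" "f x = g x"
    then show "f = g" using alg_hom_eqI [OF _ _ S] by blast
  next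
    fix s assume "s \<in> {s \<in> carrier S. s [^]\<^bsub>S\<^esub> p = \<sigma> c \<otimes>\<^bsub>S\<^esub> s}"
    then have s0: "s \<in> carrier S" "s [^]\<^bsub>S\<^esub> p = \<sigma> c \<otimes>\<^bsub>S\<^esub> s" by auto
    note s = s0(1) iffD2 [OF eq [OF s0(1)] s0(2)]
    obtain z where "z \<in> alg_homs A B \<beta> S \<sigma>" "z x = s" using alg_hom_exists [OF S s] by auto
    then show "s \<in> (\<lambda>f. f x) ` alg_homs A B \<beta> S \<sigma>" by (intro image_eqI [of _ _ z]) simp_all
  qed (use val in auto)
  show "group (pts root_group S \<sigma>)"
  proof (rule S.group_by_additive_bijection)
    show "bij_betw (\<lambda>f. f x) (carrier (pts root_group S \<sigma>)) {s \<in> carrier S. s [^]\<^bsub>S\<^esub> p = \<sigma> c \<otimes>\<^bsub>S\<^esub> s}"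
      unfolding carr by (rule bij)
  qed (use carr mul one c in \<open>auto simp: S.frob_neg S.r_minus\<close>)
qed

lemma root_group_functor: "group_functor A (root_group :: ('a, 'c, 'b \<Rightarrow> 'c) group_fun)"
  unfolding group_functor_def
proof (intro conjI allI impI ballI)
  fix S :: "'c ring" and \<sigma> assume S: "algebra_over A S \<sigma>"
  show "group (pts root_group S \<sigma>)" by (rule root_group_pts(5) [OF S])
  fix g assume "g \<in> carrier (pts root_group S \<sigma>)"
  then have g: "g \<in> alg_homs A B \<beta> S \<sigma>" unfolding root_group_pts(1) [OF S] .
  then have "g b \<in> carrier S" if "b \<in> carrier B" for b using that by (auto simp: alg_homs_def ring_hom_closed)
  then have "compose (carrier B) (\<lambda>s\<in>carrier S. s) g = g"
    using g by (intro extensionalityI [of _ "carrier B"]) (auto simp: compose_eq alg_homs_def)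
  then show "pmap root_group (\<lambda>s\<in>carrier S. s) g = g" by (simp add: root_group_def)
next
  fix S S' :: "'c ring" and \<sigma> \<sigma>' \<phi>
  assume "algebra_over A S \<sigma> \<and> algebra_over A S' \<sigma>' \<and> \<phi> \<in> alg_homs A S \<sigma> S' \<sigma>'"
  then have S: "algebra_over A S \<sigma>" and S': "algebra_over A S' \<sigma>'" and \<phi>: "\<phi> \<in> alg_homs A S \<sigma> S' \<sigma>'" by auto
  have \<phi>h: "\<phi> \<in> ring_hom S S'" using \<phi> by (simp add: alg_homs_def)
  have pm: "pmap root_group \<phi> f = compose (carrier B) \<phi> f" for f by (simp add: root_group_def)
  note cc = compose_alg_hom [OF _ \<phi>]
  show "pmap root_group \<phi> \<in> hom (pts root_group S \<sigma>) (pts root_group S' \<sigma>')"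
  proof (rule homI)
    fix f assume "f \<in> carrier (pts root_group S \<sigma>)"
    then show "pmap root_group \<phi> f \<in> carrier (pts root_group S' \<sigma>')"
      unfolding root_group_pts(1) [OF S] root_group_pts(1) [OF S'] pm by (rule cc)
    fix g assume "g \<in> carrier (pts root_group S \<sigma>)"
    with \<open>f \<in> _\<close> have f: "f \<in> alg_homs A B \<beta> S \<sigma>" and g: "g \<in> alg_homs A B \<beta> S \<sigma>"
      unfolding root_group_pts(1) [OF S] by auto
    note m = root_group_pts(2) [OF S f g] and m' = root_group_pts(2) [OF S' cc [OF f] cc [OF g]]
    show "pmap root_group \<phi> (f \<otimes>\<^bsub>pts root_group S \<sigma>\<^esub> g) = pmap root_group \<phi> f \<otimes>\<^bsub>pts root_group S' \<sigma>'\<^esub> pmap root_group \<phi> g"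
      unfolding pm
    proof (rule alg_hom_eqI [OF _ _ S'])
      show "compose (carrier B) \<phi> (f \<otimes>\<^bsub>pts root_group S \<sigma>\<^esub> g) x =
          (compose (carrier B) \<phi> f \<otimes>\<^bsub>pts root_group S' \<sigma>'\<^esub> compose (carrier B) \<phi> g) x"
        using m m' x alg_homD(2) [OF f S] alg_homD(2) [OF g S] by (simp add: compose_eq ring_hom_add [OF \<phi>h])
    qed (use m m' cc in auto)
  qed
  fix S'' :: "'c ring" and \<sigma>'' \<psi> g
  assume "algebra_over A S'' \<sigma>'' \<and> \<psi> \<in> alg_homs A S' \<sigma>' S'' \<sigma>''" and "g \<in> carrier (pts root_group S \<sigma>)"
  then have g: "g \<in> alg_homs A B \<beta> S \<sigma>" unfolding root_group_pts(1) [OF S] by simp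
  then have "g b \<in> carrier S" if "b \<in> carrier B" for b using that by (auto simp: alg_homs_def ring_hom_closed)
  then show "pmap root_group (compose (carrier S) \<psi> \<phi>) g = pmap root_group \<psi> (pmap root_group \<phi> g)"
    by (intro ext) (simp add: root_group_def compose_def)
qed

lemma root_group_represented: "represented_by A (root_group :: ('a, 'c, 'b \<Rightarrow> 'c) group_fun) B \<beta>"
  unfolding represented_by_def
proof (intro exI [of _ "\<lambda>S \<sigma> f. f"] conjI allI impI ballI)
  fix S :: "'c ring" and \<sigma> assume S: "algebra_over A S \<sigma>"
  show "bij_betw (\<lambda>f. f) (alg_homs A B \<beta> S \<sigma>) (carrier (pts root_group S \<sigma>))"
    unfolding root_group_pts(1) [OF S] by (simp add: bij_betw_def)
qed (simp add: root_group_def)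

end

text \<open>The group scheme is the spectrum of H = R[X]/(X^p - c0 X), the kernel of an additive
  polynomial. It is free of rank p over R, and \<theta> evaluates a point at the class y of the
  variable. This treats both cases of the classification at once.\<close>

lemma torsor_finite_flat:
  fixes R :: "'r ring"
  assumes R: "domain R" and pr: "Factorial_Ring.prime p" and ch: "[p] \<cdot>\<^bsub>R\<^esub> \<one>\<^bsub>R\<^esub> = \<zero>\<^bsub>R\<^esub>"
    and \<iota>: "\<iota> \<in> ring_hom R A" and c0: "c0 \<in> carrier R" "c = \<iota> c0"
    and free: "module_free A B \<beta> p"
  shows "\<exists>(G :: ('r, 'c, (nat \<Rightarrow> 'r) \<Rightarrow> 'c) group_fun) act. finite_flat_group_scheme R p G \<and> torsor A \<iota> B \<beta> G act"
proof -
  interpret R: "domain" R by (rule R)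
  have chA: "[p] \<cdot>\<^bsub>A\<^esub> \<one>\<^bsub>A\<^esub> = \<zero>\<^bsub>A\<^esub>"
    by (rule ring_hom_char [OF R.is_cring _ ch]) (use \<iota> A.is_cring in \<open>simp add: algebra_over_def\<close>)
  obtain H :: "(nat \<Rightarrow> 'r) ring" and \<eta> y where H: "algebra_over R H \<eta>" "given_by_equation R H \<eta> p c0 \<zero>\<^bsub>R\<^esub> y"
    using exists_given_by_equation [OF R.is_cring c0(1) R.zero_closed, of p] by blast
  interpret H: eqn_alg R H \<eta> p c0 "\<zero>\<^bsub>R\<^esub>" y
    by (intro eqn_alg.intro eqn_alg_axioms.intro alg.intro alg_axioms.intro R.is_cring c0(1) R.zero_closed p H(2))
       (use H(1) in \<open>simp_all add: algebra_over_def\<close>)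
  let ?G = "H.root_group :: ('r, 'c, (nat \<Rightarrow> 'r) \<Rightarrow> 'c) group_fun"
  note pts = H.root_group_pts [OF refl pr ch]
  have "finite_flat_group_scheme R p ?G"
    unfolding finite_flat_group_scheme_def
    using H.root_group_functor [OF refl pr ch] H.root_group_represented [OF refl pr ch] H(1) H.free [OF R] by blast
  moreover have "\<exists>act. torsor A \<iota> B \<beta> ?G act \<and>
    (\<forall>S \<alpha> g z. algebra_over A S \<alpha> \<and> g \<in> carrier (pts ?G S (\<alpha> \<circ> \<iota>)) \<and> z \<in> alg_homs A B \<beta> S \<alpha> \<longrightarrow>
      act S \<alpha> g z x = z x \<oplus>\<^bsub>S\<^esub> g y)"
  proof (rule torsor_exists [where \<theta> = "\<lambda>S \<sigma> f. f y" and \<iota> = \<iota> and R = R and ?c0.0 = c0, OF pr chA \<iota> c0(2) free])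
    fix S :: "'c ring" and \<sigma> assume S: "algebra_over R S \<sigma>"
    show "group (pts ?G S \<sigma>)" by (rule pts(5) [OF S])
    show "bij_betw (\<lambda>f. f y) (carrier (pts ?G S \<sigma>)) {s \<in> carrier S. s [^]\<^bsub>S\<^esub> p = \<sigma> c0 \<otimes>\<^bsub>S\<^esub> s}"
      unfolding pts(1) [OF S] by (rule pts(4) [OF S])
    show "(g \<otimes>\<^bsub>pts ?G S \<sigma>\<^esub> h) y = g y \<oplus>\<^bsub>S\<^esub> h y"
      if "g \<in> carrier (pts ?G S \<sigma>)" "h \<in> carrier (pts ?G S \<sigma>)" for g h
      using that pts(2) [OF S] unfolding pts(1) [OF S] by blast
    fix S' :: "'c ring" and \<sigma>' \<phi> g
    assume S': "algebra_over R S' \<sigma>'" and \<phi>: "\<phi> \<in> alg_homs R S \<sigma> S' \<sigma>'" and g: "g \<in> carrier (pts ?G S \<sigma>)"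
    show "pmap ?G \<phi> g \<in> carrier (pts ?G S' \<sigma>') \<and> pmap ?G \<phi> g y = \<phi> (g y)"
      using H.compose_alg_hom [OF _ \<phi>] g H.x unfolding pts(1) [OF S] pts(1) [OF S']
      by (simp add: H.root_group_def compose_eq)
  qed
  ultimately show ?thesis by blast
qed

end

section \<open>The parameter of the cover\<close>

lemma ring_hom_unit_inv:
  assumes R: "cring R" and S: "cring S" and h: "h \<in> ring_hom R S" and a: "a \<in> Units R"
  shows "h a \<in> Units S" "h (inv\<^bsub>R\<^esub> a) = inv\<^bsub>S\<^esub> (h a)"
proof -
  interpret R: cring R by (rule R)
  interpret S: cring S by (rule S)
  have c: "a \<in> carrier R" "inv\<^bsub>R\<^esub> a \<in> carrier R" using a by auto
  have "h (a \<otimes>\<^bsub>R\<^esub> inv\<^bsub>R\<^esub> a) = \<one>\<^bsub>S\<^esub>" using a ring_hom_one [OF h] by simp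
  then have p: "h a \<otimes>\<^bsub>S\<^esub> h (inv\<^bsub>R\<^esub> a) = \<one>\<^bsub>S\<^esub>" using ring_hom_mult [OF h c] by simp
  note hc = ring_hom_closed [OF h c(1)] ring_hom_closed [OF h c(2)]
  show "h (inv\<^bsub>R\<^esub> a) = inv\<^bsub>S\<^esub> (h a)" using S.comm_inv_char [OF hc p] by simp
  show "h a \<in> Units S" using hc p S.m_comm [OF hc] by (auto simp: Units_def)
qed

lemma ring_hom_int_pow:
  assumes R: "cring R" and S: "cring S" and h: "h \<in> ring_hom R S" and a: "a \<in> Units R"
  shows "h (a [^]\<^bsub>R\<^esub> (i::int)) = h a [^]\<^bsub>S\<^esub> i"
proof -
  interpret R: cring R by (rule R)
  interpret S: cring S by (rule S)
  interpret h: ring_hom_cring R S h by (rule ring_hom_cringI [OF R S h])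
  have pw: "h (a [^]\<^bsub>R\<^esub> n) = h a [^]\<^bsub>S\<^esub> n" for n :: nat using R.Units_closed [OF a] by simp
  have "a [^]\<^bsub>R\<^esub> n \<in> Units R" for n :: nat using a by (rule R.Units_pow_closed)
  note iv = ring_hom_unit_inv(2) [OF R S h this]
  show ?thesis
  proof (cases "i < 0")
    case True
    show ?thesis unfolding int_pow_def2 by (simp only: True if_True iv pw)
  next
    case False
    show ?thesis unfolding int_pow_def2 by (simp only: False if_False pw)
  qed
qed

context complete_dvr_base
begin

lemma wt_diff_higher:
  assumes f: "wt f a" and g: "g \<in> carrier A" "lo 1 (a + 1) g"
  shows "wt (f \<ominus>\<^sub>A g) a"
proof -
  note fA = wtD(1) [OF f]
  have "lo 1 a g" by (rule lo_mono [OF g(2)]) simp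
  then have "lo 1 a (f \<ominus>\<^sub>A g)" by (rule lo_A_diff [OF fA g(1) wtD(2) [OF f]])
  moreover have "\<not> cg 1 ((f \<ominus>\<^sub>A g) a) \<zero>"
  proof
    assume *: "cg 1 ((f \<ominus>\<^sub>A g) a) \<zero>"
    have "cg 1 (g a) \<zero>" by (rule loD [OF g(2)]) simp
    moreover have "cg 1 (f a) (g a)" using * fA g(1) unfolding A_minus [OF fA g(1)] by (simp add: cg_diff_zero_iff)
    ultimately have "cg 1 (f a) \<zero>" using cg_trans by blast
    with wtD(3) [OF f] show False ..
  qed
  ultimately show ?thesis using fA g(1) by (simp add: wt_def)
qed

end

text \<open>The target A is made an A-algebra through \<psi>, and the universal property of B then
  gives the map \<Theta> to it. It is injective because every nonzero b is a power of \<pi> times a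
  unit. It is surjective because products of powers of T' and S^m attain the orders 0, ..., p - 1
  and A is generated by such a family over the series in T'.\<close>

lemma (in complete_dvr_closed) parameter_of_cover:
  assumes E: "eqn_alg A B \<beta> p (mon c 0) (T [^]\<^sub>A m) x" and B: "dvr_unif B (\<beta> (mon \<pi> 0))"
    and c: "c \<in> carrier R" and T: "wt T 1" and m: "coprime m (int p)" and cm: "cg 1 c \<zero> \<or> m < 0"
  shows "\<exists>\<eta>. \<eta> \<in> carrier B \<and> \<eta> [^]\<^bsub>B\<^esub> m = x \<and> parameter R \<pi> B (\<beta> \<circ> const_ser R) \<eta>"
proof -
  interpret E: eqn_alg A B \<beta> p "mon c 0" "T [^]\<^sub>A m" x by (rule E)
  interpret B: dvr_unif B "\<beta> (mon \<pi> 0)" by (rule B)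
  define S where "S = mon \<one> 1"
  have Swt: "wt S 1" unfolding S_def using not_cg_one by (intro wt_mon) simp_all
  have SU: "S \<in> Units A" by (rule wt_unit [OF Swt])
  have SA: "S \<in> carrier A" by (rule wtD(1) [OF Swt])
  define s where "s = S [^]\<^sub>A m"
  have swt: "wt s m" using wt_int_pow [OF Swt, of m] by (simp add: s_def)
  have sA: "s \<in> carrier A" by (rule wtD(1) [OF swt])
  define v where "v = s [^]\<^sub>A p \<ominus>\<^sub>A mon c 0 \<otimes>\<^sub>A s"
  have csA: "mon c 0 \<otimes>\<^sub>A s \<in> carrier A" using c sA by simp
  \<comment> \<open>Here the hypothesis \<open>cm\<close> enters. The term c s must lie above the
    exponent p m, so that v has the order of s^p: either c vanishes modulo \<pi>, or m is negative
    and m exceeds p m.\<close>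
  have lo_cs: "lo 1 (int p * m + 1) (mon c 0 \<otimes>\<^sub>A s)"
  proof (cases "cg 1 c \<zero>")
    case True
    have "A.cg 1 (mon c 0 \<otimes>\<^sub>A s) \<zero>\<^sub>A"
    proof (rule A_cgI [OF csA A.zero_closed])
      fix i
      have "cg 1 (c \<otimes> s i) (\<zero> \<otimes> s i)" using sA by (intro cg_mult True cg_refl) simp
      then show "cg 1 ((mon c 0 \<otimes>\<^sub>A s) i) (\<zero>\<^sub>A i)" unfolding mon_mult [OF c sA] using sA by (simp add: A_zero)
    qed
    then show ?thesis by (rule A_cg_zero_lo)
  next
    case False
    then have "m < 0" using cm by simp
    then have "int p * m \<le> 2 * m" using p_gt_1 by (intro mult_right_mono_neg) auto
    then have le: "int p * m + 1 \<le> 0 + m" using \<open>m < 0\<close> by linarith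
    have "lo 1 (0 + m) (mon c 0 \<otimes>\<^sub>A s)" by (rule lo_mult [OF mon_closed [OF c] sA lo_mon [OF c] wtD(2) [OF swt]])
    then show ?thesis using le by (rule lo_mono)
  qed
  have "wt v (int p * m)" unfolding v_def by (rule wt_diff_higher [OF wt_pow [OF swt] csA lo_cs])
  then have vwt: "wt v (m * int p)" by (simp add: mult.commute)
  obtain T' where T': "wt T' (int p)" "T' [^]\<^sub>A m = v" using wt_root [OF vwt m] by blast
  interpret L1: laurent_subst R \<pi> p T 1 by unfold_locales (simp_all add: T)
  interpret L2: laurent_subst R \<pi> p T' "int p" by unfold_locales (use T' p_gt_1 in simp_all)
  \<comment> \<open>T is a parameter, so every series is f(T) for a unique f, and \<psi> sends f(T)
    to f(T').\<close>
  define \<psi> where "\<psi> = L2.lsub \<circ> inv_into (carrier A) L1.lsub"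
  have iso1: "L1.lsub \<in> ring_iso A A" by (rule L1.lsub_iso) simp
  have "inv_into (carrier A) L1.lsub \<in> ring_iso A A" by (rule ring_iso_set_sym [OF A.ring_axioms iso1])
  then have "inv_into (carrier A) L1.lsub \<in> ring_hom A A" by (simp add: ring_iso_def)
  then have \<psi>h: "\<psi> \<in> ring_hom A A" unfolding \<psi>_def by (rule ring_hom_trans [OF _ L2.lsub_hom])
  have \<psi>L: "\<psi> (L1.lsub f) = L2.lsub f" if "f \<in> carrier A" for f
    unfolding \<psi>_def comp_def using inv_into_f_f [OF L1.lsub_inj that] by simp
  have \<psi>c: "\<psi> (mon a 0) = mon a 0" if "a \<in> carrier R" for a
    using \<psi>L [of "mon a 0"] that by (simp add: L1.lsub_const L2.lsub_const)
  have \<psi>T: "\<psi> T = T'" using \<psi>L [of "mon \<one> 1"] by (simp add: L1.lsub_var L2.lsub_var)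
  have \<psi>u: "\<psi> (T [^]\<^sub>A m) = v"
    using ring_hom_int_pow [OF A.is_cring A.is_cring \<psi>h L1.T_unit, of m] by (simp add: \<psi>T T'(2))
  have alg: "algebra_over A A \<psi>" using A.is_cring \<psi>h by (simp add: algebra_over_def)
  have "s [^]\<^sub>A p = mon c 0 \<otimes>\<^sub>A s \<oplus>\<^sub>A v"
    by (rule A.eq_add_if_minus_eq [OF v_def [symmetric]]) (use sA csA in simp_all)
  then have "s [^]\<^sub>A p = \<psi> (mon c 0) \<otimes>\<^sub>A s \<oplus>\<^sub>A \<psi> (T [^]\<^sub>A m)" by (simp only: \<psi>c [OF c] \<psi>u)
  from E.alg_hom_exists [OF alg sA this] obtain \<Theta> where \<Theta>: "\<Theta> \<in> alg_homs A B \<beta> A \<psi>" "\<Theta> x = s" by blast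
  have \<Theta>h: "\<Theta> \<in> ring_hom B A" and \<Theta>\<beta>: "\<And>a. a \<in> carrier A \<Longrightarrow> \<Theta> (\<beta> a) = \<psi> a"
    using \<Theta>(1) by (auto simp: alg_homs_def)
  interpret \<Theta>: ring_hom_cring B A \<Theta> by (rule ring_hom_cringI [OF E.B.is_cring A.is_cring \<Theta>h])
  have zero: "b = \<zero>\<^bsub>B\<^esub>" if b: "b \<in> carrier B" "\<Theta> b = \<zero>\<^sub>A" for b
  proof (rule ccontr)
    assume "b \<noteq> \<zero>\<^bsub>B\<^esub>"
    from B.valuation_decomp [OF b(1) this] obtain n e where
      e: "e \<in> Units B" "b = \<beta> (mon \<pi> 0) [^]\<^bsub>B\<^esub> (n::nat) \<otimes>\<^bsub>B\<^esub> e" by blast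
    have eB: "e \<in> carrier B" using e(1) by blast
    have "mon \<pi> 0 [^]\<^sub>A n \<otimes>\<^sub>A \<Theta> e = \<zero>\<^sub>A"
      using b(2) eB unfolding e(2) by (simp add: \<Theta>\<beta> \<psi>c)
    moreover note un = ring_hom_unit_inv(1) [OF E.B.is_cring A.is_cring \<Theta>h e(1)]
    ultimately have "mon \<pi> 0 [^]\<^sub>A n = \<zero>\<^sub>A"
      using A.m_assoc [of "mon \<pi> 0 [^]\<^sub>A n" "\<Theta> e" "inv\<^bsub>A\<^esub> \<Theta> e"] A.Units_closed [OF un] A.Units_inv_closed [OF un]
        A.Units_r_inv [OF un] by simp
    then have "mon (\<pi> [^] n) 0 0 = \<zero>\<^sub>A 0" unfolding A_u_pow by simp
    then show False by (simp add: mon_def A_zero)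
  qed
  have inj: "inj_on \<Theta> (carrier B)"
  proof (rule inj_onI)
    fix a b assume ab: "a \<in> carrier B" "b \<in> carrier B" "\<Theta> a = \<Theta> b"
    have "\<Theta> (a \<ominus>\<^bsub>B\<^esub> b) = \<Theta> b \<ominus>\<^sub>A \<Theta> b" unfolding a_minus_def using ab by simp
    also have "\<dots> = \<zero>\<^sub>A" using ab by (simp add: A.minus_eq A.r_neg)
    finally have "a \<ominus>\<^bsub>B\<^esub> b = \<zero>\<^bsub>B\<^esub>" by (intro zero) (use ab in simp)
    then show "a = b" using ab by simp
  qed
  have surj: "\<Theta> ` carrier B = carrier A"
  proof (intro equalityI subsetI)
    fix f assume f: "f \<in> carrier A"
    \<comment> \<open>An inverse of m modulo p solves m i = j + p q for every j, and then T'^(-q)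
      s^i has order i m - q p = j.\<close>
    obtain y where y: "[m * y = 1] (mod int p)" using cong_solve_coprime_int [OF m] by blast
    have "\<exists>i q. m * int i = int j + int p * q" for j :: nat
    proof -
      define i where "i = nat ((y * int j) mod int p)"
      have "int i = (y * int j) mod int p" using p_gt_1 by (simp add: i_def)
      then have "[m * int i = m * (y * int j)] (mod int p)" by (simp add: cong_def mod_mult_right_eq)
      also have "[m * (y * int j) = 1 * int j] (mod int p)" using cong_scalar_right [OF y, of "int j"] by (simp add: mult.assoc)
      finally have "[m * int i = int j] (mod int p)" by simp
      then have "int p dvd m * int i - int j" by (simp add: cong_iff_dvd_diff)
      then obtain q where "m * int i - int j = int p * q" by (rule dvdE)
      then have "m * int i = int j + int p * q" by simp
      then show ?thesis by blast
    qed
    then have "\<forall>j. \<exists>iq. m * int (fst iq) = int j + int p * snd iq" by simp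
    from choice [OF this] obtain iq where iq: "\<forall>j. m * int (fst (iq j)) = int j + int p * snd (iq j)" ..
    define E where "E j = T' [^]\<^sub>A (- snd (iq j)) \<otimes>\<^sub>A s [^]\<^sub>A fst (iq j)" for j
    have EA: "E j \<in> carrier A" for j unfolding E_def using sA by simp
    have "wt (E j) (int j)" for j
    proof -
      have "wt (E j) (- snd (iq j) * int p + int (fst (iq j)) * m)"
        unfolding E_def by (intro wt_mult wt_int_pow wt_pow T' swt)
      moreover have "- snd (iq j) * int p + int (fst (iq j)) * m = int j" using iq [rule_format, of j] by (simp add: algebra_simps)
      ultimately show ?thesis by simp
    qed
    from L2.comb_surj [of E f, OF EA this f] obtain g where g: "\<forall>j. g j \<in> carrier A" "f = L2.comb E g" by blast
    define b where "b j = \<beta> (L1.lsub (mon \<one> (- snd (iq j)) \<otimes>\<^sub>A g j)) \<otimes>\<^bsub>B\<^esub> x [^]\<^bsub>B\<^esub> fst (iq j)" for j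
    have bB: "b j \<in> carrier B" for j unfolding b_def using g(1) E.x by simp
    have \<Theta>b: "\<Theta> (b j) = L2.lsub (g j) \<otimes>\<^sub>A E j" for j
    proof -
      have gj: "g j \<in> carrier A" using g(1) by simp
      have "\<Theta> (b j) = L2.lsub (mon \<one> (- snd (iq j)) \<otimes>\<^sub>A g j) \<otimes>\<^sub>A s [^]\<^sub>A fst (iq j)"
        unfolding b_def using gj E.x by (simp add: \<Theta>\<beta> \<psi>L \<Theta>(2))
      also have "L2.lsub (mon \<one> (- snd (iq j)) \<otimes>\<^sub>A g j) = T' [^]\<^sub>A (- snd (iq j)) \<otimes>\<^sub>A L2.lsub (g j)"
        using L2.lsub_mon_mult [OF one_closed gj] by (simp flip: A_one_mon)
      finally show ?thesis unfolding E_def using gj sA by (simp add: A.m_ac)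
    qed
    have "\<Theta> (\<Oplus>\<^bsub>B\<^esub>j\<in>{..<nat (int p)}. b j) = (\<Oplus>\<^bsub>A\<^esub>j\<in>{..<nat (int p)}. \<Theta> (b j))"
      using bB by (subst \<Theta>.hom_finsum) (auto simp: comp_def)
    also have "\<dots> = f" unfolding g(2) L2.comb_def \<Theta>b ..
    finally have "f = \<Theta> (\<Oplus>\<^bsub>B\<^esub>j\<in>{..<nat (int p)}. b j)" ..
    moreover have "(\<Oplus>\<^bsub>B\<^esub>j\<in>{..<nat (int p)}. b j) \<in> carrier B" using bB by (intro E.B.finsum_closed) auto
    ultimately show "f \<in> \<Theta> ` carrier B" by (rule image_eqI)
  qed auto
  have iso: "\<Theta> \<in> ring_iso B A" using \<Theta>h inj surj by (simp add: ring_iso_def bij_betw_def)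
  define \<Xi> where "\<Xi> = inv_into (carrier B) \<Theta>"
  have \<Xi>: "\<Xi> \<in> ring_iso A B" unfolding \<Xi>_def by (rule ring_iso_set_sym [OF E.B.ring_axioms iso])
  then have \<Xi>h: "\<Xi> \<in> ring_hom A B" by (simp add: ring_iso_def)
  have \<Xi>\<Theta>: "\<Xi> (\<Theta> b) = b" if "b \<in> carrier B" for b unfolding \<Xi>_def by (rule inv_into_f_f [OF inj that])
  have "\<Xi> S [^]\<^bsub>B\<^esub> m = \<Xi> s"
    unfolding s_def by (rule ring_hom_int_pow [OF A.is_cring E.B.is_cring \<Xi>h SU, symmetric])
  also have "\<dots> = x" using \<Xi>\<Theta> [OF E.x] by (simp only: \<Theta>(2))
  finally have pw: "\<Xi> S [^]\<^bsub>B\<^esub> m = x" .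
  have "\<Xi> (const_ser R a) = (\<beta> \<circ> const_ser R) a" if a: "a \<in> carrier R" for a
  proof -
    have "\<Theta> (\<beta> (mon a 0)) = mon a 0" using \<Theta>\<beta> [of "mon a 0"] a by (simp add: \<psi>c)
    then have "\<Xi> (mon a 0) = \<beta> (mon a 0)" using \<Xi>\<Theta> [of "\<beta> (mon a 0)"] a by simp
    then show ?thesis by (simp add: const_ser_mon)
  qed
  moreover have "\<Xi> (var_ser R) = \<Xi> S" by (simp add: S_def var_ser_mon)
  ultimately have "parameter R \<pi> B (\<beta> \<circ> const_ser R) (\<Xi> S)" unfolding parameter_def using \<Xi> by blast
  with pw ring_hom_closed [OF \<Xi>h SA] show ?thesis by blast
qed

section \<open>The Galois group of the cover\<close>

lemma ring_hom_cong: 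
  assumes f: "f \<in> ring_hom R S" and R: "ring R" and eq: "\<And>x. x \<in> carrier R \<Longrightarrow> g x = f x"
  shows "g \<in> ring_hom R S"
proof -
  interpret ring R by (rule R)
  show ?thesis using f by (auto simp: ring_hom_def eq)
qed

lemma (in cring) PIdl_eqI:
  assumes "x \<in> carrier R" "y \<in> carrier R" "c \<in> carrier R" "d \<in> carrier R" "x = c \<otimes> y" "y = d \<otimes> x"
  shows "PIdl x = PIdl y"
proof -
  have sub: "PIdl x \<subseteq> PIdl y" if c: "x \<in> carrier R" "y \<in> carrier R" "c \<in> carrier R" "x = c \<otimes> y" for x y c
  proof
    fix z assume "z \<in> PIdl x"
    then obtain e where e: "e \<in> carrier R" "z = e \<otimes> x" unfolding mem_cgenideal by blast
    have "z = (e \<otimes> c) \<otimes> y" unfolding e(2) c(4) using e(1) c by (simp add: m_assoc)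
    then show "z \<in> PIdl y" unfolding mem_cgenideal using e(1) c(3) by blast
  qed
  show ?thesis using sub [of x y c] sub [of y x d] assms by blast
qed

lemma dvr_uniformiser_exists:
  assumes "dvr B" shows "\<exists>b. dvr_unif B b"
proof -
  interpret principal_domain B using assms by (simp add: dvr_def)
  obtain P where P: "primeideal P B" "P \<noteq> {\<zero>\<^bsub>B\<^esub>}" using assms unfolding dvr_def by blast
  interpret P: primeideal P B by (rule P(1))
  obtain b where b: "b \<in> carrier B" "P = PIdl\<^bsub>B\<^esub> b" using exists_gen [OF P.is_ideal] by blast
  have nz: "b \<noteq> \<zero>\<^bsub>B\<^esub>"
  proof
    assume "b = \<zero>\<^bsub>B\<^esub>"
    then have "P = {\<zero>\<^bsub>B\<^esub>}" unfolding b(2) by (simp add: cgenideal_eq_genideal genideal_zero)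
    with P(2) show False ..
  qed
  have "ring_prime\<^bsub>B\<^esub> b" using primeideal_iff_prime [of b] P(1) b nz by simp
  then have "ring_irreducible\<^bsub>B\<^esub> b" using primeness_condition [OF b(1)] by simp
  then have "maximalideal (PIdl\<^bsub>B\<^esub> b) B" by (rule irreducible_imp_maximalideal [OF b(1)])
  then have "uniformiser B b" using b(1) nz by (simp add: uniformiser_def)
  then have "dvr_unif B b" using assms by (intro dvr_unif.intro dvr_unif_axioms.intro principal_domain_axioms)
  then show ?thesis ..
qed

section \<open>Uniformisers and the ramification index\<close>

context complete_dvr_base
begin

lemma A_uniformiser: "uniformiser A (mon \<pi> 0)"
proof -
  have pA: "mon \<pi> 0 \<in> carrier A" by simp
  have mem: "x \<in> PIdl\<^bsub>A\<^esub> (mon \<pi> 0) \<longleftrightarrow> A.cg 1 x \<zero>\<^sub>A" for x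
    unfolding A.mem_cgenideal A.cg_zero_iff using pA by (auto simp: A.m_comm)
  have "maximalideal (PIdl\<^bsub>A\<^esub> (mon \<pi> 0)) A"
  proof (rule maximalidealI)
    show "ideal (PIdl\<^bsub>A\<^esub> (mon \<pi> 0)) A" by (rule A.cgenideal_ideal [OF pA])
    show "carrier A \<noteq> PIdl\<^bsub>A\<^esub> (mon \<pi> 0)" using mem [of "\<one>\<^sub>A"] A_not_cg_one A.one_closed by blast
    fix J assume J: "ideal J A" "PIdl\<^bsub>A\<^esub> (mon \<pi> 0) \<subseteq> J" "J \<subseteq> carrier A"
    interpret J: ideal J A by (rule J(1))
    show "J = PIdl\<^bsub>A\<^esub> (mon \<pi> 0) \<or> J = carrier A"
    proof (cases "J \<subseteq> PIdl\<^bsub>A\<^esub> (mon \<pi> 0)")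
      case False
      then obtain y where y: "y \<in> J" "\<not> A.cg 1 y \<zero>\<^sub>A" using mem by blast
      have yA: "y \<in> carrier A" using J(3) y(1) by blast
      have "y \<in> Units A" using A_unit_iff [OF yA] y(2) by simp
      then have "inv\<^bsub>A\<^esub> y \<otimes>\<^sub>A y = \<one>\<^sub>A" "inv\<^bsub>A\<^esub> y \<in> carrier A" by auto
      then have "\<one>\<^sub>A \<in> J" using J.I_l_closed [OF y(1), of "inv\<^bsub>A\<^esub> y"] by simp
      then show ?thesis using J.one_imp_carrier by blast
    qed (use J(2) in blast)
  qed
  moreover have "mon \<pi> 0 \<noteq> \<zero>\<^sub>A"
  proof
    assume "mon \<pi> 0 = \<zero>\<^sub>A"
    then have "mon \<pi> 0 0 = \<zero>\<^sub>A 0" by simp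
    then show False by (simp add: mon_def A_zero)
  qed
  ultimately show ?thesis by (simp add: uniformiser_def)
qed

text \<open>The definition of the ramification index quantifies over all uniformisers of A. Each of
  them is a nonunit, hence divisible by \<pi>, and maximality of its ideal does the rest.\<close>

lemma A_uniformiser_ideal:
  assumes a: "uniformiser A a" shows "PIdl\<^bsub>A\<^esub> a = PIdl\<^bsub>A\<^esub> (mon \<pi> 0)"
proof -
  have aA: "a \<in> carrier A" and max: "maximalideal (PIdl\<^bsub>A\<^esub> a) A" using a by (auto simp: uniformiser_def)
  interpret M: maximalideal "PIdl\<^bsub>A\<^esub> a" A by (rule max)
  interpret N: maximalideal "PIdl\<^bsub>A\<^esub> (mon \<pi> 0)" A using A_uniformiser by (simp add: uniformiser_def)
  have "a \<notin> Units A"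
  proof
    assume "a \<in> Units A"
    then have "inv\<^bsub>A\<^esub> a \<otimes>\<^sub>A a = \<one>\<^sub>A" "inv\<^bsub>A\<^esub> a \<in> carrier A" by auto
    then have "\<one>\<^sub>A \<in> PIdl\<^bsub>A\<^esub> a" unfolding A.mem_cgenideal by force
    then show False using M.one_imp_carrier M.I_notcarr by blast
  qed
  then have "A.cg 1 a \<zero>\<^sub>A" using A_unit_iff [OF aA] by simp
  then obtain y where y: "y \<in> carrier A" "a = mon \<pi> 0 [^]\<^sub>A (1::nat) \<otimes>\<^sub>A y" unfolding A.cg_zero_iff by blast
  then have ay: "a = y \<otimes>\<^sub>A mon \<pi> 0" by (simp add: A.m_comm)
  have "PIdl\<^bsub>A\<^esub> a \<subseteq> PIdl\<^bsub>A\<^esub> (mon \<pi> 0)"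
  proof
    fix z assume "z \<in> PIdl\<^bsub>A\<^esub> a"
    then obtain e where e: "e \<in> carrier A" "z = e \<otimes>\<^sub>A a" unfolding A.mem_cgenideal by blast
    have "z = (e \<otimes>\<^sub>A y) \<otimes>\<^sub>A mon \<pi> 0" unfolding e(2) ay using e(1) y(1) by (simp add: A.m_assoc)
    then show "z \<in> PIdl\<^bsub>A\<^esub> (mon \<pi> 0)" unfolding A.mem_cgenideal using e(1) y(1) by blast
  qed
  then show ?thesis using M.I_maximal [OF N.is_ideal] N.I_notcarr N.a_subset by blast
qed

end

locale galois_p = complete_dvr_closed R \<pi> p for R :: "'r ring" (structure) and \<pi> p +
  fixes B :: "'b ring" and \<beta>
  assumes gal: "galois_cover A B \<beta> p" and ram: "ramification_index A B \<beta> = 1"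
begin

abbreviation plusB (infixl "\<oplus>\<^sub>B" 65) where "x \<oplus>\<^sub>B y \<equiv> x \<oplus>\<^bsub>B\<^esub> y"
abbreviation timesB (infixl "\<otimes>\<^sub>B" 70) where "x \<otimes>\<^sub>B y \<equiv> x \<otimes>\<^bsub>B\<^esub> y"
abbreviation diffB (infixl "\<ominus>\<^sub>B" 65) where "x \<ominus>\<^sub>B y \<equiv> x \<ominus>\<^bsub>B\<^esub> y"
abbreviation negB ("\<ominus>\<^sub>B _" [81] 80) where "\<ominus>\<^sub>B x \<equiv> \<ominus>\<^bsub>B\<^esub> x"
abbreviation oneB ("\<one>\<^sub>B") where "\<one>\<^sub>B \<equiv> \<one>\<^bsub>B\<^esub>"
abbreviation zeroB ("\<zero>\<^sub>B") where "\<zero>\<^sub>B \<equiv> \<zero>\<^bsub>B\<^esub>"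
abbreviation powB (infixr "[^]\<^sub>B" 75) where "x [^]\<^sub>B k \<equiv> x [^]\<^bsub>B\<^esub> k"

abbreviation w :: 'b where "w \<equiv> \<beta> (mon \<pi> 0)"

lemma B_dvr: "dvr B" and B_cring: "cring B" and \<beta>_hom: "\<beta> \<in> ring_hom A B" and \<beta>_inj: "inj_on \<beta> (carrier A)"
  and auts_finite: "finite (alg_auts A B \<beta>)" and auts_card: "card (alg_auts A B \<beta>) = p"
  and fixed_ring: "{b \<in> carrier B. \<forall>\<sigma>\<in>alg_auts A B \<beta>. \<sigma> b = b} = \<beta> ` carrier A"
  using gal by (auto simp: galois_cover_def algebra_over_def)

sublocale E: alg A B \<beta>
  by (intro alg.intro alg_axioms.intro A.is_cring B_cring \<beta>_hom)

lemma w_closed: "w \<in> carrier B" by simp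

text \<open>If w is a unit times b^e for some uniformiser b of B, then e is the ramification index,
  hence 1. So B and A share the uniformiser \<pi>.\<close>

lemma w_uniformiser: "uniformiser B w"
proof -
  obtain b where "dvr_unif B b" using dvr_uniformiser_exists [OF B_dvr] ..
  then interpret b: dvr_unif B b .
  have nz: "w \<noteq> \<zero>\<^sub>B"
  proof
    assume "w = \<zero>\<^sub>B"
    then have "\<beta> (mon \<pi> 0) = \<beta> \<zero>\<^sub>A" by simp
    then have "mon \<pi> 0 = \<zero>\<^sub>A" by (rule inj_onD [OF \<beta>_inj]) simp_all
    then show False using A_uniformiser by (simp add: uniformiser_def)
  qed
  obtain e v where v: "v \<in> Units B" "w = b [^]\<^sub>B (e::nat) \<otimes>\<^sub>B v" using b.valuation_decomp [OF w_closed nz] by blast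
  have vB: "v \<in> carrier B" "inv\<^bsub>B\<^esub> v \<in> carrier B" using v(1) by auto
  have we: "PIdl\<^bsub>B\<^esub> w = PIdl\<^bsub>B\<^esub> (b [^]\<^sub>B e)"
  proof (rule E.B.PIdl_eqI [OF w_closed _ vB])
    show "w = v \<otimes>\<^sub>B b [^]\<^sub>B e" using v(2) vB by (simp add: E.B.m_comm)
    have "inv\<^bsub>B\<^esub> v \<otimes>\<^sub>B w = b [^]\<^sub>B e \<otimes>\<^sub>B (v \<otimes>\<^sub>B inv\<^bsub>B\<^esub> v)"
      unfolding v(2) using vB by (simp add: E.B.m_ac)
    then show "b [^]\<^sub>B e = inv\<^bsub>B\<^esub> v \<otimes>\<^sub>B w" using v(1) by simp
  qed simp
  \<comment> \<open>The exponent e must serve every pair of uniformisers before the definite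
    description can be evaluated.\<close>
  have all: "PIdl\<^bsub>B\<^esub> (\<beta> a) = PIdl\<^bsub>B\<^esub> (b' [^]\<^sub>B e)" if a: "uniformiser A a" and b': "uniformiser B b'" for a b'
  proof -
    have aA: "a \<in> carrier A" and bB: "b' \<in> carrier B" using a b' by (auto simp: uniformiser_def)
    have "a \<in> PIdl\<^bsub>A\<^esub> (mon \<pi> 0)" using A.cgenideal_self [OF aA] A_uniformiser_ideal [OF a] by simp
    then obtain y where y: "y \<in> carrier A" "a = y \<otimes>\<^sub>A mon \<pi> 0" unfolding A.mem_cgenideal by blast
    have "mon \<pi> 0 \<in> PIdl\<^bsub>A\<^esub> a" using A.cgenideal_self [of "mon \<pi> 0"] A_uniformiser_ideal [OF a] by simp
    then obtain z where z: "z \<in> carrier A" "mon \<pi> 0 = z \<otimes>\<^sub>A a" unfolding A.mem_cgenideal by blast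
    have ba: "\<beta> a = \<beta> y \<otimes>\<^sub>B w" using arg_cong [OF y(2), of \<beta>] y(1) by simp
    have wz: "w = \<beta> z \<otimes>\<^sub>B \<beta> a" using arg_cong [OF z(2), of \<beta>] z(1) aA by simp
    have "PIdl\<^bsub>B\<^esub> (\<beta> a) = PIdl\<^bsub>B\<^esub> w"
      by (rule E.B.PIdl_eqI [OF _ w_closed _ _ ba wz]) (use aA y(1) z(1) in simp_all)
    moreover have "PIdl\<^bsub>B\<^esub> (b [^]\<^sub>B e) = PIdl\<^bsub>B\<^esub> (b' [^]\<^sub>B e)"
    proof -
      have i: "PIdl\<^bsub>B\<^esub> b' = PIdl\<^bsub>B\<^esub> b" by (rule b.uniformiser_ideal [OF b'])
      have "b \<in> PIdl\<^bsub>B\<^esub> b'" unfolding i by (rule E.B.cgenideal_self) simp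
      then obtain c where c: "c \<in> carrier B" "b = c \<otimes>\<^sub>B b'" unfolding E.B.mem_cgenideal by blast
      have "b' \<in> PIdl\<^bsub>B\<^esub> b" unfolding i [symmetric] by (rule E.B.cgenideal_self [OF bB])
      then obtain d where d: "d \<in> carrier B" "b' = d \<otimes>\<^sub>B b" unfolding E.B.mem_cgenideal by blast
      have "b [^]\<^sub>B e = c [^]\<^sub>B e \<otimes>\<^sub>B b' [^]\<^sub>B e"
        using arg_cong [OF c(2), of "\<lambda>t. t [^]\<^sub>B e"] c(1) bB by (simp add: E.B.nat_pow_distrib)
      moreover have "b' [^]\<^sub>B e = d [^]\<^sub>B e \<otimes>\<^sub>B b [^]\<^sub>B e"
        using arg_cong [OF d(2), of "\<lambda>t. t [^]\<^sub>B e"] d(1) by (simp add: E.B.nat_pow_distrib)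
      ultimately show ?thesis by (rule E.B.PIdl_eqI [rotated 4]) (use c(1) d(1) bB in simp_all)
    qed
    ultimately show ?thesis using we by simp
  qed
  have "ramification_index A B \<beta> = e"
    unfolding ramification_index_def
  proof (rule the_equality)
    show "\<forall>a b. uniformiser A a \<longrightarrow> uniformiser B b \<longrightarrow> PIdl\<^bsub>B\<^esub> (\<beta> a) = PIdl\<^bsub>B\<^esub> (b [^]\<^sub>B e)" using all by blast
    fix e' assume "\<forall>a b. uniformiser A a \<longrightarrow> uniformiser B b \<longrightarrow> PIdl\<^bsub>B\<^esub> (\<beta> a) = PIdl\<^bsub>B\<^esub> (b [^]\<^sub>B (e'::nat))"
    then have "PIdl\<^bsub>B\<^esub> w = PIdl\<^bsub>B\<^esub> (b [^]\<^sub>B e')" using A_uniformiser b.unif by blast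
    then show "e' = e" using we by (intro b.pow_u_ideal_inj) simp
  qed
  then have "e = 1" using ram by simp
  then have "PIdl\<^bsub>B\<^esub> w = PIdl\<^bsub>B\<^esub> b" using we by simp
  then show ?thesis using b.unif nz by (simp add: uniformiser_def)
qed

sublocale W: dvr_unif B w
  using B_dvr w_uniformiser by (intro dvr_unif.intro dvr_unif_axioms.intro) (simp_all add: dvr_def)

section \<open>The cyclic Galois group\<close>

abbreviation Gal :: "('b \<Rightarrow> 'b) monoid"
  where "Gal \<equiv> BijGroup (carrier B)\<lparr>carrier := alg_auts A B \<beta>\<rparr>"

lemma alg_autsD:
  assumes "s \<in> alg_auts A B \<beta>"
  shows "s \<in> ring_hom B B" "s \<in> Bij (carrier B)" "a \<in> carrier A \<Longrightarrow> s (\<beta> a) = \<beta> a"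
  using assms by (auto simp: alg_auts_def alg_homs_def Bij_def)

lemma alg_autsI:
  "s \<in> ring_hom B B \<Longrightarrow> s \<in> Bij (carrier B) \<Longrightarrow> (\<And>a. a \<in> carrier A \<Longrightarrow> s (\<beta> a) = \<beta> a) \<Longrightarrow> s \<in> alg_auts A B \<beta>"
  by (auto simp: alg_auts_def alg_homs_def Bij_def)

lemma Gal_group: "group Gal"
proof (rule subgroup.subgroup_is_group [OF _ group_BijGroup])
  show "subgroup (alg_auts A B \<beta>) (BijGroup (carrier B))"
  proof (rule group.subgroupI [OF group_BijGroup])
    show "alg_auts A B \<beta> \<subseteq> carrier (BijGroup (carrier B))" using alg_autsD(2) by (auto simp: BijGroup_def)
    show "alg_auts A B \<beta> \<noteq> {}" using auts_card p_gt_1 by auto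
    fix s assume s: "s \<in> alg_auts A B \<beta>"
    note S = alg_autsD [OF s]
    have inj: "inj_on s (carrier B)" and bij: "bij_betw s (carrier B) (carrier B)" using S(2) by (auto simp: Bij_def bij_betw_def)
    have iv: "inv\<^bsub>BijGroup (carrier B)\<^esub> s = (\<lambda>x\<in>carrier B. inv_into (carrier B) s x)" by (rule inv_BijGroup [OF S(2)])
    show "inv\<^bsub>BijGroup (carrier B)\<^esub> s \<in> alg_auts A B \<beta>"
      unfolding iv
    proof (rule alg_autsI)
      have "s \<in> ring_iso B B" using S(1) bij by (simp add: ring_iso_def)
      then have "inv_into (carrier B) s \<in> ring_iso B B" by (rule ring_iso_set_sym [OF E.B.ring_axioms])
      then have "inv_into (carrier B) s \<in> ring_hom B B" by (simp add: ring_iso_def)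
      then show "(\<lambda>x\<in>carrier B. inv_into (carrier B) s x) \<in> ring_hom B B"
        by (rule ring_hom_cong [OF _ E.B.ring_axioms]) simp
      show "(\<lambda>x\<in>carrier B. inv_into (carrier B) s x) \<in> Bij (carrier B)" by (rule restrict_inv_into_Bij [OF S(2)])
      fix a assume a: "a \<in> carrier A"
      show "(\<lambda>x\<in>carrier B. inv_into (carrier B) s x) (\<beta> a) = \<beta> a"
        using inv_into_f_f [OF inj, of "\<beta> a"] S(3) [OF a] a by simp
    qed
    fix t assume t: "t \<in> alg_auts A B \<beta>"
    note T = alg_autsD [OF t]
    have cl: "t x \<in> carrier B" if "x \<in> carrier B" for x using ring_hom_closed [OF T(1) that] .
    have m: "s \<otimes>\<^bsub>BijGroup (carrier B)\<^esub> t = compose (carrier B) s t" using S(2) T(2) by (simp add: BijGroup_def)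
    show "s \<otimes>\<^bsub>BijGroup (carrier B)\<^esub> t \<in> alg_auts A B \<beta>"
      unfolding m
    proof (rule alg_autsI)
      have "s \<circ> t \<in> ring_hom B B" by (rule ring_hom_trans [OF T(1) S(1)])
      then show "compose (carrier B) s t \<in> ring_hom B B"
        by (rule ring_hom_cong [OF _ E.B.ring_axioms]) (simp add: compose_eq)
      show "compose (carrier B) s t \<in> Bij (carrier B)" by (rule compose_Bij [OF S(2) T(2)])
      show "compose (carrier B) s t (\<beta> a) = \<beta> a" if "a \<in> carrier A" for a
        using that S(3) T(3) by (simp add: compose_eq)
    qed
  qed
qed

lemma Gal_pow:
  assumes s: "s \<in> alg_auts A B \<beta>" and b: "b \<in> carrier B"
  shows "(s [^]\<^bsub>Gal\<^esub> (n::nat)) b = (s ^^ n) b"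
  using b
proof (induction n arbitrary: b)
  case 0
  then show ?case by (simp add: BijGroup_def nat_pow_def)
next
  case (Suc n)
  interpret G: group Gal by (rule Gal_group)
  have sc: "s \<in> carrier Gal" using s by simp
  have "s [^]\<^bsub>Gal\<^esub> n \<in> carrier Gal" by (rule G.nat_pow_closed [OF sc])
  then have "s [^]\<^bsub>Gal\<^esub> n \<in> alg_auts A B \<beta>" by simp
  then have nb: "s [^]\<^bsub>Gal\<^esub> n \<in> Bij (carrier B)" by (rule alg_autsD(2))
  have e: "x \<otimes>\<^bsub>Gal\<^esub> s = compose (carrier B) x s" if "x \<in> Bij (carrier B)" for x
    using alg_autsD(2) [OF s] that by (simp add: BijGroup_def)
  have "s [^]\<^bsub>Gal\<^esub> Suc n = s [^]\<^bsub>Gal\<^esub> n \<otimes>\<^bsub>Gal\<^esub> s" by (rule G.nat_pow_Suc)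
  also have "\<dots> = compose (carrier B) (s [^]\<^bsub>Gal\<^esub> n) s" by (rule e [OF nb])
  finally have "s [^]\<^bsub>Gal\<^esub> Suc n = compose (carrier B) (s [^]\<^bsub>Gal\<^esub> n) s" .
  then have "(s [^]\<^bsub>Gal\<^esub> Suc n) b = (s [^]\<^bsub>Gal\<^esub> n) (s b)" using Suc.prems by (simp add: compose_eq)
  also have "\<dots> = (s ^^ n) (s b)" using ring_hom_closed [OF alg_autsD(1) [OF s] Suc.prems] by (rule Suc.IH)
  finally show ?case by (simp add: funpow_swap1)
qed

text \<open>A group of prime order is generated by any nontrivial element. The iterates are
  restricted to the carrier because the members of \<open>alg_auts\<close> are extensional.\<close>

lemma generator_exists:
  "\<exists>s. s \<in> alg_auts A B \<beta> \<and> (\<forall>b\<in>carrier B. (s ^^ p) b = b) \<and> (\<exists>b\<in>carrier B. s b \<noteq> b) \<and>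
    bij_betw (\<lambda>i. \<lambda>b\<in>carrier B. (s ^^ i) b) {..<p} (alg_auts A B \<beta>)"
proof -
  interpret G: group Gal by (rule Gal_group)
  have carr: "carrier Gal = alg_auts A B \<beta>" by simp
  have one: "\<one>\<^bsub>Gal\<^esub> = (\<lambda>b\<in>carrier B. b)" by (simp add: BijGroup_def)
  have fin: "finite (carrier Gal)" using auts_finite by simp
  have ord: "order Gal = p" using auts_card by (simp add: order_def)
  obtain s where s: "s \<in> carrier Gal" "s \<noteq> \<one>\<^bsub>Gal\<^esub>"
  proof -
    have "\<not> carrier Gal \<subseteq> {\<one>\<^bsub>Gal\<^esub>}"
    proof
      assume "carrier Gal \<subseteq> {\<one>\<^bsub>Gal\<^esub>}"
      then have "card (carrier Gal) \<le> card {\<one>\<^bsub>Gal\<^esub>}" by (intro card_mono) simp_all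
      then show False using ord p_gt_1 by (simp add: order_def)
    qed
    then show thesis using that by blast
  qed
  have "G.ord s dvd p" using G.ord_dvd_group_order [OF s(1)] ord by simp
  moreover have "G.ord s \<noteq> 1" using G.ord_eq_1 [OF s(1)] s(2) by simp
  ultimately have os: "G.ord s = p" using p unfolding prime_nat_iff by blast
  have sa: "s \<in> alg_auts A B \<beta>" using s(1) by simp
  have eq: "s [^]\<^bsub>Gal\<^esub> i = (\<lambda>b\<in>carrier B. (s ^^ i) b)" for i :: nat
  proof (rule extensionalityI [of _ "carrier B"])
    have "s [^]\<^bsub>Gal\<^esub> i \<in> alg_auts A B \<beta>" using G.nat_pow_closed [OF s(1), of i] by simp
    then show "s [^]\<^bsub>Gal\<^esub> i \<in> extensional (carrier B)" using alg_autsD(2) by (auto simp: Bij_def)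
  qed (simp_all add: Gal_pow [OF sa])
  have inj: "inj_on (\<lambda>i::nat. s [^]\<^bsub>Gal\<^esub> i) {..<p}"
  proof -
    have "{..<p} = {0..G.ord s - 1}" using os p_gt_1 by auto
    then show ?thesis using G.ord_inj [OF s(1)] by simp
  qed
  have "(\<lambda>i::nat. s [^]\<^bsub>Gal\<^esub> i) ` {..<p} = carrier Gal"
  proof (rule card_subset_eq [OF fin])
    show "(\<lambda>i::nat. s [^]\<^bsub>Gal\<^esub> i) ` {..<p} \<subseteq> carrier Gal" using G.nat_pow_closed [OF s(1)] by blast
    show "card ((\<lambda>i::nat. s [^]\<^bsub>Gal\<^esub> i) ` {..<p}) = card (carrier Gal)"
      using card_image [OF inj] ord by (simp add: order_def)
  qed
  then have bij: "bij_betw (\<lambda>i. \<lambda>b\<in>carrier B. (s ^^ i) b) {..<p} (alg_auts A B \<beta>)"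
    using inj unfolding bij_betw_def eq carr by simp
  have "(s ^^ p) b = b" if b: "b \<in> carrier B" for b
  proof -
    have "s [^]\<^bsub>Gal\<^esub> p = \<one>\<^bsub>Gal\<^esub>" using G.pow_ord_eq_1 [OF s(1)] os by simp
    then have "(s [^]\<^bsub>Gal\<^esub> p) b = b" using one b by simp
    then show ?thesis unfolding Gal_pow [OF sa b] .
  qed
  moreover have "\<exists>b\<in>carrier B. s b \<noteq> b"
  proof (rule ccontr)
    assume "\<not> (\<exists>b\<in>carrier B. s b \<noteq> b)"
    then have "s = (\<lambda>b\<in>carrier B. b)"
      using alg_autsD(2) [OF sa] by (intro extensionalityI [of _ "carrier B"]) (auto simp: Bij_def)
    with s(2) one show False by simp
  qed
  ultimately show ?thesis using sa bij by blast
qed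

end

locale galois_gen = galois_p +
  fixes s
  assumes s_aut: "s \<in> alg_auts A B \<beta>" and s_pow_p: "\<And>b. b \<in> carrier B \<Longrightarrow> (s ^^ p) b = b"
    and s_nontrivial: "\<exists>b\<in>carrier B. s b \<noteq> b"
    and s_bij: "bij_betw (\<lambda>i. \<lambda>b\<in>carrier B. (s ^^ i) b) {..<p} (alg_auts A B \<beta>)"
begin

sublocale s: ring_hom_cring B B s
  by (rule ring_hom_cringI [OF B_cring B_cring alg_autsD(1) [OF s_aut]])

sublocale Bc: cring_char B p
proof (intro cring_char.intro cring_char_axioms.intro B_cring p)
  have "\<beta> ([n] \<cdot>\<^bsub>A\<^esub> \<one>\<^sub>A) = [n] \<cdot>\<^bsub>B\<^esub> \<one>\<^sub>B" for n :: nat by (induction n) simp_all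
  from this [of p] show "[p] \<cdot>\<^bsub>B\<^esub> \<one>\<^sub>B = \<zero>\<^sub>B" using A.char by simp
qed

lemma s_\<beta> [simp]: "a \<in> carrier A \<Longrightarrow> s (\<beta> a) = \<beta> a"
  by (rule alg_autsD(3) [OF s_aut])

lemma s_pow_closed [simp]: "b \<in> carrier B \<Longrightarrow> (s ^^ i) b \<in> carrier B"
  by (induction i) simp_all

lemma s_pow_add: "a \<in> carrier B \<Longrightarrow> b \<in> carrier B \<Longrightarrow> (s ^^ i) (a \<oplus>\<^sub>B b) = (s ^^ i) a \<oplus>\<^sub>B (s ^^ i) b"
  by (induction i) simp_all

lemma s_pow_mult: "a \<in> carrier B \<Longrightarrow> b \<in> carrier B \<Longrightarrow> (s ^^ i) (a \<otimes>\<^sub>B b) = (s ^^ i) a \<otimes>\<^sub>B (s ^^ i) b"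
  by (induction i) simp_all

lemma s_pow_pow: "b \<in> carrier B \<Longrightarrow> (s ^^ i) (b [^]\<^sub>B (k::nat)) = ((s ^^ i) b) [^]\<^sub>B k"
  by (induction i) simp_all

lemma s_pow_\<beta> [simp]: "a \<in> carrier A \<Longrightarrow> (s ^^ i) (\<beta> a) = \<beta> a"
  by (induction i) simp_all

lemma fixed: assumes b: "b \<in> carrier B" "s b = b" shows "\<exists>a\<in>carrier A. b = \<beta> a"
proof -
  have pw: "(s ^^ i) b = b" for i by (induction i) (simp_all add: b(2))
  have "t b = b" if t: "t \<in> alg_auts A B \<beta>" for t
  proof -
    have "t \<in> (\<lambda>i. \<lambda>b\<in>carrier B. (s ^^ i) b) ` {..<p}" using s_bij t by (simp add: bij_betw_def)
    then obtain i where "t = (\<lambda>b\<in>carrier B. (s ^^ i) b)" by (rule imageE)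
    then show ?thesis using b(1) pw by simp
  qed
  then have "b \<in> \<beta> ` carrier A" using fixed_ring b(1) by blast
  then show ?thesis by blast
qed

lemma trace: assumes b: "b \<in> carrier B"
  shows "galois_trace A B \<beta> b = (\<Oplus>\<^bsub>B\<^esub>i\<in>{..<p}. (s ^^ i) b)"
proof -
  let ?h = "\<lambda>i. \<lambda>b\<in>carrier B. (s ^^ i) b"
  have inj: "inj_on ?h {..<p}" and im: "alg_auts A B \<beta> = ?h ` {..<p}" using s_bij by (auto simp: bij_betw_def)
  have "galois_trace A B \<beta> b = (\<Oplus>\<^bsub>B\<^esub>t\<in>?h ` {..<p}. t b)" by (simp only: galois_trace_def im)
  also have "\<dots> = (\<Oplus>\<^bsub>B\<^esub>i\<in>{..<p}. ?h i b)" using b by (intro E.B.finsum_reindex inj) auto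
  finally show ?thesis using b by simp
qed

end

text \<open>Newton's forward difference formula, the binomial theorem for f = 1 + D. It is proved at
  an element b because operators form no ring here; the induction uses that f fixes
  integers.\<close>

lemma (in cring) newton_difference:
  assumes f: "f \<in> ring_hom R R" and b: "b \<in> carrier R"
  shows "(f ^^ n) b = (\<Oplus>k\<in>{..n}. \<guillemotleft>int (n choose k)\<guillemotright> \<otimes> ((\<lambda>y. f y \<ominus> y) ^^ k) b)"
proof (induction n)
  case 0
  show ?case using b by simp
next
  case (Suc n)
  interpret f: ring_hom_cring R R f by (rule ring_hom_cringI [OF is_cring is_cring f])
  define d where "d k = ((\<lambda>y. f y \<ominus> y) ^^ k) b" for k
  have d: "d k \<in> carrier R" for k unfolding d_def using b by (induction k) simp_all
  have "d (Suc k) = f (d k) \<ominus> d k" for k by (simp add: d_def)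
  then have fd: "f (d k) = d k \<oplus> d (Suc k)" for k
    using eq_add_if_minus_eq [of "f (d k)" "d k" "d (Suc k)"] d by simp
  define C where "C k = \<guillemotleft>int (n choose k)\<guillemotright>" for k
  have fi: "f \<guillemotleft>int j\<guillemotright> = \<guillemotleft>int j\<guillemotright>" for j by (induction j) simp_all
  have C: "C k \<in> carrier R" "f (C k) = C k" for k by (simp_all add: C_def fi)
  have "(f ^^ Suc n) b = f (\<Oplus>k\<in>{..n}. C k \<otimes> d k)" using Suc by (simp add: C_def d_def)
  also have "\<dots> = (\<Oplus>k\<in>{..n}. f (C k \<otimes> d k))" using C(1) d by (subst f.hom_finsum) (auto simp: comp_def)
  also have "\<dots> = (\<Oplus>k\<in>{..n}. C k \<otimes> d k \<oplus> C k \<otimes> d (Suc k))"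
    using C d fd by (intro finsum_cong') (auto simp: r_distr)
  also have "\<dots> = (\<Oplus>k\<in>{..n}. C k \<otimes> d k) \<oplus> (\<Oplus>k\<in>{..n}. C k \<otimes> d (Suc k))"
    using C(1) d by (intro finsum_addf) auto
  also have "(\<Oplus>k\<in>{..n}. C k \<otimes> d k) = d 0 \<oplus> (\<Oplus>k\<in>{..n}. C (Suc k) \<otimes> d (Suc k))"
  proof -
    have "(\<Oplus>k\<in>{..Suc n}. C k \<otimes> d k) = C (Suc n) \<otimes> d (Suc n) \<oplus> (\<Oplus>k\<in>{..n}. C k \<otimes> d k)"
      using C(1) d by (subst finsum_Suc) auto
    moreover have "C (Suc n) = \<zero>" by (simp add: C_def binomial_eq_0)
    moreover have "(\<Oplus>k\<in>{..n}. C k \<otimes> d k) \<in> carrier R" using C(1) d by (intro finsum_closed) auto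
    moreover have "(\<Oplus>k\<in>{..Suc n}. C k \<otimes> d k) = C 0 \<otimes> d 0 \<oplus> (\<Oplus>k\<in>{..n}. C (Suc k) \<otimes> d (Suc k))"
      using C(1) d by (intro finsum_shift_head) auto
    moreover have "C 0 = \<one>" by (simp add: C_def)
    ultimately show ?thesis using d by simp
  qed
  finally have lhs: "(f ^^ Suc n) b = d 0 \<oplus> (\<Oplus>k\<in>{..n}. C (Suc k) \<otimes> d (Suc k)) \<oplus> (\<Oplus>k\<in>{..n}. C k \<otimes> d (Suc k))" .
  have "(\<Oplus>k\<in>{..Suc n}. \<guillemotleft>int (Suc n choose k)\<guillemotright> \<otimes> d k) =
      \<guillemotleft>int (Suc n choose 0)\<guillemotright> \<otimes> d 0 \<oplus> (\<Oplus>k\<in>{..n}. \<guillemotleft>int (Suc n choose Suc k)\<guillemotright> \<otimes> d (Suc k))"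
    using d by (intro finsum_shift_head) auto
  also have "(\<Oplus>k\<in>{..n}. \<guillemotleft>int (Suc n choose Suc k)\<guillemotright> \<otimes> d (Suc k)) =
      (\<Oplus>k\<in>{..n}. C k \<otimes> d (Suc k) \<oplus> C (Suc k) \<otimes> d (Suc k))"
    using C(1) d by (intro finsum_cong') (auto simp: C_def l_distr)
  also have "\<dots> = (\<Oplus>k\<in>{..n}. C k \<otimes> d (Suc k)) \<oplus> (\<Oplus>k\<in>{..n}. C (Suc k) \<otimes> d (Suc k))"
    using C(1) d by (intro finsum_addf) auto
  finally have rhs: "(\<Oplus>k\<in>{..Suc n}. \<guillemotleft>int (Suc n choose k)\<guillemotright> \<otimes> d k) =
    d 0 \<oplus> ((\<Oplus>k\<in>{..n}. C k \<otimes> d (Suc k)) \<oplus> (\<Oplus>k\<in>{..n}. C (Suc k) \<otimes> d (Suc k)))" using d by simp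
  have "(\<Oplus>k\<in>{..n}. C (Suc k) \<otimes> d (Suc k)) \<in> carrier R" "(\<Oplus>k\<in>{..n}. C k \<otimes> d (Suc k)) \<in> carrier R"
    using C(1) d by (auto intro!: finsum_closed)
  then have "(f ^^ Suc n) b = (\<Oplus>k\<in>{..Suc n}. \<guillemotleft>int (Suc n choose k)\<guillemotright> \<otimes> d k)"
    unfolding lhs rhs using d [of 0] by (simp add: a_ac)
  then show ?case unfolding d_def .
qed

text \<open>All inner binomial coefficients vanish in the ring, so the Newton formula for f^p
  reduces to b = D^p b + b.\<close>

lemma (in cring_char) difference_pow_p:
  assumes f: "f \<in> ring_hom R R" and b: "b \<in> carrier R" and fp: "(f ^^ p) b = b"
  shows "((\<lambda>y. f y \<ominus> y) ^^ p) b = \<zero>"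
proof -
  define d where "d k = ((\<lambda>y. f y \<ominus> y) ^^ k) b" for k
  have d: "d k \<in> carrier R" for k unfolding d_def using b ring_hom_closed [OF f] by (induction k) simp_all
  have d0: "d 0 = b" by (simp add: d_def)
  obtain q where q: "p = Suc (Suc q)"
    using p_gt_1 by (metis less_imp_Suc_add plus_1_eq_Suc add_Suc)
  let ?f = "\<lambda>k. \<guillemotleft>int (p choose k)\<guillemotright> \<otimes> d k"
  have "(\<Oplus>k\<in>{..q}. ?f (Suc k)) = (\<Oplus>k\<in>{..q}. \<zero>)"
  proof (rule finsum_cong')
    fix k assume "k \<in> {..q}"
    then have "\<guillemotleft>int (p choose Suc k)\<guillemotright> = \<zero>"
      using p q by (intro of_int_dvd, subst int_dvd_int_iff, intro dvd_choose_prime) auto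
    then show "?f (Suc k) = \<zero>" using d by simp
  qed auto
  then have mid: "(\<Oplus>k\<in>{..q}. ?f (Suc k)) = \<zero>" by simp
  have "b = (\<Oplus>k\<in>{..Suc (Suc q)}. ?f k)"
    using newton_difference [OF f b, of p] fp by (simp only: d_def q)
  also have "\<dots> = ?f (Suc (Suc q)) \<oplus> (\<Oplus>k\<in>{..Suc q}. ?f k)"
    using d by (subst finsum_Suc) auto
  also have "(\<Oplus>k\<in>{..Suc q}. ?f k) = ?f 0 \<oplus> (\<Oplus>k\<in>{..q}. ?f (Suc k))"
    using d by (intro finsum_shift_head) auto
  finally have "b = ?f (Suc (Suc q)) \<oplus> (?f 0 \<oplus> \<zero>)" unfolding mid .
  then have "b = d p \<oplus> b" using d [of p] b unfolding q [symmetric] by (simp add: d0)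
  then have "d p \<oplus> b = \<zero> \<oplus> b" using b by simp
  then have "d p = \<zero>" using d [of p] b by (metis add.right_cancel zero_closed)
  then show ?thesis by (simp add: d_def)
qed

section \<open>The element \<theta> and its equation\<close>

context galois_gen
begin

lemma w_pow_nonzero: "w [^]\<^sub>B (n::nat) \<noteq> \<zero>\<^sub>B"
  by (rule W.pow_u_nonzero)

lemma s_w [simp]: "s w = w" and s_pow_w [simp]: "s (w [^]\<^sub>B (n::nat)) = w [^]\<^sub>B n"
  by simp_all

lemma theta_exists: "\<exists>n. \<exists>\<theta>\<in>carrier B. s \<theta> = \<theta> \<oplus>\<^sub>B w [^]\<^sub>B (n::nat)"
proof -
  define D where "D = (\<lambda>y. s y \<ominus>\<^sub>B y)"
  have Dc: "D y \<in> carrier B" if "y \<in> carrier B" for y using that by (simp add: D_def)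
  have sD: "s y = y \<oplus>\<^sub>B D y" if "y \<in> carrier B" for y
    using E.B.eq_add_if_minus_eq [of "s y" y "D y"] that by (simp add: D_def)
  obtain b where b: "b \<in> carrier B" "s b \<noteq> b" using s_nontrivial by blast
  have Dk: "(D ^^ k) b \<in> carrier B" for k using b(1) Dc by (induction k) simp_all
  have Dp: "(D ^^ p) b = \<zero>\<^sub>B"
    unfolding D_def by (rule Bc.difference_pow_p [OF alg_autsD(1) [OF s_aut] b(1) s_pow_p [OF b(1)]])
  \<comment> \<open>The element b is nonzero and not fixed, so K is at least 2. Two steps before D
    kills the orbit of b lies y, and z = D y is the last nonzero member: fixed by s, hence from
    A.\<close>
  define K where "K = (LEAST k. (D ^^ k) b = \<zero>\<^sub>B)"
  have K: "(D ^^ K) b = \<zero>\<^sub>B" unfolding K_def using Dp by (rule LeastI)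
  have Kl: "(D ^^ k) b \<noteq> \<zero>\<^sub>B" if "k < K" for k using not_less_Least [of k] that unfolding K_def by blast
  have "D b \<noteq> \<zero>\<^sub>B" using sD [OF b(1)] b by auto
  moreover have "b \<noteq> \<zero>\<^sub>B" using b(2) by auto
  ultimately have "K \<noteq> 0" "K \<noteq> 1" using K by (auto intro: ccontr)
  then obtain k where k: "K = Suc (Suc k)" by (metis One_nat_def not0_implies_Suc)
  define y where "y = (D ^^ k) b"
  define z where "z = D y"
  have yB: "y \<in> carrier B" and zB: "z \<in> carrier B" using Dk [of k] Dc by (simp_all add: y_def z_def)
  have z0: "z \<noteq> \<zero>\<^sub>B" using Kl [of "Suc k"] by (simp add: k z_def y_def)
  have Dz: "D z = \<zero>\<^sub>B" using K by (simp add: k z_def y_def)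
  have "s z = z" using sD [OF zB] zB by (simp add: Dz)
  then obtain a where a: "a \<in> carrier A" "z = \<beta> a" using fixed [OF zB] by blast
  have "a \<noteq> \<zero>\<^sub>A" using z0 a(2) by auto
  from A_nonzero_decomp [OF a(1) this] obtain n e where
    e: "e \<in> Units A" "a = mon \<pi> 0 [^]\<^sub>A (n::nat) \<otimes>\<^sub>A e" by blast
  have eA: "e \<in> carrier A" "inv\<^bsub>A\<^esub> e \<in> carrier A" using e(1) by auto
  define \<theta> where "\<theta> = y \<otimes>\<^sub>B \<beta> (inv\<^bsub>A\<^esub> e)"
  have \<theta>B: "\<theta> \<in> carrier B" using yB eA by (simp add: \<theta>_def)
  have "a \<otimes>\<^sub>A inv\<^bsub>A\<^esub> e = mon \<pi> 0 [^]\<^sub>A n" unfolding e(2) using e(1) eA by (simp add: A.m_assoc)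
  then have "\<beta> (a \<otimes>\<^sub>A inv\<^bsub>A\<^esub> e) = \<beta> (mon \<pi> 0 [^]\<^sub>A n)" by (rule arg_cong)
  then have ze: "z \<otimes>\<^sub>B \<beta> (inv\<^bsub>A\<^esub> e) = w [^]\<^sub>B n" using a eA by simp
  have "s \<theta> = (y \<oplus>\<^sub>B z) \<otimes>\<^sub>B \<beta> (inv\<^bsub>A\<^esub> e)" unfolding \<theta>_def using yB eA sD [OF yB] by (simp add: z_def)
  also have "\<dots> = \<theta> \<oplus>\<^sub>B z \<otimes>\<^sub>B \<beta> (inv\<^bsub>A\<^esub> e)" unfolding \<theta>_def using yB zB eA by (simp add: E.B.l_distr)
  finally have "s \<theta> = \<theta> \<oplus>\<^sub>B w [^]\<^sub>B n" unfolding ze .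
  with \<theta>B show ?thesis by blast
qed

lemma theta_equation:
  assumes \<theta>: "\<theta> \<in> carrier B" "s \<theta> = \<theta> \<oplus>\<^sub>B w [^]\<^sub>B (n::nat)"
  shows "\<exists>u\<in>carrier A. \<theta> [^]\<^sub>B p = w [^]\<^sub>B (n * (p - 1)) \<otimes>\<^sub>B \<theta> \<oplus>\<^sub>B \<beta> u"
proof -
  define a e f where "a = \<theta> [^]\<^sub>B p" and "e = w [^]\<^sub>B (n * (p - 1))" and "f = w [^]\<^sub>B n"
  have c: "a \<in> carrier B" "e \<in> carrier B" "f \<in> carrier B" using \<theta>(1) by (simp_all add: a_def e_def f_def)
  \<comment> \<open>The exponents add up so that w^(np) = w^(n(p-1)) w^n: p-th powers and
    multiplication by w^(n(p-1)) then change by the same amount when \<theta> becomes \<theta> +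
    w^n, which is where the coefficient of the equation comes from.\<close>
  have np: "n * (p - 1) + n = n * p" using p_gt_1 by (cases p) simp_all
  have "f [^]\<^sub>B p = w [^]\<^sub>B (n * p)" unfolding f_def by (simp only: E.B.nat_pow_pow w_closed)
  also have "\<dots> = e \<otimes>\<^sub>B f" unfolding e_def f_def by (simp only: E.B.nat_pow_mult w_closed np)
  finally have "f [^]\<^sub>B p = e \<otimes>\<^sub>B f" .
  then have sa: "s a = a \<oplus>\<^sub>B e \<otimes>\<^sub>B f"
    using Bc.frob_add [OF \<theta>(1) c(3)] \<theta> unfolding a_def f_def by simp
  have se: "s e = e" by (simp add: e_def)
  have "s (a \<ominus>\<^sub>B e \<otimes>\<^sub>B \<theta>) = (a \<oplus>\<^sub>B e \<otimes>\<^sub>B f) \<ominus>\<^sub>B e \<otimes>\<^sub>B (\<theta> \<oplus>\<^sub>B f)"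
    unfolding a_minus_def using \<theta> c sa se by (simp add: f_def)
  also have "\<dots> = a \<ominus>\<^sub>B e \<otimes>\<^sub>B \<theta>" using \<theta>(1) c by algebra
  finally have fx: "s (a \<ominus>\<^sub>B e \<otimes>\<^sub>B \<theta>) = a \<ominus>\<^sub>B e \<otimes>\<^sub>B \<theta>" .
  have cl: "a \<ominus>\<^sub>B e \<otimes>\<^sub>B \<theta> \<in> carrier B" using c \<theta>(1) by simp
  obtain u where u: "u \<in> carrier A" "a \<ominus>\<^sub>B e \<otimes>\<^sub>B \<theta> = \<beta> u" using fixed [OF cl fx] by blast
  have "a = e \<otimes>\<^sub>B \<theta> \<oplus>\<^sub>B \<beta> u" by (rule E.B.eq_add_if_minus_eq [OF u(2)]) (use c \<theta>(1) u(1) in simp_all)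
  with u(1) show ?thesis unfolding a_def e_def by blast
qed

text \<open>Subtracting an element of A keeps s \<theta> - \<theta> and changes u by h^p - \<pi>^N
  h. The normal forms of series determine the choice of h.\<close>

lemma theta_shift:
  assumes \<theta>: "\<theta> \<in> carrier B" "s \<theta> = \<theta> \<oplus>\<^sub>B w [^]\<^sub>B (n::nat)" and u: "u \<in> carrier A" and h: "h \<in> carrier A"
    and eq: "\<theta> [^]\<^sub>B p = w [^]\<^sub>B (N::nat) \<otimes>\<^sub>B \<theta> \<oplus>\<^sub>B \<beta> u"
  shows "\<theta> \<ominus>\<^sub>B \<beta> h \<in> carrier B" "s (\<theta> \<ominus>\<^sub>B \<beta> h) = (\<theta> \<ominus>\<^sub>B \<beta> h) \<oplus>\<^sub>B w [^]\<^sub>B n"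
    "(\<theta> \<ominus>\<^sub>B \<beta> h) [^]\<^sub>B p = w [^]\<^sub>B N \<otimes>\<^sub>B (\<theta> \<ominus>\<^sub>B \<beta> h) \<oplus>\<^sub>B
      \<beta> (u \<ominus>\<^sub>A (h [^]\<^sub>A p \<ominus>\<^sub>A mon \<pi> 0 [^]\<^sub>A N \<otimes>\<^sub>A h))"
proof -
  define a e f k where "a = \<beta> u" and "e = w [^]\<^sub>B N" and "f = w [^]\<^sub>B n" and "k = \<beta> h"
  have c: "a \<in> carrier B" "e \<in> carrier B" "f \<in> carrier B" "k \<in> carrier B" "k [^]\<^sub>B p \<in> carrier B" using \<theta>(1) u h by (simp_all add: a_def e_def f_def k_def)
  show "\<theta> \<ominus>\<^sub>B \<beta> h \<in> carrier B" using \<theta>(1) h by simp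
  have "s (\<theta> \<ominus>\<^sub>B k) = (\<theta> \<oplus>\<^sub>B f) \<ominus>\<^sub>B k" unfolding a_minus_def using \<theta> h by (simp add: k_def f_def)
  also have "\<dots> = (\<theta> \<ominus>\<^sub>B k) \<oplus>\<^sub>B f" using \<theta>(1) c by algebra
  finally show "s (\<theta> \<ominus>\<^sub>B \<beta> h) = (\<theta> \<ominus>\<^sub>B \<beta> h) \<oplus>\<^sub>B w [^]\<^sub>B n" unfolding k_def f_def .
  have "\<beta> (u \<ominus>\<^sub>A (h [^]\<^sub>A p \<ominus>\<^sub>A mon \<pi> 0 [^]\<^sub>A N \<otimes>\<^sub>A h)) = a \<ominus>\<^sub>B (k [^]\<^sub>B p \<ominus>\<^sub>B e \<otimes>\<^sub>B k)"
    unfolding a_minus_def a_def k_def e_def using u h by simp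
  moreover have "(\<theta> \<ominus>\<^sub>B k) [^]\<^sub>B p = (e \<otimes>\<^sub>B \<theta> \<oplus>\<^sub>B a) \<ominus>\<^sub>B k [^]\<^sub>B p"
    unfolding Bc.frob_minus [OF \<theta>(1) c(4)] eq e_def a_def ..
  moreover have "(e \<otimes>\<^sub>B \<theta> \<oplus>\<^sub>B a) \<ominus>\<^sub>B t = e \<otimes>\<^sub>B (\<theta> \<ominus>\<^sub>B k) \<oplus>\<^sub>B (a \<ominus>\<^sub>B (t \<ominus>\<^sub>B e \<otimes>\<^sub>B k))"
    if "t \<in> carrier B" for t using that \<theta>(1) c(1-4) by algebra
  ultimately show "(\<theta> \<ominus>\<^sub>B \<beta> h) [^]\<^sub>B p = w [^]\<^sub>B N \<otimes>\<^sub>B (\<theta> \<ominus>\<^sub>B \<beta> h) \<oplus>\<^sub>B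
      \<beta> (u \<ominus>\<^sub>A (h [^]\<^sub>A p \<ominus>\<^sub>A mon \<pi> 0 [^]\<^sub>A N \<otimes>\<^sub>A h))"
    using c(5) unfolding k_def e_def by simp
qed

text \<open>Every translate e + i is moved by s, so it is nonzero, and X^p = X gives (e + i)^(p-1) =
  1 for all i. The sum of these powers would be p * 1 = 0, but \<open>shifted_power_sum\<close>
  evaluates it to -1.\<close>

lemma no_artin_schreier_root:
  assumes e: "e \<in> carrier B" "e [^]\<^sub>B p = e" and se: "s e = e \<oplus>\<^sub>B \<one>\<^sub>B"
  shows False
proof -
  have one: "\<one>\<^sub>B \<noteq> \<zero>\<^sub>B" by (rule W.one_not_zero)
  have fi: "s \<guillemotleft>int j\<guillemotright>\<^bsub>B\<^esub> = \<guillemotleft>int j\<guillemotright>\<^bsub>B\<^esub>" for j by (induction j) simp_all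
  have pw: "(e \<oplus>\<^sub>B \<guillemotleft>int i\<guillemotright>\<^bsub>B\<^esub> \<otimes>\<^sub>B \<one>\<^sub>B) [^]\<^sub>B (p - 1) = \<one>\<^sub>B" for i
  proof -
    define y where "y = e \<oplus>\<^sub>B \<guillemotleft>int i\<guillemotright>\<^bsub>B\<^esub>"
    have y: "y \<in> carrier B" using e(1) by (simp add: y_def)
    have sy: "s y = y \<oplus>\<^sub>B \<one>\<^sub>B" unfolding y_def using e(1) se by (simp add: fi E.B.a_ac)
    have ny: "y \<noteq> \<zero>\<^sub>B" using sy one by auto
    have "y [^]\<^sub>B p = y" unfolding y_def using e by (simp add: Bc.frob_add Bc.fermat_of_int)
    moreover have "y \<otimes>\<^sub>B y [^]\<^sub>B (p - 1) = y [^]\<^sub>B p"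
      using y p_gt_1 E.B.nat_pow_Suc2 [OF y, of "p - 1"] by simp
    ultimately have "y \<otimes>\<^sub>B y [^]\<^sub>B (p - 1) = y \<otimes>\<^sub>B \<one>\<^sub>B" using y by simp
    then have "y [^]\<^sub>B (p - 1) = \<one>\<^sub>B"
      by (rule iffD1 [OF W.m_lcancel [OF ny y E.B.nat_pow_closed [OF y] E.B.one_closed]])
    then show ?thesis by (simp add: y_def)
  qed
  have "(\<Oplus>\<^bsub>B\<^esub>i\<in>{..<p}. (e \<oplus>\<^sub>B \<guillemotleft>int i\<guillemotright>\<^bsub>B\<^esub> \<otimes>\<^sub>B \<one>\<^sub>B) [^]\<^sub>B (p - 1)) = (\<Oplus>\<^bsub>B\<^esub>i\<in>{..<p}. \<guillemotleft>1\<guillemotright>\<^bsub>B\<^esub>)"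
    unfolding pw by simp
  also have "\<dots> = \<guillemotleft>int p\<guillemotright>\<^bsub>B\<^esub>" by (subst E.B.finsum_of_int) simp_all
  also have "\<dots> = \<zero>\<^sub>B" by simp
  finally have "\<ominus>\<^sub>B \<one>\<^sub>B = \<zero>\<^sub>B"
    using Bc.shifted_power_sum [OF e(1) E.B.one_closed, of "p - 1"] p_gt_1 by simp
  then have "\<ominus>\<^sub>B (\<ominus>\<^sub>B \<one>\<^sub>B) = \<ominus>\<^sub>B \<zero>\<^sub>B" by (rule arg_cong)
  then show False using one by simp
qed

lemma W_cg_pow: "x \<in> carrier B \<Longrightarrow> W.cg 1 (x [^]\<^sub>B Suc k) \<zero>\<^sub>B \<Longrightarrow> W.cg 1 x \<zero>\<^sub>B"
proof (induction k)
  case (Suc k)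
  then have "W.cg 1 (x [^]\<^sub>B Suc k \<otimes>\<^sub>B x) \<zero>\<^sub>B" by simp
  then show ?case using W.cg_one_prime [of "x [^]\<^sub>B Suc k" x] Suc by auto
qed simp

lemma \<beta>_cg: "A.cg N a b \<Longrightarrow> W.cg N (\<beta> a) (\<beta> b)"
proof -
  assume *: "A.cg N a b"
  then obtain c where c: "c \<in> carrier A" "a = b \<oplus>\<^sub>A mon \<pi> 0 [^]\<^sub>A N \<otimes>\<^sub>A c" by (rule A.cgE)
  have b: "b \<in> carrier A" using * by (rule A.cgD)
  have "\<beta> a = \<beta> b \<oplus>\<^sub>B w [^]\<^sub>B N \<otimes>\<^sub>B \<beta> c" unfolding c(2) using b c(1) by simp
  then show ?thesis using b c(1) by (intro W.cgI [of "\<beta> b" "\<beta> c"]) simp_all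
qed

lemma theta_normal_form:
  "\<exists>n \<theta> u m. \<theta> \<in> carrier B \<and> s \<theta> = \<theta> \<oplus>\<^sub>B w [^]\<^sub>B (n::nat) \<and> u \<in> carrier A \<and>
    \<theta> [^]\<^sub>B p = w [^]\<^sub>B (n * (p - 1)) \<otimes>\<^sub>B \<theta> \<oplus>\<^sub>B \<beta> u \<and> wt u m \<and> coprime m (int p) \<and> (n = 0 \<longrightarrow> m < 0)"
proof -
  define Q where "Q n \<theta> \<longleftrightarrow> \<theta> \<in> carrier B \<and> s \<theta> = \<theta> \<oplus>\<^sub>B w [^]\<^sub>B (n::nat)" for n \<theta>
  have "\<exists>n \<theta>. Q n \<theta>" using theta_exists unfolding Q_def by blast
  then obtain n where n: "\<exists>\<theta>. Q n \<theta>" "\<And>m. m < n \<Longrightarrow> \<not> (\<exists>\<theta>. Q m \<theta>)"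
    using exists_least_iff [of "\<lambda>n. \<exists>\<theta>. Q n \<theta>"] by blast
  then obtain \<theta>0 where \<theta>0: "\<theta>0 \<in> carrier B" "s \<theta>0 = \<theta>0 \<oplus>\<^sub>B w [^]\<^sub>B n" unfolding Q_def by blast
  define N where "N = n * (p - 1)"
  obtain u0 where u0: "u0 \<in> carrier A" "\<theta>0 [^]\<^sub>B p = w [^]\<^sub>B N \<otimes>\<^sub>B \<theta>0 \<oplus>\<^sub>B \<beta> u0"
    using theta_equation [OF \<theta>0] unfolding N_def by blast
  have "\<exists>\<theta> u m. \<theta> \<in> carrier B \<and> s \<theta> = \<theta> \<oplus>\<^sub>B w [^]\<^sub>B n \<and> u \<in> carrier A \<and>
    \<theta> [^]\<^sub>B p = w [^]\<^sub>B N \<otimes>\<^sub>B \<theta> \<oplus>\<^sub>B \<beta> u \<and> wt u m \<and> coprime m (int p) \<and> (n = 0 \<longrightarrow> m < 0)"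
  proof (cases "n = 0")
    case True
    then have N0: "N = 0" by (simp add: N_def)
    obtain h where h: "h \<in> carrier A" "A.cg 1 (u0 \<ominus>\<^sub>A (h [^]\<^sub>A p \<ominus>\<^sub>A h)) \<zero>\<^sub>A \<or>
      (\<exists>m<0. coprime m (int p) \<and> wt (u0 \<ominus>\<^sub>A (h [^]\<^sub>A p \<ominus>\<^sub>A h)) m)"
      using artin_schreier_normal_form [OF u0(1)] by blast
    define \<theta> where "\<theta> = \<theta>0 \<ominus>\<^sub>B \<beta> h"
    define u where "u = u0 \<ominus>\<^sub>A (h [^]\<^sub>A p \<ominus>\<^sub>A h)"
    have uA: "u \<in> carrier A" using u0(1) h(1) by (simp add: u_def)
    have "mon \<pi> 0 [^]\<^sub>A N \<otimes>\<^sub>A h = h" using h(1) by (simp add: N0)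
    then have \<theta>: "\<theta> \<in> carrier B" "s \<theta> = \<theta> \<oplus>\<^sub>B w [^]\<^sub>B n" "\<theta> [^]\<^sub>B p = w [^]\<^sub>B N \<otimes>\<^sub>B \<theta> \<oplus>\<^sub>B \<beta> u"
      using theta_shift [OF \<theta>0 u0(1) h(1) u0(2)] unfolding \<theta>_def u_def by simp_all
    have "\<not> A.cg 1 u \<zero>\<^sub>A"
    proof
      assume "A.cg 1 u \<zero>\<^sub>A"
      then obtain y where y: "y \<in> carrier A" "u = mon \<pi> 0 [^]\<^sub>A (1::nat) \<otimes>\<^sub>A y" unfolding A.cg_zero_iff by blast
      \<comment> \<open>For u divisible by \<pi> the equation g^p = g + u is solvable in A, and
        \<theta> - g becomes a root of X^p = X that s moves by 1.\<close>
      obtain g where g: "g \<in> carrier A" "g [^]\<^sub>A p = g \<oplus>\<^sub>A mon \<pi> 0 \<otimes>\<^sub>A y" using A.artin_schreier_root [OF y(1)] by blast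
      have gu: "g [^]\<^sub>A p = g \<oplus>\<^sub>A u" using g(2) y by simp
      note sh = theta_shift [OF \<theta>(1,2) uA g(1) \<theta>(3)]
      have "u \<ominus>\<^sub>A (g [^]\<^sub>A p \<ominus>\<^sub>A mon \<pi> 0 [^]\<^sub>A N \<otimes>\<^sub>A g) = u \<ominus>\<^sub>A ((g \<oplus>\<^sub>A u) \<ominus>\<^sub>A g)"
        using g(1) by (simp add: N0 gu)
      also have "\<dots> = \<zero>\<^sub>A" using g(1) uA by algebra
      finally have z: "u \<ominus>\<^sub>A (g [^]\<^sub>A p \<ominus>\<^sub>A mon \<pi> 0 [^]\<^sub>A N \<otimes>\<^sub>A g) = \<zero>\<^sub>A" .
      have "(\<theta> \<ominus>\<^sub>B \<beta> g) [^]\<^sub>B p = \<theta> \<ominus>\<^sub>B \<beta> g" using sh(3) unfolding z using sh(1) by (simp add: N0)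
      moreover have "s (\<theta> \<ominus>\<^sub>B \<beta> g) = (\<theta> \<ominus>\<^sub>B \<beta> g) \<oplus>\<^sub>B \<one>\<^sub>B" using sh(2) True by simp
      ultimately show False by (rule no_artin_schreier_root [OF sh(1)])
    qed
    then obtain m where "m < 0" "coprime m (int p)" "wt u m" using h(2) unfolding u_def by blast
    with \<theta> uA show ?thesis by blast
  next
    case False
    obtain h where h: "h \<in> carrier A" "A.cg 1 (u0 \<ominus>\<^sub>A h [^]\<^sub>A p) \<zero>\<^sub>A \<or>
      (\<exists>m. coprime m (int p) \<and> wt (u0 \<ominus>\<^sub>A h [^]\<^sub>A p) m)"
      using kummer_normal_form [OF u0(1)] by blast
    define \<theta> where "\<theta> = \<theta>0 \<ominus>\<^sub>B \<beta> h"
    define u where "u = u0 \<ominus>\<^sub>A (h [^]\<^sub>A p \<ominus>\<^sub>A mon \<pi> 0 [^]\<^sub>A N \<otimes>\<^sub>A h)"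
    have uA: "u \<in> carrier A" using u0(1) h(1) by (simp add: u_def)
    have \<theta>: "\<theta> \<in> carrier B" "s \<theta> = \<theta> \<oplus>\<^sub>B w [^]\<^sub>B n" "\<theta> [^]\<^sub>B p = w [^]\<^sub>B N \<otimes>\<^sub>B \<theta> \<oplus>\<^sub>B \<beta> u"
      using theta_shift [OF \<theta>0 u0(1) h(1) u0(2)] unfolding \<theta>_def u_def by simp_all
    have N1: "1 \<le> N" using False p_gt_1 by (simp add: N_def)
    \<comment> \<open>For positive n the linear term is invisible modulo \<pi>, so on the residue of
      u the shift by h acts as subtraction of a p-th power.\<close>
    have "A.cg N (mon \<pi> 0 [^]\<^sub>A N \<otimes>\<^sub>A h) \<zero>\<^sub>A" unfolding A.cg_zero_iff using h(1) by blast
    then have "A.cg 1 (mon \<pi> 0 [^]\<^sub>A N \<otimes>\<^sub>A h) \<zero>\<^sub>A" using N1 by (rule A.cg_mono)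
    then have "A.cg 1 u (u0 \<ominus>\<^sub>A (h [^]\<^sub>A p \<ominus>\<^sub>A \<zero>\<^sub>A))"
      unfolding u_def using u0(1) h(1) by (intro A.cg_diff A.cg_refl) simp_all
    then have cu: "A.cg 1 u (u0 \<ominus>\<^sub>A h [^]\<^sub>A p)" using h(1) by (simp add: A.minus_eq)
    have "\<not> A.cg 1 u \<zero>\<^sub>A"
    proof
      assume "A.cg 1 u \<zero>\<^sub>A"
      then have bu: "W.cg 1 (\<beta> u) \<zero>\<^sub>B" using \<beta>_cg [of 1 u "\<zero>\<^sub>A"] by simp
      have "W.cg N (w [^]\<^sub>B N \<otimes>\<^sub>B \<theta>) \<zero>\<^sub>B" unfolding W.cg_zero_iff using \<theta>(1) by blast
      then have "W.cg 1 (w [^]\<^sub>B N \<otimes>\<^sub>B \<theta>) \<zero>\<^sub>B" using N1 by (rule W.cg_mono)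
      then have "W.cg 1 (w [^]\<^sub>B N \<otimes>\<^sub>B \<theta> \<oplus>\<^sub>B \<beta> u) (\<zero>\<^sub>B \<oplus>\<^sub>B \<zero>\<^sub>B)" using bu by (rule W.cg_add)
      then have "W.cg 1 (\<theta> [^]\<^sub>B Suc (p - 1)) \<zero>\<^sub>B" unfolding \<theta>(3) [symmetric] using p_gt_1 by (simp del: E.B.nat_pow_Suc)
      then have "W.cg 1 \<theta> \<zero>\<^sub>B" by (rule W_cg_pow [OF \<theta>(1)])
      \<comment> \<open>Cancelling w in s \<theta> = \<theta> + w^n shows that t satisfies the same
        relation with the exponent n - 1.\<close>
      then obtain t where t: "t \<in> carrier B" "\<theta> = w [^]\<^sub>B (1::nat) \<otimes>\<^sub>B t" unfolding W.cg_zero_iff by blast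
      then have wt: "\<theta> = w \<otimes>\<^sub>B t" by simp
      have wn: "w [^]\<^sub>B n = w \<otimes>\<^sub>B w [^]\<^sub>B (n - 1)"
        using False E.B.nat_pow_Suc2 [OF w_closed, of "n - 1"] by simp
      have "w \<otimes>\<^sub>B s t = s \<theta>" unfolding wt using t(1) by simp
      also have "s \<theta> = \<theta> \<oplus>\<^sub>B w [^]\<^sub>B n" by (rule \<theta>(2))
      also have "\<dots> = w \<otimes>\<^sub>B t \<oplus>\<^sub>B w \<otimes>\<^sub>B w [^]\<^sub>B (n - 1)" by (rule arg_cong2 [where f = "ring.add B", OF wt wn])
      also have "\<dots> = w \<otimes>\<^sub>B (t \<oplus>\<^sub>B w [^]\<^sub>B (n - 1))" using t(1) by (simp add: E.B.r_distr)
      finally have "s t = t \<oplus>\<^sub>B w [^]\<^sub>B (n - 1)"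
        using W.m_lcancel [OF W.u_nonzero w_closed, of "s t" "t \<oplus>\<^sub>B w [^]\<^sub>B (n - 1)"] t(1) by simp
      then have "\<exists>\<theta>. Q (n - 1) \<theta>" using t(1) unfolding Q_def by blast
      with n(2) [of "n - 1"] False show False by simp
    qed
    then have "\<not> A.cg 1 (u0 \<ominus>\<^sub>A h [^]\<^sub>A p) \<zero>\<^sub>A" using A.cg_trans [OF cu] by blast
    then obtain m where m: "coprime m (int p)" "wt (u0 \<ominus>\<^sub>A h [^]\<^sub>A p) m" using h(2) by blast
    have "wt u m" by (rule wt_cong [OF m(2) A.cg_sym [OF cu]])
    with \<theta> uA m(1) False show ?thesis by blast
  qed
  then show ?thesis unfolding N_def by blast
qed

end

section \<open>Integral basis and different\<close>

locale galois_theta = galois_gen +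
  fixes n :: nat and \<theta> u m
  assumes \<theta> [simp]: "\<theta> \<in> carrier B" and s_\<theta>: "s \<theta> = \<theta> \<oplus>\<^sub>B w [^]\<^sub>B n"
    and uA [simp]: "u \<in> carrier A"
    and \<theta>_eqn: "\<theta> [^]\<^sub>B p = w [^]\<^sub>B (n * (p - 1)) \<otimes>\<^sub>B \<theta> \<oplus>\<^sub>B \<beta> u"
    and wt_u: "wt u m" and coprime_m: "coprime m (int p)" and m_neg: "n = 0 \<longrightarrow> m < 0"
begin

abbreviation lincomb where "lincomb a \<equiv> (\<Oplus>\<^bsub>B\<^esub>i\<in>{..<p}. \<beta> (a i) \<otimes>\<^sub>B \<theta> [^]\<^sub>B i)"

abbreviation binc where "binc k \<equiv> \<guillemotleft>int ((p - 1) choose k)\<guillemotright>\<^bsub>B\<^esub>"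

definition N where "N = n * (p - 1)"

lemma eqn_N: "\<theta> [^]\<^sub>B p = w [^]\<^sub>B N \<otimes>\<^sub>B \<theta> \<oplus>\<^sub>B \<beta> u"
  unfolding N_def by (rule \<theta>_eqn)

lemma \<beta>_of_int: "\<beta> \<guillemotleft>int j\<guillemotright>\<^bsub>A\<^esub> = \<guillemotleft>int j\<guillemotright>\<^bsub>B\<^esub>" and s_of_int: "s \<guillemotleft>int j\<guillemotright>\<^bsub>B\<^esub> = \<guillemotleft>int j\<guillemotright>\<^bsub>B\<^esub>"
  by (induction j) simp_all

lemma s_pow_\<theta>: "(s ^^ i) \<theta> = \<theta> \<oplus>\<^sub>B \<guillemotleft>int i\<guillemotright>\<^bsub>B\<^esub> \<otimes>\<^sub>B w [^]\<^sub>B n"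
proof (induction i)
  case (Suc i)
  have "s (\<theta> \<oplus>\<^sub>B \<guillemotleft>int i\<guillemotright>\<^bsub>B\<^esub> \<otimes>\<^sub>B w [^]\<^sub>B n) = \<theta> \<oplus>\<^sub>B w [^]\<^sub>B n \<oplus>\<^sub>B \<guillemotleft>int i\<guillemotright>\<^bsub>B\<^esub> \<otimes>\<^sub>B w [^]\<^sub>B n"
    using s_\<theta> by (simp add: s_of_int)
  also have "\<dots> = \<theta> \<oplus>\<^sub>B (\<guillemotleft>int i\<guillemotright>\<^bsub>B\<^esub> \<oplus>\<^sub>B \<one>\<^sub>B) \<otimes>\<^sub>B w [^]\<^sub>B n" by (simp add: E.B.l_distr E.B.a_ac)
  also have "\<guillemotleft>int i\<guillemotright>\<^bsub>B\<^esub> \<oplus>\<^sub>B \<one>\<^sub>B = \<guillemotleft>int (Suc i)\<guillemotright>\<^bsub>B\<^esub>" by (simp add: E.B.a_comm)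
  finally show ?case by (simp add: Suc)
qed simp

section \<open>Traces and the powers of \<theta>\<close>

definition tr :: "'b \<Rightarrow> 'b" where "tr b = (\<Oplus>\<^bsub>B\<^esub>i\<in>{..<p}. (s ^^ i) b)"

lemma tr_trace: "b \<in> carrier B \<Longrightarrow> galois_trace A B \<beta> b = tr b"
  by (simp add: trace tr_def)

lemma tr_closed [simp]: "b \<in> carrier B \<Longrightarrow> tr b \<in> carrier B"
  unfolding tr_def by (intro E.B.finsum_closed) auto

lemma tr_in_A: assumes b: "b \<in> carrier B" shows "\<exists>a\<in>carrier A. tr b = \<beta> a"
proof (rule fixed [OF tr_closed [OF b]])
  obtain q where q: "p = Suc q" using p_gt_1 by (cases p) auto
  \<comment> \<open>The sum over the exponents 0, ..., p is split once at its head and once at its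
    end. As s^p is the identity, this shows that the trace is invariant under the cyclic
    shift.\<close>
  let ?X = "\<Oplus>\<^bsub>B\<^esub>i\<in>{..q}. (s ^^ i) b" and ?Y = "\<Oplus>\<^bsub>B\<^esub>i\<in>{..q}. (s ^^ Suc i) b"
  have cl: "?X \<in> carrier B" "?Y \<in> carrier B" using b by (auto intro!: E.B.finsum_closed simp del: funpow.simps)
  have "(\<Oplus>\<^bsub>B\<^esub>i\<in>{..Suc q}. (s ^^ i) b) = (s ^^ 0) b \<oplus>\<^sub>B ?Y"
    by (rule E.B.finsum_shift_head) (use b in auto)
  moreover have "(\<Oplus>\<^bsub>B\<^esub>i\<in>{..Suc q}. (s ^^ i) b) = (s ^^ Suc q) b \<oplus>\<^sub>B ?X"
    by (rule E.B.finsum_Suc) (use b in auto)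
  moreover have "(s ^^ Suc q) b = b" using s_pow_p [OF b] by (simp only: q)
  ultimately have "b \<oplus>\<^sub>B ?X = b \<oplus>\<^sub>B ?Y" by simp
  then have "\<ominus>\<^sub>B b \<oplus>\<^sub>B (b \<oplus>\<^sub>B ?X) = \<ominus>\<^sub>B b \<oplus>\<^sub>B (b \<oplus>\<^sub>B ?Y)" by (rule arg_cong)
  then have XY: "?X = ?Y" by (simp only: E.B.r_neg1 [OF b cl(1)] E.B.r_neg1 [OF b cl(2)])
  have t: "tr b = ?X" unfolding tr_def by (simp only: q lessThan_Suc_atMost)
  have "s ?X = (\<Oplus>\<^bsub>B\<^esub>i\<in>{..q}. s ((s ^^ i) b))" using b by (subst s.hom_finsum) (auto simp: comp_def)
  also have "\<dots> = ?Y" by simp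
  finally show "s (tr b) = tr b" unfolding t using XY by simp
qed

lemma tr_add: "a \<in> carrier B \<Longrightarrow> b \<in> carrier B \<Longrightarrow> tr (a \<oplus>\<^sub>B b) = tr a \<oplus>\<^sub>B tr b"
  unfolding tr_def by (subst E.B.finsum_addf [symmetric]) (auto simp: s_pow_add intro!: E.B.finsum_cong')

lemma tr_mult:
  assumes a: "a \<in> carrier A" and b: "b \<in> carrier B" shows "tr (\<beta> a \<otimes>\<^sub>B b) = \<beta> a \<otimes>\<^sub>B tr b"
proof -
  have "tr (\<beta> a \<otimes>\<^sub>B b) = (\<Oplus>\<^bsub>B\<^esub>i\<in>{..<p}. \<beta> a \<otimes>\<^sub>B (s ^^ i) b)"
    unfolding tr_def using a b by (intro E.B.finsum_cong') (auto simp: s_pow_mult)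
  also have "\<dots> = \<beta> a \<otimes>\<^sub>B tr b" unfolding tr_def using a b by (intro E.B.finsum_rdistr [symmetric]) auto
  finally show ?thesis .
qed

lemma tr_zero [simp]: "tr \<zero>\<^sub>B = \<zero>\<^sub>B"
  using tr_mult [of "\<zero>\<^sub>A" "\<zero>\<^sub>B"] by simp

lemma tr_finsum:
  assumes "finite I" "\<And>i. i \<in> I \<Longrightarrow> f i \<in> carrier B"
  shows "tr (\<Oplus>\<^bsub>B\<^esub>i\<in>I. f i) = (\<Oplus>\<^bsub>B\<^esub>i\<in>I. tr (f i))"
  using assms
proof (induction I rule: finite_induct)
  case (insert i I)
  then have "f \<in> I \<rightarrow> carrier B" "(\<lambda>i. tr (f i)) \<in> I \<rightarrow> carrier B" by auto
  with insert show ?case by (simp add: tr_add)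
qed simp

lemma w_pow_N: "(w [^]\<^sub>B n) [^]\<^sub>B (p - 1) = w [^]\<^sub>B N"
  unfolding N_def by (rule E.B.nat_pow_pow [OF w_closed])

text \<open>The conjugates of \<theta> are \<theta> + i w^n, to which
  \<open>shifted_power_sum\<close> applies. That only the top power has a nonzero trace drives both
  the independence of the powers and the computation of the different.\<close>

lemma tr_\<theta>_pow: assumes "k < p"
  shows "tr (\<theta> [^]\<^sub>B k) = (if k < p - 1 then \<zero>\<^sub>B else \<ominus>\<^sub>B (w [^]\<^sub>B N))"
  unfolding tr_def s_pow_pow [OF \<theta>] s_pow_\<theta>
  using Bc.shifted_power_sum [OF \<theta> E.B.nat_pow_closed [OF w_closed] assms, of n] by (simp only: w_pow_N)

text \<open>By Fermat (\<theta> - s^i \<theta>)^(p-1) = (-i)^(p-1) w^N is w^N for i between 1 and p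
  - 1, and it is 0 for i = 0. So the sum of its products with s^i b is w^N (tr b - b); the binomial
  theorem evaluates the same sum with coefficients that are traces.\<close>

lemma key_identity:
  assumes b: "b \<in> carrier B"
  shows "w [^]\<^sub>B N \<otimes>\<^sub>B b = w [^]\<^sub>B N \<otimes>\<^sub>B tr b \<ominus>\<^sub>B
    (\<Oplus>\<^bsub>B\<^esub>k\<in>{..<p}. binc k \<otimes>\<^sub>B \<theta> [^]\<^sub>B k \<otimes>\<^sub>B tr ((\<ominus>\<^sub>B \<theta>) [^]\<^sub>B (p - 1 - k) \<otimes>\<^sub>B b))"
proof -
  define W where "W = w [^]\<^sub>B N"
  have W: "W \<in> carrier B" by (simp add: W_def)
  have sc: "(s ^^ i) b \<in> carrier B" "(s ^^ i) \<theta> \<in> carrier B" for i using b by simp_all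
  have s_neg: "(s ^^ i) (\<ominus>\<^sub>B \<theta>) = \<ominus>\<^sub>B ((s ^^ i) \<theta>)" for i by (induction i) simp_all
  define S where "S = (\<Oplus>\<^bsub>B\<^esub>i\<in>{..<p}. (\<theta> \<oplus>\<^sub>B \<ominus>\<^sub>B ((s ^^ i) \<theta>)) [^]\<^sub>B (p - 1) \<otimes>\<^sub>B (s ^^ i) b)"
  define Z where "Z = (\<Oplus>\<^bsub>B\<^esub>k\<in>{..<p}. binc k \<otimes>\<^sub>B \<theta> [^]\<^sub>B k \<otimes>\<^sub>B tr ((\<ominus>\<^sub>B \<theta>) [^]\<^sub>B (p - 1 - k) \<otimes>\<^sub>B b))"
  have SB: "S \<in> carrier B" and ZB: "Z \<in> carrier B"
    unfolding S_def Z_def using b sc by (auto intro!: E.B.finsum_closed)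
  have pw: "(\<theta> \<oplus>\<^sub>B \<ominus>\<^sub>B ((s ^^ i) \<theta>)) [^]\<^sub>B (p - 1) = (if i = 0 then \<zero>\<^sub>B else W)" if i: "i < p" for i
  proof -
    have "\<theta> \<oplus>\<^sub>B \<ominus>\<^sub>B ((s ^^ i) \<theta>) = \<guillemotleft>- int i\<guillemotright>\<^bsub>B\<^esub> \<otimes>\<^sub>B w [^]\<^sub>B n"
      unfolding s_pow_\<theta> by (simp add: E.B.minus_add E.B.r_neg2 E.B.r_neg1 E.B.l_minus)
    then have e: "(\<theta> \<oplus>\<^sub>B \<ominus>\<^sub>B ((s ^^ i) \<theta>)) [^]\<^sub>B (p - 1) = \<guillemotleft>- int i\<guillemotright>\<^bsub>B\<^esub> [^]\<^sub>B (p - 1) \<otimes>\<^sub>B W"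
      unfolding W_def w_pow_N [symmetric] by (simp only: E.B.nat_pow_distrib E.B.of_int_closed E.B.nat_pow_closed w_closed)
    show ?thesis
    proof (cases "i = 0")
      case True
      have "p - 1 \<noteq> 0" using p_gt_1 by simp
      then show ?thesis unfolding e using True W by (simp add: E.B.nat_pow_zero)
    next
      case False
      then have "\<not> int p dvd - int i" using i by (auto simp: int_dvd_int_iff dest!: dvd_imp_le)
      from Bc.fermat_of_int_unit [OF this] show ?thesis unfolding e using False W by simp
    qed
  qed
  have "S \<oplus>\<^sub>B W \<otimes>\<^sub>B b = W \<otimes>\<^sub>B tr b"
  proof -
    have "S = (\<Oplus>\<^bsub>B\<^esub>i\<in>{..<p}. if i = 0 then \<zero>\<^sub>B else W \<otimes>\<^sub>B (s ^^ i) b)"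
      unfolding S_def using pw sc W b by (intro E.B.finsum_cong') auto
    moreover have "W \<otimes>\<^sub>B b = (\<Oplus>\<^bsub>B\<^esub>i\<in>{..<p}. if i = 0 then W \<otimes>\<^sub>B b else \<zero>\<^sub>B)"
      using W b p_gt_1 by (intro E.B.add.finprod_singleton_swap [symmetric]) auto
    ultimately have "S \<oplus>\<^sub>B W \<otimes>\<^sub>B b = (\<Oplus>\<^bsub>B\<^esub>i\<in>{..<p}. if i = 0 then \<zero>\<^sub>B else W \<otimes>\<^sub>B (s ^^ i) b) \<oplus>\<^sub>B
      (\<Oplus>\<^bsub>B\<^esub>i\<in>{..<p}. if i = 0 then W \<otimes>\<^sub>B b else \<zero>\<^sub>B)" by simp
    also have "\<dots> = (\<Oplus>\<^bsub>B\<^esub>i\<in>{..<p}. (if i = 0 then \<zero>\<^sub>B else W \<otimes>\<^sub>B (s ^^ i) b) \<oplus>\<^sub>B (if i = 0 then W \<otimes>\<^sub>B b else \<zero>\<^sub>B))"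
      using W b sc by (intro E.B.finsum_addf [symmetric]) auto
    also have "\<dots> = (\<Oplus>\<^bsub>B\<^esub>i\<in>{..<p}. W \<otimes>\<^sub>B (s ^^ i) b)" using W b sc by (intro E.B.finsum_cong') auto
    also have "\<dots> = W \<otimes>\<^sub>B tr b" unfolding tr_def using W sc by (intro E.B.finsum_rdistr [symmetric]) auto
    finally show ?thesis .
  qed
  moreover have "S = Z"
  proof -
    define c where "c k = binc k" for k
    have c: "c k \<in> carrier B" for k by (simp add: c_def)
    have at: "{..p - 1} = {..<p}" using p_gt_1 by auto
    have tc: "c k \<otimes>\<^sub>B \<theta> [^]\<^sub>B k \<otimes>\<^sub>B (s ^^ i) ((\<ominus>\<^sub>B \<theta>) [^]\<^sub>B (p - 1 - k) \<otimes>\<^sub>B b) \<in> carrier B" for i k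
      using c b by simp
    have "(\<theta> \<oplus>\<^sub>B \<ominus>\<^sub>B ((s ^^ i) \<theta>)) [^]\<^sub>B (p - 1) \<otimes>\<^sub>B (s ^^ i) b =
      (\<Oplus>\<^bsub>B\<^esub>k\<in>{..<p}. c k \<otimes>\<^sub>B \<theta> [^]\<^sub>B k \<otimes>\<^sub>B (s ^^ i) ((\<ominus>\<^sub>B \<theta>) [^]\<^sub>B (p - 1 - k) \<otimes>\<^sub>B b))" for i
    proof -
      let ?y = "\<ominus>\<^sub>B ((s ^^ i) \<theta>)"
      have y: "?y \<in> carrier B" using sc by simp
      have "(\<theta> \<oplus>\<^sub>B ?y) [^]\<^sub>B (p - 1) = (\<Oplus>\<^bsub>B\<^esub>k\<in>{..<p}. c k \<otimes>\<^sub>B (\<theta> [^]\<^sub>B k \<otimes>\<^sub>B ?y [^]\<^sub>B (p - 1 - k)))"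
        using E.B.binomial_theorem [OF \<theta> y, of "p - 1"] unfolding at c_def .
      then have "(\<theta> \<oplus>\<^sub>B ?y) [^]\<^sub>B (p - 1) \<otimes>\<^sub>B (s ^^ i) b =
        (\<Oplus>\<^bsub>B\<^esub>k\<in>{..<p}. c k \<otimes>\<^sub>B (\<theta> [^]\<^sub>B k \<otimes>\<^sub>B ?y [^]\<^sub>B (p - 1 - k))) \<otimes>\<^sub>B (s ^^ i) b" by (rule arg_cong)
      also have "\<dots> = (\<Oplus>\<^bsub>B\<^esub>k\<in>{..<p}. c k \<otimes>\<^sub>B (\<theta> [^]\<^sub>B k \<otimes>\<^sub>B ?y [^]\<^sub>B (p - 1 - k)) \<otimes>\<^sub>B (s ^^ i) b)"
        using c y sc by (intro E.B.finsum_ldistr) auto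
      also have "\<dots> = (\<Oplus>\<^bsub>B\<^esub>k\<in>{..<p}. c k \<otimes>\<^sub>B \<theta> [^]\<^sub>B k \<otimes>\<^sub>B (s ^^ i) ((\<ominus>\<^sub>B \<theta>) [^]\<^sub>B (p - 1 - k) \<otimes>\<^sub>B b))"
        using c y sc b tc by (intro E.B.finsum_cong') (auto simp: s_pow_mult s_pow_pow s_neg E.B.m_assoc)
      finally show ?thesis .
    qed
    then have "S = (\<Oplus>\<^bsub>B\<^esub>i\<in>{..<p}. \<Oplus>\<^bsub>B\<^esub>k\<in>{..<p}. c k \<otimes>\<^sub>B \<theta> [^]\<^sub>B k \<otimes>\<^sub>B (s ^^ i) ((\<ominus>\<^sub>B \<theta>) [^]\<^sub>B (p - 1 - k) \<otimes>\<^sub>B b))"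
      unfolding S_def by (simp only:)
    also have "\<dots> = (\<Oplus>\<^bsub>B\<^esub>k\<in>{..<p}. \<Oplus>\<^bsub>B\<^esub>i\<in>{..<p}. c k \<otimes>\<^sub>B \<theta> [^]\<^sub>B k \<otimes>\<^sub>B (s ^^ i) ((\<ominus>\<^sub>B \<theta>) [^]\<^sub>B (p - 1 - k) \<otimes>\<^sub>B b))"
      using tc by (intro E.B.finsum_swap) auto
    also have "\<dots> = Z"
      unfolding Z_def c_def [symmetric]
    proof (rule E.B.finsum_cong')
      fix k
      let ?v = "(\<ominus>\<^sub>B \<theta>) [^]\<^sub>B (p - 1 - k) \<otimes>\<^sub>B b"
      have v: "?v \<in> carrier B" using b by simp
      show "(\<Oplus>\<^bsub>B\<^esub>i\<in>{..<p}. c k \<otimes>\<^sub>B \<theta> [^]\<^sub>B k \<otimes>\<^sub>B (s ^^ i) ?v) = c k \<otimes>\<^sub>B \<theta> [^]\<^sub>B k \<otimes>\<^sub>B tr ?v"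
        unfolding tr_def using v c by (intro E.B.finsum_rdistr [symmetric]) auto
    qed (use b c in auto)
    finally show ?thesis .
  qed
  ultimately have e: "Z \<oplus>\<^sub>B W \<otimes>\<^sub>B b = W \<otimes>\<^sub>B tr b" by simp
  have "W \<otimes>\<^sub>B b = (Z \<oplus>\<^sub>B W \<otimes>\<^sub>B b) \<ominus>\<^sub>B Z" using W b ZB by algebra
  then show ?thesis unfolding e unfolding W_def Z_def .
qed

lemma span_w_pow_N:
  assumes b: "b \<in> carrier B"
  shows "\<exists>a. (\<forall>i<p. a i \<in> carrier A) \<and> w [^]\<^sub>B N \<otimes>\<^sub>B b = (lincomb a)"
proof -
  obtain t where t: "t \<in> carrier A" "tr b = \<beta> t" using tr_in_A [OF b] by blast
  have "\<forall>k. \<exists>v. v \<in> carrier A \<and> tr ((\<ominus>\<^sub>B \<theta>) [^]\<^sub>B (p - 1 - k) \<otimes>\<^sub>B b) = \<beta> v"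
  proof
    fix k
    have "(\<ominus>\<^sub>B \<theta>) [^]\<^sub>B (p - 1 - k) \<otimes>\<^sub>B b \<in> carrier B" using b by simp
    from tr_in_A [OF this] show "\<exists>v. v \<in> carrier A \<and> tr ((\<ominus>\<^sub>B \<theta>) [^]\<^sub>B (p - 1 - k) \<otimes>\<^sub>B b) = \<beta> v" by blast
  qed
  from choice [OF this] obtain v where
    v: "\<forall>k. v k \<in> carrier A \<and> tr ((\<ominus>\<^sub>B \<theta>) [^]\<^sub>B (p - 1 - k) \<otimes>\<^sub>B b) = \<beta> (v k)" ..
  have vA: "v k \<in> carrier A" for k using v by blast
  define g where "g k = \<guillemotleft>int ((p - 1) choose k)\<guillemotright>\<^bsub>A\<^esub> \<otimes>\<^sub>A v k" for k
  \<comment> \<open>The term w^N tr b belongs to the coefficient of \<theta>^0 only.\<close>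
  define h where "h k = (if k = 0 then mon \<pi> 0 [^]\<^sub>A N \<otimes>\<^sub>A t else \<zero>\<^sub>A)" for k :: nat
  have gA: "g k \<in> carrier A" and hA: "h k \<in> carrier A" for k using vA t by (simp_all add: g_def h_def)
  let ?Z = "\<Oplus>\<^bsub>B\<^esub>k\<in>{..<p}. \<beta> (g k) \<otimes>\<^sub>B \<theta> [^]\<^sub>B k" and ?X = "\<Oplus>\<^bsub>B\<^esub>k\<in>{..<p}. \<beta> (h k \<ominus>\<^sub>A g k) \<otimes>\<^sub>B \<theta> [^]\<^sub>B k"
  have cl: "?Z \<in> carrier B" "?X \<in> carrier B" using gA hA by (auto intro!: E.B.finsum_closed)
  have k1: "(\<Oplus>\<^bsub>B\<^esub>k\<in>{..<p}. binc k \<otimes>\<^sub>B \<theta> [^]\<^sub>B k \<otimes>\<^sub>B tr ((\<ominus>\<^sub>B \<theta>) [^]\<^sub>B (p - 1 - k) \<otimes>\<^sub>B b)) = ?Z"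
  proof (rule E.B.finsum_cong')
    fix k
    have "\<beta> (g k) = binc k \<otimes>\<^sub>B \<beta> (v k)" unfolding g_def using vA by (simp add: \<beta>_of_int)
    then show "binc k \<otimes>\<^sub>B \<theta> [^]\<^sub>B k \<otimes>\<^sub>B tr ((\<ominus>\<^sub>B \<theta>) [^]\<^sub>B (p - 1 - k) \<otimes>\<^sub>B b) = \<beta> (g k) \<otimes>\<^sub>B \<theta> [^]\<^sub>B k"
      using v [rule_format, of k] vA by (simp add: E.B.m_ac)
  qed (use gA in auto)
  have "?X \<oplus>\<^sub>B ?Z = (\<Oplus>\<^bsub>B\<^esub>k\<in>{..<p}. \<beta> (h k \<ominus>\<^sub>A g k) \<otimes>\<^sub>B \<theta> [^]\<^sub>B k \<oplus>\<^sub>B \<beta> (g k) \<otimes>\<^sub>B \<theta> [^]\<^sub>B k)"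
    using gA hA by (intro E.B.finsum_addf [symmetric]) auto
  also have "\<dots> = (\<Oplus>\<^bsub>B\<^esub>k\<in>{..<p}. if k = 0 then w [^]\<^sub>B N \<otimes>\<^sub>B tr b else \<zero>\<^sub>B)"
  proof (rule E.B.finsum_cong')
    fix k :: nat
    have "h k \<ominus>\<^sub>A g k \<oplus>\<^sub>A g k = h k" using gA [of k] hA [of k] by algebra
    then have "\<beta> (h k \<ominus>\<^sub>A g k) \<oplus>\<^sub>B \<beta> (g k) = \<beta> (h k)" using gA [of k] hA [of k] ring_hom_add [OF \<beta>_hom, of "h k \<ominus>\<^sub>A g k" "g k"] by simp
    then have "\<beta> (h k \<ominus>\<^sub>A g k) \<otimes>\<^sub>B \<theta> [^]\<^sub>B k \<oplus>\<^sub>B \<beta> (g k) \<otimes>\<^sub>B \<theta> [^]\<^sub>B k = \<beta> (h k) \<otimes>\<^sub>B \<theta> [^]\<^sub>B k"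
      using gA [of k] hA [of k] E.B.l_distr [of "\<beta> (h k \<ominus>\<^sub>A g k)" "\<beta> (g k)" "\<theta> [^]\<^sub>B k"] by simp
    also have "\<dots> = (if k = 0 then w [^]\<^sub>B N \<otimes>\<^sub>B tr b else \<zero>\<^sub>B)" unfolding h_def t(2) using t(1) by simp
    finally show "\<beta> (h k \<ominus>\<^sub>A g k) \<otimes>\<^sub>B \<theta> [^]\<^sub>B k \<oplus>\<^sub>B \<beta> (g k) \<otimes>\<^sub>B \<theta> [^]\<^sub>B k = (if k = 0 then w [^]\<^sub>B N \<otimes>\<^sub>B tr b else \<zero>\<^sub>B)" .
  qed (use b in auto)
  also have "\<dots> = w [^]\<^sub>B N \<otimes>\<^sub>B tr b" using b p_gt_1 by (intro E.B.add.finprod_singleton_swap) auto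
  finally have "?X \<oplus>\<^sub>B ?Z = w [^]\<^sub>B N \<otimes>\<^sub>B tr b" .
  moreover have "x = (x \<oplus>\<^sub>B z) \<ominus>\<^sub>B z" if "x \<in> carrier B" "z \<in> carrier B" for x z using that by algebra
  note this [OF cl(2,1)]
  ultimately have "w [^]\<^sub>B N \<otimes>\<^sub>B b = ?X" using key_identity [OF b] unfolding k1 by simp
  then show ?thesis using gA hA by (intro exI [of _ "\<lambda>k. h k \<ominus>\<^sub>A g k"]) simp
qed

text \<open>A triangular system: if the coefficients above j vanish, multiplying by \<theta>^(p-1-j)
  and taking the trace leaves -w^N a_j. The induction parameter \<open>d\<close> counts the top
  coefficients already known to be 0.\<close>

lemma indep:
  assumes a: "\<forall>i<p. a i \<in> carrier A" and z: "(lincomb a) = \<zero>\<^sub>B"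
  shows "\<forall>i<p. a i = \<zero>\<^sub>A"
proof -
  have "\<forall>i<p. p - d \<le> i \<longrightarrow> a i = \<zero>\<^sub>A" for d
  proof (induction d)
    case 0
    show ?case by simp
  next
    case (Suc d)
    show ?case
    proof (cases "d < p")
      case False
      then show ?thesis using Suc by simp
    next
      case True
      define j where "j = p - Suc d"
      have j: "j < p" "Suc j = p - d" using True by (simp_all add: j_def)
      have ai: "a i = \<zero>\<^sub>A" if "j < i" "i < p" for i using Suc that j by simp
      let ?e = "p - 1 - j"
      have ac: "\<And>i. i < p \<Longrightarrow> \<beta> (a i) \<in> carrier B" using a by simp
      have "\<zero>\<^sub>B = tr (\<theta> [^]\<^sub>B ?e \<otimes>\<^sub>B (lincomb a))" unfolding z by simp
      also have "\<theta> [^]\<^sub>B ?e \<otimes>\<^sub>B (lincomb a) = (\<Oplus>\<^bsub>B\<^esub>i\<in>{..<p}. \<theta> [^]\<^sub>B ?e \<otimes>\<^sub>B (\<beta> (a i) \<otimes>\<^sub>B \<theta> [^]\<^sub>B i))"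
        using ac by (intro E.B.finsum_rdistr) auto
      also have "tr \<dots> = (\<Oplus>\<^bsub>B\<^esub>i\<in>{..<p}. tr (\<theta> [^]\<^sub>B ?e \<otimes>\<^sub>B (\<beta> (a i) \<otimes>\<^sub>B \<theta> [^]\<^sub>B i)))"
        using ac by (intro tr_finsum) auto
      also have "\<dots> = (\<Oplus>\<^bsub>B\<^esub>i\<in>{..<p}. if i = j then \<beta> (a j) \<otimes>\<^sub>B \<ominus>\<^sub>B (w [^]\<^sub>B N) else \<zero>\<^sub>B)"
      proof (rule E.B.finsum_cong')
        fix i assume "i \<in> {..<p}"
        then have i: "i < p" by simp
        have aA: "a i \<in> carrier A" using a i by simp
        have "\<theta> [^]\<^sub>B ?e \<otimes>\<^sub>B (\<beta> (a i) \<otimes>\<^sub>B \<theta> [^]\<^sub>B i) = \<beta> (a i) \<otimes>\<^sub>B (\<theta> [^]\<^sub>B ?e \<otimes>\<^sub>B \<theta> [^]\<^sub>B i)"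
          using aA by (intro E.B.m_lcomm) simp_all
        also have "\<theta> [^]\<^sub>B ?e \<otimes>\<^sub>B \<theta> [^]\<^sub>B i = \<theta> [^]\<^sub>B (?e + i)" by (rule E.B.nat_pow_mult [OF \<theta>])
        finally have e: "tr (\<theta> [^]\<^sub>B ?e \<otimes>\<^sub>B (\<beta> (a i) \<otimes>\<^sub>B \<theta> [^]\<^sub>B i)) = \<beta> (a i) \<otimes>\<^sub>B tr (\<theta> [^]\<^sub>B (?e + i))"
          using tr_mult [OF aA, of "\<theta> [^]\<^sub>B (?e + i)"] by simp
        consider "i < j" | "i = j" | "j < i" by linarith
        then show "tr (\<theta> [^]\<^sub>B ?e \<otimes>\<^sub>B (\<beta> (a i) \<otimes>\<^sub>B \<theta> [^]\<^sub>B i)) = (if i = j then \<beta> (a j) \<otimes>\<^sub>B \<ominus>\<^sub>B (w [^]\<^sub>B N) else \<zero>\<^sub>B)"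
          unfolding e
        proof cases
          case 1
          then have l: "?e + i < p - 1" using j by linarith
          then show "\<beta> (a i) \<otimes>\<^sub>B tr (\<theta> [^]\<^sub>B (?e + i)) = (if i = j then \<beta> (a j) \<otimes>\<^sub>B \<ominus>\<^sub>B (w [^]\<^sub>B N) else \<zero>\<^sub>B)"
            using tr_\<theta>_pow [of "?e + i"] 1 aA by simp
        next
          case 2
          then have l: "?e + i = p - 1" using j by linarith
          show "\<beta> (a i) \<otimes>\<^sub>B tr (\<theta> [^]\<^sub>B (?e + i)) = (if i = j then \<beta> (a j) \<otimes>\<^sub>B \<ominus>\<^sub>B (w [^]\<^sub>B N) else \<zero>\<^sub>B)"
            unfolding l using tr_\<theta>_pow [of "p - 1"] 2 p_gt_1 by simp
        next
          case 3
          then show "\<beta> (a i) \<otimes>\<^sub>B tr (\<theta> [^]\<^sub>B (?e + i)) = (if i = j then \<beta> (a j) \<otimes>\<^sub>B \<ominus>\<^sub>B (w [^]\<^sub>B N) else \<zero>\<^sub>B)"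
            using ai [OF 3 i] by simp
        qed
      qed (use ac j in auto)
      also have "\<dots> = \<beta> (a j) \<otimes>\<^sub>B \<ominus>\<^sub>B (w [^]\<^sub>B N)" using ac j by (intro E.B.add.finprod_singleton_swap) auto
      finally have "\<beta> (a j) \<otimes>\<^sub>B \<ominus>\<^sub>B (w [^]\<^sub>B N) = \<zero>\<^sub>B" by simp
      then have "\<beta> (a j) \<otimes>\<^sub>B w [^]\<^sub>B N = \<zero>\<^sub>B" using ac [OF j(1)] by (simp add: E.B.r_minus)
      then have "\<beta> (a j) = \<zero>\<^sub>B"
        using W.integral [OF _ ac [OF j(1)] E.B.nat_pow_closed [OF w_closed]] w_pow_nonzero [of N] by blast
      then have "\<beta> (a j) = \<beta> \<zero>\<^sub>A" by simp
      moreover have ajA: "a j \<in> carrier A" using a j(1) by blast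
      ultimately have aj: "a j = \<zero>\<^sub>A" using inj_onD [OF \<beta>_inj _ ajA A.zero_closed] by blast
      have "a i = \<zero>\<^sub>A" if "i < p" "j \<le> i" for i
      proof (cases "i = j")
        case True
        then show ?thesis using aj by (simp only:)
      next
        case False
        with that show ?thesis by (intro ai) linarith+
      qed
      then show ?thesis unfolding j_def by blast
    qed
  qed
  from this [of p] show ?thesis by simp
qed

text \<open>If \<beta> a = w b, then b is fixed by s after cancelling w, hence comes from A. So A
  modulo \<pi> embeds in B modulo w.\<close>

lemma \<beta>_cg_iff: assumes a: "a \<in> carrier A" and c: "W.cg 1 (\<beta> a) \<zero>\<^sub>B" shows "A.cg 1 a \<zero>\<^sub>A"
proof -
  obtain b where b: "b \<in> carrier B" "\<beta> a = w [^]\<^sub>B (1::nat) \<otimes>\<^sub>B b" using c unfolding W.cg_zero_iff by blast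
  then have wb: "\<beta> a = w \<otimes>\<^sub>B b" by simp
  have "w \<otimes>\<^sub>B s b = s (\<beta> a)" unfolding wb using b(1) by simp
  also have "\<dots> = w \<otimes>\<^sub>B b" unfolding wb [symmetric] using a by simp
  finally have "s b = b" by (rule iffD1 [OF W.m_lcancel [OF W.u_nonzero w_closed s.hom_closed [OF b(1)] b(1)]])
  then obtain c where c: "c \<in> carrier A" "b = \<beta> c" using fixed [OF b(1)] by blast
  have "\<beta> a = \<beta> (mon \<pi> 0 \<otimes>\<^sub>A c)" unfolding wb c(2) using c(1) by simp
  then have "a = mon \<pi> 0 \<otimes>\<^sub>A c" by (rule inj_onD [OF \<beta>_inj]) (use a c in simp_all)
  then have "a = mon \<pi> 0 [^]\<^sub>A (1::nat) \<otimes>\<^sub>A c" by simp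
  then show ?thesis unfolding A.cg_zero_iff using c(1) by blast
qed

text \<open>For positive n one has \<theta>^p = u modulo w, so the p-th power of the combination is
  the sum of the terms a_i^p u^i. Those with nonzero residue have the orders p d_i + i m, which are
  distinct modulo p because m is prime to p. The term of least order cannot be cancelled.\<close>

lemma indep_mod:
  assumes n: "0 < n" and a: "\<forall>i<p. a i \<in> carrier A"
    and z: "W.cg 1 (lincomb a) \<zero>\<^sub>B"
  shows "\<forall>i<p. A.cg 1 (a i) \<zero>\<^sub>A"
proof (rule ccontr)
  assume neg: "\<not> (\<forall>i<p. A.cg 1 (a i) \<zero>\<^sub>A)"
  define f where "f i = a i [^]\<^sub>A p \<otimes>\<^sub>A u [^]\<^sub>A i" for i
  have fA: "f i \<in> carrier A" if "i < p" for i using a that by (simp add: f_def)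
  have ac: "\<And>i. i < p \<Longrightarrow> \<beta> (a i) \<in> carrier B" using a by simp
  have N1: "1 \<le> N" using n p_gt_1 by (simp add: N_def)
  have "W.cg N (w [^]\<^sub>B N \<otimes>\<^sub>B \<theta>) \<zero>\<^sub>B" unfolding W.cg_zero_iff using \<theta> by blast
  then have "W.cg 1 (w [^]\<^sub>B N \<otimes>\<^sub>B \<theta>) \<zero>\<^sub>B" using N1 by (rule W.cg_mono)
  then have "W.cg 1 (w [^]\<^sub>B N \<otimes>\<^sub>B \<theta> \<oplus>\<^sub>B \<beta> u) (\<zero>\<^sub>B \<oplus>\<^sub>B \<beta> u)" by (intro W.cg_add W.cg_refl) simp_all
  then have \<theta>u: "W.cg 1 (\<theta> [^]\<^sub>B p) (\<beta> u)" unfolding eqn_N by simp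
  have "W.cg 1 (\<beta> (\<Oplus>\<^bsub>A\<^esub>i\<in>{..<p}. f i)) ((lincomb a) [^]\<^sub>B p)"
  proof -
    have "\<beta> (\<Oplus>\<^bsub>A\<^esub>i\<in>{..<p}. f i) = (\<Oplus>\<^bsub>B\<^esub>i\<in>{..<p}. \<beta> (f i))" using fA by (subst ring_hom_cring.hom_finsum [OF ring_hom_cringI [OF A.is_cring B_cring \<beta>_hom]]) (auto simp: comp_def)
    moreover have "(lincomb a) [^]\<^sub>B p = (\<Oplus>\<^bsub>B\<^esub>i\<in>{..<p}. (\<beta> (a i) \<otimes>\<^sub>B \<theta> [^]\<^sub>B i) [^]\<^sub>B p)"
      using ac by (intro Bc.frob_finsum) auto
    moreover have "W.cg 1 (\<Oplus>\<^bsub>B\<^esub>i\<in>{..<p}. \<beta> (f i)) (\<Oplus>\<^bsub>B\<^esub>i\<in>{..<p}. (\<beta> (a i) \<otimes>\<^sub>B \<theta> [^]\<^sub>B i) [^]\<^sub>B p)"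
    proof (rule W.cg_finsum)
      fix i assume "i \<in> {..<p}"
      then have i: "i < p" by simp
      have "(\<theta> [^]\<^sub>B i) [^]\<^sub>B p = (\<theta> [^]\<^sub>B p) [^]\<^sub>B i" by (simp add: E.B.nat_pow_pow mult.commute)
      then have "(\<beta> (a i) \<otimes>\<^sub>B \<theta> [^]\<^sub>B i) [^]\<^sub>B p = \<beta> (a i) [^]\<^sub>B p \<otimes>\<^sub>B (\<theta> [^]\<^sub>B p) [^]\<^sub>B i"
        using ac [OF i] by (simp add: E.B.nat_pow_distrib)
      moreover have "\<beta> (f i) = \<beta> (a i) [^]\<^sub>B p \<otimes>\<^sub>B \<beta> u [^]\<^sub>B i" unfolding f_def using a i by simp
      moreover have "W.cg 1 (\<beta> (a i) [^]\<^sub>B p \<otimes>\<^sub>B \<beta> u [^]\<^sub>B i) (\<beta> (a i) [^]\<^sub>B p \<otimes>\<^sub>B (\<theta> [^]\<^sub>B p) [^]\<^sub>B i)"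
        using ac [OF i] by (intro W.cg_mult W.cg_refl W.cg_pow W.cg_sym [OF \<theta>u]) simp
      ultimately show "W.cg 1 (\<beta> (f i)) ((\<beta> (a i) \<otimes>\<^sub>B \<theta> [^]\<^sub>B i) [^]\<^sub>B p)" by simp
    qed simp
    ultimately show ?thesis by simp
  qed
  also have "W.cg 1 \<dots> (\<zero>\<^sub>B [^]\<^sub>B p)" by (rule W.cg_pow [OF z])
  finally have "W.cg 1 (\<beta> (\<Oplus>\<^bsub>A\<^esub>i\<in>{..<p}. f i)) \<zero>\<^sub>B" by simp
  then have sum0: "A.cg 1 (\<Oplus>\<^bsub>A\<^esub>i\<in>{..<p}. f i) \<zero>\<^sub>A" using fA by (intro \<beta>_cg_iff A.finsum_closed) auto
  define I where "I = {i. i < p \<and> \<not> A.cg 1 (a i) \<zero>\<^sub>A}"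
  have I: "finite I" "I \<noteq> {}" using neg by (auto simp: I_def)
  have "\<forall>i. \<exists>e. i \<in> I \<longrightarrow> wt (a i) e" using wt_exists a unfolding I_def by blast
  from choice [OF this] obtain d where d: "\<forall>i. i \<in> I \<longrightarrow> wt (a i) (d i)" ..
  define e where "e i = int p * d i + int i * m" for i
  have fw: "wt (f i) (e i)" if "i \<in> I" for i
    unfolding f_def e_def using d that by (intro wt_mult wt_pow wt_u) simp
  have e_inj: "i = j" if ij: "i \<in> I" "j \<in> I" "e i = e j" for i j
  proof -
    have "(int i - int j) * m = int p * (d j - d i)" using ij(3) by (simp add: e_def algebra_simps)
    then have "int p dvd (int i - int j) * m" by simp
    then have "int p dvd int i - int j" using coprime_m by (simp add: coprime_dvd_mult_left_iff coprime_commute)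
    then have "[int i = int j] (mod int p)" by (simp add: cong_iff_dvd_diff)
    then show ?thesis using ij(1,2) by (simp add: I_def cong_int_iff cong_def)
  qed
  obtain j where j: "j \<in> I" "\<forall>i\<in>I. e j \<le> e i"
    using ex_min_if_finite [of "e ` I"] I by (metis (mono_tags, lifting) arg_min_if_finite(1) arg_min_least)
  have jp: "j < p" using j(1) by (simp add: I_def)
  let ?r = "\<Oplus>\<^bsub>A\<^esub>i\<in>{..<p} - {j}. f i"
  have rA: "?r \<in> carrier A" using fA by (intro A.finsum_closed) auto
  have lor: "lo 1 (e j + 1) ?r"
  proof (rule lo_A_finsum)
    fix i assume i: "i \<in> {..<p} - {j}"
    show "lo 1 (e j + 1) (f i)"
    proof (cases "i \<in> I")
      case True
      then have "e j < e i" using j e_inj [OF True j(1)] i by force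
      then show ?thesis by (intro lo_mono [OF wtD(2) [OF fw [OF True]]]) simp
    next
      case False
      then have "A.cg 1 (a i) \<zero>\<^sub>A" using i by (simp add: I_def)
      then have "A.cg 1 (a i [^]\<^sub>A p \<otimes>\<^sub>A u [^]\<^sub>A i) (\<zero>\<^sub>A [^]\<^sub>A p \<otimes>\<^sub>A u [^]\<^sub>A i)"
        by (intro A.cg_mult A.cg_pow A.cg_refl) simp_all
      then have "A.cg 1 (f i) \<zero>\<^sub>A" by (simp add: f_def)
      then show ?thesis by (rule A_cg_zero_lo)
    qed
  qed (use fA in auto)
  have "{..<p} = insert j ({..<p} - {j})" using jp by auto
  then have "(\<Oplus>\<^bsub>A\<^esub>i\<in>{..<p}. f i) = (\<Oplus>\<^bsub>A\<^esub>i\<in>insert j ({..<p} - {j}). f i)" by simp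
  also have "\<dots> = f j \<oplus>\<^sub>A ?r" using fA jp by (intro A.finsum_insert) auto
  \<comment> \<open>The sum is rewritten as a difference, the form in which
    \<open>wt_diff_higher\<close> keeps the order of the leading term.\<close>
  also have "\<dots> = f j \<ominus>\<^sub>A (\<zero>\<^sub>A \<ominus>\<^sub>A ?r)" using fA [OF jp] rA by (simp add: A.minus_eq)
  finally have eq: "(\<Oplus>\<^bsub>A\<^esub>i\<in>{..<p}. f i) = f j \<ominus>\<^sub>A (\<zero>\<^sub>A \<ominus>\<^sub>A ?r)" .
  have "wt (\<Oplus>\<^bsub>A\<^esub>i\<in>{..<p}. f i) (e j)"
    unfolding eq by (rule wt_diff_higher [OF fw [OF j(1)]])
      (use rA in simp, rule lo_A_diff [OF A.zero_closed rA lo_A_zero lor])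
  then show False using wt_not_cg_zero sum0 by blast
qed

text \<open>For n = 0 the factor w^N is 1. Otherwise the factors w are cancelled one at a time: a
  combination divisible by w has all its coefficients divisible by \<pi>, by
  \<open>indep_mod\<close>.\<close>

lemma span:
  assumes b: "b \<in> carrier B"
  shows "\<exists>a. (\<forall>i<p. a i \<in> carrier A) \<and> b = (lincomb a)"
proof (cases "n = 0")
  case True
  then have N0: "N = 0" unfolding N_def by simp
  have "w [^]\<^sub>B N \<otimes>\<^sub>B b = b" unfolding N0 using b by simp
  then show ?thesis using span_w_pow_N [OF b] by simp
next
  case False
  have "\<exists>a. (\<forall>i<p. a i \<in> carrier A) \<and> b = (lincomb a)"
    if "b \<in> carrier B" "\<exists>a. (\<forall>i<p. a i \<in> carrier A) \<and> w [^]\<^sub>B M \<otimes>\<^sub>B b = (lincomb a)" for M :: nat and b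
    using that
  proof (induction M arbitrary: b)
    case 0
    then show ?case by simp
  next
    case (Suc M)
    have b: "b \<in> carrier B" by (rule Suc.prems)
    obtain a where a: "\<forall>i<p. a i \<in> carrier A" "w [^]\<^sub>B Suc M \<otimes>\<^sub>B b = (lincomb a)"
      using Suc.prems(2) by blast
    have ww: "w [^]\<^sub>B Suc M \<otimes>\<^sub>B b = w \<otimes>\<^sub>B (w [^]\<^sub>B M \<otimes>\<^sub>B b)" using b by (simp add: E.B.m_ac)
    have "W.cg (Suc M) (w [^]\<^sub>B Suc M \<otimes>\<^sub>B b) \<zero>\<^sub>B" unfolding W.cg_zero_iff using b by blast
    then have "W.cg 1 (w [^]\<^sub>B Suc M \<otimes>\<^sub>B b) \<zero>\<^sub>B" by (rule W.cg_mono) simp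
    then have "\<forall>i<p. A.cg 1 (a i) \<zero>\<^sub>A" unfolding a(2) using False a(1) by (intro indep_mod) simp_all
    then have "\<forall>i. \<exists>c. i < p \<longrightarrow> c \<in> carrier A \<and> a i = mon \<pi> 0 [^]\<^sub>A (1::nat) \<otimes>\<^sub>A c" unfolding A.cg_zero_iff by blast
    from choice [OF this] obtain c where c: "\<forall>i. i < p \<longrightarrow> c i \<in> carrier A \<and> a i = mon \<pi> 0 [^]\<^sub>A (1::nat) \<otimes>\<^sub>A c i" ..
    have cA: "c i \<in> carrier A" if "i < p" for i using c that by blast
    have "\<beta> (a i) = w \<otimes>\<^sub>B \<beta> (c i)" if i: "i < p" for i
    proof -
      have "a i = mon \<pi> 0 \<otimes>\<^sub>A c i" using c i by simp
      then show ?thesis using cA [OF i] by simp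
    qed
    then have "(lincomb a) = (\<Oplus>\<^bsub>B\<^esub>i\<in>{..<p}. w \<otimes>\<^sub>B (\<beta> (c i) \<otimes>\<^sub>B \<theta> [^]\<^sub>B i))"
      using cA by (intro E.B.finsum_cong') (auto simp: E.B.m_assoc)
    also have "\<dots> = w \<otimes>\<^sub>B (\<Oplus>\<^bsub>B\<^esub>i\<in>{..<p}. \<beta> (c i) \<otimes>\<^sub>B \<theta> [^]\<^sub>B i)"
      using cA by (intro E.B.finsum_rdistr [symmetric]) auto
    finally have "w \<otimes>\<^sub>B (w [^]\<^sub>B M \<otimes>\<^sub>B b) = w \<otimes>\<^sub>B (\<Oplus>\<^bsub>B\<^esub>i\<in>{..<p}. \<beta> (c i) \<otimes>\<^sub>B \<theta> [^]\<^sub>B i)"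
      using a(2) ww by simp
    then have "w [^]\<^sub>B M \<otimes>\<^sub>B b = (\<Oplus>\<^bsub>B\<^esub>i\<in>{..<p}. \<beta> (c i) \<otimes>\<^sub>B \<theta> [^]\<^sub>B i)"
    proof (rule iffD1 [OF W.m_lcancel [OF W.u_nonzero w_closed], rotated 2])
      show "w [^]\<^sub>B M \<otimes>\<^sub>B b \<in> carrier B" using b by simp
      show "(\<Oplus>\<^bsub>B\<^esub>i\<in>{..<p}. \<beta> (c i) \<otimes>\<^sub>B \<theta> [^]\<^sub>B i) \<in> carrier B" using cA by (intro E.B.finsum_closed) auto
    qed
    then show ?case using cA by (intro Suc.IH [OF b] exI [of _ c]) simp
  qed
  from this [OF b span_w_pow_N [OF b]] show ?thesis .
qed

lemma one_ne_zero_A: "\<one>\<^sub>A \<noteq> \<zero>\<^sub>A"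
  using A_not_cg_one by auto

lemma \<beta>_c: "\<beta> (mon (\<pi> [^] N) 0) = w [^]\<^sub>B N"
  unfolding A_u_pow [symmetric] by simp

lemma given_by_\<theta>: "given_by_equation A B \<beta> p (mon (\<pi> [^] N) 0) u \<theta>"
proof (rule E.given_by_equationI)
  show "mon (\<pi> [^] N) 0 \<in> carrier A" by simp
  show "u \<in> carrier A" "1 < p" "\<one>\<^sub>A \<noteq> \<zero>\<^sub>A" "\<theta> \<in> carrier B"
    by (rule uA, rule p_gt_1, rule one_ne_zero_A, rule \<theta>)
  show "\<theta> [^]\<^sub>B p = \<beta> (mon (\<pi> [^] N) 0) \<otimes>\<^sub>B \<theta> \<oplus>\<^sub>B \<beta> u" unfolding \<beta>_c by (rule eqn_N)
qed (rule span, assumption, rule indep, assumption+)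

text \<open>The trace of an element of B is -w^N times its coefficient at \<theta>^(p-1), so w^(-N)
  lies in the codifferent. Conversely, for b/a in the codifferent all traces in
  \<open>key_identity\<close> are divisible by a, hence so is w^N b.\<close>

lemma different_eq: "different A B \<beta> = PIdl\<^bsub>B\<^esub> (w [^]\<^sub>B N)"
proof (intro equalityI subsetI)
  fix d assume d: "d \<in> different A B \<beta>"
  \<comment> \<open>This pair stands for the fraction w^(-N), and membership of d in the different
    then says that w^N divides d.\<close>
  have "(\<one>\<^sub>B, mon \<pi> 0 [^]\<^sub>A N) \<in> codifferent_fractions A B \<beta>"
    unfolding codifferent_fractions_def
  proof (intro CollectI case_prodI conjI ballI)
    show "mon \<pi> 0 [^]\<^sub>A N \<noteq> \<zero>\<^sub>A"
    proof
      assume "mon \<pi> 0 [^]\<^sub>A N = \<zero>\<^sub>A"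
      then have "\<beta> (mon \<pi> 0 [^]\<^sub>A N) = \<beta> \<zero>\<^sub>A" by (rule arg_cong)
      then show False using w_pow_nonzero [of N] by simp
    qed
    fix y assume y: "y \<in> carrier B"
    obtain a where a: "\<forall>i<p. a i \<in> carrier A" "y = (lincomb a)" using span [OF y] by blast
    have p1: "p - 1 < p" using p_gt_1 by simp
    have "tr y = (\<Oplus>\<^bsub>B\<^esub>i\<in>{..<p}. tr (\<beta> (a i) \<otimes>\<^sub>B \<theta> [^]\<^sub>B i))" unfolding a(2) using a(1) by (intro tr_finsum) auto
    also have "\<dots> = (\<Oplus>\<^bsub>B\<^esub>i\<in>{..<p}. if i = p - 1 then \<beta> (a (p - 1)) \<otimes>\<^sub>B \<ominus>\<^sub>B (w [^]\<^sub>B N) else \<zero>\<^sub>B)"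
      using a(1) p1 by (intro E.B.finsum_cong') (auto simp: tr_mult tr_\<theta>_pow)
    also have "\<dots> = \<beta> (a (p - 1)) \<otimes>\<^sub>B \<ominus>\<^sub>B (w [^]\<^sub>B N)" using a(1) p1 by (intro E.B.add.finprod_singleton_swap) auto
    finally have "tr y = \<beta> (mon \<pi> 0 [^]\<^sub>A N) \<otimes>\<^sub>B \<beta> (\<ominus>\<^sub>A a (p - 1))"
      using a(1) p1 by (simp add: E.B.l_minus E.B.r_minus E.B.m_comm)
    moreover have "\<ominus>\<^sub>A a (p - 1) \<in> carrier A" using a(1) p1 by simp
    ultimately show "\<exists>c\<in>carrier A. galois_trace A B \<beta> (\<one>\<^sub>B \<otimes>\<^sub>B y) = \<beta> (mon \<pi> 0 [^]\<^sub>A N) \<otimes>\<^sub>B \<beta> c"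
      using y by (intro bexI [of _ "\<ominus>\<^sub>A a (p - 1)"]) (simp_all add: tr_trace)
  qed simp_all
  then have "d \<otimes>\<^sub>B \<one>\<^sub>B \<in> PIdl\<^bsub>B\<^esub> (\<beta> (mon \<pi> 0 [^]\<^sub>A N))" using d unfolding different_def by blast
  moreover have "d \<in> carrier B" using d unfolding different_def by simp
  ultimately show "d \<in> PIdl\<^bsub>B\<^esub> (w [^]\<^sub>B N)" by simp
next
  fix d assume "d \<in> PIdl\<^bsub>B\<^esub> (w [^]\<^sub>B N)"
  then obtain q where q: "q \<in> carrier B" "d = q \<otimes>\<^sub>B w [^]\<^sub>B N" unfolding E.B.mem_cgenideal by blast
  have "d \<otimes>\<^sub>B b \<in> PIdl\<^bsub>B\<^esub> (\<beta> a)" if ba: "(b, a) \<in> codifferent_fractions A B \<beta>" for b a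
  proof -
    have b: "b \<in> carrier B" and a: "a \<in> carrier A"
      and raw: "\<forall>y\<in>carrier B. \<exists>c\<in>carrier A. galois_trace A B \<beta> (b \<otimes>\<^sub>B y) = \<beta> a \<otimes>\<^sub>B \<beta> c"
      using ba unfolding codifferent_fractions_def by auto
    have tr: "\<exists>c. c \<in> carrier A \<and> tr (y \<otimes>\<^sub>B b) = \<beta> a \<otimes>\<^sub>B \<beta> c" if y: "y \<in> carrier B" for y
    proof -
      have "galois_trace A B \<beta> (b \<otimes>\<^sub>B y) = tr (y \<otimes>\<^sub>B b)" using b y tr_trace [of "b \<otimes>\<^sub>B y"] E.B.m_comm [OF b y] by simp
      then show ?thesis using bspec [OF raw y] by (simp only: Bex_def)
    qed
    obtain c where c: "c \<in> carrier A" "tr b = \<beta> a \<otimes>\<^sub>B \<beta> c" using tr [of "\<one>\<^sub>B"] b by auto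
    have "\<forall>k. \<exists>v. v \<in> carrier A \<and> tr ((\<ominus>\<^sub>B \<theta>) [^]\<^sub>B (p - 1 - k) \<otimes>\<^sub>B b) = \<beta> a \<otimes>\<^sub>B \<beta> v"
      by (intro allI tr) simp
    from choice [OF this] obtain v where
      v: "\<forall>k. v k \<in> carrier A \<and> tr ((\<ominus>\<^sub>B \<theta>) [^]\<^sub>B (p - 1 - k) \<otimes>\<^sub>B b) = \<beta> a \<otimes>\<^sub>B \<beta> (v k)" ..
    have vA: "v k \<in> carrier A" for k using v by blast
    define Z where "Z = (\<Oplus>\<^bsub>B\<^esub>k\<in>{..<p}. binc k \<otimes>\<^sub>B \<theta> [^]\<^sub>B k \<otimes>\<^sub>B \<beta> (v k))"
    have ZB: "Z \<in> carrier B" unfolding Z_def using vA by (intro E.B.finsum_closed) auto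
    have "(\<Oplus>\<^bsub>B\<^esub>k\<in>{..<p}. binc k \<otimes>\<^sub>B \<theta> [^]\<^sub>B k \<otimes>\<^sub>B tr ((\<ominus>\<^sub>B \<theta>) [^]\<^sub>B (p - 1 - k) \<otimes>\<^sub>B b)) =
      (\<Oplus>\<^bsub>B\<^esub>k\<in>{..<p}. \<beta> a \<otimes>\<^sub>B (binc k \<otimes>\<^sub>B \<theta> [^]\<^sub>B k \<otimes>\<^sub>B \<beta> (v k)))"
      using v vA a by (intro E.B.finsum_cong') (auto simp: E.B.m_ac)
    also have "\<dots> = \<beta> a \<otimes>\<^sub>B Z" unfolding Z_def using a vA by (intro E.B.finsum_rdistr [symmetric]) auto
    finally have "w [^]\<^sub>B N \<otimes>\<^sub>B b = w [^]\<^sub>B N \<otimes>\<^sub>B (\<beta> a \<otimes>\<^sub>B \<beta> c) \<ominus>\<^sub>B \<beta> a \<otimes>\<^sub>B Z"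
      using key_identity [OF b] unfolding c(2) by simp
    also have "\<dots> = (w [^]\<^sub>B N \<otimes>\<^sub>B \<beta> c \<ominus>\<^sub>B Z) \<otimes>\<^sub>B \<beta> a"
    proof -
      have "x \<otimes>\<^sub>B (y \<otimes>\<^sub>B z) \<ominus>\<^sub>B y \<otimes>\<^sub>B t = (x \<otimes>\<^sub>B z \<ominus>\<^sub>B t) \<otimes>\<^sub>B y"
        if "x \<in> carrier B" "y \<in> carrier B" "z \<in> carrier B" "t \<in> carrier B" for x y z t using that by algebra
      then show ?thesis using a c(1) ZB by simp
    qed
    finally have wb: "w [^]\<^sub>B N \<otimes>\<^sub>B b = (w [^]\<^sub>B N \<otimes>\<^sub>B \<beta> c \<ominus>\<^sub>B Z) \<otimes>\<^sub>B \<beta> a" .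
    define V where "V = w [^]\<^sub>B N \<otimes>\<^sub>B \<beta> c \<ominus>\<^sub>B Z"
    have VB: "V \<in> carrier B" unfolding V_def using c(1) ZB by simp
    have "d \<otimes>\<^sub>B b = q \<otimes>\<^sub>B (w [^]\<^sub>B N \<otimes>\<^sub>B b)"
      unfolding q(2) by (rule E.B.m_assoc [OF q(1) E.B.nat_pow_closed [OF w_closed] b])
    also have "\<dots> = q \<otimes>\<^sub>B (V \<otimes>\<^sub>B \<beta> a)" unfolding wb V_def ..
    also have "\<dots> = (q \<otimes>\<^sub>B V) \<otimes>\<^sub>B \<beta> a" by (rule E.B.m_assoc [symmetric]) (use q(1) VB a in simp_all)
    finally show ?thesis unfolding E.B.mem_cgenideal using q(1) VB by blast
  qed
  then show "d \<in> different A B \<beta>" unfolding different_def using q by auto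
qed

lemma different_degree_eq: "different_degree A B \<beta> w = N"
  unfolding different_degree_def
proof (rule the_equality)
  show "different A B \<beta> = PIdl\<^bsub>B\<^esub> (w [^]\<^sub>B N)" by (rule different_eq)
  show "d = N" if "different A B \<beta> = PIdl\<^bsub>B\<^esub> (w [^]\<^sub>B d)" for d
    using that different_eq by (intro W.pow_u_ideal_inj) simp
qed

end

section \<open>The classification\<close>

text \<open>The property descends from B along the injective map \<beta>.\<close>

lemma (in galois_p) A_domain: "domain A"
proof (rule domainI [OF A.is_cring])
  show "\<one>\<^sub>A \<noteq> \<zero>\<^sub>A" using A_not_cg_one by auto
  fix a b assume ab: "a \<otimes>\<^sub>A b = \<zero>\<^sub>A" "a \<in> carrier A" "b \<in> carrier A"
  have "\<beta> a \<otimes>\<^sub>B \<beta> b = \<zero>\<^sub>B" using arg_cong [OF ab(1), of \<beta>] ab(2,3) by simp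
  then have "\<beta> a = \<zero>\<^sub>B \<or> \<beta> b = \<zero>\<^sub>B" using W.integral ab(2,3) by simp
  then have "\<beta> a = \<beta> \<zero>\<^sub>A \<or> \<beta> b = \<beta> \<zero>\<^sub>A" by simp
  then show "a = \<zero>\<^sub>A \<or> b = \<zero>\<^sub>A" using inj_onD [OF \<beta>_inj] ab(2,3) by blast
qed

lemma (in complete_dvr_base) const_ser_hom: "const_ser R \<in> ring_hom R A"
proof (rule ring_hom_memI)
  fix a b assume a: "a \<in> carrier R" and b: "b \<in> carrier R"
  show "const_ser R (a \<otimes> b) = const_ser R a \<otimes>\<^sub>A const_ser R b"
    unfolding const_ser_mon using mon_mon [OF a b, of 0 0] by simp
  show "const_ser R (a \<oplus> b) = const_ser R a \<oplus>\<^sub>A const_ser R b"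
    unfolding const_ser_mon using mon_add [OF a b, of 0] by simp
qed (simp_all add: const_ser_mon A_one_mon)

lemma (in galois_theta) cover_cases:
  "(\<exists>(G :: ('a, 'c, (nat \<Rightarrow> 'a) \<Rightarrow> 'c) group_fun) act.
            finite_flat_group_scheme R p G \<and> torsor A (const_ser R) B \<beta> G act) \<and>
    (different_degree A B \<beta> (\<beta> (const_ser R \<pi>)) = 0 \<and>
      (\<exists>act T m \<xi>.
         torsor A (const_ser R) B \<beta> (const_Zp p :: ('a, 'c, nat \<Rightarrow> 'c) group_fun) act \<and>
         parameter R \<pi> A (const_ser R) T \<and> m < 0 \<and> coprime m (int p) \<and>
         given_by_equation A B \<beta> p \<one>\<^sub>A (T [^]\<^sub>A m) \<xi> \<and>
         (\<forall>S \<alpha> e x. algebra_over A S \<alpha> \<and> e \<in> carrier (pts (const_Zp p) S (\<alpha> \<circ> const_ser R)) \<and>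
            x \<in> alg_homs A B \<beta> S \<alpha> \<longrightarrow>
            act S \<alpha> e x \<xi> = x \<xi> \<oplus>\<^bsub>S\<^esub> (\<Oplus>\<^bsub>S\<^esub>i\<in>{..<p}. [i] \<cdot>\<^bsub>S\<^esub> e i)) \<and>
         (\<exists>\<eta>. \<eta> \<in> carrier B \<and> \<eta> [^]\<^sub>B m = \<xi> \<and> parameter R \<pi> B (\<beta> \<circ> const_ser R) \<eta>))
    \<or>
    (\<exists>n>0. different_degree A B \<beta> (\<beta> (const_ser R \<pi>)) = n * (p - 1) \<and>
      (\<exists>act T m \<xi>.
         torsor A (const_ser R) B \<beta> (M_group R \<pi> p n :: ('a, 'c, 'c) group_fun) act \<and>
         parameter R \<pi> A (const_ser R) T \<and> coprime m (int p) \<and>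
         given_by_equation A B \<beta> p (const_ser R (\<pi> [^]\<^bsub>R\<^esub> (n * (p - 1)))) (T [^]\<^sub>A m) \<xi> \<and>
         (\<forall>S \<alpha> g x. algebra_over A S \<alpha> \<and> g \<in> carrier (pts (M_group R \<pi> p n) S (\<alpha> \<circ> const_ser R)) \<and>
            x \<in> alg_homs A B \<beta> S \<alpha> \<longrightarrow>
            act S \<alpha> g x \<xi> = x \<xi> \<oplus>\<^bsub>S\<^esub> g) \<and>
         (\<exists>\<eta>. \<eta> \<in> carrier B \<and> \<eta> [^]\<^sub>B m = \<xi> \<and> parameter R \<pi> B (\<beta> \<circ> const_ser R) \<eta>))))"
proof -
  have eqn: "eqn_alg A B \<beta> p (mon (\<pi> [^] N) 0) u \<theta>"
    by (intro eqn_alg.intro eqn_alg_axioms.intro E.alg_axioms given_by_\<theta> p_gt_1 uA) simp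
  then interpret Q: eqn_alg A B \<beta> p "mon (\<pi> [^] N) 0" u \<theta> .
  have free: "module_free A B \<beta> p" by (rule Q.free [OF A_domain])
  have dR: "domain R" by (rule domain_axioms)
  have cN: "mon (\<pi> [^] N) 0 = const_ser R (\<pi> [^] N)" by (simp add: const_ser_mon)
  have 1: "\<exists>(G :: ('a, 'c, (nat \<Rightarrow> 'a) \<Rightarrow> 'c) group_fun) act.
      finite_flat_group_scheme R p G \<and> torsor A (const_ser R) B \<beta> G act"
    by (rule Q.torsor_finite_flat [OF dR p char const_ser_hom _ cN free]) simp
  have \<delta>: "different_degree A B \<beta> (\<beta> (const_ser R \<pi>)) = N"
    using different_degree_eq by (simp add: const_ser_mon)
  \<comment> \<open>The order of u is m = m * 1, so its m-th root has order 1, which makes it a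
    parameter of A.\<close>
  obtain T where T: "wt T 1" "T [^]\<^sub>A m = u" using wt_root [of u m 1] wt_u coprime_m by auto
  have par: "parameter R \<pi> A (const_ser R) T"
    by (rule laurent_subst.parameter_if_wt_one [where p = p and r = 1])
      (use T in \<open>auto intro!: laurent_subst.intro laurent_subst_axioms.intro complete_dvr_char_axioms\<close>)
  \<comment> \<open>For positive n the coefficient of the equation is divisible by \<pi>. For n = 0
    it is 1, and then m is negative.\<close>
  have cm: "cg 1 (\<pi> [^] N) \<zero> \<or> m < 0"
  proof (cases "n = 0")
    case False
    then have "1 \<le> N" using p_gt_1 by (simp add: N_def)
    moreover have "\<pi> [^] N = \<pi> [^] N \<otimes> \<one>" by simp
    then have "cg N (\<pi> [^] N) \<zero>" unfolding cg_zero_iff using one_closed by blast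
    ultimately show ?thesis using cg_mono by blast
  qed (use m_neg in simp)
  have eqn': "eqn_alg A B \<beta> p (mon (\<pi> [^] N) 0) (T [^]\<^sub>A m) \<theta>" unfolding T(2) by (rule eqn)
  have eta: "\<exists>\<eta>. \<eta> \<in> carrier B \<and> \<eta> [^]\<^sub>B m = \<theta> \<and> parameter R \<pi> B (\<beta> \<circ> const_ser R) \<eta>"
    by (rule parameter_of_cover [OF eqn' W.dvr_unif_axioms _ T(1) coprime_m cm]) simp
  show ?thesis
  proof (cases "n = 0")
    case True
    then have N0: "N = 0" unfolding N_def by simp
    have c1: "mon (\<pi> [^] N) 0 = \<one>\<^sub>A" unfolding N0 A_one_mon by simp
    have m0: "m < 0" using m_neg True by blast
    have gb: "given_by_equation A B \<beta> p \<one>\<^sub>A (T [^]\<^sub>A m) \<theta>" using given_by_\<theta> unfolding c1 T(2) .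
    have \<delta>0: "different_degree A B \<beta> (\<beta> (const_ser R \<pi>)) = 0" unfolding \<delta> by (rule N0)
    have "\<exists>act. torsor A (const_ser R) B \<beta> (const_Zp p :: ('a, 'c, nat \<Rightarrow> 'c) group_fun) act \<and>
      (\<forall>S \<alpha> e y. algebra_over A S \<alpha> \<and> e \<in> carrier (pts (const_Zp p) S (\<alpha> \<circ> const_ser R)) \<and> y \<in> alg_homs A B \<beta> S \<alpha> \<longrightarrow>
          act S \<alpha> e y \<theta> = y \<theta> \<oplus>\<^bsub>S\<^esub> (\<Oplus>\<^bsub>S\<^esub>i\<in>{..<p}. [i] \<cdot>\<^bsub>S\<^esub> e i))"
      by (rule Q.torsor_const_Zp [OF is_cring p char const_ser_hom c1 free])
    then obtain act where act: "torsor A (const_ser R) B \<beta> (const_Zp p :: ('a, 'c, nat \<Rightarrow> 'c) group_fun) act \<and>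
      (\<forall>S \<alpha> e y. algebra_over A S \<alpha> \<and> e \<in> carrier (pts (const_Zp p) S (\<alpha> \<circ> const_ser R)) \<and> y \<in> alg_homs A B \<beta> S \<alpha> \<longrightarrow>
          act S \<alpha> e y \<theta> = y \<theta> \<oplus>\<^bsub>S\<^esub> (\<Oplus>\<^bsub>S\<^esub>i\<in>{..<p}. [i] \<cdot>\<^bsub>S\<^esub> e i))" ..
    show ?thesis
      by (intro conjI 1 disjI1 \<delta>0 exI [of _ act] exI [of _ T] exI [of _ m] exI [of _ \<theta>] conjunct1 [OF act] conjunct2 [OF act] par m0 coprime_m gb eta)
  next
    case False
    then have n0: "0 < n" by simp
    have pN: "(p - 1) * n = N" unfolding N_def by (rule mult.commute)
    have gb: "given_by_equation A B \<beta> p (const_ser R (\<pi> [^] (n * (p - 1)))) (T [^]\<^sub>A m) \<theta>"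
      using given_by_\<theta> unfolding const_ser_mon T(2) N_def .
    have \<delta>n: "different_degree A B \<beta> (\<beta> (const_ser R \<pi>)) = n * (p - 1)" unfolding \<delta> N_def ..
    have c0: "mon (\<pi> [^] N) 0 = const_ser R (\<pi> [^] ((p - 1) * n))" unfolding pN by (rule cN)
    have "\<exists>act. torsor A (const_ser R) B \<beta> (M_group R \<pi> p n :: ('a, 'c, 'c) group_fun) act \<and>
      (\<forall>S \<alpha> g y. algebra_over A S \<alpha> \<and> g \<in> carrier (pts (M_group R \<pi> p n) S (\<alpha> \<circ> const_ser R)) \<and> y \<in> alg_homs A B \<beta> S \<alpha> \<longrightarrow>
          act S \<alpha> g y \<theta> = y \<theta> \<oplus>\<^bsub>S\<^esub> g)"
      by (rule Q.torsor_M_group [OF is_cring p char const_ser_hom u c0 free])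
    then obtain act where act: "torsor A (const_ser R) B \<beta> (M_group R \<pi> p n :: ('a, 'c, 'c) group_fun) act \<and>
      (\<forall>S \<alpha> g y. algebra_over A S \<alpha> \<and> g \<in> carrier (pts (M_group R \<pi> p n) S (\<alpha> \<circ> const_ser R)) \<and> y \<in> alg_homs A B \<beta> S \<alpha> \<longrightarrow>
          act S \<alpha> g y \<theta> = y \<theta> \<oplus>\<^bsub>S\<^esub> g)" ..
    show ?thesis
      by (intro conjI 1 disjI2 exI [of _ n] n0 \<delta>n exI [of _ act] exI [of _ T] exI [of _ m] exI [of _ \<theta>] conjunct1 [OF act] conjunct2 [OF act] par coprime_m gb eta)
  qed
qed

theorem proposition2p5p1:
  fixes R :: "'r ring" and \<pi> :: 'r and p \<delta> :: nat
    and A :: "(int \<Rightarrow> 'r) ring" and \<iota> :: "'r \<Rightarrow> int \<Rightarrow> 'r"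
    and B :: "'b ring" and \<beta> :: "(int \<Rightarrow> 'r) \<Rightarrow> 'b"
  defines "A \<equiv> conv_laurent R \<pi>" and "\<iota> \<equiv> const_ser R"
    and "\<delta> \<equiv> different_degree A B \<beta> (\<beta> (\<iota> \<pi>))"
  assumes "complete_dvr R \<pi>"
    and "Factorial_Ring.prime p" and "[p] \<cdot>\<^bsub>R\<^esub> \<one>\<^bsub>R\<^esub> = \<zero>\<^bsub>R\<^esub>"
    and "algebraically_closed (R Quot (PIdl\<^bsub>R\<^esub> \<pi>))"
    and "galois_cover A B \<beta> p"
    and "ramification_index A B \<beta> = 1"
  shows "(\<exists>(G :: ('r, 'c, (nat \<Rightarrow> 'r) \<Rightarrow> 'c) group_fun) act.
            finite_flat_group_scheme R p G \<and> torsor A \<iota> B \<beta> G act) \<and>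
    (\<delta> = 0 \<and>
      (\<exists>act T m \<xi>.
         torsor A \<iota> B \<beta> (const_Zp p :: ('r, 'c, nat \<Rightarrow> 'c) group_fun) act \<and>
         parameter R \<pi> A \<iota> T \<and> m < 0 \<and> coprime m (int p) \<and>
         given_by_equation A B \<beta> p \<one>\<^bsub>A\<^esub> (T [^]\<^bsub>A\<^esub> m) \<xi> \<and>
         (\<forall>S \<alpha> e x. algebra_over A S \<alpha> \<and> e \<in> carrier (pts (const_Zp p) S (\<alpha> \<circ> \<iota>)) \<and>
            x \<in> alg_homs A B \<beta> S \<alpha> \<longrightarrow>
            act S \<alpha> e x \<xi> = x \<xi> \<oplus>\<^bsub>S\<^esub> (\<Oplus>\<^bsub>S\<^esub>i\<in>{..<p}. [i] \<cdot>\<^bsub>S\<^esub> e i)) \<and>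
         (\<exists>\<eta>. \<eta> \<in> carrier B \<and> \<eta> [^]\<^bsub>B\<^esub> m = \<xi> \<and> parameter R \<pi> B (\<beta> \<circ> \<iota>) \<eta>))
    \<or>
    (\<exists>n>0. \<delta> = n * (p - 1) \<and>
      (\<exists>act T m \<xi>.
         torsor A \<iota> B \<beta> (M_group R \<pi> p n :: ('r, 'c, 'c) group_fun) act \<and>
         parameter R \<pi> A \<iota> T \<and> coprime m (int p) \<and>
         given_by_equation A B \<beta> p (\<iota> (\<pi> [^]\<^bsub>R\<^esub> (n * (p - 1)))) (T [^]\<^bsub>A\<^esub> m) \<xi> \<and>
         (\<forall>S \<alpha> g x. algebra_over A S \<alpha> \<and> g \<in> carrier (pts (M_group R \<pi> p n) S (\<alpha> \<circ> \<iota>)) \<and>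
            x \<in> alg_homs A B \<beta> S \<alpha> \<longrightarrow>
            act S \<alpha> g x \<xi> = x \<xi> \<oplus>\<^bsub>S\<^esub> g) \<and>
         (\<exists>\<eta>. \<eta> \<in> carrier B \<and> \<eta> [^]\<^bsub>B\<^esub> m = \<xi> \<and> parameter R \<pi> B (\<beta> \<circ> \<iota>) \<eta>))))"
proof -
  note a = assms(4-) [unfolded A_def]
  have dvr: "dvr R" "uniformiser R \<pi>" using a(1) by (auto simp: complete_dvr_def)
  interpret pd: principal_domain R using dvr(1) by (simp add: dvr_def)
  interpret complete_dvr_closed R \<pi> p
    by (intro complete_dvr_closed.intro complete_dvr_closed_axioms.intro complete_dvr_char.intro
      complete_dvr_base.intro complete_dvr_base_axioms.intro dvr_unif.intro dvr_unif_axioms.intro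
      cring_char.intro cring_char_axioms.intro pd.principal_domain_axioms pd.is_cring dvr a)
  interpret galois_p R \<pi> p B \<beta>
    by (intro galois_p.intro galois_p_axioms.intro complete_dvr_closed_axioms a)
  obtain s where s: "s \<in> alg_auts (conv_laurent R \<pi>) B \<beta>" "\<forall>b\<in>carrier B. (s ^^ p) b = b"
    "\<exists>b\<in>carrier B. s b \<noteq> b" "bij_betw (\<lambda>i. \<lambda>b\<in>carrier B. (s ^^ i) b) {..<p} (alg_auts (conv_laurent R \<pi>) B \<beta>)"
    using generator_exists by blast
  interpret galois_gen R \<pi> p B \<beta> s
    by (intro galois_gen.intro galois_gen_axioms.intro galois_p_axioms s s(2) [rule_format])
  obtain n \<theta> u m where \<theta>: "\<theta> \<in> carrier B" "s \<theta> = \<theta> \<oplus>\<^bsub>B\<^esub> w [^]\<^bsub>B\<^esub> (n::nat)" "u \<in> carrier (conv_laurent R \<pi>)"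
    "\<theta> [^]\<^bsub>B\<^esub> p = w [^]\<^bsub>B\<^esub> (n * (p - 1)) \<otimes>\<^bsub>B\<^esub> \<theta> \<oplus>\<^bsub>B\<^esub> \<beta> u" "wt u m" "coprime m (int p)" "n = 0 \<longrightarrow> m < 0"
    using theta_normal_form by blast
  interpret galois_theta R \<pi> p B \<beta> s n \<theta> u m
    by (intro galois_theta.intro galois_theta_axioms.intro galois_gen_axioms \<theta>)
  show ?thesis unfolding A_def \<iota>_def \<delta>_def by (rule cover_cases)
qed

end
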